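(* Let $X=\{X(t): t\ge 0\}$ be a càdlàg $\mathbb{R}^n$-valued stochastic process having stationary increments. Assume that for its two-sided extension (again denoted by $X$) the limit $v=\lim_{t\to-\infty}X(t)/t$ exists, is constant and is finite (in particular when $X$ also has ergodic increments, $E|X(1)-X(0)|<\infty$ and then $v=E(X(1)-X(0))$), and that in addition the stability condition $R^{-1}v<0$ holds (coordinate-wise). Then: (i) $W(X)(t)$ converges in distribution as $t\to\infty$ and, moreover, for every a.s. finite random vector $\xi$, $W(\xi+X)(t)$ converges in distribution to the same limit. That is, the limiting distribution is independent of initial conditions. (ii) $W(X)$ has a unique stationary version, in the sense that if, for $\xi$ and $\eta$, $W(\xi+X)$ and $W(\eta+X)$ are stationary, then the processes $W(\xi+X)$ and $W(\eta+X)$ are identically distributed. For each $t$ the distribution of this stationary version (at time $t$) coincides with the limiting distribution from (i). (iii) There is a uniquely distributed pair $(\xi,X_0)$ ($\xi$ is a random vector and $X_0$ is a process) such that $(W(\xi+X_0)(s),X_s)$ is distributed like $(\xi,X_0)$ for each $s\ge 0$. Moreover, the triplet of processes $(W_s(\xi+X_0),L_s(\xi+X_0),X_s)$ is distributed like $(W(\xi+X_0),L(\xi+X_0),X_0)$. In particular, $W(\xi+X_0)$ is stationary and $L(\xi+X_0)$ has stationary increments. (iv) If in addition $J$ is a stochastic process such that, with $J_s(\cdot)=J(\cdot+s)$, one has $(X_s,J_s)\sim(X_0,J)$ for every $s\ge 0$ (in particular $J$ is stationary and $X$ has stationary increments), then: (i-J) For every a.s. finite $\xi$, $(W(\xi+X),J)$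 converges in distribution (that is, $(W(\xi+X)(t),J(t))$ does so as $t\to\infty$) to a limit which is independent of $\xi$. (ii-J) $(W(X),J)$ has a unique stationary version. (iii-J) There is a uniquely distributed triplet $(\xi,X_0,J)$ such that $(W(\xi+X_0)(s),X_s,J_s)$ is distributed like $(\xi,X_0,J)$ for each $s\ge 0$. Moreover, $(W_s(\xi+X_0),L_s(\xi+X_0),X_s,J_s)$ is distributed like $(W(\xi+X_0),L(\xi+X_0),X_0,J)$.
   Context: Fix $n\ge 1$ and an $n\times n$ matrix $P=(p_{ij})$ with nonnegative entries and spectral radius strictly less than one. Put $R=I-P^t$, where $^t$ denotes transposition (so $R$ is invertible with $R^{-1}$ entrywise nonnegative). For a càdlàg (right continuous with left limits) function $Y:[0,\infty)\to\mathbb{R}^n$, the reflection map (Skorohod problem in $[0,\infty)^n$) gives the unique pair $(W(Y),L(Y))$ of $\mathbb{R}^n$-valued functions on $[0,\infty)$ with $W(Y)(t)=Y(t)+R\,L(Y)(t)$ for all $t\ge 0$ and, for each $i=1,\ldots,n$: (S1) $L_i(Y)$ is nondecreasing, nonnegative and right continuous; (S2) $W_i(Y)$ is nonnegative; (S3) $\int_{[0,\infty)}1_{\{W_i(Y)(t)>0\}}\,dL_i(Y)(t)=0$, where the measure $dL_i(Y)$ has an atom of mass $L_i(Y)(0)$ at $0$. For a stochastic process the map is applied path by path, and for a random vector $\xi$ (which may depend on the process $X$), $\xi+X$ denotes the process $t\mapsto\xi+X(t)$. A process $X$ has stationary increments (in the strong sense) if the law of $\{X(s+t)-X(s): t\ge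 0\}$ does not depend on $s$. Its two-sided extension is a process indexed by $t\in\mathbb{R}$ whose increments are stationary over all of $\mathbb{R}$ and have the same law as those of $X$ on $[0,\infty)$. The increments are ergodic if every event in terms of the increments that is invariant under time shifts has probability $0$ or $1$. Notation: $X_s(\cdot)=X(s+\cdot)-X(s)$ (so $X_0=X-X(0)$); $W_s(Y)(t)=W(Y)(t+s)$; $L_s(Y)(t)=L(Y)(s+t)-L(Y)(s)$. The symbol $\sim$ means equality in distribution. A process is stationary if its law is invariant under time shifts $t\mapsto t+s$, $s\ge 0$. A stationary version of $W(X)$ (respectively of $(W(X),J)$) is a stationary process of the form $W(\xi+X)$ (respectively $(W(\xi+X),J)$) for some random vector $\xi$; it is unique if any two such stationary processes are identically distributed. "Uniquely distributed" means that such an object exists and its joint law is uniquely determined.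
   Formalization: Ergodic increments and E|X(1)-X(0)|<∞ alone do not force the limit of X(t)/t to exist (rare tall narrow spikes are a counterexample); the parenthesis is proved as: if the limit v exists, then v=E(X(1)-X(0)). *)

theory Defs
  imports "HOL-Probability.Probability"
begin

section \<open>Matrices\<close>

definition complex_spectrum :: "real ^ 'n ^ 'n \<Rightarrow> complex set" where
  "complex_spectrum A =
     {z. \<exists>u :: complex ^ 'n. u \<noteq> 0 \<and> map_matrix complex_of_real A *v u = z *s u}"

definition spectral_radius :: "real ^ 'n ^ 'n \<Rightarrow> real" where
  "spectral_radius A = (SUP z\<in>complex_spectrum A. norm z)"


section \<open>The reflection map\<close>

definition cadlag :: "(real \<Rightarrow> 'c::topological_space) \<Rightarrow> bool" where
  "cadlag y \<longleftrightarrow>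
     (\<forall>t\<ge>0. continuous (at_right t) y) \<and> (\<forall>t>0. \<exists>l. (y \<longlongrightarrow> l) (at_left t))"

text \<open>
  The integrator in (S3) is extended by 0 to negative times, so that the Stieltjes measure
  \<^const>\<open>interval_measure\<close> has an atom of mass \<open>l 0 $ i\<close> at \<open>0\<close>.
\<close>
definition skorohod_problem ::
    "real ^ 'n ^ 'n \<Rightarrow> (real \<Rightarrow> real ^ 'n) \<Rightarrow> (real \<Rightarrow> real ^ 'n) \<Rightarrow> (real \<Rightarrow> real ^ 'n) \<Rightarrow> bool" where
  "skorohod_problem R y w l \<longleftrightarrow>
     (\<forall>t\<ge>0. w t = y t + R *v l t) \<and>
     (\<forall>i. mono_on {0..} (\<lambda>t. l t $ i) \<and>
          (\<forall>t\<ge>0. 0 \<le> l t $ i) \<and>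
          (\<forall>t\<ge>0. continuous (at_right t) (\<lambda>t. l t $ i)) \<and>
          (\<forall>t\<ge>0. 0 \<le> w t $ i) \<and>
          (\<integral>\<^sup>+t\<in>{0..}. indicator {t. w t $ i > 0} t
             \<partial>interval_measure (\<lambda>t. if t < 0 then 0 else l t $ i)) = 0)"

text \<open>
  Only times \<open>t \<ge> 0\<close> matter; the value 0 at negative times is a convention that makes the
  solution unique as a pair of total functions.
\<close>
definition reflection_map ::
    "real ^ 'n ^ 'n \<Rightarrow> (real \<Rightarrow> real ^ 'n) \<Rightarrow> (real \<Rightarrow> real ^ 'n) \<times> (real \<Rightarrow> real ^ 'n)" where
  "reflection_map R y =
     (THE p. skorohod_problem R y (fst p) (snd p) \<and> (\<forall>t<0. fst p t = 0 \<and> snd p t = 0))"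

text \<open>The processes \<open>W(\<xi> + X)\<close> and \<open>L(\<xi> + X)\<close>.\<close>

definition refl_W ::
    "real ^ 'n ^ 'n \<Rightarrow> ('a \<Rightarrow> real ^ 'n) \<Rightarrow> (real \<Rightarrow> 'a \<Rightarrow> real ^ 'n) \<Rightarrow> real \<Rightarrow> 'a \<Rightarrow> real ^ 'n" where
  "refl_W R \<xi> X t \<omega> = fst (reflection_map R (\<lambda>u. \<xi> \<omega> + X u \<omega>)) t"

definition refl_L ::
    "real ^ 'n ^ 'n \<Rightarrow> ('a \<Rightarrow> real ^ 'n) \<Rightarrow> (real \<Rightarrow> 'a \<Rightarrow> real ^ 'n) \<Rightarrow> real \<Rightarrow> 'a \<Rightarrow> real ^ 'n" where
  "refl_L R \<xi> X t \<omega> = snd (reflection_map R (\<lambda>u. \<xi> \<omega> + X u \<omega>)) t"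


section \<open>Laws of processes\<close>

text \<open>
  A process is a family \<open>Z t \<omega>\<close>; its law on the time set \<open>T\<close> is the law of its trajectory on the
  product space, i.e. it is given by the finite-dimensional distributions. The joint law of
  several processes is the law of the process of tuples (all state spaces below are second
  countable, so the Borel sigma-algebra of the product is the product sigma-algebra).
\<close>

definition path_space :: "real set \<Rightarrow> (real \<Rightarrow> 'c::topological_space) measure" where
  "path_space T = (\<Pi>\<^sub>M t\<in>T. borel)"

definition traj :: "real set \<Rightarrow> (real \<Rightarrow> 'a \<Rightarrow> 'c) \<Rightarrow> 'a \<Rightarrow> real \<Rightarrow> 'c" where
  "traj T Z \<omega> = (\<lambda>t\<in>T. Z t \<omega>)"

definition same_law ::
    "'c measure \<Rightarrow> 'a measure \<Rightarrow> ('a \<Rightarrow> 'c) \<Rightarrow> 'b measure \<Rightarrow> ('b \<Rightarrow> 'c) \<Rightarrow> bool" where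
  "same_law S M A N B \<longleftrightarrow>
     A \<in> measurable M S \<and> B \<in> measurable N S \<and> distr M S A = distr N S B"

definition same_process_law ::
    "'a measure \<Rightarrow> (real \<Rightarrow> 'a \<Rightarrow> 'c::topological_space) \<Rightarrow>
     'b measure \<Rightarrow> (real \<Rightarrow> 'b \<Rightarrow> 'c) \<Rightarrow> bool" where
  "same_process_law M Z N Z' \<longleftrightarrow> same_law (path_space {0..}) M (traj {0..} Z) N (traj {0..} Z')"

definition incr :: "real \<Rightarrow> (real \<Rightarrow> 'a \<Rightarrow> 'c::real_vector) \<Rightarrow> real \<Rightarrow> 'a \<Rightarrow> 'c" where
  "incr s Z t \<omega> = Z (s + t) \<omega> - Z s \<omega>"

definition stationary_process :: "'a measure \<Rightarrow> (real \<Rightarrow> 'a \<Rightarrow> 'c::topological_space) \<Rightarrow> bool" where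
  "stationary_process M Z \<longleftrightarrow> (\<forall>s\<ge>0. same_process_law M (\<lambda>t. Z (s + t)) M Z)"

definition stationary_increments ::
    "'a measure \<Rightarrow> (real \<Rightarrow> 'a \<Rightarrow> 'c::real_normed_vector) \<Rightarrow> bool" where
  "stationary_increments M Z \<longleftrightarrow> (\<forall>s\<ge>0. same_process_law M (incr s Z) M (incr 0 Z))"

definition cadlag_process ::
    "'a measure \<Rightarrow> (real \<Rightarrow> 'a \<Rightarrow> 'c::topological_space) \<Rightarrow> bool" where
  "cadlag_process M X \<longleftrightarrow>
     prob_space M \<and> (\<forall>t\<ge>0. X t \<in> borel_measurable M) \<and> (\<forall>\<omega>\<in>space M. cadlag (\<lambda>t. X t \<omega>))"

text \<open>
  The extension may live on another probability space \<open>N\<close>; only its increments are tied to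
  those of \<open>X\<close>.
\<close>
definition two_sided_extension ::
    "'a measure \<Rightarrow> (real \<Rightarrow> 'a \<Rightarrow> 'c::real_normed_vector) \<Rightarrow>
     'b measure \<Rightarrow> (real \<Rightarrow> 'b \<Rightarrow> 'c) \<Rightarrow> bool" where
  "two_sided_extension M X N Z \<longleftrightarrow>
     prob_space N \<and> (\<forall>t. Z t \<in> borel_measurable N) \<and>
     (\<forall>s. same_law (path_space UNIV) N (traj UNIV (incr s Z)) N (traj UNIV (incr 0 Z))) \<and>
     same_process_law N (incr 0 Z) M (incr 0 X)"

text \<open>
  Invariance of an event is understood up to null sets: no nontrivial event of the product
  sigma-algebra over all functions is strictly invariant under every time shift.
\<close>
definition ergodic_increments ::
    "'a measure \<Rightarrow> (real \<Rightarrow> 'a \<Rightarrow> 'c::real_normed_vector) \<Rightarrow> bool" where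
  "ergodic_increments M X \<longleftrightarrow>
     (\<forall>A\<in>sets (path_space {0..}).
        (\<forall>s\<ge>0. AE \<omega> in M. traj {0..} (incr s X) \<omega> \<in> A \<longleftrightarrow> traj {0..} (incr 0 X) \<omega> \<in> A) \<longrightarrow>
        measure M {\<omega>\<in>space M. traj {0..} (incr 0 X) \<omega> \<in> A} \<in> {0, 1})"

definition converges_in_distribution ::
    "'a measure \<Rightarrow> (real \<Rightarrow> 'a \<Rightarrow> 'c::topological_space) \<Rightarrow> 'c measure \<Rightarrow> bool" where
  "converges_in_distribution M Z \<mu> \<longleftrightarrow>
     prob_space \<mu> \<and> sets \<mu> = sets borel \<and> (\<forall>t\<ge>0. Z t \<in> borel_measurable M) \<and>
     (\<forall>f :: 'c \<Rightarrow> real. continuous_on UNIV f \<and> bounded (range f) \<longrightarrow>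
        ((\<lambda>t. \<integral>\<omega>. f (Z t \<omega>) \<partial>M) \<longlongrightarrow> (\<integral>x. f x \<partial>\<mu>)) at_top)"


section \<open>Stationary versions\<close>

text \<open>
  An enlargement of \<open>M\<close> supporting an additional random vector. The stationary initial
  condition \<open>\<xi>\<close> need not exist on \<open>M\<close> itself (it typically depends on the past before time 0);
  on the enlargement, \<open>X\<close> becomes \<open>\<lambda>t \<omega>. X t (fst \<omega>)\<close>.
\<close>
definition enlargement :: "'a measure \<Rightarrow> ('a \<times> 'c) measure \<Rightarrow> bool" where
  "enlargement M N \<longleftrightarrow> prob_space N \<and> fst \<in> measurable N M \<and> distr N M fst = M"

text \<open>\<open>(W(\<xi> + X\<^sub>0)(s), X\<^sub>s) \<sim> (\<xi>, X\<^sub>0)\<close>, without and with \<open>J\<close>.\<close>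

definition invariant_start ::
    "real ^ 'n ^ 'n \<Rightarrow> 'a measure \<Rightarrow> ('a \<Rightarrow> real ^ 'n) \<Rightarrow> (real \<Rightarrow> 'a \<Rightarrow> real ^ 'n) \<Rightarrow> bool" where
  "invariant_start R M \<xi> X \<longleftrightarrow>
     (\<forall>s\<ge>0. same_law (borel \<Otimes>\<^sub>M path_space {0..})
        M (\<lambda>\<omega>. (refl_W R \<xi> (incr 0 X) s \<omega>, traj {0..} (incr s X) \<omega>))
        M (\<lambda>\<omega>. (\<xi> \<omega>, traj {0..} (incr 0 X) \<omega>)))"

definition invariant_start_J ::
    "real ^ 'n ^ 'n \<Rightarrow> 'a measure \<Rightarrow> ('a \<Rightarrow> real ^ 'n) \<Rightarrow> (real \<Rightarrow> 'a \<Rightarrow> real ^ 'n) \<Rightarrow>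
     (real \<Rightarrow> 'a \<Rightarrow> 'j::topological_space) \<Rightarrow> bool" where
  "invariant_start_J R M \<xi> X J \<longleftrightarrow>
     (\<forall>s\<ge>0. same_law (borel \<Otimes>\<^sub>M (path_space {0..} \<Otimes>\<^sub>M path_space {0..}))
        M (\<lambda>\<omega>. (refl_W R \<xi> (incr 0 X) s \<omega>,
                 traj {0..} (incr s X) \<omega>, traj {0..} (\<lambda>t. J (s + t)) \<omega>))
        M (\<lambda>\<omega>. (\<xi> \<omega>, traj {0..} (incr 0 X) \<omega>, traj {0..} J \<omega>)))"

text \<open>
  Here \<open>X\<close>, \<open>J\<close> on \<open>M\<close> are the given processes, and \<open>Y\<close>, \<open>K\<close> on \<open>N\<close> are copies of them; the
  copies allow \<open>\<xi>\<close> to live on any probability space carrying processes with the given law.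
\<close>

definition stationary_version ::
    "real ^ 'n ^ 'n \<Rightarrow> 'a measure \<Rightarrow> (real \<Rightarrow> 'a \<Rightarrow> real ^ 'n) \<Rightarrow>
     'b measure \<Rightarrow> (real \<Rightarrow> 'b \<Rightarrow> real ^ 'n) \<Rightarrow> ('b \<Rightarrow> real ^ 'n) \<Rightarrow> bool" where
  "stationary_version R M X N Y \<xi> \<longleftrightarrow>
     cadlag_process N Y \<and> same_process_law N Y M X \<and> \<xi> \<in> borel_measurable N \<and>
     stationary_process N (refl_W R \<xi> Y)"

definition stationary_version_J ::
    "real ^ 'n ^ 'n \<Rightarrow> 'a measure \<Rightarrow> (real \<Rightarrow> 'a \<Rightarrow> real ^ 'n) \<Rightarrow> (real \<Rightarrow> 'a \<Rightarrow> 'j::topological_space) \<Rightarrow>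
     'b measure \<Rightarrow> (real \<Rightarrow> 'b \<Rightarrow> real ^ 'n) \<Rightarrow> (real \<Rightarrow> 'b \<Rightarrow> 'j) \<Rightarrow> ('b \<Rightarrow> real ^ 'n) \<Rightarrow> bool" where
  "stationary_version_J R M X J N Y K \<xi> \<longleftrightarrow>
     cadlag_process N Y \<and>
     same_process_law N (\<lambda>t \<omega>. (Y t \<omega>, K t \<omega>)) M (\<lambda>t \<omega>. (X t \<omega>, J t \<omega>)) \<and>
     \<xi> \<in> borel_measurable N \<and>
     stationary_process N (\<lambda>t \<omega>. (refl_W R \<xi> Y t \<omega>, K t \<omega>))"

definition invariant_version ::
    "real ^ 'n ^ 'n \<Rightarrow> 'a measure \<Rightarrow> (real \<Rightarrow> 'a \<Rightarrow> real ^ 'n) \<Rightarrow>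
     'b measure \<Rightarrow> (real \<Rightarrow> 'b \<Rightarrow> real ^ 'n) \<Rightarrow> ('b \<Rightarrow> real ^ 'n) \<Rightarrow> bool" where
  "invariant_version R M X N Y \<xi> \<longleftrightarrow>
     cadlag_process N Y \<and> same_process_law N (incr 0 Y) M (incr 0 X) \<and>
     \<xi> \<in> borel_measurable N \<and> invariant_start R N \<xi> Y"

definition invariant_version_J ::
    "real ^ 'n ^ 'n \<Rightarrow> 'a measure \<Rightarrow> (real \<Rightarrow> 'a \<Rightarrow> real ^ 'n) \<Rightarrow> (real \<Rightarrow> 'a \<Rightarrow> 'j::topological_space) \<Rightarrow>
     'b measure \<Rightarrow> (real \<Rightarrow> 'b \<Rightarrow> real ^ 'n) \<Rightarrow> (real \<Rightarrow> 'b \<Rightarrow> 'j) \<Rightarrow> ('b \<Rightarrow> real ^ 'n) \<Rightarrow> bool" where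
  "invariant_version_J R M X J N Y K \<xi> \<longleftrightarrow>
     cadlag_process N Y \<and>
     same_process_law N (\<lambda>t \<omega>. (incr 0 Y t \<omega>, K t \<omega>)) M (\<lambda>t \<omega>. (incr 0 X t \<omega>, J t \<omega>)) \<and>
     \<xi> \<in> borel_measurable N \<and> invariant_start_J R N \<xi> Y K"

end

theory Submission
  imports Defs
begin

text \<open>
  Write \<open>W(x + y)\<close> and \<open>L(x + y)\<close> for the reflection of a path \<open>y\<close> with \<open>y(0) = 0\<close>, started in \<open>x\<close>.
  Everything rests on two facts about single paths and on one limit of laws.

  Coupling (\<open>coupling\<close>). By definition \<open>R\<^sup>-\<^sup>1 W(x + y)(t) = R\<^sup>-\<^sup>1 (x + y(t)) + L(x + y)(t)\<close>. If
  \<open>x \<le> x'\<close>, then \<open>W(x + y) \<le> W(x' + y)\<close> and \<open>L(x + y) - L(x' + y)\<close> is nondecreasing, so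
  \<open>R\<^sup>-\<^sup>1\<close> applied to the gap \<open>W(x' + y) - W(x + y)\<close> decreases, and the gap converges to some
  \<open>\<delta> \<ge> 0\<close>. If \<open>\<delta>\<^sub>i > 0\<close>, then the \<open>i\<close>-th component of \<open>W(x' + y)\<close> stays away from \<open>0\<close> and that
  of \<open>L(x' + y)\<close> stops growing; but it differs from that of \<open>L(x + y)\<close> by a bounded amount. Hence the gap tends
  to \<open>0\<close> as soon as all components of \<open>L(y)\<close> are unbounded. They are unbounded for the paths
  considered here because \<open>L(y) \<ge> - R\<^sup>-\<^sup>1 y\<close> and \<open>R\<^sup>-\<^sup>1 v < 0\<close>.

  Bound (\<open>Wlim_stability_bound\<close>). If \<open>y(T) - y(u)\<close> deviates from \<open>(T - u) v\<close> by at most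
  \<open>C + \<epsilon> (T - u)\<close> for all \<open>u \<le> T\<close>, with \<open>\<epsilon>\<close> small, then \<open>W(y)(T) \<le> C R\<^sup>-\<^sup>1 1\<close>: raise the start
  until a linear function of time is an admissible regulator, and use that \<open>L\<close> is the least one.
  The two-sided extension has a limit of \<open>X(t) / t\<close> at minus infinity, so its increments over the
  windows ending at time \<open>0\<close> satisfy such a bound for all lengths simultaneously, with a finite
  random \<open>C\<close>. By stationarity one law of \<open>C\<close> serves for windows ending at any time
  (\<open>deviation_control\<close>), and the process started empty is tight.

  Limit law (\<open>limit_law_exists\<close>, \<open>start_limit\<close>). The state at time \<open>t\<close> of the process started
  empty, taken together with the path that drives it afterwards, has the law of \<open>(V\<^sub>t, T)\<close>, where
  \<open>T\<close> is a driving path from time \<open>0\<close> on, and \<open>V\<^sub>t\<close> the state at time \<open>0\<close> of the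
  process started empty at time \<open>-t\<close>. A single probability space carries all \<open>V\<^sub>t\<close>, by Kolmogorov
  extension. Starting earlier gives a larger state, so \<open>V\<^sub>t\<close> increases to a limit \<open>\<xi>\<close>, finite by
  tightness. Let \<open>Q\<close> be the law of \<open>(\<xi>, T)\<close>. Then \<open>E h(W(t), T\<^sub>t)\<close>, with \<open>T\<^sub>t\<close> the driving path after \<open>t\<close>,
  tends to the \<open>Q\<close>-integral of \<open>h\<close> for every bounded measurable \<open>h\<close> that is continuous in its first argument,
  and by coupling this holds for every start.

  All claims are read off from this convergence. Taking \<open>h\<close> to depend on the state and the
  background process at one time gives (i). The shifted limit is the same limit, so \<open>Q\<close> is invariant;
  conversely, along an invariant start the expectations are constant in \<open>t\<close>, so its law is \<open>Q\<close>.
  Functionals \<open>h\<close> that are products over finitely many later times identify the finite-dimensional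
  distributions of any stationary version. An invariant start exists on an enlargement of the given
  probability space because a random variable with prescribed conditional law given the path can be
  written as a function of the path and an independent uniform variable (\<open>noise_outsourcing\<close>).

  A background process \<open>J\<close> is carried along as a second component of the driving path; the
  statements without \<open>J\<close> are the case \<open>J = 0\<close>. The drift is the mean increment because the averages
  \<open>(X(k) - X(0)) / k\<close> converge to \<open>v\<close> in probability and are uniformly integrable.
\<close>

section \<open>Nonnegative matrices of spectral radius less than one\<close>

lemma inner_vec_real: "(p::real^'n) \<bullet> x = (\<Sum>i\<in>UNIV. p $ i * x $ i)"
  by (simp add: inner_vec_def)

lemma matrix_vector_nth: "(P *v x) $ i = (\<Sum>j\<in>UNIV. P $ i $ j * x $ j)"
  by (simp add: matrix_vector_mult_def)

text \<open>
  The supremum that defines the spectral radius is taken over a bounded set: look at a component of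
  largest modulus of an eigenvector.
\<close>
lemma norm_complex_spectrum_le:
  fixes P :: "real ^ 'n ^ 'n"
  assumes "z \<in> complex_spectrum P"
  shows "norm z \<le> (\<Sum>i\<in>UNIV. \<Sum>j\<in>UNIV. \<bar>P $ i $ j\<bar>)"
proof -
  obtain u :: "complex^'n" where u: "u \<noteq> 0" "map_matrix complex_of_real P *v u = z *s u"
    using assms by (auto simp: complex_spectrum_def)
  define m where "m = Max (range (\<lambda>i. norm (u $ i)))"
  have le_m: "norm (u $ i) \<le> m" for i
    unfolding m_def by (rule Max_ge) auto
  have "m \<in> range (\<lambda>i. norm (u $ i))"
    unfolding m_def by (rule Max_in) auto
  then obtain i where i: "norm (u $ i) = m" by auto
  obtain k where "u $ k \<noteq> 0" using u(1) by (auto simp: vec_eq_iff)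
  with le_m[of k] have m: "m > 0"
    by (metis less_le_trans zero_less_norm_iff)
  have "z * u $ i = (\<Sum>j\<in>UNIV. complex_of_real (P $ i $ j) * u $ j)"
    using u(2) by (simp add: vec_eq_iff matrix_vector_mult_def map_matrix_def)
  then have "norm z * m = norm (\<Sum>j\<in>UNIV. complex_of_real (P $ i $ j) * u $ j)"
    by (metis i norm_mult)
  also have "\<dots> \<le> (\<Sum>j\<in>UNIV. \<bar>P $ i $ j\<bar> * m)"
    by (intro order_trans[OF norm_sum] sum_mono) (simp add: norm_mult le_m mult_left_mono)
  also have "\<dots> = (\<Sum>j\<in>UNIV. \<bar>P $ i $ j\<bar>) * m" by (simp add: sum_distrib_right)
  finally have "norm z \<le> (\<Sum>j\<in>UNIV. \<bar>P $ i $ j\<bar>)" using m by simp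
  also have "\<dots> \<le> (\<Sum>i\<in>UNIV. \<Sum>j\<in>UNIV. \<bar>P $ i $ j\<bar>)"
    by (rule member_le_sum) (auto intro: sum_nonneg)
  finally show ?thesis .
qed

lemma spectral_radius_ge_real_eigenvalue:
  fixes P :: "real ^ 'n ^ 'n"
  assumes "x \<noteq> 0" "P *v x = c *\<^sub>R x"
  shows "\<bar>c\<bar> \<le> spectral_radius P"
proof -
  have "complex_of_real c \<in> complex_spectrum P"
    unfolding complex_spectrum_def
  proof (intro CollectI exI[of _ "\<chi> i. complex_of_real (x $ i)"] conjI)
    show "(\<chi> i. complex_of_real (x $ i)) \<noteq> 0" using assms(1) by (auto simp: vec_eq_iff)
    have "(\<Sum>j\<in>UNIV. P $ i $ j * x $ j) = c * x $ i" for i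
      using assms(2) by (simp add: vec_eq_iff matrix_vector_mult_def)
    then show "map_matrix complex_of_real P *v (\<chi> i. complex_of_real (x $ i)) =
        complex_of_real c *s (\<chi> i. complex_of_real (x $ i))"
      by (simp add: vec_eq_iff matrix_vector_mult_def map_matrix_def flip: of_real_mult of_real_sum)
  qed
  moreover have "bdd_above (norm ` complex_spectrum P)"
    using norm_complex_spectrum_le by (intro bdd_aboveI2) blast
  ultimately show ?thesis
    unfolding spectral_radius_def by (metis cSUP_upper norm_of_real)
qed

lemma compact_simplex: "compact {x :: real^'n. (\<forall>i. 0 \<le> x $ i) \<and> (\<Sum>i\<in>UNIV. x $ i) = 1}"
proof (rule compact_eq_bounded_closed[THEN iffD2], intro conjI)
  show "bounded {x :: real^'n. (\<forall>i. 0 \<le> x $ i) \<and> (\<Sum>i\<in>UNIV. x $ i) = 1}"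
  proof (rule boundedI)
    fix x :: "real^'n" assume x: "x \<in> {x. (\<forall>i. 0 \<le> x $ i) \<and> (\<Sum>i\<in>UNIV. x $ i) = 1}"
    have "norm x \<le> (\<Sum>i\<in>UNIV. \<bar>x $ i\<bar>)" by (rule norm_le_l1_cart)
    also have "\<dots> = 1" using x by simp
    finally show "norm x \<le> 1" .
  qed
qed (intro closed_Collect_conj closed_Collect_all closed_Collect_le closed_Collect_eq continuous_intros)

text \<open>
  The Perron vector is a fixed point of \<open>x \<mapsto> Q x\<close>, rescaled to total mass one, on the simplex,
  and Brouwer's theorem provides it.
\<close>
lemma positive_matrix_eigenvector:
  fixes Q :: "real ^ 'n ^ 'n"
  assumes pos: "\<And>i j. 0 < Q $ i $ j"
  obtains x c where "\<And>i. 0 < x $ i" "(\<Sum>i\<in>UNIV. x $ i) = 1" "Q *v x = c *\<^sub>R x" "0 < c"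
proof -
  define S :: "(real^'n) set" where "S = {x. (\<forall>i. 0 \<le> x $ i) \<and> (\<Sum>i\<in>UNIV. x $ i) = 1}"
  define s where "s x = (\<Sum>i\<in>UNIV. (Q *v x) $ i)" for x :: "real^'n"
  have Qpos: "0 < (Q *v x) $ i" if x: "x \<in> S" for x i
  proof -
    obtain j where "0 < x $ j"
    proof (rule ccontr)
      assume "\<not> thesis"
      then have "\<And>j. x $ j = 0" using x that by (force simp: S_def le_less)
      then show False using x by (simp add: S_def)
    qed
    then have "0 < Q $ i $ j * x $ j" using pos by simp
    also have "\<dots> \<le> (Q *v x) $ i"
      unfolding matrix_vector_nth using x pos
      by (intro member_le_sum[of j]) (auto simp: S_def intro!: mult_nonneg_nonneg intro: less_imp_le)
    finally show ?thesis .
  qed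
  have spos: "0 < s x" if "x \<in> S" for x
    unfolding s_def using Qpos[OF that] by (intro sum_pos) auto
  have "compact S" unfolding S_def by (rule compact_simplex)
  moreover have "convex S" unfolding S_def
    by (auto simp: convex_def sum.distrib simp flip: sum_distrib_left)
  moreover have "S \<noteq> {}"
  proof -
    have "(\<chi> i. 1 / real CARD('n)) \<in> S" by (simp add: S_def)
    then show ?thesis by auto
  qed
  moreover have "continuous_on S (\<lambda>x. Q *v x /\<^sub>R s x)"
  proof (intro continuous_on_scaleR continuous_on_inverse)
    show "continuous_on S ((*v) Q)" by (rule matrix_vector_mult_linear_continuous_on)
    show "continuous_on S s" unfolding s_def matrix_vector_nth by (intro continuous_intros)
    show "\<forall>x\<in>S. s x \<noteq> 0" using spos by (metis less_irrefl)
  qed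
  moreover have "(\<lambda>x. Q *v x /\<^sub>R s x) \<in> S \<rightarrow> S"
  proof
    fix x assume x: "x \<in> S"
    have "(\<Sum>i\<in>UNIV. (Q *v x) $ i / s x) = 1"
      using spos[OF x] by (simp add: s_def flip: sum_divide_distrib)
    then show "Q *v x /\<^sub>R s x \<in> S"
      using Qpos[OF x] spos[OF x] by (auto simp: S_def divide_inverse mult.commute less_imp_le)
  qed
  ultimately obtain x where x: "x \<in> S" "Q *v x /\<^sub>R s x = x"
    using brouwer by blast
  have e: "Q *v x = s x *\<^sub>R x"
  proof -
    have "s x *\<^sub>R (Q *v x /\<^sub>R s x) = s x *\<^sub>R x" using x(2) by simp
    then show ?thesis using spos[OF x(1)] by simp
  qed
  have "0 < x $ i" for i
    using Qpos[OF x(1), of i] spos[OF x(1)] by (simp add: e zero_less_mult_iff)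
  with e spos[OF x(1)] x(1) show ?thesis by (intro that[of x "s x"]) (auto simp: S_def)
qed

text \<open>
  Spectral radius below one enters only through this vector. Adding \<open>1/(k+1)\<close> to every entry of
  \<open>P\<close> makes it positive; on the simplex the perturbation adds \<open>1/(k+1)\<close> to every component of the
  image, so a Perron vector of eigenvalue below one for some \<open>k\<close> is strictly decreased by \<open>P\<close>.
\<close>
theorem strictly_subinvariant_vector:
  fixes P :: "real ^ 'n ^ 'n"
  assumes nn: "\<forall>i j. 0 \<le> P $ i $ j" and rad: "spectral_radius P < 1"
  obtains p where "\<And>i. 0 < p $ i" "\<And>i. (P *v p) $ i < p $ i"
proof -
  define Q :: "nat \<Rightarrow> real^'n^'n" where "Q k = (\<chi> i j. P $ i $ j + 1 / Suc k)" for k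
  have "\<exists>x c. (\<forall>i. 0 < x $ i) \<and> (\<Sum>i\<in>UNIV. x $ i) = 1 \<and> Q k *v x = c *\<^sub>R x \<and> 0 < c" for k
  proof -
    have "0 < Q k $ i $ j" for i j using nn by (simp add: Q_def add_nonneg_pos)
    then show ?thesis using positive_matrix_eigenvector[of "Q k"] by metis
  qed
  then obtain x c where xpos: "\<And>k i. 0 < x k $ i" and xsum: "\<And>k. (\<Sum>i\<in>UNIV. x k $ i) = 1"
    and eig: "\<And>k. Q k *v x k = c k *\<^sub>R x k" and "\<And>k. 0 < c k" by metis
  have Qx: "(Q k *v x k) $ i = (P *v x k) $ i + 1 / Suc k" for k i
    using xsum[of k] by (simp add: Q_def matrix_vector_nth distrib_right sum.distrib flip: sum_divide_distrib)
  have eigi: "(P *v x k) $ i + 1 / Suc k = c k * x k $ i" for k i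
    using Qx[of k i] by (simp add: eig)
  show ?thesis
  proof (cases "\<exists>k. c k < 1")
    case True
    then obtain k where k: "c k < 1" by auto
    have "(P *v x k) $ i < x k $ i" for i
    proof -
      have "(P *v x k) $ i < c k * x k $ i" using eigi[of k i] by (smt (verit) of_nat_0_less_iff zero_less_Suc zero_less_divide_1_iff)
      also have "\<dots> \<le> x k $ i" using k xpos[of k i] by simp
      finally show ?thesis .
    qed
    then show ?thesis using xpos that by blast
  next
    case False
    \<comment> \<open>otherwise a limit of the Perron vectors is an eigenvector of \<open>P\<close> for an eigenvalue \<open>\<ge> 1\<close>\<close>
    define K :: "(real^'n) set" where "K = {x. (\<forall>i. 0 \<le> x $ i) \<and> (\<Sum>i\<in>UNIV. x $ i) = 1}"
    have "compact K" unfolding K_def by (rule compact_simplex)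
    moreover have "\<forall>k. x k \<in> K" using xpos xsum by (auto simp: K_def less_imp_le)
    ultimately obtain l r where l: "l \<in> K" "strict_mono r" "(x \<circ> r) \<longlonglongrightarrow> l"
      unfolding compact_def by metis
    have c_eq: "c k = (\<Sum>i\<in>UNIV. (P *v x k) $ i + 1 / Suc k)" for k
      unfolding eigi using xsum[of k] by (simp flip: sum_distrib_left)
    have h: "(\<lambda>k. 1 / real (Suc (r k))) \<longlonglongrightarrow> 0"
      using LIMSEQ_subseq_LIMSEQ[OF LIMSEQ_inverse_real_of_nat l(2)]
      by (simp add: o_def inverse_eq_divide)
    have Pl: "(\<lambda>k. (P *v x (r k)) $ i) \<longlonglongrightarrow> (P *v l) $ i" for i
      unfolding matrix_vector_nth using l(3) by (intro tendsto_intros) (simp add: o_def)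
    define d where "d = (\<Sum>i\<in>UNIV. (P *v l) $ i)"
    have cl: "(\<lambda>k. c (r k)) \<longlonglongrightarrow> d"
    proof -
      have "(\<lambda>k. c (r k)) \<longlonglongrightarrow> (\<Sum>i\<in>UNIV. (P *v l) $ i + 0)"
        unfolding c_eq by (intro tendsto_sum tendsto_add Pl h)
      then show ?thesis by (simp add: d_def)
    qed
    have "1 \<le> d"
      using False by (intro LIMSEQ_le_const[OF cl]) (auto simp: not_less)
    have "(P *v l) $ i = d * l $ i" for i
    proof (rule LIMSEQ_unique)
      have "(\<lambda>k. (P *v x (r k)) $ i + 1 / Suc (r k)) \<longlonglongrightarrow> (P *v l) $ i + 0"
        by (intro tendsto_intros Pl h)
      then show "(\<lambda>k. c (r k) * x (r k) $ i) \<longlonglongrightarrow> (P *v l) $ i" by (simp only: eigi add_0_right)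
      show "(\<lambda>k. c (r k) * x (r k) $ i) \<longlonglongrightarrow> d * l $ i"
        using l(3) by (intro tendsto_intros cl) (simp add: o_def)
    qed
    then have "P *v l = d *\<^sub>R l" by (simp add: vec_eq_iff)
    moreover have "l \<noteq> 0" using l(1) by (auto simp: K_def)
    ultimately have "\<bar>d\<bar> \<le> spectral_radius P" by (rule spectral_radius_ge_real_eigenvalue[rotated])
    with \<open>1 \<le> d\<close> rad have False by simp
    then show ?thesis ..
  qed
qed

text \<open>
  The weight \<open>p\<close> turns \<open>P\<close> into a contraction: the transpose of \<open>P\<close> has norm at most \<open>\<alpha>\<close> for the
  weighted sum \<open>p \<bullet> x\<close> on nonnegative vectors. All later estimates use \<open>p\<close> and \<open>\<alpha>\<close> only.
\<close>
locale skorohod_matrix =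
  fixes P :: "real ^ 'n ^ 'n" and p :: "real ^ 'n" and \<alpha> :: real
  assumes P_nonneg: "0 \<le> P $ i $ j"
    and p_pos: "0 < p $ i"
    and contr: "(P *v p) $ i \<le> \<alpha> * p $ i"
    and \<alpha>: "0 \<le> \<alpha>" "\<alpha> < 1"

lemma skorohod_matrix_exists:
  fixes P :: "real ^ 'n ^ 'n"
  assumes nn: "\<forall>i j. 0 \<le> P $ i $ j" and rad: "spectral_radius P < 1"
  obtains p \<alpha> where "skorohod_matrix P p \<alpha>"
proof -
  obtain p where p: "\<And>i. 0 < p $ i" "\<And>i. (P *v p) $ i < p $ i"
    by (rule strictly_subinvariant_vector[OF assms]) blast
  define \<alpha> where "\<alpha> = Max (range (\<lambda>i. (P *v p) $ i / p $ i))"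
  have le: "(P *v p) $ i / p $ i \<le> \<alpha>" for i unfolding \<alpha>_def by (rule Max_ge) auto
  have "\<alpha> \<in> range (\<lambda>i. (P *v p) $ i / p $ i)" unfolding \<alpha>_def by (rule Max_in) auto
  then obtain i where i: "\<alpha> = (P *v p) $ i / p $ i" by auto
  have "0 \<le> (P *v p) $ i" unfolding matrix_vector_nth
    using nn p(1) by (intro sum_nonneg mult_nonneg_nonneg) (auto simp: less_imp_le)
  then have "0 \<le> \<alpha>" using p(1)[of i] by (simp add: i)
  moreover have "\<alpha> < 1" using p(1)[of i] p(2)[of i] by (simp add: i)
  moreover have "(P *v p) $ i \<le> \<alpha> * p $ i" for i
    using le[of i] p(1)[of i] by (simp add: pos_divide_le_eq)
  ultimately have "skorohod_matrix P p \<alpha>"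
    using nn p(1) unfolding skorohod_matrix_def by blast
  then show ?thesis by (rule that)
qed

context skorohod_matrix
begin

definition A :: "real^'n \<Rightarrow> real^'n" where "A x = transpose P *v x"

lemma linear_A: "linear A"
  unfolding A_def by (rule matrix_vector_mul_linear)

lemmas A_linear_simps = linear_add[OF linear_A] linear_diff[OF linear_A] linear_neg[OF linear_A]
  linear_0[OF linear_A] linear_cmul[OF linear_A]

abbreviation R :: "real^'n^'n" where "R \<equiv> mat 1 - transpose P"

lemma R_mult: "R *v x = x - A x"
  by (simp only: matrix_vector_mult_diff_rdistrib matrix_vector_mul_lid A_def)

lemma A_nth: "A x $ i = (\<Sum>j\<in>UNIV. P $ j $ i * x $ j)"
  by (simp only: A_def matrix_vector_nth) (simp add: transpose_def)

lemma A_mono: "x \<le> y \<Longrightarrow> A x \<le> A y"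
  using P_nonneg by (auto simp: less_eq_vec_def A_nth intro!: sum_mono mult_left_mono)

lemma A_nonneg: "0 \<le> x \<Longrightarrow> 0 \<le> A x"
  using A_mono[of 0 x] by (simp add: A_linear_simps)

lemma inner_p_mono: "x \<le> y \<Longrightarrow> p \<bullet> x \<le> p \<bullet> y"
  unfolding inner_vec_real using p_pos
  by (intro sum_mono mult_left_mono) (auto simp: less_eq_vec_def less_imp_le)

lemma inner_p_A: "0 \<le> x \<Longrightarrow> p \<bullet> A x \<le> \<alpha> * (p \<bullet> x)"
proof -
  assume x: "0 \<le> x"
  have "p \<bullet> A x = (P *v p) \<bullet> x"
    unfolding A_def by (metis dot_lmul_matrix inner_commute vector_transpose_matrix)
  also have "\<dots> \<le> (\<alpha> *\<^sub>R p) \<bullet> x"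
    unfolding inner_vec_real using contr x
    by (intro sum_mono mult_right_mono) (auto simp: less_eq_vec_def)
  finally show ?thesis by simp
qed

lemma nth_le_inner_p: "0 \<le> x \<Longrightarrow> p $ i * x $ i \<le> p \<bullet> x"
  unfolding inner_vec_real using p_pos
  by (intro member_le_sum) (auto simp: less_eq_vec_def less_imp_le)

text \<open>
  A vector dominated by \<open>b\<close> plus its own image is bounded in terms of \<open>b\<close>. This controls the
  iterates and the modulus of continuity of the regulator; the case \<open>b = 0\<close> yields uniqueness.
\<close>
lemma sub_bound: "\<lbrakk>0 \<le> x; x \<le> b + A x\<rbrakk> \<Longrightarrow> p \<bullet> x \<le> (p \<bullet> b) / (1 - \<alpha>)"
  using inner_p_mono[of x "b + A x"] inner_p_A[of x] \<alpha>
  by (simp add: inner_add_right pos_le_divide_eq algebra_simps)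

lemma sub_zero: "\<lbrakk>0 \<le> x; x \<le> A x\<rbrakk> \<Longrightarrow> x = 0"
proof -
  assume x: "0 \<le> x" "x \<le> A x"
  have "p \<bullet> x \<le> 0" using sub_bound[of x 0] x by simp
  then have "p $ i * x $ i \<le> 0" for i using nth_le_inner_p[OF x(1), of i] by simp
  then have "x $ i \<le> 0" for i using p_pos[of i] by (meson mult_le_0_iff not_less)
  then show ?thesis using x(1) by (auto simp: vec_eq_iff less_eq_vec_def intro: antisym)
qed

text \<open>
  The negative part \<open>m\<close> of \<open>x\<close> satisfies \<open>m \<le> A m\<close> and so vanishes. Invertibility of \<open>R\<close> and
  nonnegativity of its inverse follow.
\<close>
lemma R_nonneg_imp_nonneg: assumes "0 \<le> R *v x" shows "0 \<le> x"
proof -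
  define m :: "real^'n" where "m = (\<chi> i. max 0 (- x $ i))"
  have "m = 0"
  proof (rule sub_zero)
    show "0 \<le> m" by (simp add: m_def less_eq_vec_def)
    have *: "- A x \<le> A m"
    proof -
      have "A (- x) \<le> A m" by (rule A_mono) (simp add: m_def less_eq_vec_def)
      then show ?thesis by (simp add: A_linear_simps)
    qed
    have "0 \<le> A m" by (intro A_nonneg) (simp add: m_def less_eq_vec_def)
    then show "m \<le> A m" using assms * by (auto simp: R_mult m_def less_eq_vec_def) (smt (verit))
  qed
  then have "- x $ i \<le> 0" for i
    by (metis m_def max.cobounded2 vec_lambda_beta zero_index)
  then show ?thesis by (simp add: less_eq_vec_def)
qed

lemma invertible_R: "invertible R"
proof -
  have "x = 0" if "R *v x = 0" for x
  proof -
    have "R *v (- x) = 0" using that unfolding R_mult by (simp add: A_linear_simps)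
    then show ?thesis
      using R_nonneg_imp_nonneg[of x] R_nonneg_imp_nonneg[of "-x"] that
      by (auto simp: vec_eq_iff less_eq_vec_def intro: antisym)
  qed
  then show ?thesis by (metis invertible_left_inverse matrix_left_invertible_ker)
qed

lemma matrix_inv_R: "R ** matrix_inv R = mat 1" "matrix_inv R ** R = mat 1"
  using someI_ex[OF invertible_R[unfolded invertible_def]] unfolding matrix_inv_def by blast+

abbreviation Ri :: "real^'n \<Rightarrow> real^'n" where "Ri x \<equiv> matrix_inv R *v x"

lemma R_Ri [simp]: "R *v Ri x = x"
  using matrix_inv_R(1) by (metis matrix_vector_mul_assoc matrix_vector_mul_lid)

lemma Ri_R [simp]: "Ri (R *v x) = x"
  using matrix_inv_R(2) by (metis matrix_vector_mul_assoc matrix_vector_mul_lid)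

lemma Ri_nonneg: "0 \<le> x \<Longrightarrow> 0 \<le> Ri x"
  by (rule R_nonneg_imp_nonneg) simp

lemma Ri_mono: "x \<le> y \<Longrightarrow> Ri x \<le> Ri y"
  using Ri_nonneg[of "y - x"] by (simp add: matrix_vector_mult_diff_distrib)

lemma le_Ri: "0 \<le> x \<Longrightarrow> x \<le> Ri x"
proof -
  assume x: "0 \<le> x"
  have "Ri x = x + A (Ri x)" using R_Ri[of x] unfolding R_mult by (simp add: algebra_simps)
  moreover have "0 \<le> A (Ri x)" using x by (intro A_nonneg Ri_nonneg)
  ultimately show ?thesis by (simp add: less_eq_vec_def vec_eq_iff)
qed

end

section \<open>One-dimensional reflection over a time set\<close>

text \<open>
  The least nonnegative nondecreasing function that keeps \<open>z\<close> nonnegative when added to it. The set \<open>E\<close> of times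
  is either the half line or a countable skeleton of it; the latter gives measurability in the path.
\<close>
definition regulator :: "real set \<Rightarrow> (real \<Rightarrow> real) \<Rightarrow> real \<Rightarrow> real" where
  "regulator E z t = (SUP u\<in>{u\<in>E. u \<le> t}. max 0 (- z u))"

lemma regulator_bdd:
  fixes z :: "real \<Rightarrow> real"
  assumes "bdd_below (z ` {u\<in>E. u \<le> t})"
  shows "bdd_above ((\<lambda>u. max 0 (- z u)) ` {u\<in>E. u \<le> t})"
proof -
  obtain m where m: "\<And>u. u \<in> E \<Longrightarrow> u \<le> t \<Longrightarrow> m \<le> z u"
    using assms by (auto simp: bdd_below_def)
  show ?thesis by (rule bdd_aboveI2[where M = "max 0 (- m)"]) (use m in fastforce)
qed

lemma regulator_upper:
  assumes "bdd_below (z ` {u\<in>E. u \<le> t})" "u \<in> E" "u \<le> t"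
  shows "- z u \<le> regulator E z t" "0 \<le> regulator E z t"
proof -
  have "max 0 (- z u) \<le> regulator E z t"
    unfolding regulator_def using assms by (intro cSUP_upper regulator_bdd) auto
  then show "- z u \<le> regulator E z t" "0 \<le> regulator E z t" by auto
qed

lemma regulator_least:
  assumes "t \<in> E" "0 \<le> c" "\<And>u. u \<in> E \<Longrightarrow> u \<le> t \<Longrightarrow> - z u \<le> c"
  shows "regulator E z t \<le> c"
  unfolding regulator_def using assms by (intro cSUP_least) auto

lemma regulator_mono_time:
  assumes "bdd_below (z ` {u\<in>E. u \<le> t})" "s \<in> E" "s \<le> t"
  shows "regulator E z s \<le> regulator E z t"
  using assms by (intro regulator_least) (auto intro: regulator_upper)

lemma regulator_antimono:
  assumes "bdd_below (z ` {u\<in>E. u \<le> t})" "t \<in> E" "\<And>u. u \<in> E \<Longrightarrow> u \<le> t \<Longrightarrow> z u \<le> z' u"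
  shows "regulator E z' t \<le> regulator E z t"
proof (rule regulator_least)
  fix u assume u: "u \<in> E" "u \<le> t"
  show "- z' u \<le> regulator E z t"
    using regulator_upper(1)[OF assms(1) u] assms(3)[OF u] by linarith
qed (use assms in \<open>auto intro: regulator_upper\<close>)

text \<open>
  Values of \<open>z\<close> before \<open>s\<close> are already accounted for by the regulator at \<open>s\<close>, so only later values can
  raise it further.
\<close>
lemma regulator_increment_least:
  assumes "bdd_below (z ` {u\<in>E. u \<le> s})" "s \<in> E" "t \<in> E" "s \<le> t" "0 \<le> c"
    and "\<And>u. u \<in> E \<Longrightarrow> s \<le> u \<Longrightarrow> u \<le> t \<Longrightarrow> - z u - regulator E z s \<le> c"
  shows "regulator E z t - regulator E z s \<le> c"
proof -
  have "regulator E z t \<le> regulator E z s + c"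
  proof (rule regulator_least[OF assms(3)])
    show "0 \<le> regulator E z s + c"
      using regulator_upper(2)[OF assms(1,2)] assms(5) by simp
    fix u assume u: "u \<in> E" "u \<le> t"
    show "- z u \<le> regulator E z s + c"
    proof (cases "s \<le> u")
      case True
      then show ?thesis using assms(6)[OF u(1) True u(2)] by linarith
    next
      case False
      then show ?thesis using regulator_upper(1)[OF assms(1) u(1)] assms(5) by linarith
    qed
  qed
  then show ?thesis by linarith
qed

text \<open>
  The flow property in dimension one: the regulator restarts at time \<open>s\<close> from the regulated value.
\<close>
lemma regulator_shift:
  assumes "bdd_below (z ` {u\<in>{0..}. u \<le> s + t})" "0 \<le> s" "0 \<le> t"
  shows "regulator {0..} z (s + t) - regulator {0..} z s =
         regulator {0..} (\<lambda>u. z (s + u) + regulator {0..} z s) t"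
proof (rule antisym)
  have b: "bdd_below (z ` {u\<in>{0..}. u \<le> s})"
    by (rule bdd_below_mono[OF assms(1)]) (use assms in auto)
  have b': "bdd_below ((\<lambda>u. z (s + u) + regulator {0..} z s) ` {u\<in>{0..}. u \<le> t})"
  proof -
    obtain m where m: "\<And>u. 0 \<le> u \<Longrightarrow> u \<le> s + t \<Longrightarrow> m \<le> z u"
      using assms(1) by (auto simp: bdd_below_def)
    show ?thesis by (rule bdd_belowI2[where m = "m + regulator {0..} z s"]) (use m assms in auto)
  qed
  show "regulator {0..} z (s + t) - regulator {0..} z s
        \<le> regulator {0..} (\<lambda>u. z (s + u) + regulator {0..} z s) t"
  proof (rule regulator_increment_least[OF b])
    show "0 \<le> regulator {0..} (\<lambda>u. z (s + u) + regulator {0..} z s) t"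
      by (rule regulator_upper(2)[OF b', of t]) (use assms in auto)
    fix u assume u: "u \<in> {0..}" "s \<le> u" "u \<le> s + t"
    show "- z u - regulator {0..} z s \<le> regulator {0..} (\<lambda>u. z (s + u) + regulator {0..} z s) t"
      using regulator_upper(1)[OF b', of "u - s"] u by auto
  qed (use assms in auto)
  show "regulator {0..} (\<lambda>u. z (s + u) + regulator {0..} z s) t
        \<le> regulator {0..} z (s + t) - regulator {0..} z s"
  proof (rule regulator_least)
    show "0 \<le> regulator {0..} z (s + t) - regulator {0..} z s"
      using regulator_mono_time[OF assms(1), of s] assms by auto
    fix u assume u: "u \<in> {0..}" "u \<le> t"
    show "- (z (s + u) + regulator {0..} z s) \<le> regulator {0..} z (s + t) - regulator {0..} z s"
      using regulator_upper(1)[OF assms(1), of "s + u"] u assms by auto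
  qed (use assms in auto)
qed

text \<open>
  When the free path is raised by a nonnegative and nondecreasing amount, the regulator may fall behind,
  but by no more than that amount; the regulated path therefore rises, and each increment of
  the regulator becomes smaller. This is what makes the gap between two starts monotone.
\<close>
lemma regulator_compare:
  assumes b: "\<And>t. t \<in> E \<Longrightarrow> bdd_below (z ` {u\<in>E. u \<le> t})"
    and b': "\<And>t. t \<in> E \<Longrightarrow> bdd_below (z' ` {u\<in>E. u \<le> t})"
    and h: "\<And>s t. s \<in> E \<Longrightarrow> t \<in> E \<Longrightarrow> s \<le> t \<Longrightarrow> z' s - z s \<le> z' t - z t"
    and h0: "\<And>s. s \<in> E \<Longrightarrow> z s \<le> z' s"
  shows regulator_compare_value: "t \<in> E \<Longrightarrow> z t + regulator E z t \<le> z' t + regulator E z' t"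
    and regulator_compare_increment: "s \<in> E \<Longrightarrow> t \<in> E \<Longrightarrow> s \<le> t \<Longrightarrow>
      regulator E z' t - regulator E z' s \<le> regulator E z t - regulator E z s"
proof -
  show 1: "z t + regulator E z t \<le> z' t + regulator E z' t" if t: "t \<in> E" for t
  proof -
    have "regulator E z t \<le> regulator E z' t + (z' t - z t)"
    proof (rule regulator_least[OF t])
      show "0 \<le> regulator E z' t + (z' t - z t)"
        using regulator_upper(2)[OF b'[OF t] t] h0[OF t] by simp
      fix u assume u: "u \<in> E" "u \<le> t"
      show "- z u \<le> regulator E z' t + (z' t - z t)"
        using regulator_upper(1)[OF b'[OF t] u] h[OF u(1) t u(2)] by linarith
    qed
    then show ?thesis by linarith
  qed
  show "regulator E z' t - regulator E z' s \<le> regulator E z t - regulator E z s"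
    if s: "s \<in> E" and t: "t \<in> E" and st: "s \<le> t"
  proof (rule regulator_increment_least[OF b'[OF s] s t st])
    show "0 \<le> regulator E z t - regulator E z s"
      using regulator_mono_time[OF b[OF t] s st] by simp
    fix u assume u: "u \<in> E" "s \<le> u" "u \<le> t"
    show "- z' u - regulator E z' s \<le> regulator E z t - regulator E z s"
      using regulator_upper(1)[OF b[OF t] u(1,3)] 1[OF s] h[OF s u(1,2)] by linarith
  qed
qed

section \<open>The multidimensional reflection map over a time set\<close>

text \<open>
  Keeps the suprema in the iteration below finite.
\<close>
definition lower_bounded :: "real set \<Rightarrow> (real \<Rightarrow> real^'n) \<Rightarrow> bool" where
  "lower_bounded E y \<longleftrightarrow> (\<forall>t\<in>E. \<exists>c. \<forall>u\<in>E. u \<le> t \<longrightarrow> (\<forall>i. - c \<le> y u $ i))"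

lemma lower_boundedE:
  assumes "lower_bounded E y" "t \<in> E"
  obtains c where "0 \<le> c" "\<And>u i. u \<in> E \<Longrightarrow> u \<le> t \<Longrightarrow> - c \<le> y u $ i"
proof -
  obtain c where c: "\<And>u i. u \<in> E \<Longrightarrow> u \<le> t \<Longrightarrow> - c \<le> y u $ i"
    using assms unfolding lower_bounded_def by blast
  have "- max 0 c \<le> y u $ i" if "u \<in> E" "u \<le> t" for u i
    using c[OF that, of i] by linarith
  then show ?thesis by (intro that[of "max 0 c"]) auto
qed

lemma mono_on_vecD: "mono_on E (l :: real \<Rightarrow> real^'n) \<Longrightarrow> s \<in> E \<Longrightarrow> t \<in> E \<Longrightarrow> s \<le> t \<Longrightarrow> l s $ i \<le> l t $ i"
  by (meson less_eq_vec_def mono_onD)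

context skorohod_matrix
begin

text \<open>
  The successive approximations to the regulator: component \<open>i\<close> is regulated against the push
  \<open>A l\<close> exerted by the other components in the preceding round.
\<close>
primrec Lit :: "real set \<Rightarrow> (real \<Rightarrow> real^'n) \<Rightarrow> nat \<Rightarrow> real \<Rightarrow> real^'n" where
  "Lit E y 0 = (\<lambda>t. 0)"
| "Lit E y (Suc k) = (\<lambda>t. \<chi> i. regulator E (\<lambda>u. y u $ i - A (Lit E y k u) $ i) t)"

lemma Lit_Suc_nth: "Lit E y (Suc k) t $ i = regulator E (\<lambda>u. y u $ i - A (Lit E y k u) $ i) t"
  by simp

text \<open>
  Constructed over an arbitrary set of times; over the half line and for a cadlag path these are
  \<open>L(y)\<close> and \<open>W(y)\<close> (\<open>reflection_map_eq\<close>).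
\<close>
definition Llim :: "real set \<Rightarrow> (real \<Rightarrow> real^'n) \<Rightarrow> real \<Rightarrow> real^'n" where
  "Llim E y t = (\<chi> i. SUP k. Lit E y k t $ i)"

definition Wlim :: "real set \<Rightarrow> (real \<Rightarrow> real^'n) \<Rightarrow> real \<Rightarrow> real^'n" where
  "Wlim E y t = y t + R *v Llim E y t"

lemma Wlim_nth: "Wlim E y t $ i = (y t $ i - A (Llim E y t) $ i) + Llim E y t $ i"
  by (simp add: Wlim_def R_mult)

lemma tendsto_A: "(f \<longlongrightarrow> l) F \<Longrightarrow> ((\<lambda>k. A (f k)) \<longlongrightarrow> A l) F"
  using linear_A by (simp add: linear_linear bounded_linear.tendsto)

lemma A_mono_nth: "x \<le> y \<Longrightarrow> A x $ i \<le> A y $ i"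
  using A_mono by (auto simp: less_eq_vec_def)

lemma free_bdd_below:
  assumes "lower_bounded E y" "mono_on E l" "t \<in> E"
  shows "bdd_below ((\<lambda>u. y u $ i - A (l u) $ i) ` {u\<in>E. u \<le> t})"
proof -
  obtain c where c: "\<And>u i. u \<in> E \<Longrightarrow> u \<le> t \<Longrightarrow> - c \<le> y u $ i"
    using lower_boundedE[OF assms(1,3)] by metis
  show ?thesis
  proof (rule bdd_belowI2[where m = "- c - A (l t) $ i"])
    fix u assume u: "u \<in> {u\<in>E. u \<le> t}"
    have "A (l u) $ i \<le> A (l t) $ i" using u assms by (intro A_mono_nth mono_onD[OF assms(2)]) auto
    then show "- c - A (l t) $ i \<le> y u $ i - A (l u) $ i" using c[of u i] u by auto
  qed
qed

context
  fixes E and y :: "real \<Rightarrow> real^'n"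
  assumes lb: "lower_bounded E y"
begin

lemma Lit_mono_time: "mono_on E (Lit E y k)"
proof (induction k)
  case (Suc k)
  show ?case
    by (rule mono_onI)
       (auto simp: less_eq_vec_def intro!: regulator_mono_time free_bdd_below[OF lb Suc])
qed (simp add: mono_on_def)

lemma Lit_nonneg: "t \<in> E \<Longrightarrow> 0 \<le> Lit E y k t"
  by (cases k) (auto simp: less_eq_vec_def
      intro!: regulator_upper(2)[OF free_bdd_below[OF lb Lit_mono_time]])

lemma Lit_Suc_le: "t \<in> E \<Longrightarrow> Lit E y k t \<le> Lit E y (Suc k) t"
proof (induction k arbitrary: t)
  case 0
  then show ?case using Lit_nonneg[of t "Suc 0"] by simp
next
  case (Suc k)
  have "Lit E y (Suc k) t $ i \<le> Lit E y (Suc (Suc k)) t $ i" for i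
    unfolding Lit_Suc_nth[of E y k] Lit_Suc_nth[of E y "Suc k"]
    by (intro regulator_antimono free_bdd_below[OF lb Lit_mono_time] A_mono_nth diff_left_mono Suc)
  then show ?case unfolding less_eq_vec_def by blast
qed

text \<open>
  Regulating against a path bounded below by \<open>-c\<close> gives \<open>l \<le> c 1 + A l\<close> for the next iterate, so
  the weighted norm of all iterates is bounded by the geometric series in \<open>\<alpha>\<close>.
\<close>
lemma Lit_le_bound:
  assumes "t \<in> E" "0 \<le> c" "\<And>u i. u \<in> E \<Longrightarrow> u \<le> t \<Longrightarrow> - c \<le> y u $ i"
  shows "p $ i * Lit E y k t $ i \<le> c * (p \<bullet> 1) / (1 - \<alpha>)"
proof -
  have "Lit E y k t \<le> c *\<^sub>R 1 + A (Lit E y k t)"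
  proof (cases k)
    case 0
    then show ?thesis using assms by (simp add: less_eq_vec_def A_linear_simps)
  next
    case (Suc m)
    have "Lit E y (Suc m) t $ i \<le> c + A (Lit E y (Suc m) t) $ i" for i
      unfolding Lit.simps(2)[of E y m] vec_lambda_beta
    proof (rule regulator_least[OF assms(1)])
      let ?l = "\<chi> i. regulator E (\<lambda>u. y u $ i - A (Lit E y m u) $ i) t"
      have "0 \<le> ?l" using Lit_nonneg[OF assms(1), of "Suc m"] by simp
      then show "0 \<le> c + A ?l $ i" using A_nonneg[of ?l] assms(2) by (simp add: less_eq_vec_def)
      fix u assume u: "u \<in> E" "u \<le> t"
      have "Lit E y m u \<le> ?l"
        using order_trans[OF mono_onD[OF Lit_mono_time u(1) assms(1) u(2)] Lit_Suc_le[OF assms(1)], of m]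
        by simp
      then have "A (Lit E y m u) $ i \<le> A ?l $ i" by (rule A_mono_nth)
      then show "- (y u $ i - A (Lit E y m u) $ i) \<le> c + A ?l $ i"
        using assms(3)[OF u, of i] by linarith
    qed
    then show ?thesis using Suc by (simp add: less_eq_vec_def del: Lit.simps)
  qed
  from sub_bound[OF Lit_nonneg[OF assms(1)] this]
  show ?thesis using nth_le_inner_p[OF Lit_nonneg[OF assms(1)], where i=i and k1=k] by simp
qed

lemma Lit_bdd: "t \<in> E \<Longrightarrow> bdd_above (range (\<lambda>k. Lit E y k t $ i))"
proof -
  assume t: "t \<in> E"
  obtain c where c: "0 \<le> c" "\<And>u i. u \<in> E \<Longrightarrow> u \<le> t \<Longrightarrow> - c \<le> y u $ i"
    using lower_boundedE[OF lb t] by metis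
  show ?thesis
  proof (rule bdd_aboveI2[where M = "(c * (p \<bullet> 1) / (1 - \<alpha>)) / p $ i"])
    fix k show "Lit E y k t $ i \<le> (c * (p \<bullet> 1) / (1 - \<alpha>)) / p $ i"
      using Lit_le_bound[OF t c, of i k] by (subst pos_le_divide_eq[OF p_pos]) (simp only: mult.commute)
  qed
qed

lemma Lit_le_Llim: "t \<in> E \<Longrightarrow> Lit E y k t \<le> Llim E y t"
  by (auto simp: less_eq_vec_def Llim_def intro!: cSUP_upper Lit_bdd)

lemma Lit_tendsto: "t \<in> E \<Longrightarrow> (\<lambda>k. Lit E y k t) \<longlonglongrightarrow> Llim E y t"
  unfolding Llim_def
proof (rule vec_tendstoI)
  fix i assume "t \<in> E"
  then show "(\<lambda>k. Lit E y k t $ i) \<longlonglongrightarrow> (\<chi> i. SUP k. Lit E y k t $ i) $ i"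
    using Lit_Suc_le[of t] unfolding vec_lambda_beta
    by (intro LIMSEQ_incseq_SUP Lit_bdd incseq_SucI) (auto simp: less_eq_vec_def)
qed

lemma Llim_nonneg: "t \<in> E \<Longrightarrow> 0 \<le> Llim E y t"
  using Lit_le_Llim[of t 0] by simp

lemma Llim_least: "(\<And>k. Lit E y k t \<le> l) \<Longrightarrow> Llim E y t \<le> l"
  by (auto simp: less_eq_vec_def Llim_def intro!: cSUP_least)

lemma Llim_mono_time: "mono_on E (Llim E y)"
  by (intro mono_onI Llim_least) (meson Lit_le_Llim Lit_mono_time mono_onD order_trans)

lemma Llim_bdd: "t \<in> E \<Longrightarrow> bdd_below ((\<lambda>u. y u $ i - A (Llim E y u) $ i) ` {u\<in>E. u \<le> t})"
  by (rule free_bdd_below[OF lb Llim_mono_time])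

text \<open>
  The limit solves the system of one-dimensional regulator equations. The iterates increase, and
  the regulator commutes with increasing limits because each of its constraints passes to the limit.
\<close>
lemma Llim_fixpoint:
  assumes t: "t \<in> E"
  shows "Llim E y t $ i = regulator E (\<lambda>u. y u $ i - A (Llim E y u) $ i) t"
proof (rule antisym)
  have "Lit E y k t $ i \<le> regulator E (\<lambda>u. y u $ i - A (Llim E y u) $ i) t" for k
  proof (cases k)
    case 0
    then show ?thesis using regulator_upper(2)[OF Llim_bdd[OF t] t] by simp
  next
    case (Suc k)
    then show ?thesis
      by (auto intro!: regulator_antimono t Llim_bdd A_mono_nth Lit_le_Llim)
  qed
  then show "Llim E y t $ i \<le> regulator E (\<lambda>u. y u $ i - A (Llim E y u) $ i) t"
    unfolding Llim_def vec_lambda_beta by (intro cSUP_least) auto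
  show "regulator E (\<lambda>u. y u $ i - A (Llim E y u) $ i) t \<le> Llim E y t $ i"
  proof (rule regulator_least[OF t])
    show "0 \<le> Llim E y t $ i" using Llim_nonneg[OF t] by (simp add: less_eq_vec_def)
    fix u assume u: "u \<in> E" "u \<le> t"
    show "- (y u $ i - A (Llim E y u) $ i) \<le> Llim E y t $ i"
    proof (rule LIMSEQ_le_const2)
      show "(\<lambda>k. - (y u $ i - A (Lit E y k u) $ i)) \<longlonglongrightarrow> - (y u $ i - A (Llim E y u) $ i)"
        by (intro tendsto_intros tendsto_A Lit_tendsto u)
      have "- (y u $ i - A (Lit E y k u) $ i) \<le> Lit E y (Suc k) t $ i" for k
        unfolding Lit.simps(2) vec_lambda_beta
        by (rule regulator_upper(1)[OF free_bdd_below[OF lb Lit_mono_time t] u])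
      also have "Lit E y (Suc k) t $ i \<le> Llim E y t $ i" for k
        using Lit_le_Llim[OF t, of "Suc k"] unfolding less_eq_vec_def by blast
      finally show "\<exists>N. \<forall>k\<ge>N. - (y u $ i - A (Lit E y k u) $ i) \<le> Llim E y t $ i" by blast
    qed
  qed
qed

lemma Wlim_nonneg: "t \<in> E \<Longrightarrow> 0 \<le> Wlim E y t"
proof -
  assume t: "t \<in> E"
  have "0 \<le> Wlim E y t $ i" for i
    unfolding Wlim_nth Llim_fixpoint[OF t, of i] using regulator_upper(1)[OF Llim_bdd[OF t] t, of i] by linarith
  then show ?thesis by (simp add: less_eq_vec_def)
qed

text \<open>
  By induction, every admissible regulator dominates the iterates: being nondecreasing and keeping
  the path nonnegative is all that the least regulator of each component asks for. The horizon \<open>T\<close>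
  allows competitors that are admissible only up to \<open>T\<close>.
\<close>
lemma Llim_minimal:
  assumes l0: "\<And>t. t \<in> E \<Longrightarrow> t \<le> T \<Longrightarrow> 0 \<le> l t" and lm: "mono_on {t\<in>E. t \<le> T} l"
    and w: "\<And>t. t \<in> E \<Longrightarrow> t \<le> T \<Longrightarrow> 0 \<le> y t + R *v l t"
    and t: "t \<in> E" "t \<le> T"
  shows "Llim E y t \<le> l t"
proof (rule Llim_least)
  fix k show "Lit E y k t \<le> l t"
    using t
  proof (induction k arbitrary: t)
    case 0
    then show ?case using l0 by simp
  next
    case (Suc k)
    have "Lit E y (Suc k) t $ i \<le> l t $ i" for i
      unfolding Lit.simps(2) vec_lambda_beta
    proof (rule regulator_least[OF Suc.prems(1)])
      show "0 \<le> l t $ i" using l0 Suc.prems by (simp add: less_eq_vec_def)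
      fix u assume u: "u \<in> E" "u \<le> t"
      have "A (Lit E y k u) $ i \<le> A (l u) $ i" using u Suc by (intro A_mono_nth Suc.IH) auto
      moreover have "0 \<le> y u $ i + (l u $ i - A (l u) $ i)"
        using w[of u] u Suc.prems by (simp add: less_eq_vec_def R_mult)
      moreover have "l u $ i \<le> l t $ i" using u Suc.prems by (intro mono_on_vecD[OF lm]) auto
      ultimately show "- (y u $ i - A (Lit E y k u) $ i) \<le> l t $ i" by linarith
    qed
    then show ?case by (simp add: less_eq_vec_def del: Lit.simps)
  qed
qed

text \<open>
  A solution dominates \<open>Llim\<close> by minimality. The largest excess \<open>D\<close> up to time \<open>t\<close> satisfies
  \<open>D \<le> A D\<close>, because raising the push by \<open>A D\<close> raises the regulator by at most \<open>A D\<close>; hence \<open>D = 0\<close>.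
\<close>
lemma fixpoint_unique:
  assumes lm: "mono_on E l"
    and fp: "\<And>t i. t \<in> E \<Longrightarrow> l t $ i = regulator E (\<lambda>u. y u $ i - A (l u) $ i) t"
    and t: "t \<in> E"
  shows "l t = Llim E y t"
proof -
  note b = free_bdd_below[OF lb lm]
  have l0: "0 \<le> l u" if "u \<in> E" for u
    using regulator_upper(2)[OF b[OF that] that] by (simp add: less_eq_vec_def fp[OF that])
  have le: "Llim E y u \<le> l u" if u: "u \<in> E" for u
  proof (rule Llim_minimal[where T = u])
    fix s assume s: "s \<in> E"
    show "0 \<le> y s + R *v l s"
    proof -
      have "0 \<le> y s $ i + (l s $ i - A (l s) $ i)" for i
        using regulator_upper(1)[OF b[OF s] s, of i] fp[OF s, of i] by linarith
      then show ?thesis by (simp add: less_eq_vec_def R_mult)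
    qed
  qed (use u l0 in \<open>auto intro: mono_on_subset[OF lm]\<close>)
  define D :: "real^'n" where "D = (\<chi> i. SUP u\<in>{u\<in>E. u \<le> t}. l u $ i - Llim E y u $ i)"
  have bd: "bdd_above ((\<lambda>u. l u $ i - Llim E y u $ i) ` {u\<in>E. u \<le> t})" for i
  proof (rule bdd_aboveI2[where M = "l t $ i"])
    fix u assume u: "u \<in> {u\<in>E. u \<le> t}"
    have "l u $ i \<le> l t $ i" using u t by (intro mono_on_vecD[OF lm]) auto
    moreover have "0 \<le> Llim E y u $ i" using Llim_nonneg[of u] u by (simp add: less_eq_vec_def)
    ultimately show "l u $ i - Llim E y u $ i \<le> l t $ i" by linarith
  qed
  have dD: "l u - Llim E y u \<le> D" if "u \<in> E" "u \<le> t" for u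
    unfolding D_def less_eq_vec_def using that by (auto intro!: cSUP_upper2[OF bd])
  have "0 \<le> l t - Llim E y t" using le[OF t] by (simp add: less_eq_vec_def)
  then have D0: "0 \<le> D" using dD[OF t order_refl] by (rule order_trans)
  have "D \<le> A D"
    unfolding less_eq_vec_def
  proof
    fix i
    have "l s $ i - Llim E y s $ i \<le> A D $ i" if s: "s \<in> E" "s \<le> t" for s
    proof -
      have "l s $ i \<le> Llim E y s $ i + A D $ i"
        unfolding fp[OF s(1)]
      proof (rule regulator_least[OF s(1)])
        show "0 \<le> Llim E y s $ i + A D $ i"
          using Llim_nonneg[OF s(1)] A_nonneg[OF D0] by (simp add: less_eq_vec_def)
        fix u assume u: "u \<in> E" "u \<le> s"
        have "A (l u - Llim E y u) $ i \<le> A D $ i" using u s by (intro A_mono_nth dD) auto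
        then have "A (l u) $ i - A (Llim E y u) $ i \<le> A D $ i" by (simp add: A_linear_simps)
        moreover have "- (y u $ i - A (Llim E y u) $ i) \<le> Llim E y s $ i"
          unfolding Llim_fixpoint[OF s(1)] by (rule regulator_upper(1)[OF Llim_bdd[OF s(1)] u])
        ultimately show "- (y u $ i - A (l u) $ i) \<le> Llim E y s $ i + A D $ i" by linarith
      qed
      then show ?thesis by linarith
    qed
    then show "D $ i \<le> A D $ i" unfolding D_def vec_lambda_beta using t by (intro cSUP_least) auto
  qed
  with D0 have "D = 0" by (rule sub_zero)
  then show ?thesis using dD[OF t] le[OF t] by (auto simp: vec_eq_iff less_eq_vec_def intro!: antisym)
qed

end

subsection \<open>Flow property and monotonicity in the free process\<close>

lemma lower_bounded_shift:
  assumes lb: "lower_bounded {0..} y" and s: "0 \<le> s"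
  shows "lower_bounded {0..} (\<lambda>u. x + y (s + u))"
  unfolding lower_bounded_def
proof
  fix t :: real assume t: "t \<in> {0..}"
  obtain c where c: "\<And>u i. u \<in> {0..} \<Longrightarrow> u \<le> s + t \<Longrightarrow> - c \<le> y u $ i"
    using lower_boundedE[OF lb, of "s + t"] s t by (metis add_nonneg_nonneg atLeast_iff)
  have "- (c + norm x) \<le> (x + y (s + u)) $ i" if "0 \<le> u" "u \<le> t" for u i
    using c[of "s + u" i] that s component_le_norm_cart[of x i] by auto
  then show "\<exists>c. \<forall>u\<in>{0..}. u \<le> t \<longrightarrow> (\<forall>i. - c \<le> (x + y (s + u)) $ i)"
    by (intro exI[of _ "c + norm x"]) auto
qed

lemma lower_bounded_add:
  assumes "lower_bounded E y" shows "lower_bounded E (\<lambda>u. x + y u)"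
  unfolding lower_bounded_def
proof
  fix t assume t: "t \<in> E"
  obtain c where c: "\<And>u i. u \<in> E \<Longrightarrow> u \<le> t \<Longrightarrow> - c \<le> y u $ i"
    using lower_boundedE[OF assms t] by metis
  have "- (c + norm x) \<le> (x + y u) $ i" if "u \<in> E" "u \<le> t" for u i
    using c[of u i] that component_le_norm_cart[of x i] by auto
  then show "\<exists>c. \<forall>u\<in>E. u \<le> t \<longrightarrow> (\<forall>i. - c \<le> (x + y u) $ i)"
    by (intro exI[of _ "c + norm x"]) auto
qed

text \<open>
  The increment of \<open>Llim\<close> after \<open>s\<close> solves the equations of the path restarted at \<open>s\<close>, component by
  component by \<open>regulator_shift\<close>; uniqueness does the rest.
\<close>
theorem Llim_flow:
  assumes lb: "lower_bounded {0..} y" and s: "0 \<le> s" and t: "0 \<le> t"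
  shows "Llim {0..} (\<lambda>u. Wlim {0..} y s + (y (s + u) - y s)) t = Llim {0..} y (s + t) - Llim {0..} y s"
proof -
  let ?L = "Llim {0..} y"
  let ?y' = "\<lambda>u. Wlim {0..} y s + (y (s + u) - y s)"
  have y'_eq: "?y' = (\<lambda>u. (Wlim {0..} y s - y s) + y (s + u))" by auto
  have lb': "lower_bounded {0..} ?y'"
    unfolding y'_eq by (rule lower_bounded_shift[OF lb s])
  have "?L (s + t) - ?L s = Llim {0..} ?y' t"
  proof (rule fixpoint_unique[OF lb', where l = "\<lambda>t. ?L (s + t) - ?L s"])
    show "mono_on {0..} (\<lambda>t. ?L (s + t) - ?L s)"
      using s by (intro mono_onI diff_right_mono) (auto intro!: mono_onD[OF Llim_mono_time[OF lb]])
    fix t :: real and i assume t: "t \<in> {0..}"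
    have st: "s + t \<in> {0..}" "s \<in> {0..}" using s t by auto
    have eq: "?y' u $ i - A (?L (s + u) - ?L s) $ i = (y (s + u) $ i - A (?L (s + u)) $ i) + ?L s $ i" for u
      by (simp add: Wlim_def R_mult A_linear_simps)
    show "(?L (s + t) - ?L s) $ i = regulator {0..} (\<lambda>u. ?y' u $ i - A (?L (s + u) - ?L s) $ i) t"
      unfolding eq vector_minus_component Llim_fixpoint[OF lb st(1)]
      unfolding Llim_fixpoint[OF lb st(2)]
      using regulator_shift[OF Llim_bdd[OF lb st(1)] s, of i] t by simp
  qed (use t in auto)
  then show ?thesis by simp
qed

theorem Wlim_flow:
  assumes lb: "lower_bounded {0..} y" and s: "0 \<le> s" and t: "0 \<le> t"
  shows "Wlim {0..} (\<lambda>u. Wlim {0..} y s + (y (s + u) - y s)) t = Wlim {0..} y (s + t)"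
  unfolding Wlim_def[of _ _ t] Llim_flow[OF assms] unfolding Wlim_def
  by (simp add: matrix_vector_mult_diff_distrib)

lemma Lit_antimono:
  assumes lb: "lower_bounded E y" "lower_bounded E y'"
    and le: "\<And>t. t \<in> E \<Longrightarrow> y t \<le> y' t" and "t \<in> E"
  shows "Lit E y' k t \<le> Lit E y k t"
  using assms(4)
proof (induction k arbitrary: t)
  case (Suc k)
  show ?case
    using Suc.prems le
    by (auto simp: less_eq_vec_def intro!: regulator_antimono free_bdd_below[OF lb(1) Lit_mono_time[OF lb(1)]]
      diff_mono A_mono_nth Suc.IH)
qed simp

lemma Llim_antimono:
  assumes lb: "lower_bounded E y" "lower_bounded E y'"
    and "\<And>t. t \<in> E \<Longrightarrow> y t \<le> y' t" and "t \<in> E"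
  shows "Llim E y' t \<le> Llim E y t"
  using Lit_antimono[OF assms] Lit_le_Llim[OF lb(1) assms(4)] by (intro Llim_least[OF lb(2)]) (rule order_trans)

context
  fixes E and y y' :: "real \<Rightarrow> real^'n"
  assumes lb: "lower_bounded E y" and lb': "lower_bounded E y'"
    and le: "\<And>t. t \<in> E \<Longrightarrow> y t \<le> y' t"
    and incr: "\<And>s t. s \<in> E \<Longrightarrow> t \<in> E \<Longrightarrow> s \<le> t \<Longrightarrow> y' s - y s \<le> y' t - y t"
begin

text \<open>
  Both comparisons survive the iteration: if increments of the iterate shrink, then the push \<open>A l\<close>
  shrinks monotonically too, and the free path of the next round is raised by a nonnegative
  nondecreasing amount, as \<open>regulator_compare\<close> requires. The statement on values mixes two
  consecutive rounds because a round regulates against the push of the round before.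
\<close>
lemma Lit_compare:
  shows Lit_compare_increment: "s \<in> E \<Longrightarrow> t \<in> E \<Longrightarrow> s \<le> t \<Longrightarrow>
      Lit E y' k t - Lit E y' k s \<le> Lit E y k t - Lit E y k s"
    and Lit_compare_value: "t \<in> E \<Longrightarrow>
      y t - A (Lit E y k t) + Lit E y (Suc k) t \<le> y' t - A (Lit E y' k t) + Lit E y' (Suc k) t"
proof -
  let ?z = "\<lambda>k i u. y u $ i - A (Lit E y k u) $ i"
  let ?z' = "\<lambda>k i u. y' u $ i - A (Lit E y' k u) $ i"
  have z0: "?z k i s \<le> ?z' k i s" if "s \<in> E" for k s i
    using le[OF that] A_mono_nth[OF Lit_antimono[OF lb lb' le that], of k i]
    by (auto simp: less_eq_vec_def intro: diff_mono)
  have zm: "?z' k i s - ?z k i s \<le> ?z' k i t - ?z k i t"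
    if IH: "Lit E y' k t - Lit E y' k s \<le> Lit E y k t - Lit E y k s"
      and st: "s \<in> E" "t \<in> E" "s \<le> t" for k s t i
  proof -
    have "y' s $ i - y s $ i \<le> y' t $ i - y t $ i" using incr[OF st] by (simp add: less_eq_vec_def)
    with A_mono_nth[OF IH, of i] show ?thesis by (simp add: A_linear_simps)
  qed
  have c: "Lit E y' k t - Lit E y' k s \<le> Lit E y k t - Lit E y k s"
    if "s \<in> E" "t \<in> E" "s \<le> t" for s t k
    using that
  proof (induction k arbitrary: s t)
    case (Suc k)
    show ?case unfolding less_eq_vec_def Lit.simps vector_minus_component vec_lambda_beta
      by (intro allI regulator_compare_increment Suc.prems zm Suc.IH z0
          free_bdd_below[OF lb Lit_mono_time[OF lb]] free_bdd_below[OF lb' Lit_mono_time[OF lb']])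
  qed simp
  show "s \<in> E \<Longrightarrow> t \<in> E \<Longrightarrow> s \<le> t \<Longrightarrow>
      Lit E y' k t - Lit E y' k s \<le> Lit E y k t - Lit E y k s" by (rule c)
  show "y t - A (Lit E y k t) + Lit E y (Suc k) t \<le> y' t - A (Lit E y' k t) + Lit E y' (Suc k) t"
    if t: "t \<in> E"
    unfolding less_eq_vec_def Lit.simps vector_minus_component vector_add_component vec_lambda_beta
    by (intro allI regulator_compare_value t zm c z0
          free_bdd_below[OF lb Lit_mono_time[OF lb]] free_bdd_below[OF lb' Lit_mono_time[OF lb']])
qed

theorem Llim_compare_increment:
  assumes "s \<in> E" "t \<in> E" "s \<le> t"
  shows "Llim E y' t - Llim E y' s \<le> Llim E y t - Llim E y s"
  unfolding less_eq_vec_def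
proof
  fix i
  show "(Llim E y' t - Llim E y' s) $ i \<le> (Llim E y t - Llim E y s) $ i"
  proof (rule LIMSEQ_le)
    show "(\<lambda>k. (Lit E y' k t - Lit E y' k s) $ i) \<longlonglongrightarrow> (Llim E y' t - Llim E y' s) $ i"
      by (rule tendsto_vec_nth[OF tendsto_diff[OF Lit_tendsto[OF lb' assms(2)] Lit_tendsto[OF lb' assms(1)]]])
    show "(\<lambda>k. (Lit E y k t - Lit E y k s) $ i) \<longlonglongrightarrow> (Llim E y t - Llim E y s) $ i"
      by (rule tendsto_vec_nth[OF tendsto_diff[OF Lit_tendsto[OF lb assms(2)] Lit_tendsto[OF lb assms(1)]]])
    show "\<exists>N. \<forall>k\<ge>N. (Lit E y' k t - Lit E y' k s) $ i \<le> (Lit E y k t - Lit E y k s) $ i"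
      using Lit_compare_increment[OF assms] by (simp add: less_eq_vec_def)
  qed
qed

theorem Wlim_compare:
  assumes t: "t \<in> E"
  shows "Wlim E y t \<le> Wlim E y' t"
  unfolding less_eq_vec_def
proof
  fix i
  have e: "Wlim E y t = y t - A (Llim E y t) + Llim E y t" for y
    by (simp add: Wlim_def R_mult)
  show "Wlim E y t $ i \<le> Wlim E y' t $ i"
    unfolding e
  proof (rule LIMSEQ_le)
    have l: "(\<lambda>k. (y t - A (Lit E y k t) + Lit E y (Suc k) t) $ i)
        \<longlonglongrightarrow> (y t - A (Llim E y t) + Llim E y t) $ i" if "lower_bounded E y" for y
      by (rule tendsto_vec_nth[OF tendsto_add[OF tendsto_diff[OF tendsto_const
            tendsto_A[OF Lit_tendsto[OF that t]]] LIMSEQ_Suc[OF Lit_tendsto[OF that t]]]])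
    show "(\<lambda>k. (y t - A (Lit E y k t) + Lit E y (Suc k) t) $ i)
        \<longlonglongrightarrow> (y t - A (Llim E y t) + Llim E y t) $ i" by (rule l[OF lb])
    show "(\<lambda>k. (y' t - A (Lit E y' k t) + Lit E y' (Suc k) t) $ i)
        \<longlonglongrightarrow> (y' t - A (Llim E y' t) + Llim E y' t) $ i" by (rule l[OF lb'])
    show "\<exists>N. \<forall>k\<ge>N. (y t - A (Lit E y k t) + Lit E y (Suc k) t) $ i
        \<le> (y' t - A (Lit E y' k t) + Lit E y' (Suc k) t) $ i"
      using Lit_compare_value[OF t] unfolding less_eq_vec_def by blast
  qed
qed

end

lemma Wlim_mono_start:
  assumes "lower_bounded E y" "x \<le> x'" "t \<in> E"
  shows "Wlim E (\<lambda>u. x + y u) t \<le> Wlim E (\<lambda>u. x' + y u) t"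
  using assms by (intro Wlim_compare lower_bounded_add) (auto simp: less_eq_vec_def)

lemma Llim_mono_start:
  assumes "lower_bounded E y" "x \<le> x'" "t \<in> E"
  shows "Llim E (\<lambda>u. x' + y u) t \<le> Llim E (\<lambda>u. x + y u) t"
  using assms by (intro Llim_antimono lower_bounded_add) (auto simp: less_eq_vec_def)

lemma Llim_increment_start:
  assumes "lower_bounded E y" "x \<le> x'" "s \<in> E" "t \<in> E" "s \<le> t"
  shows "Llim E (\<lambda>u. x' + y u) t - Llim E (\<lambda>u. x' + y u) s
    \<le> Llim E (\<lambda>u. x + y u) t - Llim E (\<lambda>u. x + y u) s"
  using assms by (intro Llim_compare_increment lower_bounded_add) (auto simp: less_eq_vec_def)

lemma Ri_Wlim: "Ri (Wlim E y t) = Ri (y t) + Llim E y t"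
  by (simp add: Wlim_def matrix_vector_right_distrib)

lemma Ri_Wlim_diff:
  "Ri (Wlim E (\<lambda>u. x' + y u) t - Wlim E (\<lambda>u. x + y u) t)
    = Ri (x' - x) - (Llim E (\<lambda>u. x + y u) t - Llim E (\<lambda>u. x' + y u) t)"
  by (simp add: matrix_vector_mult_diff_distrib Ri_Wlim matrix_vector_right_distrib)

text \<open>
  The reflected process is Lipschitz in its start, uniformly in the path and in time. Both starts are
  compared with their componentwise maximum, for which order and \<open>le_Ri\<close> apply. This is the
  source of continuity in the state variable.
\<close>
lemma Wlim_start_diff_le:
  assumes lb: "lower_bounded E y" and t: "t \<in> E"
  shows "\<bar>Wlim E (\<lambda>u. x' + y u) t $ i - Wlim E (\<lambda>u. x + y u) t $ i\<bar> \<le> Ri (\<chi> i. \<bar>x' $ i - x $ i\<bar>) $ i"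
proof -
  let ?W = "\<lambda>x. Wlim E (\<lambda>u. x + y u) t"
  define m where "m = (\<chi> i. max (x $ i) (x' $ i))"
  have le: "x \<le> m" "x' \<le> m" by (auto simp: m_def less_eq_vec_def)
  have a: "?W m $ i - ?W x $ i \<le> Ri (\<chi> i. \<bar>x' $ i - x $ i\<bar>) $ i \<and> ?W x $ i \<le> ?W m $ i"
    if "x \<le> m" "m - x \<le> (\<chi> i. \<bar>x' $ i - x $ i\<bar>)" for x x'
  proof -
    have 1: "?W x \<le> ?W m" by (rule Wlim_mono_start[OF lb that(1) t])
    then have "?W m - ?W x \<le> Ri (?W m - ?W x)" by (intro le_Ri) (simp add: less_eq_vec_def)
    also have "\<dots> \<le> Ri (m - x)" unfolding Ri_Wlim_diff
      using Llim_mono_start[OF lb that(1) t] by (simp add: less_eq_vec_def)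
    also have "\<dots> \<le> Ri (\<chi> i. \<bar>x' $ i - x $ i\<bar>)" by (rule Ri_mono[OF that(2)])
    finally show ?thesis using 1 by (auto simp: less_eq_vec_def)
  qed
  have c: "(\<chi> i. \<bar>x' $ i - x $ i\<bar>) = (\<chi> i. \<bar>x $ i - x' $ i\<bar>)" by (simp add: abs_minus_commute)
  have "m - x \<le> (\<chi> i. \<bar>x' $ i - x $ i\<bar>)" "m - x' \<le> (\<chi> i. \<bar>x $ i - x' $ i\<bar>)"
    by (auto simp: m_def less_eq_vec_def)
  from a[OF le(1) this(1)] a[OF le(2) this(2)] show ?thesis unfolding c by linarith
qed

end

section \<open>The complementarity condition\<close>

text \<open>
  One component of \<open>L\<close>. Its extension \<open>F\<close> by zero to negative times puts an atom of mass \<open>f 0\<close> at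
  time \<open>0\<close> into the Stieltjes measure.
\<close>
locale integrator =
  fixes f :: "real \<Rightarrow> real"
  assumes mono: "mono_on {0..} f" and nonneg: "\<And>t. 0 \<le> t \<Longrightarrow> 0 \<le> f t"
    and right_cont: "\<And>t. 0 \<le> t \<Longrightarrow> continuous (at_right t) f"
begin

definition F :: "real \<Rightarrow> real" where "F t = (if t < 0 then 0 else f t)"

lemma F_mono: "x \<le> y \<Longrightarrow> F x \<le> F y"
  using mono nonneg by (auto simp: F_def mono_on_def)

lemma F_right_cont: "continuous (at_right a) F"
proof (cases "a < 0")
  case True
  have "eventually (\<lambda>u. F u = 0) (at_right a)"
    using eventually_at_right_real[OF True] by eventually_elim (auto simp: F_def)
  then show ?thesis
    using True by (auto simp: continuous_within F_def[of a] intro: tendsto_eventually)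
next
  case False
  have "eventually (\<lambda>u. F u = f u) (at_right a)"
    using eventually_at_right_less[of a] by eventually_elim (use False in \<open>auto simp: F_def\<close>)
  then show ?thesis
    using right_cont[of a] False
    by (auto simp: continuous_within F_def[of a] intro: filterlim_cong[THEN iffD2])
qed

abbreviation \<mu> :: "real measure" where "\<mu> \<equiv> interval_measure F"

lemma emeasure_Ioc: "a \<le> b \<Longrightarrow> emeasure \<mu> {a<..b} = ennreal (F b - F a)"
  by (rule emeasure_interval_measure_Ioc) (auto intro: F_mono F_right_cont)

lemma emeasure_Icc_ge:
  assumes "a \<le> t" "\<And>x. x < a \<Longrightarrow> F x \<le> c"
  shows "ennreal (F t - c) \<le> emeasure \<mu> {a..t}"
proof -
  let ?S = "\<lambda>n::nat. {a - inverse (real (Suc n))<..t}"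
  have at: "a - inverse (real (Suc n)) \<le> t" for n
    using assms(1) inverse_positive_iff_positive[of "real (Suc n)"] by linarith
  have "(\<lambda>n. emeasure \<mu> (?S n)) \<longlonglongrightarrow> emeasure \<mu> (\<Inter>n. ?S n)"
  proof (rule Lim_emeasure_decseq)
    show "decseq ?S"
    proof (rule decseq_SucI)
      fix n
      have "a - inverse (real (Suc n)) \<le> a - inverse (real (Suc (Suc n)))" by simp
      then show "?S (Suc n) \<subseteq> ?S n"
        by (meson greaterThanAtMost_iff le_less_trans subsetI)
    qed
    show "emeasure \<mu> (?S n) \<noteq> \<infinity>" for n
      by (subst emeasure_Ioc[OF at]) simp
  qed auto
  moreover have "(\<Inter>n. ?S n) = {a..t}"
  proof (intro equalityI subsetI)
    fix x assume x: "x \<in> (\<Inter>n. ?S n)"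
    have "a - x \<le> 0"
    proof (rule LIMSEQ_le_const[OF LIMSEQ_inverse_real_of_nat])
      show "\<exists>N. \<forall>n\<ge>N. a - x \<le> inverse (real (Suc n))"
        using x by (intro exI[of _ 0]) (auto simp: algebra_simps intro: less_imp_le)
    qed
    then show "x \<in> {a..t}" using x by auto
  next
    fix x assume "x \<in> {a..t}"
    then show "x \<in> (\<Inter>n. ?S n)" by (auto intro: less_le_trans[of _ a])
  qed
  ultimately have lim: "(\<lambda>n. emeasure \<mu> (?S n)) \<longlonglongrightarrow> emeasure \<mu> {a..t}" by simp
  have "ennreal (F t - c) \<le> emeasure \<mu> (?S n)" for n
    by (subst emeasure_Ioc[OF at]) (intro ennreal_leI diff_left_mono assms(2), simp)
  then show ?thesis by (intro LIMSEQ_le_const[OF lim]) auto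
qed

text \<open>
  If \<open>f\<close> exceeded the regulator \<open>c\<close> at time \<open>t\<close>, then since the first passage of \<open>f\<close> above \<open>c\<close> the
  regulated path would have been strictly positive, although \<open>f\<close> grew by a positive amount in that
  period, against complementarity.
\<close>
lemma complementary_imp_regulator:
  assumes w: "\<And>t. 0 \<le> t \<Longrightarrow> 0 \<le> z t + f t"
    and compl: "(\<integral>\<^sup>+t\<in>{0..}. indicator {t. z t + f t > 0} t \<partial>\<mu>) = 0"
    and t: "0 \<le> t"
  shows "f t = regulator {0..} z t"
proof (rule antisym)
  have fm: "f s \<le> f u" if "0 \<le> s" "s \<le> u" for s u
    using mono that by (auto simp: mono_on_def)
  have bdd: "bdd_below (z ` {u\<in>{0..}. u \<le> t})"
  proof (rule bdd_belowI2[where m = "- f t"])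
    fix u assume "u \<in> {u\<in>{0..}. u \<le> t}"
    then show "- f t \<le> z u" using w[of u] fm[of u t] by auto
  qed
  show "regulator {0..} z t \<le> f t"
  proof (rule regulator_least)
    fix u assume "u \<in> {0..}" "u \<le> t"
    then show "- z u \<le> f t" using w[of u] fm[of u t] by auto
  qed (use t nonneg in auto)
  have null: "emeasure \<mu> I = 0" if I: "I \<in> sets borel" "I \<subseteq> {t. 0 \<le> t \<and> z t + f t > 0}" for I
  proof -
    have "emeasure \<mu> I = (\<integral>\<^sup>+t. indicator I t \<partial>\<mu>)" using I by simp
    also have "\<dots> \<le> (\<integral>\<^sup>+t\<in>{0..}. indicator {t. z t + f t > 0} t \<partial>\<mu>)"
      using I by (intro nn_integral_mono) (auto simp: indicator_def)
    finally show ?thesis using compl by simp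
  qed
  show "f t \<le> regulator {0..} z t"
  proof (rule ccontr)
    define c where "c = regulator {0..} z t"
    assume "\<not> f t \<le> regulator {0..} z t"
    then have ct: "c < f t" by (simp add: c_def)
    have c0: "0 \<le> c" unfolding c_def using regulator_upper(2)[OF bdd, of t] t by auto
    \<comment> \<open>\<open>a\<close> is the first passage of \<open>f\<close> above \<open>c\<close>; the mass of \<open>f\<close> after \<open>a\<close> includes a possible atom at \<open>a\<close>\<close>
    define U where "U = {u. 0 \<le> u \<and> u \<le> t \<and> c < f u}"
    define a where "a = Inf U"
    have tU: "t \<in> U" using t ct by (simp add: U_def)
    have bU: "bdd_below U" by (auto simp: U_def bdd_below_def)
    have a0: "0 \<le> a" unfolding a_def using tU by (intro cInf_greatest) (auto simp: U_def)
    have at: "a \<le> t" unfolding a_def by (rule cInf_lower[OF tU bU])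
    have gtU: "u \<in> U" if "a < u" "u \<le> t" for u
    proof -
      have "U \<noteq> {}" using tU by auto
      from cInf_lessD[OF this that(1)[unfolded a_def]] obtain u' where u': "u' \<in> U" "u' < u" by blast
      then have "c < f u'" "0 \<le> u'" by (auto simp: U_def)
      with fm[of u' u] u'(2) that(2) show ?thesis by (simp add: U_def)
    qed
    have posU: "0 \<le> u \<and> z u + f u > 0" if "u \<in> U" for u
      using that regulator_upper(1)[OF bdd, of u] by (auto simp: U_def c_def)
    show False
    proof (cases "a \<in> U")
      case True
      have "ennreal (F t - c) \<le> emeasure \<mu> {a..t}"
      proof (rule emeasure_Icc_ge[OF at])
        fix x assume x: "x < a"
        have "x \<notin> U" using x cInf_lower[OF _ bU, of x] by (auto simp: a_def)
        then show "F x \<le> c" using x c0 at by (auto simp: F_def U_def)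
      qed
      also have "\<dots> = 0"
        using gtU True posU by (intro null) (force simp: le_less)+
      finally show False using ct t by (simp add: F_def)
    next
      case False
      have "emeasure \<mu> {a<..t} = 0" using gtU posU by (intro null) auto
      then have "f t \<le> f a" using emeasure_Ioc[OF at] a0 t by (simp add: F_def ennreal_eq_0_iff)
      then show False using False a0 at ct by (auto simp: U_def)
    qed
  qed
qed

text \<open>
  Where the regulated path is positive, the regulator is constant for a short while by right
  continuity, so such a time lies in the interval of constancy of a rational time. The left ends
  of these countably many intervals are treated separately, as possible atoms, which have no mass because a jump of the regulator ends at regulated value zero.
\<close>
lemma regulator_imp_complementary:
  assumes z: "\<And>t. 0 \<le> t \<Longrightarrow> continuous (at_right t) z"
    and bdd: "\<And>t. 0 \<le> t \<Longrightarrow> bdd_below (z ` {u\<in>{0..}. u \<le> t})"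
    and f: "\<And>t. 0 \<le> t \<Longrightarrow> f t = regulator {0..} z t"
  shows "(\<integral>\<^sup>+t\<in>{0..}. indicator {t. z t + f t > 0} t \<partial>\<mu>) = 0"
proof -
  have fm: "f s \<le> f u" if "0 \<le> s" "s \<le> u" for s u
    using mono that by (auto simp: mono_on_def)
  define B where "B = {t. 0 \<le> t \<and> z t + f t > 0}"
  \<comment> \<open>the left end of the interval of constancy of \<open>f\<close> that ends in \<open>q\<close>\<close>
  define a where "a q = Inf {s. 0 \<le> s \<and> s \<le> q \<and> f s = f q}" for q
  have atom: "emeasure \<mu> {t} = 0" if t: "t \<in> B" for t
  proof -
    have t0: "0 \<le> t" and zt: "- z t < f t" using t by (auto simp: B_def)
    have "emeasure \<mu> {t} \<le> ennreal e" if e: "0 < e" for e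
    proof -
      have "\<exists>x<t. F t - F x \<le> e"
      proof (cases "f t = 0")
        case True
        then show ?thesis using t0 e F_mono[of "-1" "t - 1"] nonneg[of "t - 1"]
          by (intro exI[of _ "t - 1"]) (auto simp: F_def)
      next
        case False
        \<comment> \<open>a level below \<open>f t\<close> that the current value of the path cannot account for, so the
          supremum comes within \<open>e\<close> of \<open>f t\<close> at an earlier time\<close>
        define m where "m = max (f t - e) (max 0 (- z t))"
        have "m < f t" using False nonneg[OF t0] zt e by (auto simp: m_def)
        then have "m < (SUP u\<in>{u\<in>{0..}. u \<le> t}. max 0 (- z u))"
          using f[OF t0] by (simp add: regulator_def)
        then obtain u where u: "0 \<le> u" "u \<le> t" "m < max 0 (- z u)"
          using less_cSUP_iff[OF _ regulator_bdd[OF bdd[OF t0]], of m] t0 by auto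
        have "m < - z u" using u(3) by (auto simp: m_def)
        then have "u \<noteq> t" by (auto simp: m_def)
        have "- z u \<le> f u" unfolding f[OF u(1)]
          by (rule regulator_upper(1)[OF bdd]) (use u in auto)
        then have "f t - e < f u" using \<open>m < - z u\<close> by (auto simp: m_def)
        then show ?thesis using u \<open>u \<noteq> t\<close> t0 by (intro exI[of _ u]) (auto simp: F_def)
      qed
      then obtain x where x: "x < t" "F t - F x \<le> e" by auto
      have "emeasure \<mu> {t} \<le> emeasure \<mu> {x<..t}" using x by (intro emeasure_mono) auto
      also have "\<dots> \<le> ennreal e" using x by (subst emeasure_Ioc) (auto intro: ennreal_leI)
      finally show ?thesis .
    qed
    then have "emeasure \<mu> {t} \<le> 0 + ennreal e" if "0 < e" for e
      using that by simp
    then have "emeasure \<mu> {t} \<le> 0" by (rule ennreal_le_epsilon)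
    then show ?thesis by simp
  qed
  have aq: "0 \<le> a q" "a q \<le> q" "f (a q) = f q" "\<And>s. 0 \<le> s \<Longrightarrow> s \<le> q \<Longrightarrow> f s = f q \<Longrightarrow> a q \<le> s"
    if q: "0 \<le> q" for q
  proof -
    let ?U = "{s. 0 \<le> s \<and> s \<le> q \<and> f s = f q}"
    have ne: "q \<in> ?U" using q by auto
    have bU: "bdd_below ?U" by (auto simp: bdd_below_def)
    show 1: "0 \<le> a q" unfolding a_def using ne by (intro cInf_greatest) auto
    show 2: "a q \<le> q" unfolding a_def by (rule cInf_lower[OF ne bU])
    show "\<And>s. 0 \<le> s \<Longrightarrow> s \<le> q \<Longrightarrow> f s = f q \<Longrightarrow> a q \<le> s"
      unfolding a_def by (rule cInf_lower[OF _ bU]) auto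
    have const: "f u = f q" if u: "a q < u" "u \<le> q" for u
    proof -
      have "?U \<noteq> {}" using ne by blast
      from cInf_lessD[OF this u(1)[unfolded a_def]] obtain s where s: "s \<in> ?U" "s < u" by blast
      then have "0 \<le> s" "f s = f q" by auto
      with fm[of s u] fm[of u q] u(2) s(2) show ?thesis by simp
    qed
    show "f (a q) = f q"
    proof (cases "a q = q")
      case False
      with 2 have lt: "a q < q" by simp
      have "eventually (\<lambda>u. f u = f q) (at_right (a q))"
        using eventually_at_right_real[OF lt] by eventually_elim (auto intro: const)
      then have l1: "(f \<longlongrightarrow> f q) (at_right (a q))" by (rule tendsto_eventually)
      have l2: "(f \<longlongrightarrow> f (a q)) (at_right (a q))"
        using right_cont[OF 1] by (simp add: continuous_within)
      show ?thesis by (rule tendsto_unique[OF trivial_limit_at_right_real l2 l1])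
    qed simp
  qed
  define N where "N = (\<Union>q\<in>{q\<in>\<rat>. 0 \<le> q}. {a q<..q} \<union> (if a q \<in> B then {a q} else {}))"
  have "N \<in> null_sets \<mu>"
    unfolding N_def
  proof (intro null_sets_UN' null_sets.Un)
    show "countable {q\<in>\<rat>. (0::real) \<le> q}" by (rule countable_subset[OF _ countable_rat]) auto
    fix q :: real assume q: "q \<in> {q\<in>\<rat>. 0 \<le> q}"
    then show "{a q<..q} \<in> null_sets \<mu>"
      using aq(1-3)[of q] by (auto simp: null_sets_def emeasure_Ioc F_def)
    show "(if a q \<in> B then {a q} else {}) \<in> null_sets \<mu>"
      using atom by (auto simp: null_sets_def)
  qed
  moreover have "B \<subseteq> N"
  proof
    fix t assume t: "t \<in> B"
    then have t0: "0 \<le> t" and zt: "- z t < f t" by (auto simp: B_def)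
    have "((\<lambda>u. - z u) \<longlongrightarrow> - z t) (at_right t)"
      using z[OF t0] by (intro tendsto_minus) (simp add: continuous_within)
    then have "eventually (\<lambda>u. - z u < f t) (at_right t)" using zt by (rule order_tendstoD)
    then obtain b where b: "t < b" "\<And>u. t < u \<Longrightarrow> u < b \<Longrightarrow> - z u < f t"
      by (auto simp: eventually_at_right_field)
    obtain q where q: "q \<in> \<rat>" "t < q" "q < b" using Rats_dense_in_real[OF b(1)] by auto
    have "f q - f t \<le> 0"
      unfolding f[OF t0] f[OF order_trans[OF t0 less_imp_le[OF q(2)]]]
    proof (rule regulator_increment_least[OF bdd[OF t0]])
      fix u assume u: "u \<in> {0..}" "t \<le> u" "u \<le> q"
      show "- z u - regulator {0..} z t \<le> 0"
        using b(2)[of u] u zt q unfolding f[OF t0, symmetric] by (cases "u = t") auto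
    qed (use t0 q in auto)
    then have fq: "f t = f q" using fm[of t q] t0 q by auto
    have q0: "0 \<le> q" using t0 q by simp
    have "a q \<le> t" using aq(4)[OF q0 t0] q fq by auto
    then have "t \<in> {a q<..q} \<union> (if a q \<in> B then {a q} else {})" using q t by (cases "a q = t") auto
    then show "t \<in> N" unfolding N_def using q q0 by blast
  qed
  ultimately have "AE t in \<mu>. t \<notin> B"
    by (intro AE_I'[of N]) auto
  then have "(\<integral>\<^sup>+t\<in>{0..}. indicator {t. z t + f t > 0} t \<partial>\<mu>) = (\<integral>\<^sup>+t. 0 \<partial>\<mu>)"
    by (intro nn_integral_cong_AE) (auto simp: B_def indicator_def)
  then show ?thesis by simp
qed

end

section \<open>Identification with the reflection map\<close>

text \<open>
  One-sided limits bound the path on a neighbourhood of each time, and bisection patches these together.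
\<close>
lemma cadlag_bounded:
  fixes y :: "real \<Rightarrow> real^'n"
  assumes "cadlag y" "0 \<le> t"
  shows "bounded (y ` {0..t})"
proof -
  have "(0::real) \<le> 0 \<longrightarrow> bounded (y ` {0..t})"
  proof (rule Bolzano[where P = "\<lambda>a b. 0 \<le> a \<longrightarrow> bounded (y ` {a..b})", OF assms(2)], goal_cases)
    case (1 a b c)
    then have "{a..c} = {a..b} \<union> {b..c}" by auto
    with 1 show ?case by (auto simp: image_Un)
  next
    case local: (2 x)
    have "(y \<longlongrightarrow> y x) (at_right x)" using assms(1) local by (auto simp: cadlag_def continuous_within)
    then have "eventually (\<lambda>u. dist (y u) (y x) < 1) (at_right x)" by (rule tendstoD) simp
    then obtain b where b: "x < b" "\<And>u. x < u \<Longrightarrow> u < b \<Longrightarrow> dist (y u) (y x) < 1"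
      by (auto simp: eventually_at_right_field)
    have "\<exists>c<x. \<exists>l. \<forall>u. c < u \<and> u < x \<and> 0 \<le> u \<longrightarrow> dist (y u) l < 1"
    proof (cases "x = 0")
      case True
      then show ?thesis by (intro exI[of _ "-1"]) auto
    next
      case False
      with local have "0 < x" by simp
      then obtain l where "(y \<longlongrightarrow> l) (at_left x)" using assms(1) unfolding cadlag_def by blast
      then have "eventually (\<lambda>u. dist (y u) l < 1) (at_left x)" by (rule tendstoD) simp
      then show ?thesis by (auto simp: eventually_at_left_field)
    qed
    then obtain c l where c: "c < x" "\<And>u. c < u \<Longrightarrow> u < x \<Longrightarrow> 0 \<le> u \<Longrightarrow> dist (y u) l < 1" by auto
    have "bounded (y ` {a'..b'})" if ab: "0 \<le> a'" "a' \<le> x" "x \<le> b'" "b' - a' < min (b - x) (x - c)" for a' b'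
    proof (rule bounded_subset)
      show "bounded (ball l 1 \<union> {y x} \<union> ball (y x) 1)" by simp
      show "y ` {a'..b'} \<subseteq> ball l 1 \<union> {y x} \<union> ball (y x) 1"
      proof
        fix v assume "v \<in> y ` {a'..b'}"
        then obtain u where u: "v = y u" "a' \<le> u" "u \<le> b'" by auto
        consider "u < x" | "u = x" | "x < u" by linarith
        then show "v \<in> ball l 1 \<union> {y x} \<union> ball (y x) 1"
          by cases (use b(2)[of u] c(2)[of u] u ab in \<open>auto simp: dist_commute\<close>)
      qed
    qed
    then show ?case using b c by (intro exI[of _ "min (b - x) (x - c)"]) auto
  qed
  then show ?thesis by simp
qed

lemma cadlag_lower_bounded:
  fixes y :: "real \<Rightarrow> real^'n"
  assumes "cadlag y"
  shows "lower_bounded {0..} y"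
  unfolding lower_bounded_def
proof
  fix t :: real assume "t \<in> {0..}"
  then obtain c where "\<forall>x\<in>y ` {0..t}. norm x \<le> c"
    using cadlag_bounded[OF assms, of t] unfolding bounded_iff by auto
  then have c: "\<And>u. 0 \<le> u \<Longrightarrow> u \<le> t \<Longrightarrow> norm (y u) \<le> c" by auto
  have "- c \<le> y u $ i" if "0 \<le> u" "u \<le> t" for u i
    using c[OF that] component_le_norm_cart[of "y u" i] by linarith
  then show "\<exists>c. \<forall>u\<in>{0..}. u \<le> t \<longrightarrow> (\<forall>i. - c \<le> y u $ i)" by auto
qed

lemma cadlag_right: "cadlag y \<Longrightarrow> 0 \<le> t \<Longrightarrow> (y \<longlongrightarrow> y t) (at_right t)"
  by (auto simp: cadlag_def continuous_within)

lemma tendsto_at_right_shift: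
  fixes f :: "real \<Rightarrow> 'b::topological_space"
  shows "(f \<longlongrightarrow> l) (at_right (s + t)) \<Longrightarrow> ((\<lambda>u. f (s + u)) \<longlongrightarrow> l) (at_right t)"
  by (rule filterlim_compose[of f]) (auto simp: filterlim_at eventually_at_filter intro!: tendsto_eq_intros)

lemma tendsto_at_left_shift:
  fixes f :: "real \<Rightarrow> 'b::topological_space"
  shows "(f \<longlongrightarrow> l) (at_left (s + t)) \<Longrightarrow> ((\<lambda>u. f (s + u)) \<longlongrightarrow> l) (at_left t)"
  by (rule filterlim_compose[of f]) (auto simp: filterlim_at eventually_at_filter intro!: tendsto_eq_intros)

lemma cadlag_shift:
  fixes y :: "real \<Rightarrow> real^'n"
  assumes "cadlag y" "0 \<le> s"
  shows "cadlag (\<lambda>u. x + (y (s + u) - z))"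
  unfolding cadlag_def
proof (intro conjI allI impI)
  fix t :: real assume t: "0 \<le> t"
  show "continuous (at_right t) (\<lambda>u. x + (y (s + u) - z))"
    unfolding continuous_within
    by (intro tendsto_intros tendsto_at_right_shift cadlag_right assms) (use t assms in auto)
next
  fix t :: real assume t: "0 < t"
  obtain l where "(y \<longlongrightarrow> l) (at_left (s + t))" using assms t unfolding cadlag_def by (metis add_nonneg_pos)
  then have "((\<lambda>u. x + (y (s + u) - z)) \<longlongrightarrow> x + (l - z)) (at_left t)"
    by (intro tendsto_intros tendsto_at_left_shift)
  then show "\<exists>l. ((\<lambda>u. x + (y (s + u) - z)) \<longlongrightarrow> l) (at_left t)" by blast
qed

context skorohod_matrix
begin

text \<open>
  If the path varies by at most \<open>e\<close> right after \<open>t\<close>, then the increment \<open>d\<close> of the regulator satisfies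
  \<open>d \<le> e 1 + A d\<close>, and \<open>sub_bound\<close> makes it of order \<open>e\<close>.
\<close>
lemma Llim_right_continuous:
  assumes lb: "lower_bounded {0..} y" and rc: "(y \<longlongrightarrow> y t) (at_right t)" and t: "0 \<le> t"
  shows "((Llim {0..} y) \<longlongrightarrow> Llim {0..} y t) (at_right t)"
proof (rule vec_tendstoI)
  fix i
  let ?L = "Llim {0..} y"
  let ?C = "(p \<bullet> 1) / (1 - \<alpha>) / p $ i"
  have bound: "\<exists>b>t. \<forall>u. t < u \<and> u < b \<longrightarrow> \<bar>?L u $ i - ?L t $ i\<bar> \<le> e * ?C" if e: "0 < e" for e
  proof -
    have "eventually (\<lambda>u. dist (y u) (y t) < e) (at_right t)" using rc e by (rule tendstoD)
    then obtain b where b: "t < b" "\<And>u. t < u \<Longrightarrow> u < b \<Longrightarrow> dist (y u) (y t) < e"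
      by (auto simp: eventually_at_right_field)
    have yb: "- y r $ j \<le> - y t $ j + e" if "t \<le> r" "r < b" for r j
    proof -
      have "dist (y r) (y t) \<le> e" using b(2)[of r] that e by (cases "r = t") auto
      then show ?thesis using component_le_norm_cart[of "y r - y t" j] by (auto simp: dist_norm)
    qed
    have "\<bar>?L u $ i - ?L t $ i\<bar> \<le> e * ?C" if u: "t < u" "u < b" for u
    proof -
      let ?d = "?L u - ?L t"
      have d0: "0 \<le> ?d" using mono_onD[OF Llim_mono_time[OF lb], of t u] t u by simp
      have "?d \<le> e *\<^sub>R 1 + A ?d"
        unfolding less_eq_vec_def
      proof
        fix j
        have "?L u $ j - ?L t $ j \<le> e + A ?d $ j"
          unfolding Llim_fixpoint[OF lb, of u, simplified, OF order_trans[OF t less_imp_le[OF u(1)]]]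
            Llim_fixpoint[OF lb, of t, simplified, OF t]
        proof (rule regulator_increment_least)
          show "bdd_below ((\<lambda>u. y u $ j - A (?L u) $ j) ` {u\<in>{0..}. u \<le> t})"
            using Llim_bdd[OF lb] t by auto
          show "0 \<le> e + A ?d $ j" using A_nonneg[OF d0] e by (simp add: less_eq_vec_def)
          fix r assume r: "r \<in> {0..}" "t \<le> r" "r \<le> u"
          have "?L r \<le> ?L u" using r u by (intro mono_onD[OF Llim_mono_time[OF lb]]) auto
          then have "A (?L r) $ j \<le> A (?L u) $ j" by (rule A_mono_nth)
          moreover have "A ?d $ j = A (?L u) $ j - A (?L t) $ j" by (simp add: A_linear_simps)
          moreover have "- (y t $ j - A (?L t) $ j) \<le> regulator {0..} (\<lambda>u. y u $ j - A (?L u) $ j) t"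
            using t by (intro regulator_upper(1) Llim_bdd[OF lb]) auto
          ultimately show "- (y r $ j - A (?L r) $ j) - regulator {0..} (\<lambda>u. y u $ j - A (?L u) $ j) t
              \<le> e + A ?d $ j"
            using yb[of r j] r u by linarith
        qed (use t u in auto)
        then show "?d $ j \<le> (e *\<^sub>R 1 + A ?d) $ j" by simp
      qed
      from sub_bound[OF d0 this] have "p $ i * ?d $ i \<le> e * (p \<bullet> 1) / (1 - \<alpha>)"
        using nth_le_inner_p[OF d0, of i] by simp
      then have "?d $ i \<le> e * ?C"
        by (subst pos_le_divide_eq[OF p_pos] times_divide_eq_right)+ (simp add: mult.commute)
      moreover have "0 \<le> ?d $ i" using d0 by (simp add: less_eq_vec_def)
      ultimately show ?thesis by simp
    qed
    then show ?thesis using b(1) by blast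
  qed
  have C: "0 \<le> ?C"
    using p_pos \<alpha> by (auto intro!: divide_nonneg_pos sum_nonneg simp: inner_vec_real less_imp_le)
  show "((\<lambda>u. ?L u $ i) \<longlongrightarrow> ?L t $ i) (at_right t)"
  proof (rule tendstoI)
    fix e :: real assume e: "0 < e"
    have C1: "0 < ?C + 1" using C by simp
    obtain b where b: "b > t" "\<And>u. t < u \<Longrightarrow> u < b \<Longrightarrow> \<bar>?L u $ i - ?L t $ i\<bar> \<le> (e / (?C + 1)) * ?C"
      using bound[of "e / (?C + 1)"] e C1 by auto
    have "(e / (?C + 1)) * ?C < e"
      by (subst times_divide_eq_left, subst pos_divide_less_eq[OF C1], rule mult_strict_left_mono[OF _ e]) simp
    then show "eventually (\<lambda>u. dist (?L u $ i) (?L t $ i) < e) (at_right t)"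
      unfolding eventually_at_right_field dist_real_def using b by (meson le_less_trans)
  qed
qed

lemma tendsto_R_free: "(y \<longlongrightarrow> a) F \<Longrightarrow> (l \<longlongrightarrow> b) F \<Longrightarrow> ((\<lambda>t. y t $ i - A (l t) $ i) \<longlongrightarrow> a $ i - A b $ i) F"
  by (intro tendsto_intros tendsto_A)

text \<open>
  Componentwise, complementarity is equivalent to being the one-dimensional regulator of the free
  path \<open>y - A l\<close>. The Skorohod problem is thus the fixed point problem solved by \<open>Llim\<close>.
\<close>
lemma skorohod_problem_iff:
  assumes lb: "lower_bounded {0..} y" and rc: "\<And>t. 0 \<le> t \<Longrightarrow> (y \<longlongrightarrow> y t) (at_right t)"
  shows "skorohod_problem R y w l \<longleftrightarrow> (\<forall>t\<ge>0. w t = Wlim {0..} y t \<and> l t = Llim {0..} y t)"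
proof
  assume sp: "skorohod_problem R y w l"
  then have w: "w t $ i = (y t $ i - A (l t) $ i) + l t $ i" if "0 \<le> t" for t i
    using that by (auto simp: skorohod_problem_def R_mult)
  have int: "integrator (\<lambda>t. l t $ i)" for i
    using sp by (auto simp: skorohod_problem_def integrator_def)
  have fp: "l t $ i = regulator {0..} (\<lambda>u. y u $ i - A (l u) $ i) t" if "0 \<le> t" for t i
  proof (rule integrator.complementary_imp_regulator[OF int _ _ that])
    show "0 \<le> y t $ i - A (l t) $ i + l t $ i" if "0 \<le> t" for t
    proof -
      have "0 \<le> w t $ i" using sp that unfolding skorohod_problem_def by blast
      then show ?thesis using w[OF that, of i] by linarith
    qed
    have "(\<integral>\<^sup>+t\<in>{0..}. indicator {t. w t $ i > 0} t \<partial>interval_measure (\<lambda>t. if t < 0 then 0 else l t $ i)) = 0"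
      using sp by (auto simp: skorohod_problem_def)
    also have "(\<integral>\<^sup>+t\<in>{0..}. indicator {t. w t $ i > 0} t \<partial>interval_measure (\<lambda>t. if t < 0 then 0 else l t $ i)) =
      (\<integral>\<^sup>+t\<in>{0..}. indicator {t. y t $ i - A (l t) $ i + l t $ i > 0} t \<partial>interval_measure (integrator.F (\<lambda>t. l t $ i)))"
      unfolding integrator.F_def[OF int, abs_def]
    proof (intro nn_integral_cong)
      fix t
      show "indicator {t. w t $ i > 0} t * indicator {0..} t =
        (indicator {t. y t $ i - A (l t) $ i + l t $ i > 0} t * indicator {0..} t :: ennreal)"
        by (cases "0 \<le> t") (simp_all add: indicator_def w)
    qed
    finally show "(\<integral>\<^sup>+t\<in>{0..}. indicator {t. y t $ i - A (l t) $ i + l t $ i > 0} t \<partial>interval_measure (integrator.F (\<lambda>t. l t $ i))) = 0" .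
  qed
  have "mono_on {0..} l" using sp by (auto simp: skorohod_problem_def mono_on_def less_eq_vec_def)
  then have l: "l t = Llim {0..} y t" if "0 \<le> t" for t
    using fp that by (intro fixpoint_unique[OF lb]) auto
  have "w t = Wlim {0..} y t" if "0 \<le> t" for t
    unfolding vec_eq_iff Wlim_nth w[OF that] l[OF that] by simp
  with l show "\<forall>t\<ge>0. w t = Wlim {0..} y t \<and> l t = Llim {0..} y t" by blast
next
  assume eq: "\<forall>t\<ge>0. w t = Wlim {0..} y t \<and> l t = Llim {0..} y t"
  let ?L = "Llim {0..} y"
  have Lrc: "((\<lambda>t. ?L t) \<longlongrightarrow> ?L t) (at_right t)" if "0 \<le> t" for t
    by (rule Llim_right_continuous[OF lb rc[OF that] that])
  have lrc: "continuous (at_right t) (\<lambda>t. l t $ i)" if "0 \<le> t" for t i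
  proof -
    have "eventually (\<lambda>u. ?L u = l u) (at_right t)"
      using eventually_at_right_less[of t] by eventually_elim (use eq that in auto)
    then have "(l \<longlongrightarrow> ?L t) (at_right t)" using Lrc[OF that] by (rule Lim_transform_eventually[rotated])
    then show ?thesis using eq that by (auto simp: continuous_within intro: tendsto_vec_nth)
  qed
  have lm: "mono_on {0..} (\<lambda>t. l t $ i)" for i
    using eq mono_on_vecD[OF Llim_mono_time[OF lb]] by (intro mono_onI) auto
  have l0: "0 \<le> l t $ i" if "0 \<le> t" for t i
    using eq Llim_nonneg[OF lb, of t] that by (auto simp: less_eq_vec_def)
  have int: "integrator (\<lambda>t. l t $ i)" for i
    using lrc lm l0 by (auto simp: integrator_def)
  have compl: "(\<integral>\<^sup>+t\<in>{0..}. indicator {t. y t $ i - A (?L t) $ i + l t $ i > 0} t \<partial>interval_measure (integrator.F (\<lambda>t. l t $ i))) = 0" for i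
  proof (rule integrator.regulator_imp_complementary[OF int])
    show "continuous (at_right t) (\<lambda>t. y t $ i - A (?L t) $ i)" if "0 \<le> t" for t
      unfolding continuous_within by (intro tendsto_R_free rc Lrc that)
    show "bdd_below ((\<lambda>t. y t $ i - A (?L t) $ i) ` {u\<in>{0..}. u \<le> t})" if "0 \<le> t" for t
      using that by (intro Llim_bdd[OF lb]) auto
    show "l t $ i = regulator {0..} (\<lambda>t. y t $ i - A (?L t) $ i) t" if "0 \<le> t" for t
      using Llim_fixpoint[OF lb, of t i] eq that by auto
  qed
  have S3: "(\<integral>\<^sup>+t\<in>{0..}. indicator {t. w t $ i > 0} t \<partial>interval_measure (\<lambda>t. if t < 0 then 0 else l t $ i)) = 0" for i
  proof -
    have "(\<integral>\<^sup>+t\<in>{0..}. indicator {t. w t $ i > 0} t \<partial>interval_measure (\<lambda>t. if t < 0 then 0 else l t $ i)) =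
      (\<integral>\<^sup>+t\<in>{0..}. indicator {t. y t $ i - A (?L t) $ i + l t $ i > 0} t \<partial>interval_measure (integrator.F (\<lambda>t. l t $ i)))"
      unfolding integrator.F_def[OF int, abs_def]
    proof (intro nn_integral_cong)
      fix t
      show "indicator {t. w t $ i > 0} t * indicator {0..} t =
        (indicator {t. y t $ i - A (?L t) $ i + l t $ i > 0} t * indicator {0..} t :: ennreal)"
      proof (cases "0 \<le> t")
        case True
        then have "w t $ i = y t $ i - A (?L t) $ i + l t $ i" using eq by (simp add: Wlim_nth)
        then show ?thesis by (simp add: indicator_def)
      qed simp
    qed
    then show ?thesis using compl[of i] by simp
  qed
  have w0: "0 \<le> w t $ i" if "0 \<le> t" for t i
    using eq Wlim_nonneg[OF lb, of t] that by (auto simp: less_eq_vec_def)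
  have weq: "w t = y t + R *v l t" if "0 \<le> t" for t using eq that by (simp add: Wlim_def)
  show "skorohod_problem R y w l"
    unfolding skorohod_problem_def by (intro conjI allI impI weq lm l0 lrc w0 S3)
qed

theorem reflection_map_eq:
  assumes "cadlag y"
  shows "reflection_map R y =
    (\<lambda>t. if t < 0 then 0 else Wlim {0..} y t, \<lambda>t. if t < 0 then 0 else Llim {0..} y t)"
  unfolding reflection_map_def
proof (rule the_equality)
  have iff: "skorohod_problem R y w l \<longleftrightarrow> (\<forall>t\<ge>0. w t = Wlim {0..} y t \<and> l t = Llim {0..} y t)" for w l
    by (rule skorohod_problem_iff[OF cadlag_lower_bounded[OF assms]]) (rule cadlag_right[OF assms])
  let ?w = "\<lambda>t. if t < 0 then 0 else Wlim {0..} y t" and ?l = "\<lambda>t. if t < 0 then 0 else Llim {0..} y t"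
  have "skorohod_problem R y ?w ?l" unfolding iff by simp
  then show "skorohod_problem R y (fst (?w, ?l)) (snd (?w, ?l)) \<and>
    (\<forall>t<0. fst (?w, ?l) t = 0 \<and> snd (?w, ?l) t = 0)" by simp
  fix q assume q: "skorohod_problem R y (fst q) (snd q) \<and> (\<forall>t<0. fst q t = 0 \<and> snd q t = 0)"
  then have eq: "\<forall>t\<ge>0. fst q t = Wlim {0..} y t \<and> snd q t = Llim {0..} y t" using iff by blast
  have "fst q = ?w" "snd q = ?l" using q eq by (auto simp: fun_eq_iff not_less)
  then show "q = (?w, ?l)" by (simp add: prod_eq_iff)
qed

end

section \<open>Asymptotic irrelevance of the initial condition\<close>

text \<open>
  After \<open>s\<close> the values of \<open>- z\<close> stay below the regulator by at least \<open>e\<close>, so they cannot account for the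
  supremum at time \<open>t\<close>, which therefore stems from times before \<open>s\<close>.
\<close>
lemma regulator_constant:
  assumes bdd: "bdd_below (z ` {u\<in>E. u \<le> t})" and s: "s \<in> E" and t: "t \<in> E" and st: "s \<le> t"
    and e: "0 < e" "\<And>u. u \<in> E \<Longrightarrow> s \<le> u \<Longrightarrow> u \<le> t \<Longrightarrow> e \<le> z u + regulator E z u"
  shows "regulator E z t = regulator E z s"
proof -
  let ?r = "regulator E z"
  have m: "?r u \<le> ?r t" if "u \<in> E" "u \<le> t" for u
    by (rule regulator_mono_time[OF bdd that])
  have bs: "bdd_below (z ` {u\<in>E. u \<le> s})" by (rule bdd_below_mono[OF bdd]) (use st in auto)
  have "?r t \<le> max (?r s) (?r t - e)"
  proof (rule regulator_least[OF t])
    show "0 \<le> max (?r s) (?r t - e)" using regulator_upper(2)[OF bs s] by simp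
    fix u assume u: "u \<in> E" "u \<le> t"
    show "- z u \<le> max (?r s) (?r t - e)"
    proof (cases "u \<le> s")
      case True
      then show ?thesis using regulator_upper(1)[OF bs u(1)] by simp
    next
      case False
      then show ?thesis using e(2)[of u] m[OF u] u by simp
    qed
  qed
  then show ?thesis using m[OF s st] e(1) by simp
qed

context skorohod_matrix
begin

lemma Llim_diff_le:
  assumes lb: "lower_bounded E y" and le: "x \<le> x'" and t: "t \<in> E"
  shows "Llim E (\<lambda>u. x + y u) t $ i - Llim E (\<lambda>u. x' + y u) t $ i \<le> Ri (x' - x) $ i"
proof -
  have "0 \<le> Ri (Wlim E (\<lambda>u. x' + y u) t - Wlim E (\<lambda>u. x + y u) t)"
    using Wlim_mono_start[OF lb le t] by (intro Ri_nonneg) (simp add: less_eq_vec_def)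
  then show ?thesis unfolding Ri_Wlim_diff by (simp add: less_eq_vec_def)
qed

text \<open>
  The difference of regulators is nondecreasing and bounded by \<open>R\<^sup>-\<^sup>1(x' - x)\<close>, hence convergent, and
  so is the gap between the two processes. A positive limit in component \<open>i\<close> keeps the upper process
  off the boundary, freezing its regulator, while the lower regulator is unbounded: their difference
  would not be bounded.
\<close>
lemma coupling_ordered:
  assumes lb: "lower_bounded {0..} y" and le: "x \<le> x'"
    and unb: "\<And>i c. \<exists>t\<ge>0. c \<le> Llim {0..} (\<lambda>u. x + y u) t $ i"
  shows "((\<lambda>t. Wlim {0..} (\<lambda>u. x' + y u) t - Wlim {0..} (\<lambda>u. x + y u) t) \<longlongrightarrow> 0) at_top"
proof -
  let ?L = "\<lambda>x. Llim {0..} (\<lambda>u. x + y u)" and ?W = "\<lambda>x. Wlim {0..} (\<lambda>u. x + y u)"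
  let ?G = "\<lambda>t. ?L x t - ?L x' t"
  have lb': "lower_bounded {0..} (\<lambda>u. x + y u)" for x by (rule lower_bounded_add[OF lb])
  have Gm: "?G s $ i \<le> ?G t $ i" if "0 \<le> s" "s \<le> t" for s t i
    using Llim_increment_start[OF lb le, of s t] that by (simp add: less_eq_vec_def algebra_simps)
  have Gb: "?G t $ i \<le> Ri (x' - x) $ i" if "0 \<le> t" for t i
    using Llim_diff_le[OF lb le, of t i] that by simp
  define g :: "real^'n" where "g = (\<chi> i. SUP t\<in>{0..}. ?G t $ i)"
  have bdd: "bdd_above ((\<lambda>t. ?G t $ i) ` {0..})" for i
    using Gb by (intro bdd_aboveI2[where M = "Ri (x' - x) $ i"]) auto
  have Gg: "?G t $ i \<le> g $ i" if "0 \<le> t" for t i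
    unfolding g_def vec_lambda_beta using that by (intro cSUP_upper[OF _ bdd]) simp
  have Glim: "(?G \<longlongrightarrow> g) at_top"
  proof (rule vec_tendstoI)
    fix i
    show "((\<lambda>t. ?G t $ i) \<longlongrightarrow> g $ i) at_top"
    proof (rule increasing_tendsto)
      show "eventually (\<lambda>t. ?G t $ i \<le> g $ i) at_top"
        using eventually_ge_at_top[of "0::real"]
        by eventually_elim (rule Gg)
      fix a assume "a < g $ i"
      then obtain s where s: "0 \<le> s" "a < ?G s $ i"
        using less_cSUP_iff[OF _ bdd, of a i] by (auto simp: g_def)
      show "eventually (\<lambda>t. a < ?G t $ i) at_top"
        using eventually_ge_at_top[of s] by eventually_elim (use s Gm in \<open>force intro: less_le_trans\<close>)
    qed
  qed
  define \<delta> where "\<delta> = R *v (Ri (x' - x) - g)"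
  have eq: "?W x' t - ?W x t = R *v (Ri (x' - x) - ?G t)" for t
    using R_Ri[of "?W x' t - ?W x t"] unfolding Ri_Wlim_diff by simp
  have lim: "((\<lambda>t. ?W x' t - ?W x t) \<longlongrightarrow> \<delta>) at_top"
    unfolding eq \<delta>_def R_mult by (intro tendsto_intros tendsto_A Glim)
  have ge: "0 \<le> (?W x' t - ?W x t) $ i" if "0 \<le> t" for t i
    using Wlim_mono_start[OF lb le, of t] that by (simp add: less_eq_vec_def)
  have "\<delta> $ i = 0" for i
  proof (rule ccontr)
    assume "\<delta> $ i \<noteq> 0"
    moreover have "0 \<le> \<delta> $ i"
    proof (rule tendsto_lowerbound[OF tendsto_vec_nth[OF lim]])
      show "eventually (\<lambda>t. 0 \<le> (?W x' t - ?W x t) $ i) at_top"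
        using eventually_ge_at_top[of "0::real"] by eventually_elim (rule ge)
    qed simp
    ultimately have pos: "0 < \<delta> $ i" by simp
    have "eventually (\<lambda>t. \<delta> $ i / 2 < (?W x' t - ?W x t) $ i) at_top"
      using pos by (intro order_tendstoD(1)[OF tendsto_vec_nth[OF lim]]) simp
    then obtain T0 where T0: "\<And>t. T0 \<le> t \<Longrightarrow> \<delta> $ i / 2 < (?W x' t - ?W x t) $ i"
      by (auto simp: eventually_at_top_linorder)
    define T where "T = max 0 T0"
    have T: "\<delta> $ i / 2 \<le> ?W x' t $ i" if "T \<le> t" for t
    proof -
      have "0 \<le> ?W x t" using that by (intro Wlim_nonneg[OF lb']) (simp add: T_def)
      then show ?thesis using T0[of t] that by (simp add: T_def less_eq_vec_def) (smt (verit))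
    qed
    have const: "?L x' t $ i = ?L x' T $ i" if t: "T \<le> t" for t
    proof -
      have 1: "t \<in> {0..}" "T \<in> {0..}" using t by (auto simp: T_def)
      show ?thesis unfolding Llim_fixpoint[OF lb' 1(1)] unfolding Llim_fixpoint[OF lb' 1(2)]
      proof (rule regulator_constant[OF Llim_bdd[OF lb' 1(1)] 1(2,1) t])
        show "0 < \<delta> $ i / 2" using pos by simp
        fix u assume u: "u \<in> {0..}" "T \<le> u" "u \<le> t"
        show "\<delta> $ i / 2 \<le> (x' + y u) $ i - A (?L x' u) $ i
            + regulator {0..} (\<lambda>u. (x' + y u) $ i - A (?L x' u) $ i) u"
          using T[OF u(2)] unfolding Wlim_nth Llim_fixpoint[OF lb' u(1), of x' i] .
      qed
    qed
    obtain t where t: "0 \<le> t" "Ri (x' - x) $ i + ?L x' T $ i + 1 \<le> ?L x t $ i"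
      using unb by blast
    have "?L x t $ i \<le> ?L x (max t T) $ i"
      using t by (intro mono_on_vecD[OF Llim_mono_time[OF lb']]) auto
    also have "\<dots> \<le> Ri (x' - x) $ i + ?L x' (max t T) $ i"
      using Gb[of "max t T" i] max.coboundedI1[OF t(1), of T] by simp
    also have "?L x' (max t T) $ i = ?L x' T $ i" by (rule const) simp
    finally show False using t by simp
  qed
  then have "\<delta> = 0" by (simp add: vec_eq_iff)
  with lim show ?thesis by simp
qed

text \<open>
  Both starts, \<open>x\<close> and \<open>0\<close>, are compared with their componentwise maximum.
\<close>
theorem coupling:
  assumes lb: "lower_bounded {0..} y" and unb: "\<And>i c. \<exists>t\<ge>0. c \<le> Llim {0..} y t $ i"
  shows "((\<lambda>t. Wlim {0..} (\<lambda>u. x + y u) t - Wlim {0..} y t) \<longlongrightarrow> 0) at_top"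
proof -
  define m where "m = (\<chi> i. max 0 (x $ i))"
  have m: "x \<le> m" "0 \<le> m" by (auto simp: m_def less_eq_vec_def)
  let ?L = "\<lambda>x. Llim {0..} (\<lambda>u. x + y u)" and ?W = "\<lambda>x. Wlim {0..} (\<lambda>u. x + y u)"
  have unbx: "\<exists>t\<ge>0. c \<le> ?L x t $ i" for i c
  proof -
    obtain t where t: "0 \<le> t" "c + Ri m $ i \<le> Llim {0..} y t $ i" using unb by blast
    have "?L m t $ i \<le> ?L x t $ i"
      using Llim_mono_start[OF lb m(1), of t] t by (simp add: less_eq_vec_def)
    moreover have "?L 0 t $ i - ?L m t $ i \<le> Ri (m - 0) $ i"
      by (rule Llim_diff_le[OF lb m(2)]) (use t in simp)
    ultimately show ?thesis using t by (intro exI[of _ t]) simp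
  qed
  have "((\<lambda>t. ?W m t - ?W x t) \<longlongrightarrow> 0) at_top" by (rule coupling_ordered[OF lb m(1) unbx])
  moreover have "((\<lambda>t. ?W m t - ?W 0 t) \<longlongrightarrow> 0) at_top"
    by (rule coupling_ordered[OF lb m(2)]) (use unb in simp)
  ultimately have "((\<lambda>t. (?W m t - ?W 0 t) - (?W m t - ?W x t)) \<longlongrightarrow> 0 - 0) at_top"
    by (intro tendsto_diff)
  then show ?thesis by simp
qed

text \<open>
  A path drifting to minus infinity under \<open>R\<^sup>-\<^sup>1\<close> forces the regulator to grow; this feeds the
  hypothesis of \<open>coupling\<close>.
\<close>
lemma Llim_ge:
  assumes lb: "lower_bounded E y" and t: "t \<in> E"
  shows "- Ri (y t) $ i \<le> Llim E y t $ i"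
proof -
  have "0 \<le> Ri (Wlim E y t)" by (intro Ri_nonneg Wlim_nonneg[OF lb t])
  then have "0 \<le> Ri (y t) $ i + Llim E y t $ i"
    unfolding Ri_Wlim by (simp add: less_eq_vec_def)
  then show ?thesis by simp
qed

section \<open>A pathwise bound under the stability condition\<close>

text \<open>
  Start in \<open>x\<close>, large enough that the linear function \<open>l u = - u R\<^sup>-\<^sup>1 (v + \<epsilon> 1)\<close>, nondecreasing by
  the smallness of \<open>\<epsilon>\<close>, keeps the path nonnegative up to \<open>T\<close>. By minimality \<open>L(T) \<le> l T\<close>, and \<open>x\<close> is
  chosen so that \<open>x + y(T) + R l(T)\<close> is exactly \<open>C 1\<close>. A larger start only enlarges the state.
\<close>
theorem Wlim_stability_bound:
  assumes lb: "lower_bounded {0..} y" and y0: "y 0 = 0" and T: "0 \<le> T" and C: "0 \<le> C"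
    and \<epsilon>: "\<And>i. \<epsilon> * Ri 1 $ i \<le> - Ri v $ i"
    and dev: "\<And>u i. 0 \<le> u \<Longrightarrow> u \<le> T \<Longrightarrow> \<bar>y T $ i - y u $ i - v $ i * (T - u)\<bar> \<le> C + \<epsilon> * (T - u)"
  shows "Wlim {0..} y T $ i \<le> C * Ri 1 $ i"
proof -
  define x where "x = (\<chi> i. - (y T $ i - T * v $ i) + C + \<epsilon> * T)"
  define l where "l u = u *\<^sub>R (- Ri v - \<epsilon> *\<^sub>R Ri 1)" for u :: real
  have "0 \<le> x"
  proof -
    have "0 \<le> x $ i" for i using dev[of 0 i] T by (simp add: x_def y0 mult.commute)
    then show ?thesis by (simp add: less_eq_vec_def)
  qed
  have Rl: "R *v l u = - u *\<^sub>R v - (u * \<epsilon>) *\<^sub>R 1" for u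
  proof -
    have "l u = Ri (- u *\<^sub>R v - (u * \<epsilon>) *\<^sub>R 1)"
      by (simp add: l_def matrix_vector_mult_diff_distrib matrix_vector_mult_scaleR scaleR_diff_right
          flip: scaleR_minus_left)
    then show ?thesis by simp
  qed
  have pos: "0 \<le> - Ri v - \<epsilon> *\<^sub>R Ri 1" using \<epsilon> by (simp add: less_eq_vec_def)
  have L: "Llim {0..} (\<lambda>u. x + y u) T \<le> l T"
  proof (rule Llim_minimal[OF lower_bounded_add[OF lb], where T = T])
    show "0 \<le> l t" if "t \<in> {0..}" for t
      using that pos by (simp add: l_def less_eq_vec_def)
    show "mono_on {t \<in> {0..}. t \<le> T} l"
      using pos by (intro mono_onI) (auto simp: l_def less_eq_vec_def intro: mult_right_mono)
    fix t assume t: "t \<in> {0..}" "t \<le> T"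
    have "0 \<le> x $ i + y t $ i - t * v $ i - t * \<epsilon>" for i
      using dev[of t i] t by (simp add: x_def algebra_simps abs_le_iff)
    then show "0 \<le> x + y t + R *v l t"
      unfolding Rl by (simp add: less_eq_vec_def algebra_simps)
  qed (use T in auto)
  have "Wlim {0..} (\<lambda>u. 0 + y u) T \<le> Wlim {0..} (\<lambda>u. x + y u) T"
    by (rule Wlim_mono_start[OF lb \<open>0 \<le> x\<close>]) (use T in simp)
  also have "\<dots> \<le> Ri (Wlim {0..} (\<lambda>u. x + y u) T)"
    by (intro le_Ri Wlim_nonneg lower_bounded_add lb) (use T in simp)
  also have "\<dots> \<le> Ri (x + y T) + l T"
    unfolding Ri_Wlim by (rule add_left_mono[OF L])
  also have "\<dots> = Ri (x + y T + R *v l T)" by (simp add: matrix_vector_right_distrib)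
  also have "x + y T + R *v l T = C *\<^sub>R 1"
    unfolding Rl by (simp add: x_def vec_eq_iff algebra_simps)
  finally have "Wlim {0..} y T \<le> C *\<^sub>R Ri 1" by (simp add: matrix_vector_mult_scaleR)
  then show ?thesis by (simp add: less_eq_vec_def)
qed

end

section \<open>The reflection map as a measurable functional of the path\<close>

text \<open>
  A real supremum over an unbounded set is a fixed default value, and the set of points where this
  happens is measurable; elsewhere the supremum agrees with the extended real one.
\<close>
lemma borel_measurable_SUP_real:
  fixes f :: "'i \<Rightarrow> 'a \<Rightarrow> real"
  assumes I: "countable I" "I \<noteq> {}" and [measurable]: "\<And>i. i \<in> I \<Longrightarrow> f i \<in> borel_measurable M"
  shows "(\<lambda>x. SUP i\<in>I. f i x) \<in> borel_measurable M"
proof -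
  \<comment> \<open>the common value of all suprema of unbounded sets\<close>
  define c where "c = (LEAST z::real. False)"
  have "(SUP i\<in>I. f i x) = (if \<exists>n::nat. \<forall>i\<in>I. f i x \<le> real n then real_of_ereal (SUP i\<in>I. ereal (f i x)) else c)" for x
  proof (cases "\<exists>n::nat. \<forall>i\<in>I. f i x \<le> real n")
    case True
    then obtain n where n: "\<And>i. i \<in> I \<Longrightarrow> f i x \<le> real n" by auto
    obtain i where i: "i \<in> I" using I by auto
    have "ereal (f i x) \<le> (SUP i\<in>I. ereal (f i x))" using i by (rule SUP_upper)
    moreover have "(SUP i\<in>I. ereal (f i x)) \<le> ereal (real n)" using n by (intro SUP_least) simp
    ultimately have "\<bar>SUP i\<in>I. ereal (f i x)\<bar> \<noteq> \<infinity>" by auto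
    from ereal_SUP[OF this] have "real_of_ereal (SUP i\<in>I. ereal (f i x)) = (SUP i\<in>I. f i x)"
      by (metis real_of_ereal.simps(1))
    with True show ?thesis by simp
  next
    case False
    have no: "\<not> (\<forall>y\<in>(\<lambda>i. f i x) ` I. y \<le> z)" for z
    proof
      assume a: "\<forall>y\<in>(\<lambda>i. f i x) ` I. y \<le> z"
      obtain n :: nat where "z \<le> real n" using real_arch_simple by blast
      with a False show False by (metis imageI order_trans)
    qed
    show ?thesis unfolding if_not_P[OF False] Sup_real_def c_def by (simp only: no)
  qed
  moreover have "Measurable.pred M (\<lambda>x. \<exists>n::nat. \<forall>i\<in>I. f i x \<le> real n)"
    using I by (intro pred_intros_countable pred_intros_countable_bounded) measurable
  moreover have "(\<lambda>x. real_of_ereal (SUP i\<in>I. ereal (f i x))) \<in> borel_measurable M"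
    using I by measurable
  ultimately show ?thesis by (simp only: measurable_If_restrict_space_iff) (intro measurable_If; simp)
qed

lemma borel_measurable_vec_iff:
  fixes f :: "'a \<Rightarrow> real^'n"
  shows "f \<in> borel_measurable M \<longleftrightarrow> (\<forall>i. (\<lambda>x. f x $ i) \<in> borel_measurable M)"
proof -
  have B: "(Basis :: (real^'n) set) = range (\<lambda>i. axis i 1)" by (auto simp: Basis_vec_def)
  show ?thesis by (subst borel_measurable_euclidean_space) (simp add: B inner_axis)
qed

lemma borel_measurable_nth [measurable (raw)]:
  fixes f :: "'a \<Rightarrow> real^'n"
  shows "f \<in> borel_measurable M \<Longrightarrow> (\<lambda>x. f x $ i) \<in> borel_measurable M"
  unfolding borel_measurable_vec_iff by blast

lemma measurable_path_eval [measurable (raw)]: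
  assumes "f \<in> measurable N (path_space T)" "t \<in> T"
  shows "(\<lambda>x. f x t) \<in> borel_measurable N"
  using assms measurable_compose[OF _ measurable_component_singleton[of t T "\<lambda>_. borel"]]
  unfolding path_space_def by blast

text \<open>
  A countable set of times that determines the reflection at time \<open>t\<close> of a right-continuous path.
  The time \<open>t\<close> itself is included because values to the right of \<open>t\<close> may not be consulted.
\<close>
definition skeleton :: "real \<Rightarrow> real set" where
  "skeleton t = insert t (\<rat> \<inter> {0..t})"

lemma countable_skeleton: "countable (skeleton t)"
  unfolding skeleton_def by (intro countable_insert countable_Int1 countable_rat)

lemma skeleton_subset: "0 \<le> t \<Longrightarrow> skeleton t \<subseteq> {0..t}"
  by (auto simp: skeleton_def)

lemma skeleton_self: "t \<in> skeleton t"
  by (simp add: skeleton_def)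

lemma lower_bounded_skeleton: "0 \<le> t \<Longrightarrow> lower_bounded {0..} y \<Longrightarrow> lower_bounded (skeleton t) y"
  unfolding lower_bounded_def using skeleton_subset[of t] by (meson atLeastAtMost_iff atLeast_iff subsetD)

lemma lower_bounded_skeleton_iff:
  assumes "0 \<le> t"
  shows "lower_bounded (skeleton t) y \<longleftrightarrow> (\<exists>c::nat. \<forall>u\<in>skeleton t. \<forall>i. - real c \<le> y u $ i)"
proof
  assume "lower_bounded (skeleton t) y"
  from lower_boundedE[OF this skeleton_self] obtain c where
    c: "\<And>u i. u \<in> skeleton t \<Longrightarrow> u \<le> t \<Longrightarrow> - c \<le> y u $ i" by metis
  obtain n :: nat where "c \<le> real n" using real_arch_simple by blast
  then have "- real n \<le> y u $ i" if "u \<in> skeleton t" for u i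
    using c[OF that, of i] skeleton_subset[OF assms] that by fastforce
  then show "\<exists>c::nat. \<forall>u\<in>skeleton t. \<forall>i. - real c \<le> y u $ i" by blast
next
  assume "\<exists>c::nat. \<forall>u\<in>skeleton t. \<forall>i. - real c \<le> y u $ i"
  then show "lower_bounded (skeleton t) y" unfolding lower_bounded_def by blast
qed

text \<open>
  A value of \<open>- z\<close> exceeding the supremum over the skeleton would persist, by right continuity, at some
  rational time to its right.
\<close>
lemma regulator_skeleton:
  assumes bdd: "bdd_below (z ` {u\<in>{0..}. u \<le> u'})" and u': "u' \<in> skeleton t" "0 \<le> t"
    and rc: "\<And>r. 0 \<le> r \<Longrightarrow> (z \<longlongrightarrow> z r) (at_right r)"
  shows "regulator {0..} z u' = regulator (skeleton t) z u'"
proof (rule antisym)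
  have u0: "0 \<le> u'" "u' \<le> t" using u' skeleton_subset[of t] by auto
  have b: "bdd_below (z ` {u\<in>skeleton t. u \<le> u'})"
    by (rule bdd_below_mono[OF bdd]) (use u' skeleton_subset[of t] in auto)
  let ?m = "regulator (skeleton t) z u'"
  show "regulator {0..} z u' \<le> ?m"
  proof (rule regulator_least)
    show "0 \<le> ?m" by (rule regulator_upper(2)[OF b u'(1)]) simp
    fix r :: real assume r: "r \<in> {0..}" "r \<le> u'"
    show "- z r \<le> ?m"
    proof (cases "r = u'")
      case True
      then show ?thesis using regulator_upper(1)[OF b u'(1)] by simp
    next
      case False
      show ?thesis
      proof (rule ccontr)
        assume "\<not> - z r \<le> ?m"
        moreover have "((\<lambda>u. - z u) \<longlongrightarrow> - z r) (at_right r)" using r by (intro tendsto_minus rc) simp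
        ultimately have "eventually (\<lambda>u. ?m < - z u) (at_right r)" by (intro order_tendstoD(1)) auto
        then obtain b' where b': "r < b'" "\<And>u. r < u \<Longrightarrow> u < b' \<Longrightarrow> ?m < - z u"
          by (auto simp: eventually_at_right_field)
        obtain q where q: "q \<in> \<rat>" "r < q" "q < min b' u'"
          using Rats_dense_in_real[of r "min b' u'"] b' r False by auto
        have "q \<in> skeleton t" using q r u0 by (auto simp: skeleton_def)
        then have "- z q \<le> ?m" using q by (intro regulator_upper(1)[OF b]) auto
        then show False using b'(2)[of q] q by auto
      qed
    qed
  qed (use u0 in auto)
  show "?m \<le> regulator {0..} z u'"
    by (rule regulator_least[OF u'(1)])
      (use u' u0 skeleton_subset[of t] in \<open>auto intro!: regulator_upper[OF bdd]\<close>)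
qed

context skorohod_matrix
begin

lemma Llim_skeleton:
  assumes y: "cadlag y" and t: "0 \<le> t" and u: "u \<in> skeleton t"
  shows "Llim (skeleton t) y u = Llim {0..} y u"
proof -
  note lb = cadlag_lower_bounded[OF y]
  have sub: "skeleton t \<subseteq> {0..}" using skeleton_subset[OF t] by auto
  have "Llim {0..} y u = Llim (skeleton t) y u"
  proof (rule fixpoint_unique[OF lower_bounded_skeleton[OF t lb] mono_on_subset[OF Llim_mono_time[OF lb] sub] _ u])
    fix s i assume s: "s \<in> skeleton t"
    with sub have s0: "s \<in> {0..}" by blast
    show "Llim {0..} y s $ i = regulator (skeleton t) (\<lambda>u. y u $ i - A (Llim {0..} y u) $ i) s"
      unfolding Llim_fixpoint[OF lb s0, of i]
    proof (rule regulator_skeleton[OF Llim_bdd[OF lb s0] s t])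
      fix r :: real assume "0 \<le> r"
      then show "((\<lambda>u. y u $ i - A (Llim {0..} y u) $ i) \<longlongrightarrow> y r $ i - A (Llim {0..} y r) $ i) (at_right r)"
        by (intro tendsto_R_free cadlag_right[OF y] Llim_right_continuous[OF lb])
    qed
  qed
  then show ?thesis by simp
qed

lemma Wlim_skeleton:
  "cadlag y \<Longrightarrow> 0 \<le> t \<Longrightarrow> u \<in> skeleton t \<Longrightarrow> Wlim (skeleton t) y u = Wlim {0..} y u"
  by (simp add: Wlim_def Llim_skeleton)

lemma Lit_cong:
  assumes "\<And>u. u \<in> E \<Longrightarrow> y u = y' u" "t \<in> E"
  shows "Lit E y k t = Lit E y' k t"
  using assms(2)
proof (induction k arbitrary: t)
  case (Suc k)
  have "regulator E (\<lambda>u. y u $ i - A (Lit E y k u) $ i) t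
      = regulator E (\<lambda>u. y' u $ i - A (Lit E y' k u) $ i) t" for i
    unfolding regulator_def using assms(1) Suc.IH by (intro SUP_cong refl) auto
  then show ?case by (simp only: Lit.simps)
qed simp

lemma Llim_cong: "(\<And>u. u \<in> E \<Longrightarrow> y u = y' u) \<Longrightarrow> t \<in> E \<Longrightarrow> Llim E y t = Llim E y' t"
  using Lit_cong[of E y y' t] by (simp add: Llim_def)

lemma Wlim_cong: "(\<And>u. u \<in> E \<Longrightarrow> y u = y' u) \<Longrightarrow> t \<in> E \<Longrightarrow> Wlim E y t = Wlim E y' t"
  using Llim_cong[of E y y' t] by (simp add: Wlim_def)

lemma measurable_Lit:
  assumes E: "countable E" and Y: "\<And>u. u \<in> E \<Longrightarrow> (\<lambda>x. Y x u) \<in> borel_measurable N" and t: "t \<in> E"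
  shows "(\<lambda>x. Lit E (Y x) k t) \<in> borel_measurable N"
  using t
proof (induction k arbitrary: t)
  case (Suc k)
  have "(\<lambda>x. SUP u\<in>{u\<in>E. u \<le> t}. max 0 (- (Y x u $ i - A (Lit E (Y x) k u) $ i))) \<in> borel_measurable N" for i
  proof (rule borel_measurable_SUP_real)
    show "countable {u\<in>E. u \<le> t}" using E by (rule countable_subset[rotated]) auto
    show "{u\<in>E. u \<le> t} \<noteq> {}" using Suc.prems by auto
    fix u assume "u \<in> {u\<in>E. u \<le> t}"
    then have [measurable]: "(\<lambda>x. Lit E (Y x) k u) \<in> borel_measurable N" "(\<lambda>x. Y x u) \<in> borel_measurable N"
      using Suc.IH Y by auto
    show "(\<lambda>x. max 0 (- (Y x u $ i - A (Lit E (Y x) k u) $ i))) \<in> borel_measurable N"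
      unfolding A_nth by measurable
  qed
  then show ?case by (simp add: borel_measurable_vec_iff regulator_def)
qed simp

lemma measurable_Llim:
  assumes "countable E" "\<And>u. u \<in> E \<Longrightarrow> (\<lambda>x. Y x u) \<in> borel_measurable N" "t \<in> E"
  shows "(\<lambda>x. Llim E (Y x) t) \<in> borel_measurable N"
proof -
  have [measurable]: "(\<lambda>x. Lit E (Y x) k t) \<in> borel_measurable N" for k by (rule measurable_Lit[OF assms])
  have "(\<lambda>x. SUP k. Lit E (Y x) k t $ i) \<in> borel_measurable N" for i
    by (rule borel_measurable_SUP_real) auto
  then show ?thesis by (simp add: borel_measurable_vec_iff Llim_def)
qed

lemma measurable_Wlim:
  assumes "countable E" "\<And>u. u \<in> E \<Longrightarrow> (\<lambda>x. Y x u) \<in> borel_measurable N" "t \<in> E"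
  shows "(\<lambda>x. Wlim E (Y x) t) \<in> borel_measurable N"
proof -
  have [measurable]: "(\<lambda>x. Llim E (Y x) t) \<in> borel_measurable N" "(\<lambda>x. Y x t) \<in> borel_measurable N"
    using measurable_Llim[OF assms] assms by auto
  show ?thesis unfolding borel_measurable_vec_iff Wlim_nth A_nth by measurable
qed

text \<open>
  The reflection started in \<open>w\<close> as a measurable function of an arbitrary, possibly irregular, path
  \<open>x\<close>. It makes sense for every point of the product space, on which laws of processes live, and
  agrees with the reflection map on cadlag paths.
\<close>
definition Wf :: "real \<Rightarrow> real^'n \<Rightarrow> (real \<Rightarrow> real^'n) \<Rightarrow> real^'n" where
  "Wf t w x = Wlim (skeleton t) (\<lambda>u. w + x u) t"

definition Lf :: "real \<Rightarrow> real^'n \<Rightarrow> (real \<Rightarrow> real^'n) \<Rightarrow> real^'n" where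
  "Lf t w x = Llim (skeleton t) (\<lambda>u. w + x u) t"

lemma measurable_Wf [measurable (raw)]:
  assumes [measurable]: "w \<in> borel_measurable N" "x \<in> measurable N (path_space {0..})" and t: "0 \<le> t"
  shows "(\<lambda>\<omega>. Wf t (w \<omega>) (x \<omega>)) \<in> borel_measurable N"
  unfolding Wf_def
proof (rule measurable_Wlim[OF countable_skeleton _ skeleton_self])
  fix u assume "u \<in> skeleton t"
  then have "u \<in> {0..}" using skeleton_subset[OF t] by auto
  then show "(\<lambda>\<omega>. w \<omega> + x \<omega> u) \<in> borel_measurable N" by measurable
qed

lemma measurable_Lf [measurable (raw)]:
  assumes [measurable]: "w \<in> borel_measurable N" "x \<in> measurable N (path_space {0..})" and t: "0 \<le> t"
  shows "(\<lambda>\<omega>. Lf t (w \<omega>) (x \<omega>)) \<in> borel_measurable N"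
  unfolding Lf_def
proof (rule measurable_Llim[OF countable_skeleton _ skeleton_self])
  fix u assume "u \<in> skeleton t"
  then have "u \<in> {0..}" using skeleton_subset[OF t] by auto
  then show "(\<lambda>\<omega>. w \<omega> + x \<omega> u) \<in> borel_measurable N" by measurable
qed

lemma Wf_continuous:
  assumes lb: "lower_bounded (skeleton t) x"
  shows "continuous_on UNIV (\<lambda>w. Wf t w x)"
proof -
  have "((\<lambda>w. Wf t w x) \<longlongrightarrow> Wf t a x) (at a)" for a
  proof (rule vec_tendstoI)
    fix i
    have l: "((\<lambda>w. Ri (\<chi> i. \<bar>w $ i - a $ i\<bar>) $ i) \<longlongrightarrow> 0) (at a)"
    proof -
      have "((\<lambda>w. \<chi> i. \<bar>w $ i - a $ i\<bar>) \<longlongrightarrow> (\<chi> i. \<bar>a $ i - a $ i\<bar>)) (at a)"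
        by (intro tendsto_intros)
      from bounded_linear.tendsto[OF matrix_vector_mul_bounded_linear this, of "matrix_inv R"]
      have "((\<lambda>w. Ri (\<chi> i. \<bar>w $ i - a $ i\<bar>) $ i) \<longlongrightarrow> Ri (\<chi> i. \<bar>a $ i - a $ i\<bar>) $ i) (at a)"
        by (rule tendsto_vec_nth)
      moreover have "(\<chi> i. \<bar>a $ i - a $ i\<bar>) = 0" by (simp add: vec_eq_iff)
      ultimately show ?thesis by simp
    qed
    have "((\<lambda>w. Wf t w x $ i - Wf t a x $ i) \<longlongrightarrow> 0) (at a)"
    proof (rule Lim_null_comparison[OF _ l])
      show "eventually (\<lambda>w. norm (Wf t w x $ i - Wf t a x $ i) \<le> Ri (\<chi> i. \<bar>w $ i - a $ i\<bar>) $ i) (at a)"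
        unfolding Wf_def real_norm_def
        by (intro always_eventually allI Wlim_start_diff_le[OF lb skeleton_self])
    qed
    then show "((\<lambda>w. Wf t w x $ i) \<longlongrightarrow> Wf t a x $ i) (at a)" by (simp add: LIM_zero_iff)
  qed
  then show ?thesis by (simp add: continuous_on_def tendsto_within_subset)
qed

lemma cadlag_add: "cadlag (y :: real \<Rightarrow> real^'n) \<Longrightarrow> cadlag (\<lambda>u. x + y u)"
  using cadlag_shift[of y 0 x 0] by simp

lemma reflection_eq_functional:
  assumes c: "cadlag (\<lambda>u. X u \<omega>)" and t: "0 \<le> t"
  shows refl_W_eq: "refl_W R \<xi> X t \<omega> = Wf t (\<xi> \<omega>) (traj {0..} X \<omega>)"
    and refl_L_eq: "refl_L R \<xi> X t \<omega> = Lf t (\<xi> \<omega>) (traj {0..} X \<omega>)"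
proof -
  have c': "cadlag (\<lambda>u. \<xi> \<omega> + X u \<omega>)" by (rule cadlag_add[OF c])
  have sk: "\<xi> \<omega> + X u \<omega> = \<xi> \<omega> + traj {0..} X \<omega> u" if "u \<in> skeleton t" for u
    using skeleton_subset[OF t] that by (auto simp: traj_def)
  show "refl_W R \<xi> X t \<omega> = Wf t (\<xi> \<omega>) (traj {0..} X \<omega>)"
    using t Wlim_skeleton[OF c' t skeleton_self]
      Wlim_cong[where E = "skeleton t" and t = t, OF sk skeleton_self]
    by (simp add: refl_W_def reflection_map_eq[OF c'] Wf_def)
  show "refl_L R \<xi> X t \<omega> = Lf t (\<xi> \<omega>) (traj {0..} X \<omega>)"
    using t Llim_skeleton[OF c' t skeleton_self]
      Llim_cong[where E = "skeleton t" and t = t, OF sk skeleton_self]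
    by (simp add: refl_L_def reflection_map_eq[OF c'] Lf_def)
qed

lemma refl_W_Wlim: "cadlag (\<lambda>u. X u \<omega>) \<Longrightarrow> 0 \<le> t \<Longrightarrow> refl_W R \<xi> X t \<omega> = Wlim {0..} (\<lambda>u. \<xi> \<omega> + X u \<omega>) t"
  by (simp add: refl_W_def reflection_map_eq[OF cadlag_add])

lemma refl_L_Llim: "cadlag (\<lambda>u. X u \<omega>) \<Longrightarrow> 0 \<le> t \<Longrightarrow> refl_L R \<xi> X t \<omega> = Llim {0..} (\<lambda>u. \<xi> \<omega> + X u \<omega>) t"
  by (simp add: refl_L_def reflection_map_eq[OF cadlag_add])

end

section \<open>Laws determined by continuous test functions\<close>

text \<open>
  The approximating functions are cut-off multiples of the distance to the complement.
\<close>
lemma open_indicator_approx: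
  fixes U :: "'a::metric_space set"
  assumes "open U"
  obtains g :: "nat \<Rightarrow> 'a \<Rightarrow> real" where "\<And>m. continuous_on UNIV (g m)"
    "\<And>m x. 0 \<le> g m x" "\<And>m x. g m x \<le> 1" "\<And>x. (\<lambda>m. g m x) \<longlonglongrightarrow> indicator U x"
proof (cases "U = UNIV")
  case True
  then show ?thesis by (intro that[of "\<lambda>_ _. 1"]) auto
next
  case False
  let ?d = "\<lambda>x. infdist x (- U)"
  have lim: "(\<lambda>m. min 1 (real m * ?d x)) \<longlonglongrightarrow> indicator U x" for x
  proof (cases "x \<in> U")
    case True
    then have d: "0 < ?d x"
      using assms False infdist_pos_not_in_closed[of "- U" x] by auto
    obtain N :: nat where N: "1 / ?d x \<le> real N" using real_arch_simple by blast
    have "eventually (\<lambda>m. min 1 (real m * ?d x) = 1) sequentially"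
      unfolding eventually_sequentially
    proof (intro exI allI impI)
      fix m assume "N \<le> m"
      then have "1 / ?d x \<le> real m" using N by simp
      then have "1 \<le> real m * ?d x" using d by (simp add: pos_divide_le_eq)
      then show "min 1 (real m * ?d x) = 1" by simp
    qed
    with True show ?thesis by (simp add: tendsto_eventually)
  next
    case False
    then have "?d x = 0" by (intro infdist_zero) simp
    with False show ?thesis by simp
  qed
  show ?thesis
  proof (rule that[of "\<lambda>m x. min 1 (real m * ?d x)"])
    show "continuous_on UNIV (\<lambda>x. min 1 (real m * ?d x))" for m
      by (intro continuous_intros)
  qed (use lim in \<open>auto simp: infdist_nonneg\<close>)
qed

text \<open>
  Test functions need to be continuous in the first coordinate only. This matters because the
  convergence theorem below gives no continuity with respect to the driving path.
\<close>
lemma pair_law_eqI: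
  fixes \<mu> \<nu> :: "('a::metric_space \<times> 'b) measure"
  assumes \<mu>: "prob_space \<mu>" "sets \<mu> = sets (borel \<Otimes>\<^sub>M S)" and \<nu>: "prob_space \<nu>" "sets \<nu> = sets (borel \<Otimes>\<^sub>M S)"
    and eq: "\<And>f A. continuous_on UNIV f \<Longrightarrow> (\<And>x. 0 \<le> f x) \<Longrightarrow> (\<And>x. f x \<le> (1::real)) \<Longrightarrow> A \<in> sets S \<Longrightarrow>
      (\<integral>z. f (fst z) * indicator A (snd z) \<partial>\<mu>) = (\<integral>z. f (fst z) * indicator A (snd z) \<partial>\<nu>)"
  shows "\<mu> = \<nu>"
proof -
  define E where "E = {U \<times> A | U A. open (U::'a set) \<and> A \<in> sets S}"
  define \<Omega> where "\<Omega> = (UNIV::'a set) \<times> space S"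
  have E_Pow: "E \<subseteq> Pow \<Omega>" using sets.sets_into_space by (fastforce simp: E_def \<Omega>_def)
  have stable: "Int_stable E"
  proof (rule Int_stableI)
    fix a b assume "a \<in> E" "b \<in> E"
    then obtain U A V B where "a = U \<times> A" "b = V \<times> B" "open U" "open V" "A \<in> sets S" "B \<in> sets S"
      by (auto simp: E_def)
    then have "a \<inter> b = (U \<inter> V) \<times> (A \<inter> B)" "open (U \<inter> V)" "A \<inter> B \<in> sets S" by auto
    then show "a \<inter> b \<in> E" unfolding E_def by blast
  qed
  have "sets (borel \<Otimes>\<^sub>M S) = sigma_sets \<Omega> E"
  proof
    let ?\<Sigma> = "sigma \<Omega> E"
    have sp: "space ?\<Sigma> = \<Omega>" using E_Pow by (rule space_measure_of)
    have se: "sets ?\<Sigma> = sigma_sets \<Omega> E" using E_Pow by (rule sets_measure_of)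
    have 1: "fst \<in> measurable ?\<Sigma> borel"
    proof (rule borel_measurableI)
      fix U :: "'a set" assume "open U"
      then have "fst -` U \<inter> space ?\<Sigma> \<in> E" unfolding sp by (auto simp: E_def \<Omega>_def intro!: exI[of _ U] exI[of _ "space S"])
      then show "fst -` U \<inter> space ?\<Sigma> \<in> sets ?\<Sigma>" unfolding se by (rule sigma_sets.Basic)
    qed
    have 2: "snd \<in> measurable ?\<Sigma> S"
    proof (rule measurableI)
      fix A assume A: "A \<in> sets S"
      then have "snd -` A \<inter> space ?\<Sigma> \<in> E" unfolding sp using sets.sets_into_space[OF A]
        by (auto simp: E_def \<Omega>_def intro!: exI[of _ UNIV] exI[of _ A])
      then show "snd -` A \<inter> space ?\<Sigma> \<in> sets ?\<Sigma>" unfolding se by (rule sigma_sets.Basic)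
    next
      fix x assume "x \<in> space ?\<Sigma>"
      then show "snd x \<in> space S" unfolding sp by (auto simp: \<Omega>_def)
    qed
    have id: "(\<lambda>z. (fst z, snd z)) \<in> measurable ?\<Sigma> (borel \<Otimes>\<^sub>M S)" by (rule measurable_Pair[OF 1 2])
    show "sets (borel \<Otimes>\<^sub>M S) \<subseteq> sigma_sets \<Omega> E"
    proof
      fix X :: "('a \<times> 'b) set" assume X: "X \<in> sets (borel \<Otimes>\<^sub>M S)"
      have "(\<lambda>z::'a \<times> 'b. (fst z, snd z)) -` X \<inter> space ?\<Sigma> = X"
        using sets.sets_into_space[OF X] unfolding sp by (auto simp: \<Omega>_def space_pair_measure)
      then show "X \<in> sigma_sets \<Omega> E" using measurable_sets[OF id X] unfolding se by simp
    qed
    have "E \<subseteq> sets (borel \<Otimes>\<^sub>M S)" by (auto simp: E_def)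
    then have "sigma_sets (space (borel \<Otimes>\<^sub>M S)) E \<subseteq> sets (borel \<Otimes>\<^sub>M S)" by (rule sets.sigma_sets_subset)
    then show "sigma_sets \<Omega> E \<subseteq> sets (borel \<Otimes>\<^sub>M S)" by (simp add: \<Omega>_def space_pair_measure)
  qed
  note sets_eq = this
  have eqE: "emeasure \<mu> X = emeasure \<nu> X" if X: "X \<in> E" for X
  proof -
    obtain U A where UA: "X = U \<times> A" "open U" "A \<in> sets S" using X by (auto simp: E_def)
    obtain g where g: "\<And>m. continuous_on UNIV (g m)" "\<And>m x. 0 \<le> g m x" "\<And>m x. g m x \<le> (1::real)"
      "\<And>x. (\<lambda>m. g m x) \<longlonglongrightarrow> indicator U x" using open_indicator_approx[OF UA(2)] by blast
    have lim: "(\<lambda>m. \<integral>z. g m (fst z) * indicator A (snd z) \<partial>\<rho>) \<longlonglongrightarrow> measure \<rho> X"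
      if \<rho>: "prob_space \<rho>" "sets \<rho> = sets (borel \<Otimes>\<^sub>M S)" for \<rho>
    proof -
      interpret prob_space \<rho> by fact
      note [measurable_cong] = \<rho>(2)
      have [measurable]: "g m \<in> borel_measurable borel" for m
        using g(1) by (rule borel_measurable_continuous_onI)
      note [measurable] = UA(3) borel_open[OF UA(2)]
      have "(\<lambda>m. \<integral>z. g m (fst z) * indicator A (snd z) \<partial>\<rho>) \<longlonglongrightarrow> (\<integral>z. indicator U (fst z) * indicator A (snd z) \<partial>\<rho>)"
      proof (rule integral_dominated_convergence[where w = "\<lambda>_. 1"])
        show "AE z in \<rho>. (\<lambda>m. g m (fst z) * indicator A (snd z)) \<longlonglongrightarrow> indicator U (fst z) * indicator A (snd z)"
          by (intro AE_I2 tendsto_intros g(4))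
        show "AE z in \<rho>. norm (g m (fst z) * indicator A (snd z)) \<le> 1" for m
          using g(2,3) by (intro AE_I2) (auto simp: indicator_def)
        show "(\<lambda>z. g m (fst z) * indicator A (snd z)) \<in> borel_measurable \<rho>" for m by measurable
        show "(\<lambda>z. indicator U (fst z) * indicator A (snd z) :: real) \<in> borel_measurable \<rho>" by measurable
      qed simp
      also have "(\<integral>z. (indicator U (fst z) * indicator A (snd z) :: real) \<partial>\<rho>) = (\<integral>z. indicator X z \<partial>\<rho>)"
        by (intro Bochner_Integration.integral_cong) (auto simp: UA(1) indicator_def)
      also have "\<dots> = measure \<rho> X"
      proof -
        have "X \<subseteq> space \<rho>" using sets_eq_imp_space_eq[OF \<rho>(2)] sets.sets_into_space[OF UA(3)]
          by (auto simp: UA(1) space_pair_measure)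
        then show ?thesis by (simp add: Int_absorb2)
      qed
      finally show ?thesis .
    qed
    have "measure \<mu> X = measure \<nu> X"
      by (rule LIMSEQ_unique[OF lim[OF \<mu>]])
        (use lim[OF \<nu>] in \<open>simp only: eq[OF g(1) g(2) g(3) UA(3)]\<close>)
    then show ?thesis
      by (simp add: finite_measure.emeasure_eq_measure[OF prob_space.finite_measure] \<mu> \<nu>)
  qed
  show ?thesis
  proof (rule measure_eqI_generator_eq[OF stable E_Pow eqE, of "\<lambda>_. \<Omega>"])
    show "range (\<lambda>_::nat. \<Omega>) \<subseteq> E" by (auto simp: E_def \<Omega>_def)
    show "emeasure \<mu> \<Omega> \<noteq> \<infinity>"
      by (simp add: finite_measure.emeasure_eq_measure[OF prob_space.finite_measure[OF \<mu>(1)]])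
  qed (use \<mu>(2) \<nu>(2) sets_eq in auto)
qed

lemma space_path_space: "space (path_space T) = extensional T"
  by (simp add: path_space_def space_PiM PiE_UNIV_domain PiE_def)

lemma measurable_path_spaceI:
  assumes "\<And>t. t \<in> T \<Longrightarrow> f t \<in> borel_measurable N"
  shows "(\<lambda>\<omega>. \<lambda>t\<in>T. f t \<omega>) \<in> measurable N (path_space T)"
  unfolding path_space_def using assms by (rule measurable_restrict)

text \<open>
  Finite-dimensional distributions determine the law of a process, and products of continuous
  functions determine each of them.
\<close>
lemma path_law_eqI:
  fixes \<mu> \<nu> :: "(real \<Rightarrow> 'c::metric_space) measure"
  assumes \<mu>: "prob_space \<mu>" "sets \<mu> = sets (path_space T)" and \<nu>: "prob_space \<nu>" "sets \<nu> = sets (path_space T)"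
    and eq: "\<And>F g. finite F \<Longrightarrow> F \<subseteq> T \<Longrightarrow> (\<And>t. continuous_on UNIV (g t)) \<Longrightarrow> (\<And>t x. 0 \<le> g t x) \<Longrightarrow>
      (\<And>t x. g t x \<le> (1::real)) \<Longrightarrow> (\<integral>f. (\<Prod>t\<in>F. g t (f t)) \<partial>\<mu>) = (\<integral>f. (\<Prod>t\<in>F. g t (f t)) \<partial>\<nu>)"
  shows "\<mu> = \<nu>"
proof -
  define C where "C F U = {f\<in>extensional T. \<forall>t\<in>F. f t \<in> (U t :: 'c set)}" for F U
  define E where "E = {C F U | F U. finite F \<and> F \<subseteq> T \<and> (\<forall>t. open (U t))}"
  have E_Pow: "E \<subseteq> Pow (extensional T)" by (auto simp: E_def C_def)
  have stable: "Int_stable E"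
  proof (rule Int_stableI)
    fix a b assume "a \<in> E" "b \<in> E"
    then obtain F U F' U' where *: "a = C F U" "finite F" "F \<subseteq> T" "\<forall>t. open (U t)"
      "b = C F' U'" "finite F'" "F' \<subseteq> T" "\<forall>t. open (U' t)"
      unfolding E_def by blast
    have "a \<inter> b = C (F \<union> F') (\<lambda>t. (if t \<in> F then U t else UNIV) \<inter> (if t \<in> F' then U' t else UNIV))"
      unfolding * C_def by auto
    moreover have "\<forall>t. open ((if t \<in> F then U t else UNIV) \<inter> (if t \<in> F' then U' t else UNIV))"
      using * by auto
    ultimately show "a \<inter> b \<in> E" unfolding E_def using * by blast
  qed
  have C_sets: "C F U \<in> sets (path_space T)" if "finite F" "F \<subseteq> T" "\<forall>t. open (U t)" for F U
  proof -
    have "C F U = prod_emb T (\<lambda>_. borel) F (Pi\<^sub>E F U)"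
      using that(2) by (auto simp: C_def prod_emb_def PiE_def extensional_def Pi_def subset_eq)
    then show ?thesis unfolding path_space_def using that by (simp add: sets_PiM_I)
  qed
  have sets_eq: "sets (path_space T) = sigma_sets (extensional T) E"
  proof
    let ?\<Sigma> = "sigma (extensional T) E"
    have sp: "space ?\<Sigma> = extensional T" using E_Pow by (rule space_measure_of)
    have se: "sets ?\<Sigma> = sigma_sets (extensional T) E" using E_Pow by (rule sets_measure_of)
    have ev: "(\<lambda>f. f t) \<in> borel_measurable ?\<Sigma>" if t: "t \<in> T" for t
    proof (rule borel_measurableI)
      fix U :: "'c set" assume U: "open U"
      have "(\<lambda>f. f t) -` U \<inter> space ?\<Sigma> = C {t} (\<lambda>_. U)" unfolding sp by (auto simp: C_def)
      then have "(\<lambda>f. f t) -` U \<inter> space ?\<Sigma> \<in> E"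
        unfolding E_def using t U by (intro CollectI exI[of _ "{t}"] exI[of _ "\<lambda>_. U"]) auto
      then show "(\<lambda>f. f t) -` U \<inter> space ?\<Sigma> \<in> sets ?\<Sigma>" unfolding se by (rule sigma_sets.Basic)
    qed
    have id: "(\<lambda>f. \<lambda>t\<in>T. f t) \<in> measurable ?\<Sigma> (path_space T)"
      by (rule measurable_path_spaceI[OF ev])
    show "sets (path_space T) \<subseteq> sigma_sets (extensional T) E"
    proof
      fix X :: "(real \<Rightarrow> 'c) set" assume X: "X \<in> sets (path_space T)"
      have "(\<lambda>f. \<lambda>t\<in>T. f t) -` X \<inter> space ?\<Sigma> = X"
        using sets.sets_into_space[OF X] by (auto simp: sp space_path_space extensional_restrict)
      then show "X \<in> sigma_sets (extensional T) E" using measurable_sets[OF id X] unfolding se by simp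
    qed
    have "E \<subseteq> sets (path_space T)" unfolding E_def using C_sets by blast
    then have "sigma_sets (space (path_space T)) E \<subseteq> sets (path_space T)" by (rule sets.sigma_sets_subset)
    then show "sigma_sets (extensional T) E \<subseteq> sets (path_space T)" by (simp add: space_path_space)
  qed
  have eqE: "emeasure \<mu> X = emeasure \<nu> X" if X: "X \<in> E" for X
  proof -
    obtain F U where FU: "X = C F U" "finite F" "F \<subseteq> T" "\<And>t. open (U t)"
      using X unfolding E_def by blast
    have "\<forall>t. \<exists>g. (\<forall>m. continuous_on UNIV (g m)) \<and> (\<forall>m x. 0 \<le> g m x) \<and> (\<forall>m x. g m x \<le> (1::real)) \<and>
      (\<forall>x. (\<lambda>m. g m x) \<longlonglongrightarrow> indicator (U t) x)"
      using open_indicator_approx[OF FU(4)] by metis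
    then obtain g where g: "\<And>t m. continuous_on UNIV (g t m)" "\<And>t m x. 0 \<le> g t m x"
      "\<And>t m x. g t m x \<le> (1::real)" "\<And>t x. (\<lambda>m. g t m x) \<longlonglongrightarrow> indicator (U t) x" by metis
    have lim: "(\<lambda>m. \<integral>f. (\<Prod>t\<in>F. g t m (f t)) \<partial>\<rho>) \<longlonglongrightarrow> measure \<rho> X"
      if \<rho>: "prob_space \<rho>" "sets \<rho> = sets (path_space T)" for \<rho>
    proof -
      interpret prob_space \<rho> by fact
      have m1: "(\<lambda>f. f t) \<in> borel_measurable \<rho>" if "t \<in> F" for t
      proof -
        have "(\<lambda>f. f t) \<in> borel_measurable (path_space T)"
          unfolding path_space_def using that FU(3) by (intro measurable_component_singleton) auto
        then show ?thesis by (simp add: measurable_cong_sets[OF \<rho>(2) refl])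
      qed
      have m2: "(\<lambda>f. g t m (f t)) \<in> borel_measurable \<rho>" if "t \<in> F" for t m
        by (rule measurable_compose[OF m1[OF that] borel_measurable_continuous_onI[OF g(1)]])
      have m3: "(\<lambda>f. indicator (U t) (f t) :: real) \<in> borel_measurable \<rho>" if "t \<in> F" for t
        by (rule measurable_compose[OF m1[OF that]]) (simp add: FU(4))
      have "(\<lambda>m. \<integral>f. (\<Prod>t\<in>F. g t m (f t)) \<partial>\<rho>) \<longlonglongrightarrow> (\<integral>f. (\<Prod>t\<in>F. indicator (U t) (f t)) \<partial>\<rho>)"
      proof (rule integral_dominated_convergence[where w = "\<lambda>_. 1"])
        show "(\<lambda>f. \<Prod>t\<in>F. indicator (U t) (f t) :: real) \<in> borel_measurable \<rho>"
          by (intro borel_measurable_prod m3)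
        show "(\<lambda>f. \<Prod>t\<in>F. g t m (f t)) \<in> borel_measurable \<rho>" for m
          by (intro borel_measurable_prod m2)
        show "AE f in \<rho>. (\<lambda>m. \<Prod>t\<in>F. g t m (f t)) \<longlonglongrightarrow> (\<Prod>t\<in>F. indicator (U t) (f t))"
          by (intro AE_I2 tendsto_prod g(4))
        show "AE f in \<rho>. norm (\<Prod>t\<in>F. g t m (f t)) \<le> 1" for m
          using g(2,3) by (intro AE_I2) (auto simp: abs_prod intro!: prod_le_1)
      qed simp
      also have "(\<integral>f. (\<Prod>t\<in>F. indicator (U t) (f t) :: real) \<partial>\<rho>) = (\<integral>f. indicator X f \<partial>\<rho>)"
      proof (rule Bochner_Integration.integral_cong[OF refl])
        fix f assume "f \<in> space \<rho>"
        then have "f \<in> extensional T" using sets_eq_imp_space_eq[OF \<rho>(2)] by (simp add: space_path_space)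
        then show "(\<Prod>t\<in>F. indicator (U t) (f t)) = (indicator X f :: real)"
          using FU(2) by (auto simp: FU(1) C_def indicator_def intro!: prod.neutral)
      qed
      also have "\<dots> = measure \<rho> X"
      proof -
        have "X \<subseteq> space \<rho>" using sets_eq_imp_space_eq[OF \<rho>(2)] by (auto simp: FU(1) C_def space_path_space)
        then show ?thesis by (simp add: Int_absorb2)
      qed
      finally show ?thesis .
    qed
    have "measure \<mu> X = measure \<nu> X"
      by (rule LIMSEQ_unique[OF lim[OF \<mu>]])
        (use lim[OF \<nu>] in \<open>simp only: eq[OF FU(2,3) g(1) g(2) g(3)]\<close>)
    then show ?thesis
      by (simp add: finite_measure.emeasure_eq_measure[OF prob_space.finite_measure] \<mu> \<nu>)
  qed
  show ?thesis
  proof (rule measure_eqI_generator_eq[OF stable E_Pow eqE, of "\<lambda>_. extensional T"])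
    have "extensional T = C {} (\<lambda>_. UNIV)" by (auto simp: C_def)
    then have "extensional T \<in> E" unfolding E_def
      by (intro CollectI exI[of _ "{}"] exI[of _ "\<lambda>_. UNIV"]) auto
    then show "range (\<lambda>_::nat. extensional T) \<subseteq> E" by auto
    show "emeasure \<mu> (extensional T) \<noteq> \<infinity>"
      by (simp add: finite_measure.emeasure_eq_measure[OF prob_space.finite_measure[OF \<mu>(1)]])
  qed (use \<mu>(2) \<nu>(2) sets_eq in auto)
qed

section \<open>Realising a conditional law by independent noise\<close>

abbreviation uniform01 :: "real measure" where "uniform01 \<equiv> uniform_measure lborel {0..1}"

lemma prob_space_uniform01: "prob_space uniform01"
  by (rule prob_space_uniform_measure) auto

text \<open>
  Integrated over the path, this turns the conditional distribution function into a probability that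
  involves the independent uniform variable.
\<close>
lemma emeasure_uniform01_le:
  assumes "c \<le> 1"
  shows "emeasure uniform01 {u. ennreal u \<le> c} = c"
proof -
  have "c < top" using assms by (rule le_less_trans) simp
  then have c: "c = ennreal (enn2real c)" "enn2real c \<le> 1"
    using assms by (auto simp: enn2real_leI)
  have "{0..1} \<inter> {u. ennreal u \<le> c} = {0..enn2real c}"
    using c(2) by (subst c(1)) (auto simp: ennreal_le_iff enn2real_nonneg intro: order_trans)
  then show ?thesis by (subst emeasure_uniform_measure) (auto simp: c(1)[symmetric] divide_ennreal_def)
qed

lemma AE_le_of_integral_le:
  fixes f g :: "'a \<Rightarrow> ennreal"
  assumes [measurable]: "f \<in> borel_measurable D" "g \<in> borel_measurable D"
    and le: "\<And>A. A \<in> sets D \<Longrightarrow> (\<integral>\<^sup>+x. f x * indicator A x \<partial>D) \<le> (\<integral>\<^sup>+x. g x * indicator A x \<partial>D)"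
    and fin: "(\<integral>\<^sup>+x. g x \<partial>D) \<noteq> \<infinity>"
  shows "AE x in D. f x \<le> g x"
proof -
  define A where "A = {x\<in>space D. g x < f x}"
  have [measurable]: "A \<in> sets D" unfolding A_def by measurable
  have finA: "(\<integral>\<^sup>+x. g x * indicator A x \<partial>D) < top"
  proof -
    have "(\<integral>\<^sup>+x. g x * indicator A x \<partial>D) \<le> (\<integral>\<^sup>+x. g x \<partial>D)"
      by (intro nn_integral_mono) (auto simp: indicator_def)
    also have "\<dots> < top" using fin unfolding infinity_ennreal_def less_top .
    finally show ?thesis .
  qed
  have "(\<integral>\<^sup>+x. f x * indicator A x - g x * indicator A x \<partial>D) =
      (\<integral>\<^sup>+x. f x * indicator A x \<partial>D) - (\<integral>\<^sup>+x. g x * indicator A x \<partial>D)"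
  proof (rule nn_integral_diff)
    show "(\<integral>\<^sup>+x. g x * indicator A x \<partial>D) \<noteq> \<infinity>" using finA unfolding infinity_ennreal_def less_top .
    show "AE x in D. g x * indicator A x \<le> f x * indicator A x"
      by (intro AE_I2) (auto simp: indicator_def A_def)
  qed measurable
  also have "\<dots> = 0" using le[of A] finA by (intro diff_eq_0_ennreal) (auto intro: le_less_trans)
  finally have "AE x in D. f x * indicator A x - g x * indicator A x = 0"
    by (subst (asm) nn_integral_0_iff_AE) auto
  with AE_space show ?thesis
  proof eventually_elim
    case (elim x)
    show "f x \<le> g x"
    proof (rule ccontr)
      assume n: "\<not> f x \<le> g x"
      with elim(1) have "x \<in> A" by (auto simp: A_def)
      with elim(2) have "f x - g x = 0" by simp
      with n show False by (auto simp: diff_eq_0_iff_ennreal)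
    qed
  qed
qed

lemma RN_density_exists:
  assumes Q: "prob_space Q" "sets Q = sets (borel \<Otimes>\<^sub>M S)"
    and B: "B \<in> sets (borel :: real measure)"
  obtains f where "f \<in> borel_measurable S"
    "\<And>A. A \<in> sets S \<Longrightarrow> (\<integral>\<^sup>+x. f x * indicator A x \<partial>distr Q S snd) = emeasure Q (B \<times> A)"
proof -
  interpret prob_space Q by fact
  note [measurable_cong] = Q(2)
  have sp: "space Q = UNIV \<times> space S" using sets_eq_imp_space_eq[OF Q(2)] by (simp add: space_pair_measure)
  let ?D = "distr Q S snd"
  interpret D: prob_space ?D by (rule prob_space_distr) measurable
  define N where "N = distr (density Q (\<lambda>z. indicator B (fst z))) S snd"
  have N: "emeasure N A = emeasure Q (B \<times> A)" if A: "A \<in> sets S" for A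
  proof -
    have [measurable]: "B \<in> sets borel" "A \<in> sets S" using A B by auto
    have "emeasure N A = emeasure (density Q (\<lambda>z. indicator B (fst z))) (snd -` A \<inter> space Q)"
      unfolding N_def by (subst emeasure_distr) auto
    also have "\<dots> = (\<integral>\<^sup>+z. indicator B (fst z) * indicator (snd -` A \<inter> space Q) z \<partial>Q)"
      by (subst emeasure_density) auto
    also have "\<dots> = (\<integral>\<^sup>+z. indicator (B \<times> A) z \<partial>Q)"
      using sets.sets_into_space[OF A] by (intro nn_integral_cong) (auto simp: indicator_def sp)
    also have "\<dots> = emeasure Q (B \<times> A)" by (rule nn_integral_indicator) measurable
    finally show ?thesis .
  qed
  have "absolutely_continuous ?D N"
    unfolding absolutely_continuous_def
  proof
    fix A assume "A \<in> null_sets ?D"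
    then have A: "A \<in> sets S" "emeasure ?D A = 0" by auto
    have "emeasure Q (B \<times> A) \<le> emeasure Q (snd -` A \<inter> space Q)"
      using A sets.sets_into_space[OF A(1)] by (intro emeasure_mono) (auto simp: sp)
    also have "\<dots> = 0" using A by (subst (asm) emeasure_distr) auto
    finally show "A \<in> null_sets N" using A N[OF A(1)] by (auto simp: null_sets_def N_def)
  qed
  moreover have "sets N = sets ?D" by (simp add: N_def)
  ultimately obtain f where f: "f \<in> borel_measurable ?D" "density ?D f = N"
    using D.Radon_Nikodym by blast
  show ?thesis
  proof (rule that[of f])
    show "f \<in> borel_measurable S" using f(1) by simp
    fix A assume A: "A \<in> sets S"
    have "emeasure N A = (\<integral>\<^sup>+x. f x * indicator A x \<partial>?D)"
      unfolding f(2)[symmetric] using f(1) A by (subst emeasure_density) auto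
    then show "(\<integral>\<^sup>+x. f x * indicator A x \<partial>?D) = emeasure Q (B \<times> A)" using N[OF A] by simp
  qed
qed

text \<open>
  Densities of \<open>A \<mapsto> Q({..<q} \<times> A)\<close> with respect to the second marginal, one for each rational \<open>q\<close>.
  They are monotone in \<open>q\<close> and at most one only almost everywhere; taking the supremum over smaller
  rationals and truncating makes this hold everywhere without changing a density on more than a
  null set.
\<close>
lemma conditional_cdf_exists:
  fixes Q :: "(real \<times> 'b) measure"
  assumes Q: "prob_space Q" "sets Q = sets (borel \<Otimes>\<^sub>M S)"
  obtains F :: "rat \<Rightarrow> 'b \<Rightarrow> ennreal" where "\<And>q. F q \<in> borel_measurable S" "\<And>q \<tau>. F q \<tau> \<le> 1"
    "\<And>q q' \<tau>. q \<le> q' \<Longrightarrow> F q \<tau> \<le> F q' \<tau>"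
    "\<And>q A. A \<in> sets S \<Longrightarrow> (\<integral>\<^sup>+x. F q x * indicator A x \<partial>distr Q S snd) = emeasure Q ({..<of_rat q} \<times> A)"
proof -
  interpret prob_space Q by fact
  note [measurable_cong] = Q(2)
  let ?D = "distr Q S snd"
  interpret D: prob_space ?D by (rule prob_space_distr) measurable
  have "\<exists>f. f \<in> borel_measurable S \<and> (\<forall>A\<in>sets S. (\<integral>\<^sup>+x. f x * indicator A x \<partial>?D) = emeasure Q ({..<of_rat q} \<times> A))"
    for q :: rat
    using RN_density_exists[OF Q, of "{..<of_rat q}"] by (metis lessThan_borel)
  then obtain f where f[measurable]: "\<And>q. f q \<in> borel_measurable S"
    and fi: "\<And>q A. A \<in> sets S \<Longrightarrow> (\<integral>\<^sup>+x. f q x * indicator A x \<partial>?D) = emeasure Q ({..<of_rat (q::rat)} \<times> A)"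
    by metis
  have fin: "(\<integral>\<^sup>+x. f q x \<partial>?D) \<noteq> \<infinity>" for q
  proof -
    have "(\<integral>\<^sup>+x. f q x \<partial>?D) = (\<integral>\<^sup>+x. f q x * indicator (space S) x \<partial>?D)"
      by (intro nn_integral_cong) (auto simp: indicator_def)
    also have "\<dots> = emeasure Q ({..<of_rat q} \<times> space S)" by (rule fi) simp
    finally show ?thesis by simp
  qed
  have mono: "AE x in ?D. f q x \<le> f q' x" if "q \<le> q'" for q q'
  proof (rule AE_le_of_integral_le)
    fix A assume "A \<in> sets ?D"
    then have A: "A \<in> sets S" by simp
    show "(\<integral>\<^sup>+x. f q x * indicator A x \<partial>?D) \<le> (\<integral>\<^sup>+x. f q' x * indicator A x \<partial>?D)"
      unfolding fi[OF A] using that A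
      by (intro emeasure_mono) (auto simp: of_rat_less_eq intro: less_le_trans)
  qed (use fin in auto)
  have le1: "AE x in ?D. f q x \<le> 1" for q
  proof (rule AE_le_of_integral_le)
    fix A assume "A \<in> sets ?D"
    then have A: "A \<in> sets S" by simp
    have "(\<integral>\<^sup>+x. f q x * indicator A x \<partial>?D) \<le> emeasure Q (snd -` A \<inter> space Q)"
      unfolding fi[OF A] using A sets.sets_into_space[OF A] sets_eq_imp_space_eq[OF Q(2)]
      by (intro emeasure_mono) (auto simp: space_pair_measure)
    also have "\<dots> = emeasure ?D A" using A by (subst emeasure_distr) auto
    finally show "(\<integral>\<^sup>+x. f q x * indicator A x \<partial>?D) \<le> (\<integral>\<^sup>+x. 1 * indicator A x \<partial>?D)"
      using A by simp
  qed (use fin D.emeasure_space_1 in auto)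
  define F where "F q x = min 1 (SUP q'\<in>{..q}. f q' x)" for q x
  have AE_eq: "AE x in ?D. F q x = f q x" for q
  proof -
    have "AE x in ?D. \<forall>q'\<in>{..q}. f q' x \<le> f q x"
      by (subst AE_ball_countable) (auto intro: mono)
    with le1[of q] show ?thesis
    proof eventually_elim
      case (elim x)
      have "(SUP q'\<in>{..q}. f q' x) = f q x"
        by (rule antisym) (use elim(2) in \<open>auto intro!: SUP_least SUP_upper\<close>)
      with elim(1) show ?case by (simp add: F_def min_def)
    qed
  qed
  show ?thesis
  proof (rule that[of F])
    show [measurable]: "F q \<in> borel_measurable S" for q unfolding F_def by measurable
    show "F q \<tau> \<le> 1" for q \<tau> by (simp add: F_def)
    show "F q \<tau> \<le> F q' \<tau>" if "q \<le> q'" for q q' \<tau>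
      unfolding F_def using that by (intro min.mono order_refl SUP_subset_mono) auto
    fix q A assume A: "A \<in> sets S"
    have "(\<integral>\<^sup>+x. F q x * indicator A x \<partial>?D) = (\<integral>\<^sup>+x. f q x * indicator A x \<partial>?D)"
      by (rule nn_integral_cong_AE) (use AE_eq[of q] in eventually_elim, simp)
    then show "(\<integral>\<^sup>+x. F q x * indicator A x \<partial>?D) = emeasure Q ({..<of_rat q} \<times> A)"
      using fi[OF A] by simp
  qed
qed

text \<open>
  The quantile transform of the conditional distribution function, applied to an independent uniform
  variable. The quantile \<open>H\<close> is first taken in the extended reals, where \<open>H < r\<close> holds exactly if the
  uniform variable is at most the conditional distribution function at some rational below \<open>r\<close>; this
  event has the right probability jointly with any event of the second coordinate.
\<close>
lemma noise_outsourcing_real: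
  fixes Q :: "(real \<times> 'b) measure"
  assumes Q: "prob_space Q" "sets Q = sets (borel \<Otimes>\<^sub>M S)"
  obtains G :: "'b \<times> real \<Rightarrow> real" where "G \<in> borel_measurable (S \<Otimes>\<^sub>M borel)"
    "distr (distr Q S snd \<Otimes>\<^sub>M uniform01) (borel \<Otimes>\<^sub>M S) (\<lambda>z. (G z, fst z)) = Q"
proof -
  interpret Q: prob_space Q by fact
  note [measurable_cong] = Q(2)
  let ?D = "distr Q S snd"
  interpret D: prob_space ?D by (rule Q.prob_space_distr) measurable
  interpret U: prob_space uniform01 by (rule prob_space_uniform01)
  interpret DU: pair_prob_space ?D uniform01 ..
  obtain F where [measurable]: "\<And>q. F q \<in> borel_measurable S" and F1: "\<And>q \<tau>. F q \<tau> \<le> 1"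
    and Fm: "\<And>q q' \<tau>. q \<le> q' \<Longrightarrow> F q \<tau> \<le> F q' \<tau>"
    and Fi: "\<And>q A. A \<in> sets S \<Longrightarrow> (\<integral>\<^sup>+x. F q x * indicator A x \<partial>?D) = emeasure Q ({..<of_rat q} \<times> A)"
    using conditional_cdf_exists[OF Q] by blast
  define H :: "'b \<times> real \<Rightarrow> ereal" where
    "H z = (INF q::rat. if ennreal (snd z) \<le> F q (fst z) then ereal (of_rat q) else \<infinity>)" for z
  define G where "G z = real_of_ereal (H z)" for z
  have Hm[measurable]: "H \<in> borel_measurable (S \<Otimes>\<^sub>M borel)" unfolding H_def by measurable
  have Gm[measurable]: "G \<in> borel_measurable (S \<Otimes>\<^sub>M borel)" unfolding G_def by measurable
  let ?P = "?D \<Otimes>\<^sub>M uniform01"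
  have spP: "space ?P = space S \<times> UNIV" by (simp add: space_pair_measure)
  have Hless: "H z < ereal r \<longleftrightarrow> (\<exists>q. of_rat q < r \<and> ennreal (snd z) \<le> F q (fst z))" for z r
    unfolding H_def INF_less_iff by (auto split: if_splits)
  have law: "emeasure ?P {z\<in>space ?P. H z < ereal r \<and> fst z \<in> A} = emeasure Q ({..<r} \<times> A)"
    if A: "A \<in> sets S" for r A
  proof -
    note [measurable] = A
    have As: "A \<subseteq> space S" using A by (rule sets.sets_into_space)
    obtain q :: "nat \<Rightarrow> rat" where q: "incseq q" "\<And>n. of_rat (q n) < r" "(\<lambda>n. of_rat (q n) :: real) \<longlonglongrightarrow> r"
    proof -
      have "\<exists>c::rat. r - 1 / real (Suc n) < of_rat c \<and> of_rat c < r" for n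
        by (rule of_rat_dense) simp
      then obtain c :: "nat \<Rightarrow> rat" where c: "\<And>n. r - 1 / real (Suc n) < of_rat (c n)" "\<And>n. of_rat (c n) < r"
        by metis
      define q where "q n = Max (c ` {..n})" for n
      have qc: "\<exists>m. q n = c m" for n
      proof -
        have "Max (c ` {..n}) \<in> c ` {..n}" by (rule Max_in) auto
        then show ?thesis unfolding q_def by blast
      qed
      show ?thesis
      proof (rule that[of q])
        show "incseq q" unfolding q_def by (intro monoI Max_mono) auto
        show less: "of_rat (q n) < r" for n using qc[of n] c(2) by auto
        show "(\<lambda>n. of_rat (q n) :: real) \<longlonglongrightarrow> r"
        proof (rule tendsto_sandwich[of "\<lambda>n. r - 1 / real (Suc n)" _ _ "\<lambda>_. r"])
          have "r - 1 / real (Suc n) \<le> of_rat (q n)" for n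
          proof -
            have "c n \<le> q n" unfolding q_def by (rule Max_ge) auto
            then have "(of_rat (c n) :: real) \<le> of_rat (q n)" by (simp add: of_rat_less_eq)
            with c(1)[of n] show ?thesis by linarith
          qed
          then show "eventually (\<lambda>n. r - 1 / real (Suc n) \<le> of_rat (q n)) sequentially" by simp
          show "eventually (\<lambda>n. of_rat (q n) \<le> r) sequentially" using less by (simp add: less_imp_le)
          have "(\<lambda>n. r - inverse (real (Suc n))) \<longlonglongrightarrow> r - 0" by (intro tendsto_intros LIMSEQ_inverse_real_of_nat)
          then show "(\<lambda>n. r - 1 / real (Suc n)) \<longlonglongrightarrow> r" by (simp add: inverse_eq_divide)
        qed simp
      qed
    qed
    let ?B = "\<lambda>n. {z\<in>space ?P. ennreal (snd z) \<le> F (q n) (fst z) \<and> fst z \<in> A}"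
    have cof: "\<exists>n. q' \<le> q n" if "of_rat q' < r" for q' :: rat
    proof -
      have "eventually (\<lambda>n. of_rat q' < (of_rat (q n) :: real)) sequentially"
        using q(3) that by (rule order_tendstoD)
      then obtain n where "of_rat q' < (of_rat (q n) :: real)" by (auto simp: eventually_sequentially)
      then show ?thesis by (auto simp: of_rat_less intro: less_imp_le)
    qed
    have "{z\<in>space ?P. H z < ereal r \<and> fst z \<in> A} = (\<Union>n. ?B n)"
      unfolding Hless using q(2) cof Fm by (auto, meson order_trans)
    also have "emeasure ?P (\<Union>n. ?B n) = (SUP n. emeasure ?P (?B n))"
    proof (rule SUP_emeasure_incseq[symmetric])
      show "incseq ?B" using q(1) Fm by (auto simp: incseq_def, meson order_trans)
      show "range ?B \<subseteq> sets ?P" by (intro image_subsetI) measurable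
    qed
    also have "\<dots> = (SUP n. emeasure Q ({..<of_rat (q n)} \<times> A))"
    proof (rule SUP_cong[OF refl])
      fix n
      have "emeasure ?P (?B n) = (\<integral>\<^sup>+\<tau>. emeasure uniform01 (Pair \<tau> -` ?B n) \<partial>?D)"
        by (rule U.emeasure_pair_measure_alt) measurable
      also have "\<dots> = (\<integral>\<^sup>+\<tau>. F (q n) \<tau> * indicator A \<tau> \<partial>?D)"
      proof (rule nn_integral_cong)
        fix \<tau> assume "\<tau> \<in> space ?D"
        then have "Pair \<tau> -` ?B n = (if \<tau> \<in> A then {u. ennreal u \<le> F (q n) \<tau>} else {})" by (auto simp: spP)
        then show "emeasure uniform01 (Pair \<tau> -` ?B n) = F (q n) \<tau> * indicator A \<tau>"
          using emeasure_uniform01_le[OF F1] by simp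
      qed
      finally show "emeasure ?P (?B n) = emeasure Q ({..<of_rat (q n)} \<times> A)" using Fi[OF A] by simp
    qed
    also have "\<dots> = emeasure Q (\<Union>n. {..<of_rat (q n)} \<times> A)"
    proof (rule SUP_emeasure_incseq)
      show "incseq (\<lambda>n. {..<of_rat (q n) :: real} \<times> A)"
        using q(1) by (fastforce simp: incseq_def of_rat_less_eq intro: less_le_trans)
    qed (auto simp: Q(2))
    also have "(\<Union>n. {..<of_rat (q n) :: real} \<times> A) = {..<r} \<times> A"
    proof -
      have "\<exists>n. x < of_rat (q n)" if "x < r" for x
        using order_tendstoD(1)[OF q(3) that] by (auto simp: eventually_sequentially)
      then show ?thesis using q(2) by (auto intro: less_trans)
    qed
    finally show ?thesis .
  qed
  have Qsp: "space Q = UNIV \<times> space S" using sets_eq_imp_space_eq[OF Q(2)] by (simp add: space_pair_measure)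
  have law': "emeasure ?P {z\<in>space ?P. H z < ereal r} = emeasure Q ({..<r} \<times> space S)" for r
  proof -
    have "{z\<in>space ?P. H z < ereal r} = {z\<in>space ?P. H z < ereal r \<and> fst z \<in> space S}" by (auto simp: spP)
    then show ?thesis using law[of "space S" r] by simp
  qed
  have H_less: "AE z in ?P. H z < \<infinity>"
  proof -
    have "emeasure ?P {z\<in>space ?P. H z < \<infinity>} = emeasure ?P (\<Union>n::nat. {z\<in>space ?P. H z < ereal (real n)})"
      by (rule arg_cong[where f = "emeasure ?P"]) (auto simp: less_PInf_Ex_of_nat)
    also have "\<dots> = (SUP n::nat. emeasure ?P {z\<in>space ?P. H z < ereal (real n)})"
    proof (rule SUP_emeasure_incseq[symmetric])
      show "incseq (\<lambda>n::nat. {z\<in>space ?P. H z < ereal (real n)})"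
        by (auto simp: incseq_def intro: less_le_trans)
      show "range (\<lambda>n::nat. {z\<in>space ?P. H z < ereal (real n)}) \<subseteq> sets ?P" by (intro image_subsetI) measurable
    qed
    also have "\<dots> = emeasure Q (\<Union>n::nat. {..<real n} \<times> space S)"
      unfolding law'
    proof (rule SUP_emeasure_incseq)
      show "incseq (\<lambda>n::nat. {..<real n} \<times> space S)"
        by (auto simp: incseq_def intro: less_le_trans)
    qed (auto simp: Q(2))
    also have "(\<Union>n::nat. {..<real n} \<times> space S) = space Q" by (auto simp: Qsp reals_Archimedean2)
    also have "emeasure Q (space Q) = 1" by (rule Q.emeasure_space_1)
    finally have "DU.prob {z\<in>space ?P. H z < \<infinity>} = 1" by (simp add: measure_def)
    moreover have "{z\<in>space ?P. H z < \<infinity>} \<in> sets ?P" by measurable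
    ultimately show ?thesis by (simp only: DU.prob_Collect_eq_1)
  qed
  have H_gt: "AE z in ?P. H z \<noteq> - \<infinity>"
  proof -
    have "emeasure ?P {z\<in>space ?P. H z = - \<infinity>} \<le> emeasure Q ({..<- real n} \<times> space S)" for n
      unfolding law'[symmetric]
    proof (rule emeasure_mono)
      show "{z\<in>space ?P. H z < ereal (- real n)} \<in> sets ?P" by measurable
    qed auto
    moreover have "(\<lambda>n. emeasure Q ({..<- real n} \<times> space S)) \<longlonglongrightarrow> emeasure Q (\<Inter>n. {..<- real n} \<times> space S)"
      by (rule Lim_emeasure_decseq) (auto simp: Q(2) decseq_def intro: less_le_trans)
    moreover have "(\<Inter>n. {..<- real n} \<times> space S) = {}"
    proof -
      have "\<exists>n. \<not> x < - real n" for x :: real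
        using real_arch_simple[of "- x"] by (auto simp: not_less) (metis minus_le_iff)
      then show ?thesis by auto
    qed
    ultimately have "emeasure ?P {z\<in>space ?P. H z = - \<infinity>} \<le> 0"
      by (intro LIMSEQ_le_const) auto
    then have "emeasure ?P {z\<in>space ?P. H z = - \<infinity>} = 0" by simp
    moreover have "{z\<in>space ?P. H z = - \<infinity>} \<in> sets ?P" by measurable
    ultimately show ?thesis using AE_iff_measurable[of "{z\<in>space ?P. H z = - \<infinity>}" ?P "\<lambda>z. H z \<noteq> - \<infinity>"] by simp
  qed
  have HG: "AE z in ?P. H z = ereal (G z)"
    using H_less H_gt by eventually_elim (auto simp: G_def ereal_real)
  let ?T = "\<lambda>z. (G z, fst z)"
  have Tm[measurable]: "?T \<in> measurable ?P (borel \<Otimes>\<^sub>M S)" by measurable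
  define E where "E = {{..<r} \<times> A | (r::real) A. A \<in> sets S}"
  define \<Omega> where "\<Omega> = (UNIV::real set) \<times> space S"
  have E_Pow: "E \<subseteq> Pow \<Omega>" using sets.sets_into_space by (fastforce simp: E_def \<Omega>_def)
  have stable: "Int_stable E"
  proof (rule Int_stableI)
    fix a b assume "a \<in> E" "b \<in> E"
    then obtain r A r' B where "a = {..<r} \<times> A" "b = {..<r'} \<times> B" "A \<in> sets S" "B \<in> sets S"
      by (auto simp: E_def)
    then have "a \<inter> b = {..<min r r'} \<times> (A \<inter> B)" "A \<inter> B \<in> sets S" by auto
    then show "a \<inter> b \<in> E" unfolding E_def by blast
  qed
  have sets_eq: "sets (borel \<Otimes>\<^sub>M S) = sigma_sets \<Omega> E"
  proof
    let ?\<Sigma> = "sigma \<Omega> E"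
    have sp: "space ?\<Sigma> = \<Omega>" using E_Pow by (rule space_measure_of)
    have se: "sets ?\<Sigma> = sigma_sets \<Omega> E" using E_Pow by (rule sets_measure_of)
    have 1: "fst \<in> measurable ?\<Sigma> borel"
    proof (rule borel_measurable_iff_less[THEN iffD2], rule allI)
      fix r
      have "{w \<in> space ?\<Sigma>. fst w < r} = {..<r} \<times> space S" unfolding sp by (auto simp: \<Omega>_def)
      then show "{w \<in> space ?\<Sigma>. fst w < r} \<in> sets ?\<Sigma>"
        unfolding se by (auto simp: E_def intro!: sigma_sets.Basic)
    qed
    have 2: "snd \<in> measurable ?\<Sigma> S"
    proof (rule measurableI)
      fix A assume A: "A \<in> sets S"
      have "snd -` A \<inter> space ?\<Sigma> = (\<Union>n::nat. {..<real n} \<times> A)"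
        unfolding sp using sets.sets_into_space[OF A] by (auto simp: \<Omega>_def reals_Archimedean2)
      moreover have "{..<real n} \<times> A \<in> sets ?\<Sigma>" for n
        unfolding se using A by (intro sigma_sets.Basic) (auto simp: E_def)
      ultimately show "snd -` A \<inter> space ?\<Sigma> \<in> sets ?\<Sigma>" by (simp add: sets.countable_nat_UN image_subset_iff)
    next
      fix x assume "x \<in> space ?\<Sigma>"
      then show "snd x \<in> space S" unfolding sp by (auto simp: \<Omega>_def)
    qed
    have id: "(\<lambda>z. (fst z, snd z)) \<in> measurable ?\<Sigma> (borel \<Otimes>\<^sub>M S)" by (rule measurable_Pair[OF 1 2])
    show "sets (borel \<Otimes>\<^sub>M S) \<subseteq> sigma_sets \<Omega> E"
    proof
      fix X :: "(real \<times> 'b) set" assume X: "X \<in> sets (borel \<Otimes>\<^sub>M S)"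
      have "(\<lambda>z::real \<times> 'b. (fst z, snd z)) -` X \<inter> space ?\<Sigma> = X"
        using sets.sets_into_space[OF X] unfolding sp by (auto simp: \<Omega>_def space_pair_measure)
      then show "X \<in> sigma_sets \<Omega> E" using measurable_sets[OF id X] unfolding se by simp
    qed
    have "E \<subseteq> sets (borel \<Otimes>\<^sub>M S)" by (auto simp: E_def)
    then have "sigma_sets (space (borel \<Otimes>\<^sub>M S)) E \<subseteq> sets (borel \<Otimes>\<^sub>M S)" by (rule sets.sigma_sets_subset)
    then show "sigma_sets \<Omega> E \<subseteq> sets (borel \<Otimes>\<^sub>M S)" by (simp add: \<Omega>_def space_pair_measure)
  qed
  have "distr ?P (borel \<Otimes>\<^sub>M S) ?T = Q"
  proof (rule measure_eqI_generator_eq[OF stable E_Pow, of _ _ "\<lambda>n. {..<real n} \<times> space S"])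
    fix X assume "X \<in> E"
    then obtain r A where X: "X = {..<r} \<times> A" and A: "A \<in> sets S" by (auto simp: E_def)
    note [measurable] = A
    have "emeasure (distr ?P (borel \<Otimes>\<^sub>M S) ?T) X = emeasure ?P (?T -` X \<inter> space ?P)"
      unfolding X by (rule emeasure_distr) measurable
    also have "\<dots> = emeasure ?P {z\<in>space ?P. H z < ereal r \<and> fst z \<in> A}"
    proof (rule emeasure_eq_AE)
      show "AE z in ?P. z \<in> ?T -` X \<inter> space ?P \<longleftrightarrow> z \<in> {z\<in>space ?P. H z < ereal r \<and> fst z \<in> A}"
        using HG by eventually_elim (auto simp: X)
      show "?T -` X \<inter> space ?P \<in> sets ?P" unfolding X by measurable
    qed measurable
    also have "\<dots> = emeasure Q X" unfolding X by (rule law[OF A])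
    finally show "emeasure (distr ?P (borel \<Otimes>\<^sub>M S) ?T) X = emeasure Q X" .
  next
    show "range (\<lambda>n::nat. {..<real n} \<times> space S) \<subseteq> E" by (auto simp: E_def)
    show "(\<Union>n::nat. {..<real n} \<times> space S) = \<Omega>" by (auto simp: \<Omega>_def reals_Archimedean2)
    show "emeasure (distr ?P (borel \<Otimes>\<^sub>M S) ?T) ({..<real n} \<times> space S) \<noteq> \<infinity>" for n
      using finite_measure.emeasure_finite[OF prob_space.finite_measure[OF DU.prob_space_distr[OF Tm]]] by simp
  qed (use sets_eq Q(2) in auto)
  with Gm show ?thesis by (rule that)
qed

subsection \<open>A measurable encoding of vectors by reals\<close>

text \<open>
  A vector is determined by the countably many bits that tell whether component \<open>i\<close> is below the
  rational \<open>q\<close>. Writing the bits as ternary digits \<open>0\<close> and \<open>2\<close> leaves a gap between the two values of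
  each digit, so that all digits can be read off again by a measurable recursion.
\<close>
lemma real_encoding_exists:
  obtains \<phi> :: "real^'n \<Rightarrow> real" and \<psi> :: "real \<Rightarrow> real^'n"
  where "\<phi> \<in> borel_measurable borel" "\<psi> \<in> borel_measurable borel" "\<And>x. \<psi> (\<phi> x) = x"
proof -
  define b :: "real^'n \<Rightarrow> nat \<Rightarrow> real" where
    "b x k = (if x $ fst (from_nat k :: 'n \<times> rat) < of_rat (snd (from_nat k :: 'n \<times> rat)) then 1 else 0)" for x k
  \<comment> \<open>the ternary number with digits \<open>2 b\<^sub>k, 2 b\<^sub>k\<^sub>+\<^sub>1, \<dots>\<close>; reading a digit off removes it\<close>
  define S where "S x k = (\<Sum>j. 2 * b x (j + k) * (1/3) ^ Suc j)" for x k
  have b01: "b x k = 0 \<or> b x k = 1" for x k by (simp add: b_def)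
  have summ: "summable (\<lambda>j. 2 * b x (j + k) * (1/3) ^ Suc j)" for x k
  proof (rule summable_comparison_test'[of "\<lambda>j. 2 * (1/3) ^ Suc j" 0])
    show "summable (\<lambda>j. 2 * (1/3::real) ^ Suc j)" by (intro summable_mult summable_Suc_iff[THEN iffD2] summable_geometric) simp
    show "norm (2 * b x (n + k) * (1/3) ^ Suc n) \<le> 2 * (1/3) ^ Suc n" for n
      using b01[of x "n + k"] by auto
  qed
  have S0: "0 \<le> S x k" for x k
    unfolding S_def using b01 by (intro suminf_nonneg summ) (metis mult_nonneg_nonneg order_refl zero_le_numeral zero_le_one zero_le_power zero_le_divide_1_iff)
  have S1: "S x k \<le> 1" for x k
  proof -
    have "S x k \<le> (\<Sum>j. 2 * (1/3) ^ Suc j)"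
      unfolding S_def
    proof (rule suminf_le[OF _ summ])
      show "2 * b x (n + k) * (1/3) ^ Suc n \<le> 2 * (1/3) ^ Suc n" for n
        using b01[of x "n + k"] by auto
      show "summable (\<lambda>j. 2 * (1/3::real) ^ Suc j)" by (intro summable_mult summable_Suc_iff[THEN iffD2] summable_geometric) simp
    qed
    also have "(\<Sum>j. 2 * (1/3::real) ^ Suc j) = (2/3) * (\<Sum>j. (1/3) ^ j)"
      by (subst suminf_mult[symmetric]) (auto intro: summable_geometric)
    also have "\<dots> = 1" by (subst suminf_geometric) auto
    finally show ?thesis .
  qed
  have Srec: "S x k = 2 * b x k / 3 + S x (Suc k) / 3" for x k
  proof -
    have "S x k = (\<Sum>j. 2 * b x (Suc j + k) * (1/3) ^ Suc (Suc j)) + 2 * b x (0 + k) * (1/3) ^ Suc 0"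
      unfolding S_def using suminf_split_head[OF summ[of x k]] by simp
    also have "(\<Sum>j. 2 * b x (Suc j + k) * (1/3) ^ Suc (Suc j)) = (\<Sum>j. (1/3) * (2 * b x (j + Suc k) * (1/3) ^ Suc j))"
      by (intro suminf_cong) simp
    also have "\<dots> = (1/3) * S x (Suc k)" unfolding S_def by (rule suminf_mult[OF summ])
    finally show ?thesis by simp
  qed
  define d where "d z = (if (2/3::real) \<le> z then 1 else 0 :: real)" for z
  define step where "step z = 3 * z - 2 * d z" for z
  have dS: "d (S x k) = b x k" for x k
    using Srec[of x k] b01[of x k] S0[of x "Suc k"] S1[of x "Suc k"] by (auto simp: d_def)
  have stepS: "(step ^^ k) (S x 0) = S x k" for x k
  proof (induction k)
    case (Suc k)
    have "(step ^^ Suc k) (S x 0) = step (S x k)" using Suc by simp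
    also have "\<dots> = 3 * S x k - 2 * b x k" by (simp add: step_def dS)
    finally have "(step ^^ Suc k) (S x 0) = 3 * S x k - 2 * b x k" .
    then show ?case using Srec[of x k] by linarith
  qed simp
  have [measurable]: "d \<in> borel_measurable borel" unfolding d_def by measurable
  have [measurable]: "step \<in> borel_measurable borel" unfolding step_def by measurable
  have stepm[measurable]: "(\<lambda>z. (step ^^ k) z) \<in> borel_measurable borel" for k
  proof (induction k)
    case (Suc k)
    note [measurable] = Suc
    show ?case by simp
  qed simp
  define \<psi> :: "real \<Rightarrow> real^'n" where
    "\<psi> z = (\<chi> i. real_of_ereal (INF q::rat. if d ((step ^^ to_nat (i, q)) z) = 1 then ereal (of_rat q) else \<infinity>))" for z
  show ?thesis
  proof (rule that[of "\<lambda>x. S x 0" \<psi>])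
    have nth: "(\<lambda>x::real^'n. x $ i) \<in> borel_measurable borel" for i
      by (intro borel_measurable_continuous_onI continuous_intros)
    have [measurable]: "(\<lambda>x. b x k) \<in> borel_measurable borel" for k
      unfolding b_def using nth by measurable
    show "(\<lambda>x. S x 0) \<in> borel_measurable borel" unfolding S_def by measurable
    have B: "(Basis :: (real^'n) set) = range (\<lambda>i. axis i 1)" by (auto simp: Basis_vec_def)
    have "(\<lambda>z. \<psi> z $ i) \<in> borel_measurable borel" for i
      unfolding \<psi>_def vec_lambda_beta by measurable
    then show "\<psi> \<in> borel_measurable borel"
      by (subst borel_measurable_euclidean_space) (simp add: B inner_axis)
    fix x :: "real^'n"
    have "(INF q::rat. if x $ i < of_rat q then ereal (of_rat q) else \<infinity>) = ereal (x $ i)" for i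
    proof (rule antisym)
      show "(INF q::rat. if x $ i < of_rat q then ereal (of_rat q) else \<infinity>) \<le> ereal (x $ i)"
      proof (rule ereal_le_epsilon2)
        fix e :: real assume "0 < e"
        then obtain q :: rat where q: "x $ i < of_rat q" "of_rat q < x $ i + e"
          using of_rat_dense[of "x $ i" "x $ i + e"] by auto
        have "(INF q::rat. if x $ i < of_rat q then ereal (of_rat q) else \<infinity>) \<le> ereal (of_rat q)"
          using q by (intro INF_lower2[of q]) auto
        also have "\<dots> \<le> ereal (x $ i) + ereal e" using q by simp
        finally show "(INF q::rat. if x $ i < of_rat q then ereal (of_rat q) else \<infinity>) \<le> ereal (x $ i) + ereal e" .
      qed
      show "ereal (x $ i) \<le> (INF q::rat. if x $ i < of_rat q then ereal (of_rat q) else \<infinity>)"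
        by (intro INF_greatest) (auto simp: less_imp_le)
    qed
    moreover have "d ((step ^^ to_nat (i, q)) (S x 0)) = 1 \<longleftrightarrow> x $ i < of_rat q" for i and q :: rat
      unfolding stepS dS by (simp add: b_def)
    ultimately show "\<psi> (S x 0) = x" by (simp add: \<psi>_def vec_eq_iff)
  qed
qed

text \<open>
  A random vector jointly distributed with something else can be reproduced from the latter and an
  independent uniform variable. The vector case reduces to the real one by encoding.
\<close>
theorem noise_outsourcing:
  fixes Q :: "((real^'n) \<times> 'b) measure"
  assumes Q: "prob_space Q" "sets Q = sets (borel \<Otimes>\<^sub>M S)"
  obtains G :: "'b \<times> real \<Rightarrow> real^'n" where "G \<in> borel_measurable (S \<Otimes>\<^sub>M borel)"
    "distr (distr Q S snd \<Otimes>\<^sub>M uniform01) (borel \<Otimes>\<^sub>M S) (\<lambda>z. (G z, fst z)) = Q"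
proof -
  interpret Q: prob_space Q by fact
  note [measurable_cong] = Q(2)
  obtain \<phi> :: "real^'n \<Rightarrow> real" and \<psi> :: "real \<Rightarrow> real^'n"
    where [measurable]: "\<phi> \<in> borel_measurable borel" "\<psi> \<in> borel_measurable borel"
      and inv: "\<And>x. \<psi> (\<phi> x) = x" by (rule real_encoding_exists) blast
  let ?Q' = "distr Q (borel \<Otimes>\<^sub>M S) (\<lambda>z. (\<phi> (fst z), snd z))"
  have 1: "prob_space ?Q'" by (rule Q.prob_space_distr) measurable
  obtain G where G[measurable]: "G \<in> borel_measurable (S \<Otimes>\<^sub>M borel)"
    "distr (distr ?Q' S snd \<Otimes>\<^sub>M uniform01) (borel \<Otimes>\<^sub>M S) (\<lambda>z. (G z, fst z)) = ?Q'"
    by (rule noise_outsourcing_real[OF 1 sets_distr])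
  have snd: "distr ?Q' S snd = distr Q S snd" by (subst distr_distr) (auto simp: comp_def)
  have "distr (distr Q S snd \<Otimes>\<^sub>M uniform01) (borel \<Otimes>\<^sub>M S) (\<lambda>z. (\<psi> (G z), fst z)) =
      distr (distr (distr Q S snd \<Otimes>\<^sub>M uniform01) (borel \<Otimes>\<^sub>M S) (\<lambda>z. (G z, fst z))) (borel \<Otimes>\<^sub>M S) (\<lambda>z. (\<psi> (fst z), snd z))"
    by (subst distr_distr) (auto simp: comp_def)
  also have "\<dots> = distr ?Q' (borel \<Otimes>\<^sub>M S) (\<lambda>z. (\<psi> (fst z), snd z))" using G(2) unfolding snd by simp
  also have "\<dots> = distr Q (borel \<Otimes>\<^sub>M S) (\<lambda>z. z)" by (subst distr_distr) (auto simp: comp_def inv)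
  also have "\<dots> = Q" using Q(2) by (intro distr_id2) simp
  finally show ?thesis by (intro that[of "\<lambda>z. \<psi> (G z)"]) auto
qed

section \<open>The driving path seen from a time onwards\<close>

text \<open>
  The Kolmogorov extension below has pairs of a state and a background value as coordinates, and requires
  them to form a polish space.
\<close>
instance prod :: (polish_space, polish_space) polish_space ..

definition drive_space :: "((real \<Rightarrow> real^'n) \<times> (real \<Rightarrow> 'j::topological_space)) measure" where
  "drive_space = path_space {0..} \<Otimes>\<^sub>M path_space {0..}"

text \<open>
  Everything that happens from time \<open>s\<close> on: the increments of \<open>X\<close> and the values of \<open>J\<close>.
\<close>
definition drive :: "real \<Rightarrow> (real \<Rightarrow> 'a \<Rightarrow> real^'n) \<Rightarrow> (real \<Rightarrow> 'a \<Rightarrow> 'j) \<Rightarrow> 'a \<Rightarrow> (real \<Rightarrow> real^'n) \<times> (real \<Rightarrow> 'j)" where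
  "drive s X J \<omega> = (traj {0..} (incr s X) \<omega>, traj {0..} (\<lambda>t. J (s + t)) \<omega>)"

text \<open>
  The shift of driving paths, which re-centres the first component at its new origin.
\<close>
definition advance :: "real \<Rightarrow> (real \<Rightarrow> real^'n) \<times> (real \<Rightarrow> 'j) \<Rightarrow> (real \<Rightarrow> real^'n) \<times> (real \<Rightarrow> 'j)" where
  "advance s \<tau> = (\<lambda>t\<in>{0..}. fst \<tau> (s + t) - fst \<tau> s, \<lambda>t\<in>{0..}. snd \<tau> (s + t))"

lemma advance_drive: "0 \<le> s \<Longrightarrow> advance s (drive r X J \<omega>) = drive (r + s) X J \<omega>"
  by (auto simp: advance_def drive_def traj_def incr_def fun_eq_iff restrict_def add.assoc)

lemma advance_advance: "0 \<le> s \<Longrightarrow> 0 \<le> r \<Longrightarrow> advance s (advance r \<tau>) = advance (r + s) \<tau>"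
  by (auto simp: advance_def fun_eq_iff restrict_def add.assoc)

lemma measurable_advance [measurable]:
  assumes s: "0 \<le> s"
  shows "advance s \<in> measurable drive_space (drive_space :: ((real \<Rightarrow> real^'n) \<times> (real \<Rightarrow> 'j::topological_space)) measure)"
proof -
  have f: "(\<lambda>\<tau>. fst \<tau> u) \<in> borel_measurable (drive_space :: ((real \<Rightarrow> real^'n) \<times> (real \<Rightarrow> 'j)) measure)" if "0 \<le> u" for u
    unfolding drive_space_def using that
    by (intro measurable_path_eval[of _ _ "{0..}"] measurable_fst) auto
  have g: "(\<lambda>\<tau>. snd \<tau> u) \<in> borel_measurable (drive_space :: ((real \<Rightarrow> real^'n) \<times> (real \<Rightarrow> 'j)) measure)" if "0 \<le> u" for u
    unfolding drive_space_def using that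
    by (intro measurable_path_eval[of _ _ "{0..}"] measurable_snd) auto
  show ?thesis
    unfolding advance_def drive_space_def
    by (rule measurable_Pair; rule measurable_path_spaceI)
       (use s in \<open>auto intro!: borel_measurable_diff f g simp flip: drive_space_def\<close>)
qed

text \<open>
  What the probabilistic part needs to know about the driving law \<open>D\<close>. Unboundedness of the
  regulator is expressed along integer times, through \<open>- R\<^sup>-\<^sup>1\<close> of the path, and tightness through the
  process started empty, observed at integer times.
\<close>
locale stationary_driver = skorohod_matrix P p \<alpha>
  for P :: "real^'n^'n" and p :: "real^'n" and \<alpha> :: real +
  fixes D :: "((real \<Rightarrow> real^'n) \<times> (real \<Rightarrow> 'j::polish_space)) measure"
    and M :: "'a measure" and X :: "real \<Rightarrow> 'a \<Rightarrow> real^'n" and J :: "real \<Rightarrow> 'a \<Rightarrow> 'j"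
  assumes M_cadlag: "cadlag_process M X"
    and M_meas: "drive 0 X J \<in> measurable M drive_space"
    and D_eq: "D = distr M drive_space (drive 0 X J)"
    and D_shift: "\<And>s. 0 \<le> s \<Longrightarrow> distr D drive_space (advance s) = D"
    and D_unbounded: "AE \<tau> in D. \<forall>i. \<forall>c::nat. \<exists>k::nat. Ri (fst \<tau> (real k)) $ i \<le> - real c"
    and D_tight: "\<And>\<delta>. 0 < \<delta> \<Longrightarrow> \<exists>b. \<forall>k::nat. measure D {\<tau>\<in>space D. \<exists>i. b < Wf (real k) 0 (fst \<tau>) $ i} \<le> \<delta>"
begin

sublocale M: prob_space M using M_cadlag by (simp add: cadlag_process_def)

lemma sets_D [simp, measurable_cong]: "sets D = sets drive_space" by (simp add: D_eq)
lemma space_D [simp]: "space D = space drive_space" by (simp add: D_eq)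

sublocale D: prob_space D unfolding D_eq by (rule M.prob_space_distr[OF M_meas])

text \<open>
  Copies of the driving pair on other probability spaces; the reflected process started empty
  has the same law for all of them.
\<close>
definition carries :: "'z measure \<Rightarrow> (real \<Rightarrow> 'z \<Rightarrow> real^'n) \<Rightarrow> (real \<Rightarrow> 'z \<Rightarrow> 'j) \<Rightarrow> bool" where
  "carries N Y K \<longleftrightarrow> cadlag_process N Y \<and> drive 0 Y K \<in> measurable N drive_space \<and>
     distr N drive_space (drive 0 Y K) = D"

lemma carries_M: "carries M X J"
  unfolding carries_def by (intro conjI M_cadlag M_meas D_eq[symmetric])

lemma carries_drive:
  assumes c: "carries N Y K" and s: "0 \<le> s"
  shows measurable_drive: "drive s Y K \<in> measurable N drive_space"
    and distr_drive: "distr N drive_space (drive s Y K) = D"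
proof -
  have e: "drive s Y K = advance s \<circ> drive 0 Y K" using advance_drive[OF s, of 0 Y K] by (auto simp: fun_eq_iff)
  have m: "drive 0 Y K \<in> measurable N drive_space" using c by (simp add: carries_def)
  show "drive s Y K \<in> measurable N drive_space"
    unfolding e by (rule measurable_comp[OF m measurable_advance[OF s]])
  have "distr N drive_space (drive s Y K) = distr (distr N drive_space (drive 0 Y K)) drive_space (advance s)"
    unfolding e by (rule distr_distr[symmetric, OF measurable_advance[OF s] m])
  also have "\<dots> = D" using c D_shift[OF s] by (simp add: carries_def)
  finally show "distr N drive_space (drive s Y K) = D" .
qed

lemma carries_cadlag:
  assumes c: "carries N Y K" and \<omega>: "\<omega> \<in> space N" and s: "0 \<le> s"
  shows "cadlag (\<lambda>u. incr s Y u \<omega>)"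
proof -
  have "cadlag (\<lambda>u. Y u \<omega>)" using c \<omega> by (auto simp: carries_def cadlag_process_def)
  from cadlag_shift[OF this s, of 0 "Y s \<omega>"] show ?thesis by (simp add: incr_def)
qed

lemma Wf_drive:
  assumes "carries N Y K" "\<omega> \<in> space N" "0 \<le> s" "0 \<le> t"
  shows "Wf t w (fst (drive s Y K \<omega>)) = Wlim {0..} (\<lambda>u. w + incr s Y u \<omega>) t"
  using refl_W_eq[where X = "incr s Y" and \<omega> = \<omega> and \<xi> = "\<lambda>_. w", OF carries_cadlag[OF assms(1-3)] assms(4)]
    refl_W_Wlim[where X = "incr s Y" and \<omega> = \<omega> and \<xi> = "\<lambda>_. w", OF carries_cadlag[OF assms(1-3)] assms(4)]
  by (simp add: drive_def)

lemma Lf_drive: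
  assumes "carries N Y K" "\<omega> \<in> space N" "0 \<le> s" "0 \<le> t"
  shows "Lf t w (fst (drive s Y K \<omega>)) = Llim {0..} (\<lambda>u. w + incr s Y u \<omega>) t"
  using refl_L_eq[where X = "incr s Y" and \<omega> = \<omega> and \<xi> = "\<lambda>_. w", OF carries_cadlag[OF assms(1-3)] assms(4)]
    refl_L_Llim[where X = "incr s Y" and \<omega> = \<omega> and \<xi> = "\<lambda>_. w", OF carries_cadlag[OF assms(1-3)] assms(4)]
  by (simp add: drive_def)

lemma drive_flow:
  assumes c: "carries N Y K" "\<omega> \<in> space N" and r: "0 \<le> r" and s: "0 \<le> s" and t: "0 \<le> t"
  shows Wf_flow: "Wf (s + t) w (fst (drive r Y K \<omega>)) = Wf t (Wf s w (fst (drive r Y K \<omega>))) (fst (drive (r + s) Y K \<omega>))"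
    and Lf_flow: "Lf (s + t) w (fst (drive r Y K \<omega>)) - Lf s w (fst (drive r Y K \<omega>)) =
      Lf t (Wf s w (fst (drive r Y K \<omega>))) (fst (drive (r + s) Y K \<omega>))"
proof -
  let ?y = "\<lambda>u. w + incr r Y u \<omega>"
  have lb: "lower_bounded {0..} ?y"
    by (rule lower_bounded_add[OF cadlag_lower_bounded[OF carries_cadlag[OF c r]]])
  have i: "?y (s + u) - ?y s = incr (r + s) Y u \<omega>" for u by (simp add: incr_def add.assoc)
  have rs: "0 \<le> r + s" "0 \<le> s + t" using r s t by auto
  show "Wf (s + t) w (fst (drive r Y K \<omega>)) = Wf t (Wf s w (fst (drive r Y K \<omega>))) (fst (drive (r + s) Y K \<omega>))"
    unfolding Wf_drive[OF c r rs(2)] Wf_drive[OF c r s] Wf_drive[OF c rs(1) t]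
    using Wlim_flow[OF lb s t] unfolding i by simp
  show "Lf (s + t) w (fst (drive r Y K \<omega>)) - Lf s w (fst (drive r Y K \<omega>)) =
      Lf t (Wf s w (fst (drive r Y K \<omega>))) (fst (drive (r + s) Y K \<omega>))"
    unfolding Lf_drive[OF c r rs(2)] Lf_drive[OF c r s] Wf_drive[OF c r s] Lf_drive[OF c rs(1) t]
    using Llim_flow[OF lb s t] unfolding i by simp
qed

lemma Wf_nonneg:
  assumes c: "carries N Y K" "\<omega> \<in> space N" and r: "0 \<le> r" and s: "0 \<le> s"
  shows "0 \<le> Wf s w (fst (drive r Y K \<omega>))"
  unfolding Wf_drive[OF c r s]
  by (rule Wlim_nonneg[OF lower_bounded_add[OF cadlag_lower_bounded[OF carries_cadlag[OF c r]]]]) (use s in simp)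

text \<open>
  The process started empty at the earlier time has a nonnegative state when the other one starts,
  and order is preserved from there.
\<close>
lemma Wf_longer:
  assumes c: "carries N Y K" "\<omega> \<in> space N" and r: "0 \<le> r" and s: "0 \<le> s" and t: "0 \<le> t"
  shows "Wf t 0 (fst (drive (r + s) Y K \<omega>)) \<le> Wf (s + t) 0 (fst (drive r Y K \<omega>))"
proof -
  have rs: "0 \<le> r + s" using r s by simp
  show ?thesis
    unfolding Wf_flow[OF c r s t] unfolding Wf_drive[OF c rs t]
    by (rule Wlim_mono_start[OF cadlag_lower_bounded[OF carries_cadlag[OF c rs]] Wf_nonneg[OF c r s]])
      (use t in simp)
qed

section \<open>Starting the reflected process ever further in the past\<close>

text \<open>
  Coordinate \<open>r \<ge> 0\<close> carries the driving path, coordinate \<open>r < 0\<close> the value at time \<open>0\<close> of the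
  process started empty at time \<open>r\<close>. The origin of time is placed at \<open>K\<close>, so a path from time \<open>0\<close> on
  determines all coordinates \<open>r \<ge> - K\<close>. For negative \<open>r\<close> the second entry is a dummy, which lets both
  kinds of coordinates share one type.
\<close>
definition history :: "real \<Rightarrow> real \<Rightarrow> (real \<Rightarrow> real^'n) \<times> (real \<Rightarrow> 'j) \<Rightarrow> (real^'n) \<times> 'j" where
  "history K r \<tau> = (if 0 \<le> r then (fst \<tau> (K + r) - fst \<tau> K, snd \<tau> (K + r))
     else (Wf (- r) 0 (fst (advance (K + r) \<tau>)), undefined))"

lemma history_shift:
  assumes "0 \<le> K" "0 \<le> h" "- K \<le> r"
  shows "history (K + h) r \<tau> = history K r (advance h \<tau>)"
proof (cases "0 \<le> r")
  case True
  then show ?thesis using assms by (simp add: history_def advance_def add_ac)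
next
  case False
  then have "advance (K + r) (advance h \<tau>) = advance (K + h + r) \<tau>"
    using assms by (subst advance_advance) (auto simp: add_ac)
  then show ?thesis using False by (simp add: history_def)
qed

lemma history_drive:
  assumes "0 \<le> K" "- K \<le> r"
  shows "history K r (drive 0 Y J' \<omega>) = (if 0 \<le> r then (incr K Y r \<omega>, J' (K + r) \<omega>)
     else (Wf (- r) 0 (fst (drive (K + r) Y J' \<omega>)), undefined))"
  using assms by (auto simp: history_def advance_drive) (auto simp: drive_def traj_def incr_def)

lemma measurable_drive_space_eval:
  assumes "0 \<le> t"
  shows "(\<lambda>\<tau>. fst \<tau> t) \<in> borel_measurable (drive_space :: ((real \<Rightarrow> real^'n) \<times> (real \<Rightarrow> 'j)) measure)"
    "(\<lambda>\<tau>. snd \<tau> t) \<in> borel_measurable (drive_space :: ((real \<Rightarrow> real^'n) \<times> (real \<Rightarrow> 'j)) measure)"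
  unfolding drive_space_def using assms
  by (auto intro!: measurable_path_eval[of _ _ "{0..}"])

lemma measurable_fst_drive_space [measurable]:
  "fst \<in> measurable (drive_space :: ((real \<Rightarrow> real^'n) \<times> (real \<Rightarrow> 'j)) measure) (path_space {0..})"
  "snd \<in> measurable (drive_space :: ((real \<Rightarrow> real^'n) \<times> (real \<Rightarrow> 'j)) measure) (path_space {0..})"
  unfolding drive_space_def by auto

lemma measurable_history:
  assumes "0 \<le> K" "- K \<le> r"
  shows "history K r \<in> borel_measurable drive_space"
proof (cases "0 \<le> r")
  case True
  then have "history K r = (\<lambda>\<tau>. (fst \<tau> (K + r) - fst \<tau> K, snd \<tau> (K + r)))"
    by (auto simp: history_def)
  then show ?thesis using assms True
    by (auto intro!: borel_measurable_Pair borel_measurable_diff measurable_drive_space_eval)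
next
  case False
  then have e: "history K r = (\<lambda>\<tau>. (Wf (- r) 0 (fst (advance (K + r) \<tau>)), undefined))"
    by (auto simp: history_def)
  have "0 \<le> K + r" using assms by simp
  from measurable_compose[OF measurable_advance[OF this] measurable_fst_drive_space(1)]
  have "(\<lambda>\<tau>. fst (advance (K + r) \<tau>)) \<in> measurable (drive_space :: ((real \<Rightarrow> real^'n) \<times> (real \<Rightarrow> 'j)) measure) (path_space {0..})" .
  then show ?thesis unfolding e using False
    by (intro borel_measurable_Pair measurable_Wf) auto
qed

lemma measurable_histories:
  assumes "0 \<le> K" "F \<subseteq> {- K..}"
  shows "(\<lambda>\<tau>. \<lambda>r\<in>F. history K r \<tau>) \<in> measurable drive_space (PiM F (\<lambda>_. borel))"
  using assms by (intro measurable_restrict measurable_history) auto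

text \<open>
  By stationarity the law of the coordinates does not depend on where the origin is placed, so the
  laws for different origins form a consistent family.
\<close>
lemma distr_histories:
  assumes K: "0 \<le> K" "K \<le> K'" and F: "F \<subseteq> {- K..}"
  shows "distr D (PiM F (\<lambda>_. borel)) (\<lambda>\<tau>. \<lambda>r\<in>F. history K' r \<tau>) =
         distr D (PiM F (\<lambda>_. borel)) (\<lambda>\<tau>. \<lambda>r\<in>F. history K r \<tau>)"
proof -
  define h where "h = K' - K"
  have h: "0 \<le> h" "K' = K + h" using K by (auto simp: h_def)
  have "(\<lambda>\<tau>. \<lambda>r\<in>F. history K' r \<tau>) = (\<lambda>\<tau>. \<lambda>r\<in>F. history K r \<tau>) \<circ> advance h"
  proof
    fix \<tau>
    show "(\<lambda>r\<in>F. history K' r \<tau>) = ((\<lambda>\<tau>. \<lambda>r\<in>F. history K r \<tau>) \<circ> advance h) \<tau>"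
      unfolding o_def h(2) using F by (intro restrict_ext history_shift K h) auto
  qed
  then have "distr D (PiM F (\<lambda>_. borel)) (\<lambda>\<tau>. \<lambda>r\<in>F. history K' r \<tau>) =
      distr (distr D drive_space (advance h)) (PiM F (\<lambda>_. borel)) (\<lambda>\<tau>. \<lambda>r\<in>F. history K r \<tau>)"
    using measurable_advance[OF h(1)] measurable_histories[OF K(1) F]
    by (subst distr_distr) (auto simp: measurable_cong_sets[OF sets_D refl])
  then show ?thesis unfolding D_shift[OF h(1)] .
qed

text \<open>
  Kolmogorov extension to all real times. For a finite set \<open>F\<close> of coordinates the origin is placed at
  \<open>k F\<close>, late enough for all of them and monotone in \<open>F\<close>. On each half line of coordinates the
  extension is compared with the original process through cylinder sets.
\<close>
lemma backward_space_exists: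
  obtains \<Omega> :: "(real \<Rightarrow> (real^'n) \<times> 'j) measure" where "prob_space \<Omega>"
    "sets \<Omega> = sets (PiM UNIV (\<lambda>_. borel))"
    "\<And>K. 0 \<le> K \<Longrightarrow> distr \<Omega> (PiM {-K..} (\<lambda>_. borel)) (\<lambda>f. restrict f {-K..}) =
       distr D (PiM {-K..} (\<lambda>_. borel)) (\<lambda>\<tau>. \<lambda>r\<in>{-K..}. history K r \<tau>)"
proof -
  define k where "k F = (\<Sum>r\<in>F. \<bar>r\<bar>)" for F :: "real set"
  define Fam where "Fam F = distr D (PiM F (\<lambda>_. borel)) (\<lambda>\<tau>. \<lambda>r\<in>F. history (k F) r \<tau>)" for F
  have k0: "0 \<le> k F" for F by (simp add: k_def sum_nonneg)
  have kF: "F \<subseteq> {- k F..}" if "finite F" for F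
  proof
    fix r assume "r \<in> F"
    then have "\<bar>r\<bar> \<le> k F" unfolding k_def using that by (intro member_le_sum) auto
    then show "r \<in> {- k F..}" by auto
  qed
  interpret pol: polish_projective UNIV Fam
  proof (intro polish_projective.intro projective_family.intro, goal_cases)
    case FH: (1 F H)
    from FH(1,2) have fF: "finite F" by (rule finite_subset)
    have kk: "k F \<le> k H" unfolding k_def using FH by (intro sum_mono2) auto
    have "distr (Fam H) (PiM F (\<lambda>_. borel)) (\<lambda>f. restrict f F) =
        distr D (PiM F (\<lambda>_. borel)) ((\<lambda>f. restrict f F) \<circ> (\<lambda>\<tau>. \<lambda>r\<in>H. history (k H) r \<tau>))"
      unfolding Fam_def using measurable_histories[OF k0 kF[OF FH(2)]] FH(1)
      by (intro distr_distr measurable_restrict_subset) (auto simp: measurable_cong_sets[OF sets_D refl])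
    also have "(\<lambda>f. restrict f F) \<circ> (\<lambda>\<tau>. \<lambda>r\<in>H. history (k H) r \<tau>) = (\<lambda>\<tau>. \<lambda>r\<in>F. history (k H) r \<tau>)"
      using FH(1) by (auto simp: fun_eq_iff restrict_def)
    also have "distr D (PiM F (\<lambda>_. borel)) (\<lambda>\<tau>. \<lambda>r\<in>F. history (k H) r \<tau>) = Fam F"
      unfolding Fam_def by (rule distr_histories[OF k0 kk kF[OF fF]])
    finally show ?case by (rule sym)
  next
    case (2 F)
    then show ?case unfolding Fam_def
      using measurable_histories[OF k0 kF] by (intro D.prob_space_distr) (simp add: measurable_cong_sets[OF sets_D refl])
  qed
  show ?thesis
  proof (rule that[of pol.lim])
    show "prob_space pol.lim" by (rule pol.P.prob_space_axioms)
    show "sets pol.lim = sets (PiM UNIV (\<lambda>_. borel))" by simp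
    fix K :: real assume K: "0 \<le> K"
    let ?I = "{-K..}"
    have mr: "(\<lambda>f. restrict f ?I) \<in> measurable pol.lim (PiM ?I (\<lambda>_. borel))"
      by (simp add: measurable_cong_sets[OF pol.sets_lim refl] measurable_restrict_subset)
    have mh: "(\<lambda>\<tau>. \<lambda>r\<in>?I. history K r \<tau>) \<in> measurable D (PiM ?I (\<lambda>_. borel))"
      using measurable_histories[OF K order_refl] by (simp add: measurable_cong_sets[OF sets_D refl])
    show "distr pol.lim (PiM ?I (\<lambda>_. borel)) (\<lambda>f. restrict f ?I) =
       distr D (PiM ?I (\<lambda>_. borel)) (\<lambda>\<tau>. \<lambda>r\<in>?I. history K r \<tau>)"
    proof (rule measure_eqI_PiM_infinite)
      fix A :: "real \<Rightarrow> ((real^'n) \<times> 'j) set" and F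
      assume F: "finite F" "F \<subseteq> ?I" and A: "\<And>i. i \<in> F \<Longrightarrow> A i \<in> sets borel"
      let ?B = "Pi\<^sub>E F A"
      have B: "?B \<in> sets (PiM F (\<lambda>_. borel))" using F A by (intro sets_PiM_I_finite) auto
      have E: "prod_emb ?I (\<lambda>_. borel) F ?B \<in> sets (PiM ?I (\<lambda>_. borel))" using F A by (intro sets_PiM_I) auto
      have "emeasure (distr pol.lim (PiM ?I (\<lambda>_. borel)) (\<lambda>f. restrict f ?I)) (prod_emb ?I (\<lambda>_. borel) F ?B)
          = emeasure pol.lim (prod_emb UNIV (\<lambda>_. borel) F ?B)"
        using F E by (subst emeasure_distr[OF mr]) (auto intro!: arg_cong[where f = "emeasure pol.lim"]
            simp: prod_emb_def space_PiM restrict_def PiE_iff fun_eq_iff extensional_def subset_eq split: if_splits)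
      also have "\<dots> = emeasure (Fam F) ?B" by (rule pol.emeasure_lim_emb) (use F B in auto)
      also have "Fam F = distr D (PiM F (\<lambda>_. borel)) (\<lambda>\<tau>. \<lambda>r\<in>F. history (max K (k F)) r \<tau>)"
        unfolding Fam_def by (rule distr_histories[symmetric, OF k0 _ kF[OF F(1)]]) simp
      also have "\<dots> = distr D (PiM F (\<lambda>_. borel)) (\<lambda>\<tau>. \<lambda>r\<in>F. history K r \<tau>)"
        by (rule distr_histories[OF K _ F(2)]) simp
      also have "emeasure \<dots> ?B = emeasure (distr D (PiM ?I (\<lambda>_. borel)) (\<lambda>\<tau>. \<lambda>r\<in>?I. history K r \<tau>)) (prod_emb ?I (\<lambda>_. borel) F ?B)"
        using measurable_histories[OF K F(2)] B
        by (subst emeasure_distr[OF mh E], subst emeasure_distr[OF _ B])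
           (use F in \<open>auto intro!: arg_cong[where f = "emeasure D"] simp: measurable_cong_sets[OF sets_D refl] prod_emb_def
              PiE_iff extensional_def subset_eq\<close>)
      finally show "emeasure (distr pol.lim (PiM ?I (\<lambda>_. borel)) (\<lambda>f. restrict f ?I)) (prod_emb ?I (\<lambda>_. borel) F ?B)
        = emeasure (distr D (PiM ?I (\<lambda>_. borel)) (\<lambda>\<tau>. \<lambda>r\<in>?I. history K r \<tau>)) (prod_emb ?I (\<lambda>_. borel) F ?B)" .
    next
      show "finite_measure (distr pol.lim (PiM ?I (\<lambda>_. borel)) (\<lambda>f. restrict f ?I))"
        by (rule prob_space.finite_measure[OF pol.P.prob_space_distr[OF mr]])
    qed auto
  qed
qed

end

context stationary_driver
begin

text \<open>
  The law \<open>Q\<close> of a state together with the path that drives it afterwards, as the limit of these pairs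
  for the process started empty. The test functions are continuous in the state for almost every
  path, but only measurable in the path: the path component has law \<open>D\<close> at every time, and no topology
  on paths is involved.
\<close>
definition limit_law :: "((real^'n) \<times> (real \<Rightarrow> real^'n) \<times> (real \<Rightarrow> 'j)) measure \<Rightarrow> bool" where
  "limit_law Q \<longleftrightarrow> prob_space Q \<and> sets Q = sets (borel \<Otimes>\<^sub>M drive_space) \<and> distr Q drive_space snd = D \<and>
    (\<forall>(h :: _ \<Rightarrow> real) B. h \<in> borel_measurable (borel \<Otimes>\<^sub>M drive_space) \<longrightarrow> (\<forall>z. \<bar>h z\<bar> \<le> B) \<longrightarrow>
      (AE \<tau> in D. continuous_on UNIV (\<lambda>w. h (w, \<tau>))) \<longrightarrow>
      ((\<lambda>t. \<integral>\<omega>. h (Wf t 0 (fst (drive 0 X J \<omega>)), drive t X J \<omega>) \<partial>M) \<longlongrightarrow> (\<integral>z. h z \<partial>Q)) at_top)"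

text \<open>
  On the space of histories, \<open>V t\<close> is the state at time \<open>0\<close> after an empty start at \<open>-t\<close>, and \<open>T\<close> the
  path driving it afterwards. Here \<open>T\<close> stays fixed as \<open>t\<close> grows and \<open>V t\<close> converges almost surely, so
  dominated convergence applies to test functions that are continuous in the state only.
\<close>
theorem limit_law_exists: obtains Q where "limit_law Q"
proof -
  obtain \<Omega> where \<Omega>: "prob_space \<Omega>" "sets \<Omega> = sets (PiM UNIV (\<lambda>_. borel :: ((real^'n) \<times> 'j) measure))"
    and hist: "\<And>K. 0 \<le> K \<Longrightarrow> distr \<Omega> (PiM {-K..} (\<lambda>_. borel)) (\<lambda>f. restrict f {-K..}) =
       distr D (PiM {-K..} (\<lambda>_. borel)) (\<lambda>\<tau>. \<lambda>r\<in>{-K..}. history K r \<tau>)"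
    by (rule backward_space_exists) blast
  interpret \<Omega>: prob_space \<Omega> by fact
  define V where "V t f = fst (f (- t))" for t :: real and f :: "real \<Rightarrow> (real^'n) \<times> 'j"
  define T where "T f = (\<lambda>t\<in>{0..}. fst (f t), \<lambda>t\<in>{0..}. snd (f t))" for f :: "real \<Rightarrow> (real^'n) \<times> 'j"
  let ?S = "drive_space :: ((real \<Rightarrow> real^'n) \<times> (real \<Rightarrow> 'j)) measure"
  let ?P = "\<lambda>I. PiM I (\<lambda>_. borel :: ((real^'n) \<times> 'j) measure)"
  have fstm: "fst \<in> borel_measurable (borel :: ((real^'n) \<times> 'j) measure)"
    by (intro borel_measurable_continuous_onI continuous_intros)
  have sndm: "snd \<in> borel_measurable (borel :: ((real^'n) \<times> 'j) measure)"
    by (intro borel_measurable_continuous_onI continuous_intros)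
  have coord: "(\<lambda>f. f r) \<in> borel_measurable (?P I)" if "r \<in> I" for r I
    using that by (rule measurable_component_singleton)
  have Vm_gen: "V t \<in> borel_measurable (?P I)" if "- t \<in> I" for t I
    unfolding V_def[abs_def] by (rule measurable_compose[OF coord[OF that] fstm])
  have Tm_gen: "T \<in> measurable (?P I) ?S" if "{0..} \<subseteq> I" for I
    unfolding T_def[abs_def] drive_space_def
    by (intro measurable_Pair measurable_path_spaceI measurable_compose[OF coord fstm]
        measurable_compose[OF coord sndm]) (use that in auto)
  have cong: "measurable \<Omega> N = measurable (?P UNIV) N" for N :: "'q measure"
    by (rule measurable_cong_sets[OF \<Omega>(2) refl])
  have Vm[measurable]: "V t \<in> borel_measurable \<Omega>" for t unfolding cong by (rule Vm_gen) simp
  have Tm[measurable]: "T \<in> measurable \<Omega> ?S" unfolding measurable_cong_sets[OF \<Omega>(2) refl] by (rule Tm_gen) simp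
  have rm: "(\<lambda>f. restrict f I) \<in> measurable \<Omega> (?P I)" for I
    unfolding measurable_cong_sets[OF \<Omega>(2) refl] by (rule measurable_restrict_subset) simp
  have hm: "(\<lambda>\<omega>. \<lambda>r\<in>{-K..}. history K r (drive 0 X J \<omega>)) \<in> measurable M (?P {-K..})" if "0 \<le> K" for K
    by (rule measurable_compose[OF M_meas measurable_histories[OF that order_refl]])
  have histM: "distr \<Omega> (?P {-K..}) (\<lambda>f. restrict f {-K..}) =
       distr M (?P {-K..}) (\<lambda>\<omega>. \<lambda>r\<in>{-K..}. history K r (drive 0 X J \<omega>))" if K: "0 \<le> K" for K
    unfolding hist[OF K] D_eq
    by (subst distr_distr[OF measurable_histories[OF K order_refl] M_meas]) (simp add: comp_def)

  \<comment> \<open>the law of the state at time \<open>t\<close> together with the path driving it afterwards\<close>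
  have law: "distr \<Omega> (borel \<Otimes>\<^sub>M ?S) (\<lambda>f. (V t f, T f)) =
      distr M (borel \<Otimes>\<^sub>M ?S) (\<lambda>\<omega>. (Wf t 0 (fst (drive 0 X J \<omega>)), drive t X J \<omega>))" if t: "0 < t" for t
  proof -
    let ?I = "{-t..}"
    have gm: "(\<lambda>f. (V t f, T f)) \<in> measurable (?P ?I) (borel \<Otimes>\<^sub>M ?S)"
      using t by (intro measurable_Pair Vm_gen Tm_gen) auto
    have "distr \<Omega> (borel \<Otimes>\<^sub>M ?S) (\<lambda>f. (V t f, T f)) =
        distr (distr \<Omega> (?P ?I) (\<lambda>f. restrict f ?I)) (borel \<Otimes>\<^sub>M ?S) (\<lambda>f. (V t f, T f))"
      unfolding distr_distr[OF gm rm]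
      using t by (intro distr_cong refl) (auto simp: V_def T_def fun_eq_iff restrict_def)
    also have "\<dots> = distr M (borel \<Otimes>\<^sub>M ?S) (\<lambda>\<omega>. (Wf t 0 (fst (drive 0 X J \<omega>)), drive t X J \<omega>))"
      unfolding histM[OF less_imp_le[OF t]] distr_distr[OF gm hm[OF less_imp_le[OF t]]]
    proof (intro distr_cong refl)
      fix \<omega>
      have h: "history t r (drive 0 X J \<omega>) = (incr t X r \<omega>, J (t + r) \<omega>)" if "0 \<le> r" for r
        using t that by (simp add: history_drive)
      have "T (\<lambda>r\<in>?I. history t r (drive 0 X J \<omega>)) = (\<lambda>r\<in>{0..}. incr t X r \<omega>, \<lambda>r\<in>{0..}. J (t + r) \<omega>)"
        using t by (auto simp: T_def h fun_eq_iff restrict_def)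
      then have "T (\<lambda>r\<in>?I. history t r (drive 0 X J \<omega>)) = drive t X J \<omega>"
        by (simp add: drive_def traj_def)
      then show "((\<lambda>f. (V t f, T f)) \<circ> (\<lambda>\<omega>. \<lambda>r\<in>?I. history t r (drive 0 X J \<omega>))) \<omega> =
          (Wf t 0 (fst (drive 0 X J \<omega>)), drive t X J \<omega>)"
        using t by (simp add: V_def history_drive)
    qed
    finally show ?thesis .
  qed
  have MWm: "(\<lambda>\<omega>. Wf t 0 (fst (drive s X J \<omega>))) \<in> borel_measurable M" if "0 \<le> t" "0 \<le> s" for t s
    using that by (intro measurable_Wf measurable_compose[OF measurable_drive[OF carries_M] measurable_fst_drive_space(1)]) auto
  have Mm: "(\<lambda>\<omega>. (Wf t 0 (fst (drive 0 X J \<omega>)), drive t X J \<omega>)) \<in> measurable M (borel \<Otimes>\<^sub>M ?S)" if "0 \<le> t" for t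
    using that by (intro measurable_Pair MWm measurable_drive[OF carries_M]) auto
  have lawT: "distr \<Omega> ?S T = D"
  proof -
    have "distr \<Omega> ?S T = distr (distr \<Omega> (borel \<Otimes>\<^sub>M ?S) (\<lambda>f. (V 1 f, T f))) ?S snd"
      by (subst distr_distr) (auto simp: comp_def)
    also have "\<dots> = distr M ?S (drive 1 X J)"
      unfolding law[OF zero_less_one] by (subst distr_distr[OF _ Mm]) (auto simp: comp_def)
    finally show ?thesis using distr_drive[OF carries_M, of 1] by simp
  qed

  \<comment> \<open>starting earlier from the empty state yields a larger state at time 0\<close>
  have mono: "AE f in \<Omega>. V s f \<le> V t f" if st: "0 < s" "s \<le> t" for s t
  proof -
    let ?I = "{-t..}"
    have t: "0 \<le> t" using st by simp
    have Im: "{f\<in>space (?P ?I). V s f \<le> V t f} \<in> sets (?P ?I)"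
    proof -
      have "V s \<in> borel_measurable (?P ?I)" "V t \<in> borel_measurable (?P ?I)"
        using st by (auto intro!: Vm_gen)
      then show ?thesis unfolding less_eq_vec_def
        by (intro sets.sets_Collect_countable_All borel_measurable_le borel_measurable_nth)
    qed
    have "AE f in distr M (?P ?I) (\<lambda>\<omega>. \<lambda>r\<in>?I. history t r (drive 0 X J \<omega>)). V s f \<le> V t f"
    proof (subst AE_distr_iff[OF hm[OF t] Im], rule AE_I2)
      fix \<omega> assume \<omega>: "\<omega> \<in> space M"
      have "Wf s 0 (fst (drive (0 + (t - s)) X J \<omega>)) \<le> Wf (t - s + s) 0 (fst (drive 0 X J \<omega>))"
        by (rule Wf_longer[OF carries_M \<omega>]) (use st in auto)
      then show "V s (\<lambda>r\<in>?I. history t r (drive 0 X J \<omega>)) \<le> V t (\<lambda>r\<in>?I. history t r (drive 0 X J \<omega>))"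
        using st by (simp add: V_def history_drive)
    qed
    then have "AE f in distr \<Omega> (?P ?I) (\<lambda>f. restrict f ?I). V s f \<le> V t f"
      unfolding histM[OF t] .
    from AE_distrD[OF rm this] show ?thesis
      using st by (simp add: V_def)
  qed

  \<comment> \<open>and these states stay bounded\<close>
  \<comment> \<open>the event that the bound \<open>b\<close> is exceeded; it increases with \<open>k\<close> up to null sets\<close>
  define U where "U k b = {f\<in>space \<Omega>. \<exists>i. b < V (real (Suc k)) f $ i}" for k :: nat and b :: real
  have [measurable]: "U k b \<in> sets \<Omega>" for k b unfolding U_def by measurable
  have monoAE: "AE f in \<Omega>. \<forall>m k. m \<le> k \<longrightarrow> V (real (Suc m)) f \<le> V (real (Suc k)) f"
    unfolding AE_all_countable using mono by auto
  have U_le: "measure \<Omega> (U k b) = measure D {\<tau>\<in>space D. \<exists>i. b < Wf (real (Suc k)) 0 (fst \<tau>) $ i}" for k b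
  proof -
    let ?A = "{z\<in>space (borel \<Otimes>\<^sub>M ?S). \<exists>i. b < fst z $ i}"
    have Am: "?A \<in> sets (borel \<Otimes>\<^sub>M ?S)" by measurable
    have 0: "0 \<le> real (Suc k)" "0 < real (Suc k)" by auto
    have "measure \<Omega> (U k b) = measure (distr \<Omega> (borel \<Otimes>\<^sub>M ?S) (\<lambda>f. (V (real (Suc k)) f, T f))) ?A"
      by (subst measure_distr[OF _ Am])
        (auto intro!: arg_cong[where f = "measure \<Omega>"] simp: U_def space_pair_measure dest: measurable_space[OF Tm])
    also have "\<dots> = measure M {\<omega>\<in>space M. \<exists>i. b < Wf (real (Suc k)) 0 (fst (drive 0 X J \<omega>)) $ i}"
      unfolding law[OF 0(2)]
      by (subst measure_distr[OF Mm[OF 0(1)] Am])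
        (auto intro!: arg_cong[where f = "measure M"] simp: space_pair_measure dest: measurable_space[OF measurable_drive[OF carries_M 0(1)]])
    also have "\<dots> = measure D {\<tau>\<in>space D. \<exists>i. b < Wf (real (Suc k)) 0 (fst \<tau>) $ i}"
    proof -
      have [measurable]: "(\<lambda>\<tau>. Wf (real (Suc k)) 0 (fst \<tau>)) \<in> borel_measurable ?S"
        by (intro measurable_Wf measurable_fst_drive_space) auto
      have "{\<tau>\<in>space ?S. \<exists>i. b < Wf (real (Suc k)) 0 (fst \<tau>) $ i} \<in> sets ?S" by measurable
      then show ?thesis unfolding space_D unfolding D_eq
        by (subst measure_distr[OF M_meas])
          (auto intro!: arg_cong[where f = "measure M"] dest: measurable_space[OF M_meas])
    qed
    finally show ?thesis .
  qed
  have small: "\<exists>b. measure \<Omega> (\<Union>k. U k b) \<le> \<delta>" if \<delta>: "0 < \<delta>" for \<delta>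
  proof -
    obtain b where b: "\<And>k::nat. measure D {\<tau>\<in>space D. \<exists>i. b < Wf (real k) 0 (fst \<tau>) $ i} \<le> \<delta>"
      using D_tight[OF \<delta>] by blast
    have eq: "measure \<Omega> (\<Union>j\<le>k. U j b) = measure \<Omega> (U k b)" for k
    proof (rule \<Omega>.finite_measure_eq_AE)
      show "AE f in \<Omega>. f \<in> (\<Union>j\<le>k. U j b) \<longleftrightarrow> f \<in> U k b"
        using monoAE
      proof eventually_elim
        case (elim f)
        then have "V (real (Suc j)) f $ i \<le> V (real (Suc k)) f $ i" if "j \<le> k" for i j
          using that by (auto simp: less_eq_vec_def)
        then show ?case unfolding U_def by (auto intro: less_le_trans)
      qed
    qed auto
    have "(\<lambda>k. measure \<Omega> (\<Union>j\<le>k. U j b)) \<longlonglongrightarrow> measure \<Omega> (\<Union>k. \<Union>j\<le>k. U j b)"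
    proof (rule \<Omega>.finite_Lim_measure_incseq)
      show "incseq (\<lambda>k. \<Union>j\<le>k. U j b)" unfolding incseq_def by (auto intro: order_trans)
    qed auto
    moreover have "(\<Union>k. \<Union>j\<le>k. U j b) = (\<Union>k. U k b)" by auto
    ultimately have "(\<lambda>k. measure \<Omega> (U k b)) \<longlonglongrightarrow> measure \<Omega> (\<Union>k. U k b)" by (simp only: eq)
    then have "measure \<Omega> (\<Union>k. U k b) \<le> \<delta>"
      by (rule LIMSEQ_le_const2) (use b[of "Suc _"] in \<open>simp only: U_le, blast\<close>)
    then show ?thesis by blast
  qed
  have bounded: "AE f in \<Omega>. \<exists>b::nat. \<forall>k i. V (real (Suc k)) f $ i \<le> real b"
  proof -
    let ?N = "\<Inter>b::nat. \<Union>k. U k (real b)"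
    have "measure \<Omega> ?N \<le> 0"
    proof (rule field_le_epsilon)
      fix \<delta> :: real assume "0 < \<delta>"
      then obtain b where b: "measure \<Omega> (\<Union>k. U k b) \<le> \<delta>" using small by blast
      obtain n :: nat where n: "b \<le> real n" using real_arch_simple by blast
      have "measure \<Omega> ?N \<le> measure \<Omega> (\<Union>k. U k b)"
      proof (rule \<Omega>.finite_measure_mono)
        have "U k (real n) \<subseteq> U k b" for k using n by (auto simp: U_def intro: le_less_trans)
        then show "?N \<subseteq> (\<Union>k. U k b)" by blast
      qed auto
      with b show "measure \<Omega> ?N \<le> 0 + \<delta>" by simp
    qed
    then have "emeasure \<Omega> ?N = 0" by (simp add: \<Omega>.emeasure_eq_measure measure_le_0_iff)
    then have "?N \<in> null_sets \<Omega>" by (intro null_setsI) auto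
    from AE_not_in[OF this] AE_space show ?thesis
    proof eventually_elim
      case (elim f)
      then obtain b :: nat where "\<And>k. f \<notin> U k (real b)" by auto
      then show ?case using elim(2) by (auto simp: U_def not_less)
    qed
  qed
  define \<xi> where "\<xi> f = lim (\<lambda>k. V (real (Suc k)) f)" for f
  have \<xi>m[measurable]: "\<xi> \<in> borel_measurable \<Omega>" unfolding \<xi>_def by measurable
  have lim: "AE f in \<Omega>. (\<lambda>k. V (real (Suc k)) f) \<longlonglongrightarrow> \<xi> f"
    using monoAE bounded
  proof eventually_elim
    case (elim f)
    obtain b :: nat where b: "\<And>k i. V (real (Suc k)) f $ i \<le> real b" using elim(2) by blast
    have "(\<lambda>k. V (real (Suc k)) f) \<longlonglongrightarrow> (\<chi> i. SUP k. V (real (Suc k)) f $ i)"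
    proof (rule vec_tendstoI)
      fix i
      have "(\<lambda>k. V (real (Suc k)) f $ i) \<longlonglongrightarrow> (SUP k. V (real (Suc k)) f $ i)"
      proof (rule LIMSEQ_incseq_SUP)
        show "bdd_above (range (\<lambda>k. V (real (Suc k)) f $ i))" by (rule bdd_aboveI2[OF b])
        show "incseq (\<lambda>k. V (real (Suc k)) f $ i)"
          using elim(1) unfolding incseq_def less_eq_vec_def by blast
      qed
      then show "(\<lambda>k. V (real (Suc k)) f $ i) \<longlonglongrightarrow> (\<chi> i. SUP k. V (real (Suc k)) f $ i) $ i" by simp
    qed
    then show ?case unfolding \<xi>_def by (rule convergent_LIMSEQ_iff[THEN iffD1, OF convergentI])
  qed
  \<comment> \<open>monotonicity sandwiches an arbitrary time between consecutive integers\<close>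
  have lim_seq: "AE f in \<Omega>. (\<lambda>m. V (x m) f) \<longlonglongrightarrow> \<xi> f" if x: "filterlim x at_top sequentially" for x :: "nat \<Rightarrow> real"
  proof -
    define k where "k m = nat \<lfloor>x m\<rfloor>" for m
    have k: "1 \<le> k m \<and> real (k m) \<le> x m \<and> x m \<le> real (Suc (k m))" if "1 \<le> x m" for m
      using that unfolding k_def by (auto simp: le_nat_iff le_floor_iff) linarith+
    have kinf: "filterlim k at_top sequentially"
      unfolding k_def by (rule filterlim_compose[OF filterlim_nat_sequentially filterlim_compose[OF filterlim_floor_sequentially x]])
    have ev: "eventually (\<lambda>m. 1 \<le> x m) sequentially"
      using x by (auto simp: filterlim_at_top)
    have "AE f in \<Omega>. \<forall>m. 1 \<le> x m \<longrightarrow> V (real (k m)) f \<le> V (x m) f \<and> V (x m) f \<le> V (real (Suc (k m))) f"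
      unfolding AE_all_countable
    proof
      fix m
      show "AE f in \<Omega>. 1 \<le> x m \<longrightarrow> V (real (k m)) f \<le> V (x m) f \<and> V (x m) f \<le> V (real (Suc (k m))) f"
      proof (cases "1 \<le> x m")
        case True
        have "AE f in \<Omega>. V (real (k m)) f \<le> V (x m) f" by (rule mono) (use k[OF True] in auto)
        moreover have "AE f in \<Omega>. V (x m) f \<le> V (real (Suc (k m))) f" by (rule mono) (use k[OF True] True in auto)
        ultimately show ?thesis by eventually_elim simp
      qed simp
    qed
    with lim show ?thesis
    proof eventually_elim
      case (elim f)
      have l1: "(\<lambda>k. V (real k) f) \<longlonglongrightarrow> \<xi> f" using elim(1) by (rule LIMSEQ_imp_Suc)
      show ?case
      proof (rule vec_tendstoI)
        fix i
        show "(\<lambda>m. V (x m) f $ i) \<longlonglongrightarrow> \<xi> f $ i"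
        proof (rule tendsto_sandwich)
          show "(\<lambda>m. V (real (k m)) f $ i) \<longlonglongrightarrow> \<xi> f $ i"
            by (rule tendsto_vec_nth[OF filterlim_compose[OF l1 kinf]])
          show "(\<lambda>m. V (real (Suc (k m))) f $ i) \<longlonglongrightarrow> \<xi> f $ i"
            by (rule tendsto_vec_nth[OF filterlim_compose[OF elim(1) kinf]])
          show "eventually (\<lambda>m. V (real (k m)) f $ i \<le> V (x m) f $ i) sequentially"
            using ev by eventually_elim (use elim(2) in \<open>auto simp: less_eq_vec_def\<close>)
          show "eventually (\<lambda>m. V (x m) f $ i \<le> V (real (Suc (k m))) f $ i) sequentially"
            using ev by eventually_elim (use elim(2) in \<open>auto simp: less_eq_vec_def\<close>)
        qed
      qed
    qed
  qed
  define Q where "Q = distr \<Omega> (borel \<Otimes>\<^sub>M ?S) (\<lambda>f. (\<xi> f, T f))"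
  show ?thesis
  proof (rule that[of Q], unfold limit_law_def, intro conjI allI impI)
    show "prob_space Q" unfolding Q_def by (rule \<Omega>.prob_space_distr) measurable
    show "sets Q = sets (borel \<Otimes>\<^sub>M ?S)" by (simp add: Q_def)
    show "distr Q ?S snd = D" unfolding Q_def lawT[symmetric] by (subst distr_distr) (auto simp: comp_def)
    fix h :: "(real^'n) \<times> (real \<Rightarrow> real^'n) \<times> (real \<Rightarrow> 'j) \<Rightarrow> real" and B
    assume h[measurable]: "h \<in> borel_measurable (borel \<Otimes>\<^sub>M ?S)" and "\<forall>z. \<bar>h z\<bar> \<le> B"
      and cont: "AE \<tau> in D. continuous_on UNIV (\<lambda>w. h (w, \<tau>))"
    then have B: "\<And>z. \<bar>h z\<bar> \<le> B" by blast
    show "((\<lambda>t. \<integral>\<omega>. h (Wf t 0 (fst (drive 0 X J \<omega>)), drive t X J \<omega>) \<partial>M) \<longlongrightarrow> (\<integral>z. h z \<partial>Q)) at_top"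
    proof (rule tendsto_at_topI_sequentially)
      fix x :: "nat \<Rightarrow> real" assume x: "filterlim x at_top sequentially"
      have contT: "AE f in \<Omega>. continuous_on UNIV (\<lambda>w. h (w, T f))"
        by (rule AE_distrD[OF Tm]) (unfold lawT, rule cont)
      have l1: "(\<lambda>m. \<integral>f. h (V (x m) f, T f) \<partial>\<Omega>) \<longlonglongrightarrow> (\<integral>f. h (\<xi> f, T f) \<partial>\<Omega>)"
      proof (rule integral_dominated_convergence[where w = "\<lambda>_. B"])
        show "AE f in \<Omega>. (\<lambda>m. h (V (x m) f, T f)) \<longlonglongrightarrow> h (\<xi> f, T f)"
          using contT lim_seq[OF x]
          by eventually_elim (rule continuous_on_tendsto_compose, auto)
      qed (use B in auto)
      have l2: "(\<integral>f. h (\<xi> f, T f) \<partial>\<Omega>) = (\<integral>z. h z \<partial>Q)"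
        unfolding Q_def by (subst integral_distr) auto
      have l3: "eventually (\<lambda>m. (\<integral>f. h (V (x m) f, T f) \<partial>\<Omega>) =
          (\<integral>\<omega>. h (Wf (x m) 0 (fst (drive 0 X J \<omega>)), drive (x m) X J \<omega>) \<partial>M)) sequentially"
      proof -
        have "eventually (\<lambda>m. 0 < x m) sequentially" using x by (auto simp: filterlim_at_top_dense)
        then show ?thesis
        proof eventually_elim
          case (elim m)
          have "(\<integral>f. h (V (x m) f, T f) \<partial>\<Omega>) = (\<integral>z. h z \<partial>distr \<Omega> (borel \<Otimes>\<^sub>M ?S) (\<lambda>f. (V (x m) f, T f)))"
            by (subst integral_distr) auto
          also have "\<dots> = (\<integral>\<omega>. h (Wf (x m) 0 (fst (drive 0 X J \<omega>)), drive (x m) X J \<omega>) \<partial>M)"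
            unfolding law[OF elim] by (rule integral_distr[OF Mm[OF less_imp_le[OF elim]] h])
          finally show ?case .
        qed
      qed
      show "(\<lambda>m. \<integral>\<omega>. h (Wf (x m) 0 (fst (drive 0 X J \<omega>)), drive (x m) X J \<omega>) \<partial>M) \<longlonglongrightarrow> (\<integral>z. h z \<partial>Q)"
        by (rule Lim_transform_eventually[OF l1[unfolded l2] l3])
    qed
  qed
qed

section \<open>Convergence in law from an arbitrary start\<close>

lemma measurable_start_step:
  assumes "carries N Y K" "\<xi> \<in> borel_measurable N" "0 \<le> s"
  shows "(\<lambda>\<omega>. (Wf s (\<xi> \<omega>) (fst (drive 0 Y K \<omega>)), drive s Y K \<omega>)) \<in> measurable N (borel \<Otimes>\<^sub>M drive_space)"
  using assms
  by (intro measurable_Pair measurable_Wf measurable_drive[OF assms(1)]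
      measurable_compose[OF measurable_drive[OF assms(1)] measurable_fst_drive_space(1)]) auto

lemma measurable_step:
  assumes "0 \<le> s"
  shows "(\<lambda>z. (Wf s (fst z) (fst (snd z)), advance s (snd z))) \<in>
    measurable (borel \<Otimes>\<^sub>M (drive_space :: ((real \<Rightarrow> real^'n) \<times> (real \<Rightarrow> 'j)) measure)) (borel \<Otimes>\<^sub>M drive_space)"
  using assms
  by (intro measurable_Pair measurable_Wf measurable_fst
      measurable_compose[OF measurable_snd measurable_fst_drive_space(1)]
      measurable_compose[OF measurable_snd measurable_advance]) auto

lemma zero_start_integral:
  assumes c: "carries N Y K" and h: "h \<in> borel_measurable (borel \<Otimes>\<^sub>M drive_space)" and t: "0 \<le> t"
  shows "(\<integral>\<omega>. (h (Wf t 0 (fst (drive 0 Y K \<omega>)), drive t Y K \<omega>) :: real) \<partial>N) = (\<integral>\<tau>. h (Wf t 0 (fst \<tau>), advance t \<tau>) \<partial>D)"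
proof -
  have m: "(\<lambda>\<tau>. h (Wf t 0 (fst \<tau>), advance t \<tau>)) \<in> borel_measurable drive_space"
    using measurable_compose[OF measurable_compose[OF measurable_Pair1'[of 0] measurable_step[OF t]] h]
    by simp
  have d: "distr N drive_space (drive 0 Y K) = D" "drive 0 Y K \<in> measurable N drive_space"
    using c by (auto simp: carries_def)
  have "(\<integral>\<tau>. h (Wf t 0 (fst \<tau>), advance t \<tau>) \<partial>D) =
      (\<integral>\<tau>. h (Wf t 0 (fst \<tau>), advance t \<tau>) \<partial>distr N drive_space (drive 0 Y K))" by (simp only: d(1))
  also have "\<dots> = (\<integral>\<omega>. h (Wf t 0 (fst (drive 0 Y K \<omega>)), advance t (drive 0 Y K \<omega>)) \<partial>N)"
    by (rule integral_distr[OF d(2) m])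
  finally show ?thesis by (simp add: advance_drive[OF t])
qed

context
  fixes Q assumes Q: "limit_law Q"
begin

lemma Q_prob: "prob_space Q" and Q_sets: "sets Q = sets (borel \<Otimes>\<^sub>M drive_space)"
  and Q_snd: "distr Q drive_space snd = D"
  using Q by (auto simp: limit_law_def)

text \<open>
  The convergence defining \<open>Q\<close> concerns the law \<open>D\<close> only, hence every copy of the driving pair.
\<close>
lemma zero_start_limit:
  assumes c: "carries N Y K" and h: "h \<in> borel_measurable (borel \<Otimes>\<^sub>M drive_space)"
    and B: "\<And>z. \<bar>h z\<bar> \<le> (B::real)" and cont: "AE \<tau> in D. continuous_on UNIV (\<lambda>w. h (w, \<tau>))"
  shows "((\<lambda>t. \<integral>\<omega>. h (Wf t 0 (fst (drive 0 Y K \<omega>)), drive t Y K \<omega>) \<partial>N) \<longlongrightarrow> (\<integral>z. h z \<partial>Q)) at_top"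
proof -
  have "((\<lambda>t. \<integral>\<omega>. h (Wf t 0 (fst (drive 0 X J \<omega>)), drive t X J \<omega>) \<partial>M) \<longlongrightarrow> (\<integral>z. h z \<partial>Q)) at_top"
    using Q h B cont unfolding limit_law_def by blast
  moreover have "eventually (\<lambda>t. (\<integral>\<omega>. h (Wf t 0 (fst (drive 0 X J \<omega>)), drive t X J \<omega>) \<partial>M) =
      (\<integral>\<omega>. h (Wf t 0 (fst (drive 0 Y K \<omega>)), drive t Y K \<omega>) \<partial>N)) at_top"
    using eventually_ge_at_top[of 0]
    by eventually_elim (simp only: zero_start_integral[OF c h] zero_start_integral[OF carries_M h])
  ultimately show ?thesis by (rule Lim_transform_eventually)
qed

lemma start_irrelevant:
  assumes c: "carries N Y K"
  shows "AE \<omega> in N. \<forall>w. ((\<lambda>t. Wf t w (fst (drive 0 Y K \<omega>)) - Wf t 0 (fst (drive 0 Y K \<omega>))) \<longlongrightarrow> 0) at_top"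
proof -
  have d: "drive 0 Y K \<in> measurable N drive_space" "distr N drive_space (drive 0 Y K) = D"
    using c by (auto simp: carries_def)
  have "AE \<omega> in N. \<forall>i. \<forall>c::nat. \<exists>k::nat. Ri (fst (drive 0 Y K \<omega>) (real k)) $ i \<le> - real c"
    by (rule AE_distrD[OF d(1)]) (unfold d(2), rule D_unbounded)
  with AE_space show ?thesis
  proof eventually_elim
    case (elim \<omega>)
    let ?y = "\<lambda>u. incr 0 Y u \<omega>"
    have lb: "lower_bounded {0..} ?y"
      by (rule cadlag_lower_bounded[OF carries_cadlag[OF c elim(1)]]) simp
    have unb: "\<exists>t\<ge>0. a \<le> Llim {0..} ?y t $ i" for i a
    proof -
      obtain n :: nat where n: "a \<le> real n" using real_arch_simple by blast
      obtain k :: nat where "Ri (fst (drive 0 Y K \<omega>) (real k)) $ i \<le> - real n" using elim(2) by blast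
      then have "Ri (?y (real k)) $ i \<le> - real n" by (simp add: drive_def traj_def)
      then have "a \<le> Llim {0..} ?y (real k) $ i" using Llim_ge[OF lb, of "real k" i] n by simp
      then show ?thesis by (intro exI[of _ "real k"]) simp
    qed
    have "((\<lambda>t. Wf t w (fst (drive 0 Y K \<omega>)) - Wf t 0 (fst (drive 0 Y K \<omega>))) \<longlongrightarrow> 0) at_top" for w
    proof (rule Lim_transform_eventually[OF coupling[OF lb unb, of w]])
      show "eventually (\<lambda>t. Wlim {0..} (\<lambda>u. w + ?y u) t - Wlim {0..} ?y t =
          Wf t w (fst (drive 0 Y K \<omega>)) - Wf t 0 (fst (drive 0 Y K \<omega>))) at_top"
        using eventually_ge_at_top[of 0] by eventually_elim (simp add: Wf_drive[OF c elim(1)])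
    qed
    then show ?case by blast
  qed
qed

text \<open>
  For almost every path a test function is uniformly continuous in the state on a bounded ball. Off
  a set of paths of small probability one modulus of continuity serves for all of them. The sets
  \<open>G n\<close> are defined through a countable dense set of states, which makes them measurable and still
  controls all states by continuity.
\<close>
lemma uniformly_continuous_sets:
  fixes h :: "(real^'n) \<times> (real \<Rightarrow> real^'n) \<times> (real \<Rightarrow> 'j) \<Rightarrow> real"
  assumes h: "h \<in> borel_measurable (borel \<Otimes>\<^sub>M drive_space)"
    and cont: "AE \<tau> in D. continuous_on UNIV (\<lambda>w. h (w, \<tau>))" and \<eta>: "0 < \<eta>"
  obtains G \<delta> where "G \<in> sets drive_space" "0 < \<delta>" "\<delta> \<le> 1" "measure D (space D - G) < \<eta>"
    "\<And>\<tau> w w'. \<tau> \<in> G \<Longrightarrow> continuous_on UNIV (\<lambda>w. h (w, \<tau>)) \<Longrightarrow> norm w < c \<Longrightarrow> norm w' < c \<Longrightarrow> dist w w' < \<delta> \<Longrightarrow>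
      \<bar>h (w, \<tau>) - h (w', \<tau>)\<bar> \<le> \<eta>"
proof -
  obtain E :: "(real^'n) set" where E: "countable E" "\<And>X. open X \<Longrightarrow> X \<noteq> {} \<Longrightarrow> \<exists>d\<in>E. d \<in> X"
    by (rule countable_dense_setE) blast
  have "E \<noteq> {}" using E(2)[of UNIV] by auto
  then obtain a :: "nat \<Rightarrow> real^'n" where a: "range a = E"
    using range_from_nat_into[OF _ E(1)] by blast
  define \<delta> where "\<delta> n = 1 / real (Suc n)" for n
  define G where "G n = {\<tau>\<in>space drive_space. \<forall>k l. norm (a k) < c \<longrightarrow> norm (a l) < c \<longrightarrow> dist (a k) (a l) < \<delta> n \<longrightarrow>
     \<bar>h (a k, \<tau>) - h (a l, \<tau>)\<bar> \<le> \<eta>}" for n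
  have hm: "(\<lambda>\<tau>. h (w, \<tau>)) \<in> borel_measurable drive_space" for w
    by (rule measurable_compose[OF measurable_Pair1' h]) simp
  have Gs[measurable]: "G n \<in> sets drive_space" for n
  proof -
    note [measurable] = hm
    show ?thesis unfolding G_def by measurable
  qed
  have ev: "AE \<tau> in D. eventually (\<lambda>n. \<tau> \<in> G n) sequentially"
    using cont AE_space
  proof eventually_elim
    case (elim \<tau>)
    have "uniformly_continuous_on (cball 0 c) (\<lambda>w. h (w, \<tau>))"
      by (intro compact_uniformly_continuous continuous_on_subset[OF elim(1)]) auto
    then obtain d where d: "0 < d" "\<And>w w'. norm w \<le> c \<Longrightarrow> norm w' \<le> c \<Longrightarrow> dist w' w < d \<Longrightarrow> dist (h (w', \<tau>)) (h (w, \<tau>)) < \<eta>"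
      using \<eta> unfolding uniformly_continuous_on_def by auto
    have "(\<lambda>n. \<delta> n) \<longlonglongrightarrow> 0" unfolding \<delta>_def using LIMSEQ_inverse_real_of_nat by (simp add: inverse_eq_divide)
    then have "eventually (\<lambda>n. \<delta> n < d) sequentially" using d(1) by (rule order_tendstoD)
    then show ?case
      by eventually_elim (use elim(2) d(2) in \<open>force simp: G_def dist_real_def intro: less_imp_le less_trans\<close>)
  qed
  have "(\<lambda>n. \<integral>\<tau>. (indicator (space D - G n) \<tau> :: real) \<partial>D) \<longlonglongrightarrow> (\<integral>\<tau>. 0 \<partial>D)"
  proof (rule integral_dominated_convergence[where w = "\<lambda>_. 1"])
    show "AE \<tau> in D. (\<lambda>n. indicator (space D - G n) \<tau> :: real) \<longlonglongrightarrow> 0"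
      using ev by eventually_elim (auto intro!: tendsto_eventually elim!: eventually_mono)
  qed (auto simp: indicator_def)
  then have "(\<lambda>n. measure D (space D - G n)) \<longlonglongrightarrow> 0" by (simp add: Int_absorb2)
  then have "eventually (\<lambda>n. measure D (space D - G n) < \<eta>) sequentially" using \<eta> by (rule order_tendstoD)
  then obtain n where n: "measure D (space D - G n) < \<eta>" by (auto simp: eventually_sequentially)
  show ?thesis
  proof (rule that[of "G n" "\<delta> n"])
    show "0 < \<delta> n" "\<delta> n \<le> 1" by (auto simp: \<delta>_def)
    fix \<tau> and w w' :: "real^'n"
    assume \<tau>: "\<tau> \<in> G n" and ct: "continuous_on UNIV (\<lambda>w. h (w, \<tau>))" and w: "norm w < c" "norm w' < c" "dist w w' < \<delta> n"
    show "\<bar>h (w, \<tau>) - h (w', \<tau>)\<bar> \<le> \<eta>"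
    proof (rule ccontr)
      assume neg: "\<not> \<bar>h (w, \<tau>) - h (w', \<tau>)\<bar> \<le> \<eta>"
      let ?O = "{z. \<eta> < \<bar>h (fst z, \<tau>) - h (snd z, \<tau>)\<bar> \<and> norm (fst z) < c \<and> norm (snd z) < c \<and> dist (fst z) (snd z) < \<delta> n}"
      have "continuous_on UNIV (\<lambda>z. h (fst z, \<tau>))" "continuous_on UNIV (\<lambda>z. h (snd z, \<tau>))"
        by (rule continuous_on_compose2[OF ct], auto intro: continuous_intros)+
      then have "open ?O" by (intro open_Collect_conj open_Collect_less continuous_intros)
      moreover have "(w, w') \<in> ?O" using neg w by simp
      ultimately obtain A B where AB: "open A" "open B" "(w, w') \<in> A \<times> B" "A \<times> B \<subseteq> ?O"
        by (rule open_prod_elim)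
      obtain k l where "a k \<in> A" "a l \<in> B" using E(2)[OF AB(1)] E(2)[OF AB(2)] AB(3) unfolding a[symmetric] by auto
      then have "(a k, a l) \<in> ?O" using AB(4) by auto
      then show False using \<tau> by (force simp: G_def)
    qed
  qed (use n in auto)
qed

text \<open>
  Replacing the empty start by \<open>\<xi>\<close> changes the test function by at most \<open>\<eta>\<close>, unless the process started
  empty is far out, the path after \<open>t\<close> lies outside the set of uniform continuity, or the two
  processes are at least \<open>\<delta>\<close> apart. The first event is unlikely by convergence of its law, the
  second has the same probability at every time by stationarity, and the third is eventually unlikely by
  coupling.
\<close>
theorem start_limit:
  assumes c: "carries N Y K" and \<xi>: "\<xi> \<in> borel_measurable N"
    and h: "h \<in> borel_measurable (borel \<Otimes>\<^sub>M drive_space)"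
    and B: "\<And>z. \<bar>h z\<bar> \<le> (B::real)" and cont: "AE \<tau> in D. continuous_on UNIV (\<lambda>w. h (w, \<tau>))"
  shows "((\<lambda>t. \<integral>\<omega>. h (Wf t (\<xi> \<omega>) (fst (drive 0 Y K \<omega>)), drive t Y K \<omega>) \<partial>N) \<longlongrightarrow> (\<integral>z. h z \<partial>Q)) at_top"
proof -
  interpret N: prob_space N using c by (simp add: carries_def cadlag_process_def)
  interpret Q: prob_space Q by (rule Q_prob)
  have B0: "0 \<le> B" using B[of undefined] by linarith
  let ?W = "\<lambda>t \<omega>. Wf t (\<xi> \<omega>) (fst (drive 0 Y K \<omega>))" and ?V = "\<lambda>t \<omega>. Wf t 0 (fst (drive 0 Y K \<omega>))"
  let ?T = "\<lambda>t. drive t Y K"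
  have Wm: "?W t \<in> borel_measurable N" "?V t \<in> borel_measurable N" if "0 \<le> t" for t
    using that c \<xi> by (auto intro!: measurable_Wf measurable_compose[OF measurable_drive[OF c] measurable_fst_drive_space(1)])
  have Tm: "?T t \<in> measurable N drive_space" if "0 \<le> t" for t by (rule measurable_drive[OF c that])
  have hW: "(\<lambda>\<omega>. h (?W t \<omega>, ?T t \<omega>)) \<in> borel_measurable N" "(\<lambda>\<omega>. h (?V t \<omega>, ?T t \<omega>)) \<in> borel_measurable N" if "0 \<le> t" for t
    using that by (auto intro!: measurable_compose[OF _ h] measurable_Pair Wm Tm)
  have "((\<lambda>t. (\<integral>\<omega>. h (?W t \<omega>, ?T t \<omega>) \<partial>N) - (\<integral>\<omega>. h (?V t \<omega>, ?T t \<omega>) \<partial>N)) \<longlongrightarrow> 0) at_top"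
  proof (rule tendstoI)
    fix e :: real assume e: "0 < e"
    \<comment> \<open>three exceptional events of probability below \<open>\<eta>\<close>, each costing at most \<open>2 B\<close>, and an error \<open>\<eta>\<close> elsewhere
      add up to less than \<open>e\<close>\<close>
    define \<eta> where "\<eta> = e / 2 / (1 + 6 * B)"
    have nz: "1 + 6 * B \<noteq> 0" using B0 by simp
    have \<eta>: "0 < \<eta>" using e B0 by (simp add: \<eta>_def)
    have \<eta>e: "\<eta> + 2 * B * (3 * \<eta>) < e"
    proof -
      have "\<eta> + 2 * B * (3 * \<eta>) = \<eta> * (1 + 6 * B)" by (simp add: algebra_simps)
      also have "\<dots> = e / 2" by (rule nonzero_eq_divide_eq[OF nz, THEN iffD1, OF \<eta>_def])
      finally show ?thesis using e by simp
    qed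
    \<comment> \<open>tightness of the process started empty\<close>
    define \<phi> :: "nat \<Rightarrow> (real^'n) \<times> (real \<Rightarrow> real^'n) \<times> (real \<Rightarrow> 'j) \<Rightarrow> real"
      where "\<phi> b z = min 1 (max 0 (norm (fst z) - real b))" for b z
    have \<phi>m[measurable]: "\<phi> b \<in> borel_measurable (borel \<Otimes>\<^sub>M drive_space)" for b unfolding \<phi>_def[abs_def] by measurable
    have \<phi>b: "0 \<le> \<phi> b z" "\<phi> b z \<le> 1" "\<bar>\<phi> b z\<bar> \<le> 1" for b z by (auto simp: \<phi>_def)
    have "(\<lambda>b. \<integral>z. \<phi> b z \<partial>Q) \<longlonglongrightarrow> (\<integral>z. 0 \<partial>Q)"
    proof (rule integral_dominated_convergence[where w = "\<lambda>_. 1"])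
      show "AE z in Q. (\<lambda>b. \<phi> b z) \<longlonglongrightarrow> 0"
      proof (intro AE_I2 tendsto_eventually)
        fix z :: "(real^'n) \<times> (real \<Rightarrow> real^'n) \<times> (real \<Rightarrow> 'j)"
        obtain k :: nat where "norm (fst z) \<le> real k" using real_arch_simple by blast
        then show "eventually (\<lambda>b. \<phi> b z = 0) sequentially"
          by (intro eventually_sequentiallyI[of k]) (auto simp: \<phi>_def)
      qed
    qed (use \<phi>b \<phi>m in \<open>auto simp: measurable_cong_sets[OF Q_sets refl]\<close>)
    then have "eventually (\<lambda>b. (\<integral>z. \<phi> b z \<partial>Q) < \<eta>) sequentially"
      using \<eta> by (intro order_tendstoD) auto
    then obtain b where b: "(\<integral>z. \<phi> b z \<partial>Q) < \<eta>" by (auto simp: eventually_sequentially)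
    have "((\<lambda>t. \<integral>\<omega>. \<phi> b (?V t \<omega>, ?T t \<omega>) \<partial>N) \<longlongrightarrow> (\<integral>z. \<phi> b z \<partial>Q)) at_top"
      by (rule zero_start_limit[OF c \<phi>m \<phi>b(3)]) (auto simp: \<phi>_def intro!: continuous_intros)
    then have ev1: "eventually (\<lambda>t. (\<integral>\<omega>. \<phi> b (?V t \<omega>, ?T t \<omega>) \<partial>N) < \<eta>) at_top"
      using b by (rule order_tendstoD)
    \<comment> \<open>equicontinuity of the test function off a small set of driving paths\<close>
    obtain G \<delta> where G[measurable]: "G \<in> sets drive_space" and \<delta>: "0 < \<delta>" "\<delta> \<le> 1" and Gs: "measure D (space D - G) < \<eta>"
      and Gc: "\<And>\<tau> w w'. \<tau> \<in> G \<Longrightarrow> continuous_on UNIV (\<lambda>w. h (w, \<tau>)) \<Longrightarrow> norm w < real b + 2 \<Longrightarrow> norm w' < real b + 2 \<Longrightarrow>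
        dist w w' < \<delta> \<Longrightarrow> \<bar>h (w, \<tau>) - h (w', \<tau>)\<bar> \<le> \<eta>"
      by (rule uniformly_continuous_sets[OF h cont \<eta>, where c = "real b + 2"]) blast
    have GT: "(\<integral>\<omega>. indicator (space D - G) (?T t \<omega>) \<partial>N) < \<eta>" if t: "0 \<le> t" for t
    proof -
      have "(\<integral>\<omega>. indicator (space D - G) (?T t \<omega>) \<partial>N) = (\<integral>\<tau>. (indicator (space D - G) \<tau> :: real) \<partial>distr N drive_space (?T t))"
        by (rule integral_distr[symmetric, OF Tm[OF t]]) simp
      also have "\<dots> = measure D (space D - G)" unfolding distr_drive[OF c t] by (simp add: Int_absorb2)
      finally show ?thesis using Gs by simp
    qed
    \<comment> \<open>the two starts are eventually close\<close>
    let ?far = "\<lambda>t \<omega>. indicator {d. \<delta> \<le> norm d} (?W t \<omega> - ?V t \<omega>) :: real"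
    \<comment> \<open>the argument \<open>max 0 t\<close> keeps the integrand measurable at all times\<close>
    have ev3: "eventually (\<lambda>t. (\<integral>\<omega>. ?far t \<omega> \<partial>N) < \<eta>) at_top"
    proof -
      have "((\<lambda>t. \<integral>\<omega>. ?far (max 0 t) \<omega> \<partial>N) \<longlongrightarrow> (\<integral>\<omega>. 0 \<partial>N)) at_top"
      proof (rule tendsto_at_topI_sequentially)
        fix x :: "nat \<Rightarrow> real" assume x: "filterlim x at_top sequentially"
        then have x': "filterlim (\<lambda>m. max 0 (x m)) at_top sequentially"
          by (rule filterlim_at_top_mono) simp
        show "(\<lambda>m. \<integral>\<omega>. ?far (max 0 (x m)) \<omega> \<partial>N) \<longlonglongrightarrow> (\<integral>\<omega>. 0 \<partial>N)"
        proof (rule integral_dominated_convergence[where w = "\<lambda>_. 1"])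
          show "AE \<omega> in N. (\<lambda>m. ?far (max 0 (x m)) \<omega>) \<longlonglongrightarrow> 0"
            using start_irrelevant[OF c]
          proof eventually_elim
            case (elim \<omega>)
            then have "((\<lambda>t. ?W t \<omega> - ?V t \<omega>) \<longlongrightarrow> 0) at_top" by blast
            from tendstoD[OF filterlim_compose[OF this x'] \<delta>(1)]
            have "eventually (\<lambda>m. ?far (max 0 (x m)) \<omega> = 0) sequentially"
              by eventually_elim (simp add: indicator_def)
            then show ?case by (rule tendsto_eventually)
          qed
          show "?far (max 0 (x m)) \<in> borel_measurable N" for m
            by (rule measurable_compose[OF borel_measurable_diff[OF Wm]]) auto
        qed (auto simp: indicator_def)
      qed
      then have "eventually (\<lambda>t. (\<integral>\<omega>. ?far (max 0 t) \<omega> \<partial>N) < \<eta>) at_top"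
        using \<eta> by (intro order_tendstoD) auto
      then show ?thesis using eventually_ge_at_top[of 0] by eventually_elim (simp add: max_def)
    qed
    show "eventually (\<lambda>t. dist ((\<integral>\<omega>. h (?W t \<omega>, ?T t \<omega>) \<partial>N) - (\<integral>\<omega>. h (?V t \<omega>, ?T t \<omega>) \<partial>N)) 0 < e) at_top"
      using ev1 ev3 eventually_ge_at_top[of 0]
    proof eventually_elim
      case (elim t)
      have ib: "integrable N f" if "f \<in> borel_measurable N" "\<And>\<omega>. \<bar>f \<omega>\<bar> \<le> r" for f :: "_ \<Rightarrow> real" and r
        using that by (intro N.integrable_const_bound[where B = r]) auto
      have i1: "integrable N (\<lambda>\<omega>. h (?W t \<omega>, ?T t \<omega>))" "integrable N (\<lambda>\<omega>. h (?V t \<omega>, ?T t \<omega>))"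
        by (rule ib[OF hW(1)[OF elim(3)] B], rule ib[OF hW(2)[OF elim(3)] B])
      have i2: "integrable N (\<lambda>\<omega>. \<phi> b (?V t \<omega>, ?T t \<omega>))"
        by (rule ib[OF measurable_compose[OF measurable_Pair[OF Wm(2)[OF elim(3)] Tm[OF elim(3)]] \<phi>m] \<phi>b(3)])
      have ind: "\<bar>indicator S x :: real\<bar> \<le> 1" for S :: "'q set" and x by (simp add: indicator_def)
      have i3: "integrable N (\<lambda>\<omega>. indicator (space D - G) (?T t \<omega>) :: real)"
        by (rule ib[OF measurable_compose[OF Tm[OF elim(3)]] ind]) simp
      have i4: "integrable N (?far t)"
        by (rule ib[OF measurable_compose[OF borel_measurable_diff[OF Wm[OF elim(3)]]] ind]) simp
      \<comment> \<open>each of the three terms in parentheses is at least one when its exceptional event occurs\<close>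
      let ?bd = "\<lambda>\<omega>. \<eta> + 2 * B * (\<phi> b (?V t \<omega>, ?T t \<omega>) + indicator (space D - G) (?T t \<omega>) + ?far t \<omega>)"
      have contT: "AE \<omega> in N. continuous_on UNIV (\<lambda>w. h (w, ?T t \<omega>))"
        by (rule AE_distrD[OF Tm[OF elim(3)]]) (unfold distr_drive[OF c elim(3)], rule cont)
      have ptw: "AE \<omega> in N. \<bar>h (?W t \<omega>, ?T t \<omega>) - h (?V t \<omega>, ?T t \<omega>)\<bar> \<le> ?bd \<omega>"
        using contT AE_space
      proof eventually_elim
        case (elim \<omega>)
        let ?s = "\<phi> b (?V t \<omega>, ?T t \<omega>) + indicator (space D - G) (?T t \<omega>) + ?far t \<omega>"
        have s0: "0 \<le> ?s" using \<phi>b(1) by (simp add: indicator_def)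
        have hb: "\<bar>h (?W t \<omega>, ?T t \<omega>) - h (?V t \<omega>, ?T t \<omega>)\<bar> \<le> 2 * B"
          using B[of "(?W t \<omega>, ?T t \<omega>)"] B[of "(?V t \<omega>, ?T t \<omega>)"] by linarith
        show ?case
        proof (cases "1 \<le> ?s")
          case True
          then have "2 * B * 1 \<le> 2 * B * ?s" using B0 by (intro mult_left_mono) auto
          then show ?thesis using hb \<eta> by linarith
        next
          case False
          have ind01: "indicator S x = (0::real) \<or> indicator S x = (1::real)" for S :: "'q set" and x
            by (simp add: indicator_def)
          have three: "a < 1 \<and> b = 0 \<and> c = 0" if "\<not> 1 \<le> a + b + c" "0 \<le> a" "b = 0 \<or> b = 1" "c = 0 \<or> c = 1" for a b c :: real
            using that by (elim disjE) auto
          have "\<phi> b (?V t \<omega>, ?T t \<omega>) < 1 \<and> indicator (space D - G) (?T t \<omega>) = (0::real) \<and> ?far t \<omega> = 0"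
            by (rule three[OF False \<phi>b(1) ind01 ind01])
          then have "\<phi> b (?V t \<omega>, ?T t \<omega>) < 1" "?T t \<omega> \<notin> space D - G" "?far t \<omega> = 0"
            by (auto simp: indicator_eq_0_iff simp del: Diff_iff)
          then have nV: "norm (?V t \<omega>) < real b + 1" and nd: "norm (?W t \<omega> - ?V t \<omega>) < \<delta>"
            by (auto simp: \<phi>_def indicator_def split: if_splits)
          have "?T t \<omega> \<in> G" using \<open>?T t \<omega> \<notin> space D - G\<close> measurable_space[OF Tm[OF \<open>0 \<le> t\<close>] elim(2)] by simp
          moreover have "norm (?W t \<omega>) < real b + 2"
            using nV nd \<delta>(2) norm_triangle_ineq[of "?W t \<omega> - ?V t \<omega>" "?V t \<omega>"] by simp
          ultimately have "\<bar>h (?W t \<omega>, ?T t \<omega>) - h (?V t \<omega>, ?T t \<omega>)\<bar> \<le> \<eta>"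
            using nV nd elim(1) by (intro Gc) (auto simp: dist_norm)
          moreover have "0 \<le> 2 * B * ?s" using B0 s0 by (intro mult_nonneg_nonneg) auto
          ultimately show ?thesis by linarith
        qed
      qed
      have "\<bar>(\<integral>\<omega>. h (?W t \<omega>, ?T t \<omega>) \<partial>N) - (\<integral>\<omega>. h (?V t \<omega>, ?T t \<omega>) \<partial>N)\<bar> =
          \<bar>\<integral>\<omega>. h (?W t \<omega>, ?T t \<omega>) - h (?V t \<omega>, ?T t \<omega>) \<partial>N\<bar>"
        using i1 by simp
      also have "\<dots> \<le> (\<integral>\<omega>. \<bar>h (?W t \<omega>, ?T t \<omega>) - h (?V t \<omega>, ?T t \<omega>)\<bar> \<partial>N)" by (rule integral_abs_bound)
      also have "\<dots> \<le> (\<integral>\<omega>. ?bd \<omega> \<partial>N)"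
        by (rule integral_mono_AE[OF _ _ ptw]) (use i1 i2 i3 i4 in \<open>auto intro!: Bochner_Integration.integrable_add integrable_mult_right\<close>)
      also have "\<dots> = \<eta> + 2 * B * ((\<integral>\<omega>. \<phi> b (?V t \<omega>, ?T t \<omega>) \<partial>N) + (\<integral>\<omega>. indicator (space D - G) (?T t \<omega>) \<partial>N) + (\<integral>\<omega>. ?far t \<omega> \<partial>N))"
        using i2 i3 i4 by (simp add: N.prob_space)
      also have "\<dots> \<le> \<eta> + 2 * B * (3 * \<eta>)"
        using elim(1,2) GT[OF elim(3)] B0 by (intro add_left_mono mult_left_mono) auto
      finally show ?case using \<eta>e by simp
    qed
  qed
  from tendsto_add[OF this zero_start_limit[OF c h B cont]] show ?thesis by simp
qed

end

end

section \<open>Transport of equality in law\<close>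

text \<open>
  The two images are prescribed as functions on the sample spaces, which need to agree with the
  transformation pointwise only.
\<close>
lemma same_law_map:
  assumes "same_law S M A N B" "g \<in> measurable S S'"
    and "\<And>\<omega>. \<omega> \<in> space M \<Longrightarrow> A' \<omega> = g (A \<omega>)" "\<And>\<omega>. \<omega> \<in> space N \<Longrightarrow> B' \<omega> = g (B \<omega>)"
  shows "same_law S' M A' N B'"
proof -
  have m: "A \<in> measurable M S" "B \<in> measurable N S" and e: "distr M S A = distr N S B"
    using assms(1) by (auto simp: same_law_def)
  have "A' \<in> measurable M S'" "B' \<in> measurable N S'"
    using measurable_compose[OF m(1) assms(2)] measurable_compose[OF m(2) assms(2)] assms(3,4)
    by (simp_all cong: measurable_cong)
  moreover have "distr M S' A' = distr (distr M S A) S' g"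
    by (subst distr_distr[OF assms(2) m(1)]) (intro distr_cong refl, simp add: assms(3))
  moreover have "distr N S' B' = distr (distr N S B) S' g"
    by (subst distr_distr[OF assms(2) m(2)]) (intro distr_cong refl, simp add: assms(4))
  ultimately show ?thesis by (simp add: same_law_def e)
qed

lemma same_law_sym: "same_law S M A N B \<Longrightarrow> same_law S N B M A"
  by (simp add: same_law_def)

lemma same_law_trans: "same_law S M A N B \<Longrightarrow> same_law S N B L C \<Longrightarrow> same_law S M A L C"
  by (simp add: same_law_def)

lemma measurable_path_coordinate: "t \<in> T \<Longrightarrow> (\<lambda>f. f t) \<in> borel_measurable (path_space T)"
  unfolding path_space_def by (rule measurable_component_singleton)

lemma same_process_law_map:
  assumes "same_process_law M Z N Z'" "\<phi> \<in> borel_measurable borel"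
  shows "same_process_law M (\<lambda>t \<omega>. \<phi> (Z t \<omega>)) N (\<lambda>t \<omega>. \<phi> (Z' t \<omega>))"
  unfolding same_process_law_def
proof (rule same_law_map[OF assms(1)[unfolded same_process_law_def]])
  show "(\<lambda>f. \<lambda>t\<in>{0..}. \<phi> (f t)) \<in> measurable (path_space {0..}) (path_space {0..})"
    by (intro measurable_path_spaceI measurable_compose[OF measurable_path_coordinate assms(2)])
qed (auto simp: traj_def fun_eq_iff restrict_def)

lemma measurable_trajI:
  assumes "\<And>t. 0 \<le> t \<Longrightarrow> Z t \<in> borel_measurable M"
  shows "traj {0..} Z \<in> measurable M (path_space {0..})"
  unfolding traj_def[abs_def] using assms by (intro measurable_path_spaceI) auto

text \<open>
  Recovers the driving pair from the trajectory of the joint process \<open>(X, J)\<close>, or equally from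
  that of \<open>(X - X(0), J)\<close>.
\<close>
definition pair_drive :: "(real \<Rightarrow> (real^'n) \<times> 'j) \<Rightarrow> (real \<Rightarrow> real^'n) \<times> (real \<Rightarrow> 'j)" where
  "pair_drive f = (\<lambda>t\<in>{0..}. fst (f t) - fst (f 0), \<lambda>t\<in>{0..}. snd (f t))"

lemma borel_measurable_fst_snd:
  "fst \<in> borel_measurable (borel :: ('b::second_countable_topology \<times> 'c::second_countable_topology) measure)"
  "snd \<in> borel_measurable (borel :: ('b::second_countable_topology \<times> 'c::second_countable_topology) measure)"
  by (auto intro!: borel_measurable_continuous_onI continuous_intros)

lemma measurable_pair_drive:
  "(pair_drive :: (real \<Rightarrow> (real^'n) \<times> 'j::polish_space) \<Rightarrow> _) \<in> measurable (path_space {0..}) drive_space"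
  unfolding pair_drive_def[abs_def] drive_space_def
  by (intro measurable_Pair measurable_path_spaceI borel_measurable_diff
      measurable_compose[OF measurable_path_coordinate borel_measurable_fst_snd(1)]
      measurable_compose[OF measurable_path_coordinate borel_measurable_fst_snd(2)]) auto

lemma pair_drive_traj: "pair_drive (traj {0..} (\<lambda>t \<omega>. (Y t \<omega>, K t \<omega>)) \<omega>) = drive 0 Y K \<omega>"
  by (auto simp: pair_drive_def drive_def traj_def incr_def fun_eq_iff restrict_def)

lemma pair_drive_traj_incr: "pair_drive (traj {0..} (\<lambda>t \<omega>. (incr s Y t \<omega>, K (s + t) \<omega>)) \<omega>) = drive s Y K \<omega>"
  by (auto simp: pair_drive_def drive_def traj_def incr_def fun_eq_iff restrict_def)

lemma drive_incr: "drive 0 (incr 0 Y) K \<omega> = drive 0 Y K \<omega>"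
  by (auto simp: drive_def traj_def incr_def fun_eq_iff restrict_def)

section \<open>Invariance and uniqueness of the limit law\<close>

context stationary_driver
begin

text \<open>
  The set of cadlag paths is not measurable in the product space; boundedness from below on a
  skeleton is a measurable substitute and suffices for continuity in the state.
\<close>
lemma AE_lower_bounded:
  assumes s: "0 \<le> s"
  shows "AE \<tau> in D. lower_bounded (skeleton s) (fst \<tau>)"
proof -
  let ?S = "drive_space :: ((real \<Rightarrow> real^'n) \<times> (real \<Rightarrow> 'j)) measure"
  have "skeleton s \<noteq> {}" using skeleton_self by blast
  then obtain a :: "nat \<Rightarrow> real" where a: "range a = skeleton s"
    using range_from_nat_into[OF _ countable_skeleton] by blast
  have a0: "0 \<le> a k" for k using a skeleton_subset[OF s] by (metis atLeastAtMost_iff rangeI subsetD)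
  have iff: "lower_bounded (skeleton s) y \<longleftrightarrow> (\<exists>c::nat. \<forall>k i. - real c \<le> y (a k) $ i)" for y :: "real \<Rightarrow> real^'n"
    by (subst lower_bounded_skeleton_iff[OF s]) (simp flip: a)
  have [measurable]: "(\<lambda>\<tau>. fst \<tau> (a k)) \<in> borel_measurable ?S" for k
    by (rule measurable_drive_space_eval[OF a0])
  have m: "{\<tau>\<in>space ?S. lower_bounded (skeleton s) (fst \<tau>)} \<in> sets ?S"
    unfolding iff by measurable
  show ?thesis unfolding D_eq
  proof (subst AE_distr_iff[OF M_meas m], rule AE_I2)
    fix \<omega> assume \<omega>: "\<omega> \<in> space M"
    have "lower_bounded (skeleton s) (\<lambda>u. incr 0 X u \<omega>)"
      by (rule lower_bounded_skeleton[OF s cadlag_lower_bounded[OF carries_cadlag[OF carries_M \<omega>]]]) simp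
    then show "lower_bounded (skeleton s) (fst (drive 0 X J \<omega>))"
      using skeleton_subset[OF s] unfolding lower_bounded_def drive_def traj_def by (auto simp: subset_eq)
  qed
qed

text \<open>
  The later development of the state and the background process, as a function of the present state
  and the driving pair ahead.
\<close>
definition WK_path :: "(real^'n) \<times> (real \<Rightarrow> real^'n) \<times> (real \<Rightarrow> 'j) \<Rightarrow> real \<Rightarrow> (real^'n) \<times> 'j" where
  "WK_path z = (\<lambda>t\<in>{0..}. (Wf t (fst z) (fst (snd z)), snd (snd z) t))"

definition full_path :: "(real^'n) \<times> (real \<Rightarrow> real^'n) \<times> (real \<Rightarrow> 'j) \<Rightarrow> real \<Rightarrow> (real^'n) \<times> (real^'n) \<times> (real^'n) \<times> 'j" where
  "full_path z = (\<lambda>t\<in>{0..}. (Wf t (fst z) (fst (snd z)), Lf t (fst z) (fst (snd z)), fst (snd z) t, snd (snd z) t))"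

lemma measurable_flow_coordinates:
  assumes "0 \<le> t"
  shows "(\<lambda>z. Wf t (fst z) (fst (snd z))) \<in> borel_measurable (borel \<Otimes>\<^sub>M (drive_space :: ((real \<Rightarrow> real^'n) \<times> (real \<Rightarrow> 'j)) measure))"
    "(\<lambda>z. Lf t (fst z) (fst (snd z))) \<in> borel_measurable (borel \<Otimes>\<^sub>M (drive_space :: ((real \<Rightarrow> real^'n) \<times> (real \<Rightarrow> 'j)) measure))"
    "(\<lambda>z. fst (snd z) t) \<in> borel_measurable ((borel :: (real^'n) measure) \<Otimes>\<^sub>M (drive_space :: ((real \<Rightarrow> real^'n) \<times> (real \<Rightarrow> 'j)) measure))"
    "(\<lambda>z. snd (snd z) t) \<in> borel_measurable ((borel :: (real^'n) measure) \<Otimes>\<^sub>M (drive_space :: ((real \<Rightarrow> real^'n) \<times> (real \<Rightarrow> 'j)) measure))"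
  using assms
  by (auto intro!: measurable_Wf measurable_Lf measurable_fst
      measurable_compose[OF measurable_snd measurable_fst_drive_space(1)]
      measurable_compose[OF measurable_snd measurable_drive_space_eval(1)]
      measurable_compose[OF measurable_snd measurable_drive_space_eval(2)])

lemma measurable_WK_path:
  "WK_path \<in> measurable (borel \<Otimes>\<^sub>M drive_space) (path_space {0..})"
  unfolding WK_path_def[abs_def]
  by (intro measurable_path_spaceI borel_measurable_Pair measurable_flow_coordinates) auto

lemma measurable_full_path:
  "full_path \<in> measurable (borel \<Otimes>\<^sub>M drive_space) (path_space {0..})"
  unfolding full_path_def[abs_def]
  by (intro measurable_path_spaceI borel_measurable_Pair measurable_flow_coordinates) auto

context
  fixes Q assumes Q: "limit_law Q"
begin

text \<open>
  Advancing by \<open>s\<close> turns the pair at time \<open>t\<close> into the pair at time \<open>s + t\<close>, which has the same limit.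
  That advancing preserves continuity of test functions in the state is \<open>Wf_continuous\<close>.
\<close>
lemma limit_law_invariant:
  assumes s: "0 \<le> s"
  shows "distr Q (borel \<Otimes>\<^sub>M drive_space) (\<lambda>z. (Wf s (fst z) (fst (snd z)), advance s (snd z))) = Q"
proof -
  let ?S = "drive_space :: ((real \<Rightarrow> real^'n) \<times> (real \<Rightarrow> 'j)) measure"
  let ?st = "\<lambda>z. (Wf s (fst z) (fst (snd z)), advance s (snd z))"
  interpret Q: prob_space Q by (rule Q_prob[OF Q])
  have stm: "?st \<in> measurable Q (borel \<Otimes>\<^sub>M ?S)"
    using measurable_step[OF s] by (simp add: measurable_cong_sets[OF Q_sets[OF Q] refl])
  show ?thesis
  proof (rule pair_law_eqI[where S = ?S])
    show "prob_space (distr Q (borel \<Otimes>\<^sub>M ?S) ?st)" by (rule Q.prob_space_distr[OF stm])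
    fix f :: "real^'n \<Rightarrow> real" and A
    assume f: "continuous_on UNIV f" "\<And>x. 0 \<le> f x" "\<And>x. f x \<le> 1" and A: "A \<in> sets ?S"
    define g where "g z = f (fst z) * indicator A (snd z)" for z
    have fm: "f \<in> borel_measurable borel" using f(1) by (rule borel_measurable_continuous_onI)
    have gm: "g \<in> borel_measurable (borel \<Otimes>\<^sub>M ?S)"
    proof -
      note [measurable] = fm A
      show ?thesis unfolding g_def[abs_def] by measurable
    qed
    have hm: "(\<lambda>z. g (?st z)) \<in> borel_measurable (borel \<Otimes>\<^sub>M ?S)"
      by (rule measurable_compose[OF measurable_step[OF s] gm])
    have gb: "\<bar>g z\<bar> \<le> 1" for z using f(2,3) by (auto simp: g_def indicator_def abs_mult)
    have gc: "AE \<tau> in D. continuous_on UNIV (\<lambda>w. g (w, \<tau>))"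
      by (simp add: g_def continuous_on_mult_right f(1))
    have hc: "AE \<tau> in D. continuous_on UNIV (\<lambda>w. g (?st (w, \<tau>)))"
      using AE_lower_bounded[OF s]
    proof eventually_elim
      case (elim \<tau>)
      have "continuous_on UNIV (\<lambda>w. f (Wf s w (fst \<tau>)))"
        by (rule continuous_on_compose2[OF f(1) Wf_continuous[OF elim]]) simp
      then show ?case by (simp add: g_def continuous_on_mult_right)
    qed
    have l1: "((\<lambda>t. \<integral>\<omega>. g (?st (Wf t 0 (fst (drive 0 X J \<omega>)), drive t X J \<omega>)) \<partial>M) \<longlongrightarrow> (\<integral>z. g (?st z) \<partial>Q)) at_top"
      by (rule zero_start_limit[OF Q carries_M hm gb hc])
    have l2: "((\<lambda>t. \<integral>\<omega>. g (Wf t 0 (fst (drive 0 X J \<omega>)), drive t X J \<omega>) \<partial>M) \<longlongrightarrow> (\<integral>z. g z \<partial>Q)) at_top"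
      by (rule zero_start_limit[OF Q carries_M gm gb gc])
    have "filterlim (\<lambda>t. s + t) at_top at_top"
      by (rule filterlim_tendsto_add_at_top[OF tendsto_const filterlim_ident])
    from filterlim_compose[OF l2 this]
    have l3: "((\<lambda>t. \<integral>\<omega>. g (Wf (s + t) 0 (fst (drive 0 X J \<omega>)), drive (s + t) X J \<omega>) \<partial>M) \<longlongrightarrow> (\<integral>z. g z \<partial>Q)) at_top" .
    have "eventually (\<lambda>t. (\<integral>\<omega>. g (Wf (s + t) 0 (fst (drive 0 X J \<omega>)), drive (s + t) X J \<omega>) \<partial>M) =
        (\<integral>\<omega>. g (?st (Wf t 0 (fst (drive 0 X J \<omega>)), drive t X J \<omega>)) \<partial>M)) at_top"
      using eventually_ge_at_top[of 0]
    proof eventually_elim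
      case (elim t)
      show ?case
      proof (rule Bochner_Integration.integral_cong[OF refl])
        fix \<omega> assume \<omega>: "\<omega> \<in> space M"
        have "Wf (t + s) 0 (fst (drive 0 X J \<omega>)) = Wf s (Wf t 0 (fst (drive 0 X J \<omega>))) (fst (drive (0 + t) X J \<omega>))"
          by (rule Wf_flow[OF carries_M \<omega> order_refl elim s])
        then show "g (Wf (s + t) 0 (fst (drive 0 X J \<omega>)), drive (s + t) X J \<omega>) =
            g (?st (Wf t 0 (fst (drive 0 X J \<omega>)), drive t X J \<omega>))"
          by (simp add: advance_drive[OF s] add.commute)
      qed
    qed
    from Lim_transform_eventually[OF l3 this]
    have "(\<integral>z. g z \<partial>Q) = (\<integral>z. g (?st z) \<partial>Q)"
      using l1 by (intro tendsto_unique[OF trivial_limit_at_top_linorder])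
    moreover have "(\<integral>z. g (?st z) \<partial>Q) = (\<integral>z. g z \<partial>distr Q (borel \<Otimes>\<^sub>M ?S) ?st)"
      by (rule integral_distr[symmetric, OF stm gm])
    ultimately show "(\<integral>z. f (fst z) * indicator A (snd z) \<partial>distr Q (borel \<Otimes>\<^sub>M ?S) ?st) =
        (\<integral>z. f (fst z) * indicator A (snd z) \<partial>Q)"
      by (simp add: g_def)
  qed (simp_all add: Q_prob[OF Q] Q_sets[OF Q])
qed

lemma step_law:
  assumes c: "carries N Y K" and \<xi>: "\<xi> \<in> borel_measurable N"
    and law: "distr N (borel \<Otimes>\<^sub>M drive_space) (\<lambda>\<omega>. (\<xi> \<omega>, drive 0 Y K \<omega>)) = Q" and s: "0 \<le> s"
  shows "distr N (borel \<Otimes>\<^sub>M drive_space) (\<lambda>\<omega>. (Wf s (\<xi> \<omega>) (fst (drive 0 Y K \<omega>)), drive s Y K \<omega>)) = Q"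
proof -
  let ?S = "drive_space :: ((real \<Rightarrow> real^'n) \<times> (real \<Rightarrow> 'j)) measure"
  have m: "(\<lambda>\<omega>. (\<xi> \<omega>, drive 0 Y K \<omega>)) \<in> measurable N (borel \<Otimes>\<^sub>M ?S)"
    by (intro measurable_Pair \<xi> measurable_drive[OF c]) simp
  have "distr N (borel \<Otimes>\<^sub>M ?S) (\<lambda>\<omega>. (Wf s (\<xi> \<omega>) (fst (drive 0 Y K \<omega>)), drive s Y K \<omega>)) =
      distr (distr N (borel \<Otimes>\<^sub>M ?S) (\<lambda>\<omega>. (\<xi> \<omega>, drive 0 Y K \<omega>))) (borel \<Otimes>\<^sub>M ?S)
        (\<lambda>z. (Wf s (fst z) (fst (snd z)), advance s (snd z)))"
    by (subst distr_distr[OF measurable_step[OF s] m]) (simp add: comp_def advance_drive[OF s])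
  then show ?thesis unfolding law limit_law_invariant[OF s] .
qed

text \<open>
  Under invariance the expectations in \<open>start_limit\<close> do not change with time, so they equal their
  limit.
\<close>
lemma invariant_imp_limit_law:
  assumes c: "carries N Y K" and \<xi>: "\<xi> \<in> borel_measurable N"
    and inv: "\<And>s. 0 \<le> s \<Longrightarrow>
      distr N (borel \<Otimes>\<^sub>M drive_space) (\<lambda>\<omega>. (Wf s (\<xi> \<omega>) (fst (drive 0 Y K \<omega>)), drive s Y K \<omega>)) =
      distr N (borel \<Otimes>\<^sub>M drive_space) (\<lambda>\<omega>. (\<xi> \<omega>, drive 0 Y K \<omega>))"
  shows "distr N (borel \<Otimes>\<^sub>M drive_space) (\<lambda>\<omega>. (\<xi> \<omega>, drive 0 Y K \<omega>)) = Q"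
proof -
  let ?S = "drive_space :: ((real \<Rightarrow> real^'n) \<times> (real \<Rightarrow> 'j)) measure"
  interpret N: prob_space N using c by (simp add: carries_def cadlag_process_def)
  have m: "(\<lambda>\<omega>. (\<xi> \<omega>, drive 0 Y K \<omega>)) \<in> measurable N (borel \<Otimes>\<^sub>M ?S)"
    by (intro measurable_Pair \<xi> measurable_drive[OF c]) simp
  show ?thesis
  proof (rule pair_law_eqI[where S = ?S])
    show "prob_space (distr N (borel \<Otimes>\<^sub>M ?S) (\<lambda>\<omega>. (\<xi> \<omega>, drive 0 Y K \<omega>)))" by (rule N.prob_space_distr[OF m])
    fix f :: "real^'n \<Rightarrow> real" and A
    assume f: "continuous_on UNIV f" "\<And>x. 0 \<le> f x" "\<And>x. f x \<le> 1" and A: "A \<in> sets ?S"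
    define g where "g z = f (fst z) * indicator A (snd z)" for z
    have fm: "f \<in> borel_measurable borel" using f(1) by (rule borel_measurable_continuous_onI)
    have gm: "g \<in> borel_measurable (borel \<Otimes>\<^sub>M ?S)"
    proof -
      note [measurable] = fm A
      show ?thesis unfolding g_def[abs_def] by measurable
    qed
    have gb: "\<bar>g z\<bar> \<le> 1" for z using f(2,3) by (auto simp: g_def indicator_def abs_mult)
    have gc: "AE \<tau> in D. continuous_on UNIV (\<lambda>w. g (w, \<tau>))"
      by (simp add: g_def continuous_on_mult_right f(1))
    have "((\<lambda>t. \<integral>\<omega>. g (Wf t (\<xi> \<omega>) (fst (drive 0 Y K \<omega>)), drive t Y K \<omega>) \<partial>N) \<longlongrightarrow> (\<integral>z. g z \<partial>Q)) at_top"
      by (rule start_limit[OF Q c \<xi> gm gb gc])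
    moreover have "eventually (\<lambda>t. (\<integral>\<omega>. g (Wf t (\<xi> \<omega>) (fst (drive 0 Y K \<omega>)), drive t Y K \<omega>) \<partial>N) =
        (\<integral>z. g z \<partial>distr N (borel \<Otimes>\<^sub>M ?S) (\<lambda>\<omega>. (\<xi> \<omega>, drive 0 Y K \<omega>)))) at_top"
      using eventually_ge_at_top[of 0]
    proof eventually_elim
      case (elim t)
      show ?case unfolding inv[OF elim, symmetric]
        by (rule integral_distr[symmetric, OF measurable_start_step[OF c \<xi> elim] gm])
    qed
    ultimately have "((\<lambda>t. \<integral>z. g z \<partial>distr N (borel \<Otimes>\<^sub>M ?S) (\<lambda>\<omega>. (\<xi> \<omega>, drive 0 Y K \<omega>))) \<longlongrightarrow> (\<integral>z. g z \<partial>Q)) (at_top :: real filter)"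
      by (rule Lim_transform_eventually)
    then have "(\<integral>z. g z \<partial>distr N (borel \<Otimes>\<^sub>M ?S) (\<lambda>\<omega>. (\<xi> \<omega>, drive 0 Y K \<omega>))) = (\<integral>z. g z \<partial>Q)"
      by (simp add: tendsto_const_iff trivial_limit_at_top_linorder)
    then show "(\<integral>z. f (fst z) * indicator A (snd z) \<partial>distr N (borel \<Otimes>\<^sub>M ?S) (\<lambda>\<omega>. (\<xi> \<omega>, drive 0 Y K \<omega>))) =
        (\<integral>z. f (fst z) * indicator A (snd z) \<partial>Q)"
      by (simp add: g_def)
  qed (simp_all add: Q_prob[OF Q] Q_sets[OF Q])
qed

text \<open>
  Stationarity of the reflected process with \<open>K\<close>, without reference to the driving path, still makes the
  expectations constant for test functions of the development, and these identify its law.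
\<close>
lemma stationary_imp_path_law:
  assumes c: "carries N Y K" and \<xi>: "\<xi> \<in> borel_measurable N"
    and st: "\<And>s. 0 \<le> s \<Longrightarrow>
      distr N (path_space {0..}) (\<lambda>\<omega>. WK_path (Wf s (\<xi> \<omega>) (fst (drive 0 Y K \<omega>)), drive s Y K \<omega>)) =
      distr N (path_space {0..}) (\<lambda>\<omega>. WK_path (\<xi> \<omega>, drive 0 Y K \<omega>))"
  shows "distr N (path_space {0..}) (\<lambda>\<omega>. WK_path (\<xi> \<omega>, drive 0 Y K \<omega>)) = distr Q (path_space {0..}) WK_path"
proof -
  let ?S = "drive_space :: ((real \<Rightarrow> real^'n) \<times> (real \<Rightarrow> 'j)) measure"
  let ?P = "path_space {0..} :: (real \<Rightarrow> (real^'n) \<times> 'j) measure"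
  interpret N: prob_space N using c by (simp add: carries_def cadlag_process_def)
  interpret Q: prob_space Q by (rule Q_prob[OF Q])
  have m0: "(\<lambda>\<omega>. (\<xi> \<omega>, drive 0 Y K \<omega>)) \<in> measurable N (borel \<Otimes>\<^sub>M ?S)"
    by (intro measurable_Pair \<xi> measurable_drive[OF c]) simp
  have m: "(\<lambda>\<omega>. WK_path (\<xi> \<omega>, drive 0 Y K \<omega>)) \<in> measurable N ?P"
    by (rule measurable_compose[OF m0 measurable_WK_path])
  have mQ: "WK_path \<in> measurable Q ?P"
    using measurable_WK_path by (simp add: measurable_cong_sets[OF Q_sets[OF Q] refl])
  show ?thesis
  proof (rule path_law_eqI[where T = "{0..}"])
    show "prob_space (distr N ?P (\<lambda>\<omega>. WK_path (\<xi> \<omega>, drive 0 Y K \<omega>)))" by (rule N.prob_space_distr[OF m])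
    show "prob_space (distr Q ?P WK_path)" by (rule Q.prob_space_distr[OF mQ])
    fix F :: "real set" and g :: "real \<Rightarrow> (real^'n) \<times> 'j \<Rightarrow> real"
    assume F: "finite F" "F \<subseteq> {0..}" and g: "\<And>t. continuous_on UNIV (g t)" "\<And>t x. 0 \<le> g t x" "\<And>t x. g t x \<le> 1"
    define H where "H f = (\<Prod>t\<in>F. g t (f t))" for f :: "real \<Rightarrow> (real^'n) \<times> 'j"
    have Hm: "H \<in> borel_measurable ?P"
      unfolding H_def[abs_def] using F
      by (intro borel_measurable_prod measurable_compose[OF measurable_path_coordinate borel_measurable_continuous_onI[OF g(1)]]) auto
    have hm: "(\<lambda>z. H (WK_path z)) \<in> borel_measurable (borel \<Otimes>\<^sub>M ?S)"
      by (rule measurable_compose[OF measurable_WK_path Hm])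
    have hb: "\<bar>H (WK_path z)\<bar> \<le> 1" for z
    proof -
      have "0 \<le> H (WK_path z)" unfolding H_def by (intro prod_nonneg g(2))
      moreover have "H (WK_path z) \<le> 1" unfolding H_def by (intro prod_le_1 conjI g(2,3))
      ultimately show ?thesis by simp
    qed
    have "AE \<tau> in D. \<forall>t\<in>F. lower_bounded (skeleton t) (fst \<tau>)"
      using F by (subst AE_finite_all) (auto intro!: AE_lower_bounded)
    then have hc: "AE \<tau> in D. continuous_on UNIV (\<lambda>w. H (WK_path (w, \<tau>)))"
    proof eventually_elim
      case (elim \<tau>)
      have "continuous_on UNIV (\<lambda>w. \<Prod>t\<in>F. g t (Wf t w (fst \<tau>), snd \<tau> t))"
      proof (rule continuous_on_prod)
        fix t assume t: "t \<in> F"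
        have "continuous_on UNIV (\<lambda>w. (Wf t w (fst \<tau>), snd \<tau> t))"
          using elim t by (intro continuous_on_Pair Wf_continuous continuous_on_const) auto
        then show "continuous_on UNIV (\<lambda>w. g t (Wf t w (fst \<tau>), snd \<tau> t))"
          by (rule continuous_on_compose2[OF g(1)]) simp
      qed
      moreover have "H (WK_path (w, \<tau>)) = (\<Prod>t\<in>F. g t (Wf t w (fst \<tau>), snd \<tau> t))" for w
        unfolding H_def using F by (intro prod.cong refl) (auto simp: WK_path_def)
      ultimately show ?case by simp
    qed
    have "((\<lambda>t. \<integral>\<omega>. H (WK_path (Wf t (\<xi> \<omega>) (fst (drive 0 Y K \<omega>)), drive t Y K \<omega>)) \<partial>N) \<longlongrightarrow> (\<integral>z. H (WK_path z) \<partial>Q)) at_top"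
      by (rule start_limit[OF Q c \<xi> hm hb hc])
    moreover have "eventually (\<lambda>t. (\<integral>\<omega>. H (WK_path (Wf t (\<xi> \<omega>) (fst (drive 0 Y K \<omega>)), drive t Y K \<omega>)) \<partial>N) =
        (\<integral>f. H f \<partial>distr N ?P (\<lambda>\<omega>. WK_path (\<xi> \<omega>, drive 0 Y K \<omega>)))) at_top"
      using eventually_ge_at_top[of 0]
    proof eventually_elim
      case (elim t)
      show ?case unfolding st[OF elim, symmetric]
        by (rule integral_distr[symmetric, OF measurable_compose[OF measurable_start_step[OF c \<xi> elim] measurable_WK_path] Hm])
    qed
    ultimately have "((\<lambda>t. \<integral>f. H f \<partial>distr N ?P (\<lambda>\<omega>. WK_path (\<xi> \<omega>, drive 0 Y K \<omega>))) \<longlongrightarrow> (\<integral>z. H (WK_path z) \<partial>Q)) (at_top :: real filter)"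
      by (rule Lim_transform_eventually)
    then have "(\<integral>f. H f \<partial>distr N ?P (\<lambda>\<omega>. WK_path (\<xi> \<omega>, drive 0 Y K \<omega>))) = (\<integral>z. H (WK_path z) \<partial>Q)"
      by (simp add: tendsto_const_iff trivial_limit_at_top_linorder)
    also have "\<dots> = (\<integral>f. H f \<partial>distr Q ?P WK_path)" by (rule integral_distr[symmetric, OF mQ Hm])
    finally show "(\<integral>f. (\<Prod>t\<in>F. g t (f t)) \<partial>distr N ?P (\<lambda>\<omega>. WK_path (\<xi> \<omega>, drive 0 Y K \<omega>))) =
        (\<integral>f. (\<Prod>t\<in>F. g t (f t)) \<partial>distr Q ?P WK_path)"
      by (simp add: H_def)
  qed simp_all
qed

text \<open>
  The enlargement carries an independent uniform variable, stored in the vector coordinate by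
  repeating it in every component, and the start is the function of path and noise provided by
  \<open>noise_outsourcing\<close>.
\<close>
lemma stationary_start_exists:
  obtains N :: "('a \<times> (real^'n)) measure" and \<xi> where "enlargement M N" "\<xi> \<in> borel_measurable N"
    "carries N (\<lambda>t \<omega>. X t (fst \<omega>)) (\<lambda>t \<omega>. J t (fst \<omega>))"
    "distr N (borel \<Otimes>\<^sub>M drive_space) (\<lambda>\<omega>. (\<xi> \<omega>, drive 0 (\<lambda>t \<omega>. X t (fst \<omega>)) (\<lambda>t \<omega>. J t (fst \<omega>)) \<omega>)) = Q"
proof -
  let ?S = "drive_space :: ((real \<Rightarrow> real^'n) \<times> (real \<Rightarrow> 'j)) measure"
  obtain G :: "((real \<Rightarrow> real^'n) \<times> (real \<Rightarrow> 'j)) \<times> real \<Rightarrow> real^'n" where Gm: "G \<in> borel_measurable (?S \<Otimes>\<^sub>M borel)"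
    and Gl: "distr (distr Q ?S snd \<Otimes>\<^sub>M uniform01) (borel \<Otimes>\<^sub>M ?S) (\<lambda>z. (G z, fst z)) = Q"
    by (rule noise_outsourcing[OF Q_prob[OF Q] Q_sets[OF Q]]) blast
  interpret U: prob_space uniform01 by (rule prob_space_uniform01)
  interpret MU: pair_prob_space M uniform01 ..
  let ?e = "\<lambda>z. (fst z, (\<chi> i. snd z) :: real^'n)"
  define N where "N = distr (M \<Otimes>\<^sub>M uniform01) (M \<Otimes>\<^sub>M (borel :: (real^'n) measure)) ?e"
  define \<xi> where "\<xi> \<omega> = G (drive 0 X J (fst \<omega>), snd \<omega> $ undefined)" for \<omega> :: "'a \<times> (real^'n)"
  have cm: "(\<lambda>u. \<chi> i. u) \<in> borel_measurable (borel :: real measure)"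
    by (simp add: borel_measurable_vec_iff)
  have sets_U: "sets uniform01 = sets borel" by simp
  have sndU: "snd \<in> borel_measurable (M \<Otimes>\<^sub>M uniform01)"
    using measurable_snd[of M uniform01] unfolding measurable_cong_sets[OF refl sets_U] .
  have em: "?e \<in> measurable (M \<Otimes>\<^sub>M uniform01) (M \<Otimes>\<^sub>M (borel :: (real^'n) measure))"
    by (rule measurable_Pair[OF measurable_fst measurable_compose[OF sndU cm]])
  have dr: "drive 0 (\<lambda>t \<omega>. X t (fst \<omega>)) (\<lambda>t \<omega>. J t (fst \<omega>)) \<omega> = drive 0 X J (fst \<omega>)" for \<omega> :: "'a \<times> (real^'n)"
    by (simp add: drive_def traj_def incr_def)
  have N_sets: "sets N = sets (M \<Otimes>\<^sub>M (borel :: (real^'n) measure))" by (simp add: N_def)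
  have N_prob: "prob_space N" unfolding N_def by (rule MU.prob_space_distr[OF em])
  have fstm: "fst \<in> measurable N M" by (simp add: measurable_cong_sets[OF N_sets refl])
  have fst_law: "distr N M fst = M"
  proof -
    have "distr N M fst = distr (M \<Otimes>\<^sub>M uniform01) M fst"
      unfolding N_def by (subst distr_distr[OF measurable_fst em]) (simp add: comp_def)
    also have "\<dots> = M" by (rule U.distr_pair_fst)
    finally show ?thesis .
  qed
  have enl: "enlargement M N" using N_prob fstm fst_law by (simp add: enlargement_def)
  have \<xi>m0: "\<xi> \<in> borel_measurable (M \<Otimes>\<^sub>M (borel :: (real^'n) measure))"
    unfolding \<xi>_def[abs_def]
    by (intro measurable_compose[OF measurable_Pair Gm] measurable_compose[OF measurable_fst M_meas]
        borel_measurable_nth measurable_snd)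
  have \<xi>m: "\<xi> \<in> borel_measurable N" using \<xi>m0 by (simp add: measurable_cong_sets[OF N_sets refl])
  have Nsp: "fst \<omega> \<in> space M" if "\<omega> \<in> space N" for \<omega> using measurable_space[OF fstm that] .
  have drm: "(\<lambda>\<omega>. drive 0 X J (fst \<omega>)) \<in> measurable N ?S" by (rule measurable_compose[OF fstm M_meas])
  have car: "carries N (\<lambda>t \<omega>. X t (fst \<omega>)) (\<lambda>t \<omega>. J t (fst \<omega>))"
    unfolding carries_def
  proof (intro conjI)
    show "cadlag_process N (\<lambda>t \<omega>. X t (fst \<omega>))"
      using M_cadlag N_prob Nsp fstm by (auto simp: cadlag_process_def intro: measurable_compose)
    show "drive 0 (\<lambda>t \<omega>. X t (fst \<omega>)) (\<lambda>t \<omega>. J t (fst \<omega>)) \<in> measurable N ?S"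
      using drm by (simp add: dr[abs_def])
    have "distr N ?S (\<lambda>\<omega>. drive 0 X J (fst \<omega>)) = distr (distr N M fst) ?S (drive 0 X J)"
      by (subst distr_distr[OF M_meas fstm]) (simp add: comp_def)
    then show "distr N ?S (drive 0 (\<lambda>t \<omega>. X t (fst \<omega>)) (\<lambda>t \<omega>. J t (fst \<omega>))) = D"
      by (simp add: dr[abs_def] fst_law D_eq)
  qed
  have "distr N (borel \<Otimes>\<^sub>M ?S) (\<lambda>\<omega>. (\<xi> \<omega>, drive 0 X J (fst \<omega>))) = Q"
  proof -
    have m1: "(\<lambda>\<omega>. (\<xi> \<omega>, drive 0 X J (fst \<omega>))) \<in> measurable (M \<Otimes>\<^sub>M (borel :: (real^'n) measure)) (borel \<Otimes>\<^sub>M ?S)"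
      by (intro measurable_Pair \<xi>m0 measurable_compose[OF measurable_fst M_meas])
    have m2: "(\<lambda>z. (G z, fst z)) \<in> measurable (?S \<Otimes>\<^sub>M borel) (borel \<Otimes>\<^sub>M ?S)"
      by (intro measurable_Pair Gm measurable_fst)
    have m3: "(\<lambda>z. (drive 0 X J (fst z), snd z)) \<in> measurable (M \<Otimes>\<^sub>M uniform01) (?S \<Otimes>\<^sub>M borel)"
      by (rule measurable_Pair[OF measurable_compose[OF measurable_fst M_meas] sndU])
    have idU: "distr uniform01 borel (\<lambda>x. x) = uniform01"
      by (rule distr_id2) simp
    have "distr N (borel \<Otimes>\<^sub>M ?S) (\<lambda>\<omega>. (\<xi> \<omega>, drive 0 X J (fst \<omega>))) =
        distr (M \<Otimes>\<^sub>M uniform01) (borel \<Otimes>\<^sub>M ?S) (\<lambda>z. (G (drive 0 X J (fst z), snd z), drive 0 X J (fst z)))"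
      unfolding N_def by (subst distr_distr[OF m1 em]) (simp add: comp_def \<xi>_def)
    also have "\<dots> = distr (distr (M \<Otimes>\<^sub>M uniform01) (?S \<Otimes>\<^sub>M borel) (\<lambda>z. (drive 0 X J (fst z), snd z))) (borel \<Otimes>\<^sub>M ?S) (\<lambda>z. (G z, fst z))"
      by (subst distr_distr[OF m2 m3]) (simp add: comp_def)
    also have "distr (M \<Otimes>\<^sub>M uniform01) (?S \<Otimes>\<^sub>M borel) (\<lambda>z. (drive 0 X J (fst z), snd z)) = D \<Otimes>\<^sub>M uniform01"
    proof -
      have "distr M ?S (drive 0 X J) \<Otimes>\<^sub>M distr uniform01 borel (\<lambda>x. x) =
          distr (M \<Otimes>\<^sub>M uniform01) (?S \<Otimes>\<^sub>M borel) (\<lambda>(x, y). (drive 0 X J x, y))"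
        by (rule pair_measure_distr[OF M_meas measurable_ident_sets[OF sets_U]])
          (simp add: idU U.sigma_finite_measure_axioms)
      then show ?thesis by (simp add: idU D_eq case_prod_beta')
    qed
    also have "D \<Otimes>\<^sub>M uniform01 = distr Q ?S snd \<Otimes>\<^sub>M uniform01" by (simp add: Q_snd[OF Q])
    also have "distr \<dots> (borel \<Otimes>\<^sub>M ?S) (\<lambda>z. (G z, fst z)) = Q" by (rule Gl)
    finally show ?thesis .
  qed
  then show ?thesis using that[OF enl \<xi>m car] by (simp add: dr[abs_def])
qed

end

end

section \<open>Stationary versions with a background process\<close>

context stationary_driver
begin

lemma carries_if_same_law:
  assumes "cadlag_process N Y" "same_law drive_space N (drive 0 Y K) M (drive 0 X J)"
  shows "carries N Y K"
  unfolding carries_def using assms unfolding same_law_def by (metis D_eq)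

lemma carries_if_process_law:
  assumes "cadlag_process N Y" "same_process_law N (\<lambda>t \<omega>. (Y t \<omega>, K t \<omega>)) M (\<lambda>t \<omega>. (X t \<omega>, J t \<omega>))"
  shows "carries N Y K"
  by (rule carries_if_same_law[OF assms(1)], rule same_law_map[OF assms(2)[unfolded same_process_law_def] measurable_pair_drive])
    (simp_all add: pair_drive_traj)

lemma carries_if_incr_law:
  assumes "cadlag_process N Y" "same_process_law N (\<lambda>t \<omega>. (incr 0 Y t \<omega>, K t \<omega>)) M (\<lambda>t \<omega>. (incr 0 X t \<omega>, J t \<omega>))"
  shows "carries N Y K"
  by (rule carries_if_same_law[OF assms(1)], rule same_law_map[OF assms(2)[unfolded same_process_law_def] measurable_pair_drive])
    (simp_all add: pair_drive_traj drive_incr)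

lemma refl_incr:
  assumes "carries N Y K" "\<omega> \<in> space N" "0 \<le> t"
  shows "refl_W R \<xi> (incr 0 Y) t \<omega> = Wf t (\<xi> \<omega>) (fst (drive 0 Y K \<omega>))"
    and "refl_L R \<xi> (incr 0 Y) t \<omega> = Lf t (\<xi> \<omega>) (fst (drive 0 Y K \<omega>))"
  using refl_W_eq[where X = "incr 0 Y" and \<omega> = \<omega> and \<xi> = \<xi>, OF carries_cadlag[OF assms(1,2) order_refl] assms(3)]
    refl_L_eq[where X = "incr 0 Y" and \<omega> = \<omega> and \<xi> = \<xi>, OF carries_cadlag[OF assms(1,2) order_refl] assms(3)]
  by (simp_all add: drive_def)

text \<open>
  The initial value of \<open>Y\<close> is part of the start: the driving pair only knows increments.
\<close>
lemma refl_plain: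
  assumes c: "carries N Y K" "\<omega> \<in> space N" and t: "0 \<le> t"
  shows "refl_W R \<eta> Y t \<omega> = Wf t (\<eta> \<omega> + Y 0 \<omega>) (fst (drive 0 Y K \<omega>))"
proof -
  have "cadlag (\<lambda>u. Y u \<omega>)" using c by (auto simp: carries_def cadlag_process_def)
  then have "refl_W R \<eta> Y t \<omega> = Wlim {0..} (\<lambda>u. \<eta> \<omega> + Y u \<omega>) t"
    using t by (intro refl_W_Wlim)
  moreover have "Wf t (\<eta> \<omega> + Y 0 \<omega>) (fst (drive 0 Y K \<omega>)) = Wlim {0..} (\<lambda>u. (\<eta> \<omega> + Y 0 \<omega>) + incr 0 Y u \<omega>) t"
    by (rule Wf_drive[OF c order_refl t])
  ultimately show ?thesis by (simp add: incr_def)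
qed

lemma carries_start_measurable: "carries N Y K \<Longrightarrow> Y 0 \<in> borel_measurable N"
  by (simp add: carries_def cadlag_process_def)

lemma carries_J_measurable:
  assumes c: "carries N Y K" and t: "0 \<le> t"
  shows "K t \<in> borel_measurable N"
proof -
  have "(\<lambda>\<omega>. snd (drive 0 Y K \<omega>) t) \<in> borel_measurable N"
    by (rule measurable_compose[OF measurable_drive[OF c order_refl] measurable_drive_space_eval(2)[OF t]])
  then show ?thesis using t by (simp add: drive_def traj_def)
qed

lemma measurable_W:
  assumes "carries N Y K" "\<xi> \<in> borel_measurable N" "0 \<le> t"
  shows "(\<lambda>\<omega>. Wf t (\<xi> \<omega>) (fst (drive 0 Y K \<omega>))) \<in> borel_measurable N"
  using assms
  by (intro measurable_Wf measurable_compose[OF measurable_drive[OF assms(1) order_refl] measurable_fst_drive_space(1)])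

lemma measurable_start:
  assumes "carries N Y K" "\<xi> \<in> borel_measurable N"
  shows "(\<lambda>\<omega>. (\<xi> \<omega>, drive 0 Y K \<omega>)) \<in> measurable N (borel \<Otimes>\<^sub>M drive_space)"
  by (intro measurable_Pair assms(2) measurable_drive[OF assms(1)]) simp

lemma WK_path_step:
  assumes c: "carries N Y K" "\<omega> \<in> space N" and s: "0 \<le> s"
  shows "WK_path (Wf s w (fst (drive 0 Y K \<omega>)), drive s Y K \<omega>) =
    (\<lambda>t\<in>{0..}. (Wf (s + t) w (fst (drive 0 Y K \<omega>)), K (s + t) \<omega>))"
proof -
  have "Wf (s + t) w (fst (drive 0 Y K \<omega>)) = Wf t (Wf s w (fst (drive 0 Y K \<omega>))) (fst (drive s Y K \<omega>))" if "0 \<le> t" for t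
    using Wf_flow[OF c order_refl s that, of w] by simp
  moreover have "snd (drive s Y K \<omega>) t = K (s + t) \<omega>" if "0 \<le> t" for t
    using that by (simp add: drive_def traj_def)
  ultimately show ?thesis by (auto simp: WK_path_def fun_eq_iff restrict_def)
qed

lemma WK_path_start:
  "WK_path (w, drive 0 Y K \<omega>) = (\<lambda>t\<in>{0..}. (Wf t w (fst (drive 0 Y K \<omega>)), K t \<omega>))"
  by (auto simp: WK_path_def drive_def traj_def fun_eq_iff restrict_def)

lemma traj_refl_J:
  assumes c: "carries N Y K" "\<omega> \<in> space N" and s: "0 \<le> s"
  shows "traj {0..} (\<lambda>t \<omega>. (refl_W R \<eta> Y (s + t) \<omega>, K (s + t) \<omega>)) \<omega> =
    WK_path (Wf s (\<eta> \<omega> + Y 0 \<omega>) (fst (drive 0 Y K \<omega>)), drive s Y K \<omega>)"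
  unfolding WK_path_step[OF c s] traj_def using s
  by (intro restrict_ext) (simp add: refl_plain[OF c])

lemma traj_refl_J0:
  assumes c: "carries N Y K" "\<omega> \<in> space N"
  shows "traj {0..} (\<lambda>t \<omega>. (refl_W R \<eta> Y t \<omega>, K t \<omega>)) \<omega> = WK_path (\<eta> \<omega> + Y 0 \<omega>, drive 0 Y K \<omega>)"
  unfolding WK_path_start traj_def
  by (intro restrict_ext) (simp add: refl_plain[OF c])

context
  fixes Q assumes Q: "limit_law Q"
begin

lemma converges_J:
  assumes \<eta>: "\<eta> \<in> borel_measurable M"
  shows "converges_in_distribution M (\<lambda>t \<omega>. (refl_W R \<eta> X t \<omega>, J t \<omega>))
    (distr Q borel (\<lambda>z. (fst z, snd (snd z) 0)))"
proof -
  let ?S = "drive_space :: ((real \<Rightarrow> real^'n) \<times> (real \<Rightarrow> 'j)) measure"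
  interpret Q: prob_space Q by (rule Q_prob[OF Q])
  let ?\<xi> = "\<lambda>\<omega>. \<eta> \<omega> + X 0 \<omega>"
  have \<xi>: "?\<xi> \<in> borel_measurable M" using \<eta> carries_start_measurable[OF carries_M] by simp
  have qm: "(\<lambda>z. (fst z, snd (snd z) 0)) \<in> borel_measurable ((borel :: (real^'n) measure) \<Otimes>\<^sub>M ?S)"
    by (intro borel_measurable_Pair measurable_fst measurable_flow_coordinates(4)) simp
  have qmQ: "(\<lambda>z. (fst z, snd (snd z) 0)) \<in> borel_measurable Q"
    using qm by (simp add: measurable_cong_sets[OF Q_sets[OF Q] refl])
  show ?thesis
    unfolding converges_in_distribution_def
  proof (intro conjI allI impI)
    show "prob_space (distr Q borel (\<lambda>z. (fst z, snd (snd z) 0)))" by (rule Q.prob_space_distr[OF qmQ])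
    show "(\<lambda>\<omega>. (refl_W R \<eta> X t \<omega>, J t \<omega>)) \<in> borel_measurable M" if t: "0 \<le> t" for t
    proof -
      have "(\<lambda>\<omega>. refl_W R \<eta> X t \<omega>) \<in> borel_measurable M \<longleftrightarrow> (\<lambda>\<omega>. Wf t (?\<xi> \<omega>) (fst (drive 0 X J \<omega>))) \<in> borel_measurable M"
        by (intro measurable_cong refl_plain[OF carries_M _ t])
      then show ?thesis
        using measurable_W[OF carries_M \<xi> t] carries_J_measurable[OF carries_M t] by (intro borel_measurable_Pair) auto
    qed
    fix f :: "(real^'n) \<times> 'j \<Rightarrow> real" assume f: "continuous_on UNIV f \<and> bounded (range f)"
    obtain B where B: "\<And>x. \<bar>f x\<bar> \<le> B" using f by (auto simp: bounded_iff)
    have fm: "f \<in> borel_measurable borel" using f by (intro borel_measurable_continuous_onI) simp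
    have hm: "(\<lambda>z. f (fst z, snd (snd z) 0)) \<in> borel_measurable (borel \<Otimes>\<^sub>M ?S)"
      by (rule measurable_compose[OF qm fm])
    have cont: "AE \<tau> in D. continuous_on UNIV (\<lambda>w. f (fst (w, \<tau>), snd (snd (w, \<tau>)) 0))"
    proof (rule AE_I2)
      fix \<tau>
      show "continuous_on UNIV (\<lambda>w. f (fst (w, \<tau>), snd (snd (w, \<tau>)) 0))"
        by (rule continuous_on_compose2[OF conjunct1[OF f]]) (auto intro!: continuous_intros)
    qed
    have "((\<lambda>t. \<integral>\<omega>. f (Wf t (?\<xi> \<omega>) (fst (drive 0 X J \<omega>)), snd (drive t X J \<omega>) 0) \<partial>M) \<longlongrightarrow>
        (\<integral>z. f (fst z, snd (snd z) 0) \<partial>Q)) at_top"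
      using start_limit[OF Q carries_M \<xi> hm B cont] by simp
    moreover have "eventually (\<lambda>t. (\<integral>\<omega>. f (Wf t (?\<xi> \<omega>) (fst (drive 0 X J \<omega>)), snd (drive t X J \<omega>) 0) \<partial>M) =
        (\<integral>\<omega>. f (refl_W R \<eta> X t \<omega>, J t \<omega>) \<partial>M)) at_top"
      using eventually_ge_at_top[of 0]
    proof eventually_elim
      case (elim t)
      show ?case
        by (rule Bochner_Integration.integral_cong[OF refl])
          (simp add: refl_plain[OF carries_M _ elim], simp add: drive_def traj_def)
    qed
    ultimately have "((\<lambda>t. \<integral>\<omega>. f (refl_W R \<eta> X t \<omega>, J t \<omega>) \<partial>M) \<longlongrightarrow> (\<integral>z. f (fst z, snd (snd z) 0) \<partial>Q)) at_top"
      by (rule Lim_transform_eventually)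
    then show "((\<lambda>t. \<integral>\<omega>. f (refl_W R \<eta> X t \<omega>, J t \<omega>) \<partial>M) \<longlongrightarrow>
        (\<integral>x. f x \<partial>distr Q borel (\<lambda>z. (fst z, snd (snd z) 0)))) at_top"
      by (simp add: integral_distr[OF qmQ fm])
  qed simp
qed

text \<open>
  Invariant starts are exactly the starts with law \<open>Q\<close>, whence their existence and uniqueness in law.
\<close>
lemma invariant_start_iff:
  assumes c: "carries N Y K" and \<xi>: "\<xi> \<in> borel_measurable N"
  shows "invariant_start_J R N \<xi> Y K \<longleftrightarrow> distr N (borel \<Otimes>\<^sub>M drive_space) (\<lambda>\<omega>. (\<xi> \<omega>, drive 0 Y K \<omega>)) = Q"
proof -
  let ?S = "drive_space :: ((real \<Rightarrow> real^'n) \<times> (real \<Rightarrow> 'j)) measure"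
  let ?B = "\<lambda>\<omega>. (\<xi> \<omega>, traj {0..} (incr 0 Y) \<omega>, traj {0..} K \<omega>)"
  let ?A = "\<lambda>s \<omega>. (refl_W R \<xi> (incr 0 Y) s \<omega>, traj {0..} (incr s Y) \<omega>, traj {0..} (\<lambda>t. K (s + t)) \<omega>)"
  have B: "?B \<omega> = (\<xi> \<omega>, drive 0 Y K \<omega>)" for \<omega> by (simp add: drive_def)
  have A: "?A s \<omega> = (Wf s (\<xi> \<omega>) (fst (drive 0 Y K \<omega>)), drive s Y K \<omega>)" if "\<omega> \<in> space N" "0 \<le> s" for s \<omega>
    unfolding refl_incr(1)[OF c that] by (simp add: drive_def)
  have mA: "?A s \<in> measurable N (borel \<Otimes>\<^sub>M ?S)" if "0 \<le> s" for s
    using measurable_start_step[OF c \<xi> that] A[OF _ that] by (simp cong: measurable_cong)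
  have dA: "distr N (borel \<Otimes>\<^sub>M ?S) (?A s) =
      distr N (borel \<Otimes>\<^sub>M ?S) (\<lambda>\<omega>. (Wf s (\<xi> \<omega>) (fst (drive 0 Y K \<omega>)), drive s Y K \<omega>))" if "0 \<le> s" for s
    using A[OF _ that] by (intro distr_cong refl)
  have eq: "same_law (borel \<Otimes>\<^sub>M ?S) N (?A s) N ?B \<longleftrightarrow>
      distr N (borel \<Otimes>\<^sub>M ?S) (\<lambda>\<omega>. (Wf s (\<xi> \<omega>) (fst (drive 0 Y K \<omega>)), drive s Y K \<omega>)) =
      distr N (borel \<Otimes>\<^sub>M ?S) (\<lambda>\<omega>. (\<xi> \<omega>, drive 0 Y K \<omega>))" if "0 \<le> s" for s
    using mA[OF that] measurable_start[OF c \<xi>] unfolding same_law_def dA[OF that] B by blast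
  show ?thesis
    unfolding invariant_start_J_def drive_space_def[symmetric]
  proof
    assume h: "\<forall>s\<ge>0. same_law (borel \<Otimes>\<^sub>M ?S) N (?A s) N ?B"
    show "distr N (borel \<Otimes>\<^sub>M ?S) (\<lambda>\<omega>. (\<xi> \<omega>, drive 0 Y K \<omega>)) = Q"
    proof (rule invariant_imp_limit_law[OF Q c \<xi>])
      fix s :: real assume s: "0 \<le> s"
      then show "distr N (borel \<Otimes>\<^sub>M ?S) (\<lambda>\<omega>. (Wf s (\<xi> \<omega>) (fst (drive 0 Y K \<omega>)), drive s Y K \<omega>)) =
          distr N (borel \<Otimes>\<^sub>M ?S) (\<lambda>\<omega>. (\<xi> \<omega>, drive 0 Y K \<omega>))"
        using h eq[OF s] by blast
    qed
  next
    assume l: "distr N (borel \<Otimes>\<^sub>M ?S) (\<lambda>\<omega>. (\<xi> \<omega>, drive 0 Y K \<omega>)) = Q"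
    show "\<forall>s\<ge>0. same_law (borel \<Otimes>\<^sub>M ?S) N (?A s) N ?B"
    proof (intro allI impI)
      fix s :: real assume s: "0 \<le> s"
      show "same_law (borel \<Otimes>\<^sub>M ?S) N (?A s) N ?B"
        unfolding eq[OF s] l by (rule step_law[OF Q c \<xi> l s])
    qed
  qed
qed

text \<open>
  A stationary version develops like a process started from \<open>Q\<close>; the one-time marginals are then the
  first marginal of \<open>Q\<close> by invariance.
\<close>
lemma stationary_version_J_path_law:
  assumes v: "stationary_version_J R M X J N Y K \<eta>"
  shows "traj {0..} (\<lambda>t \<omega>. (refl_W R \<eta> Y t \<omega>, K t \<omega>)) \<in> measurable N (path_space {0..})"
    and "distr N (path_space {0..}) (traj {0..} (\<lambda>t \<omega>. (refl_W R \<eta> Y t \<omega>, K t \<omega>))) = distr Q (path_space {0..}) WK_path"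
    and "0 \<le> t \<Longrightarrow> distr N borel (refl_W R \<eta> Y t) = distr Q borel fst"
proof -
  let ?S = "drive_space :: ((real \<Rightarrow> real^'n) \<times> (real \<Rightarrow> 'j)) measure"
  let ?P = "path_space {0..} :: (real \<Rightarrow> (real^'n) \<times> 'j) measure"
  let ?Z = "\<lambda>t \<omega>. (refl_W R \<eta> Y t \<omega>, K t \<omega>)"
  let ?\<xi> = "\<lambda>\<omega>. \<eta> \<omega> + Y 0 \<omega>"
  have c: "carries N Y K" and \<eta>: "\<eta> \<in> borel_measurable N" and st: "stationary_process N ?Z"
    using v by (auto simp: stationary_version_J_def intro: carries_if_process_law)
  have \<xi>: "?\<xi> \<in> borel_measurable N" using \<eta> carries_start_measurable[OF c] by simp
  have d0: "distr N ?P (traj {0..} ?Z) = distr N ?P (\<lambda>\<omega>. WK_path (?\<xi> \<omega>, drive 0 Y K \<omega>))"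
    by (intro distr_cong refl traj_refl_J0[OF c])
  have ds: "distr N ?P (traj {0..} (\<lambda>t. ?Z (s + t))) =
      distr N ?P (\<lambda>\<omega>. WK_path (Wf s (?\<xi> \<omega>) (fst (drive 0 Y K \<omega>)), drive s Y K \<omega>))" if "0 \<le> s" for s
    by (intro distr_cong refl traj_refl_J[OF c _ that])
  show m: "traj {0..} ?Z \<in> measurable N ?P"
    using st by (auto simp: stationary_process_def same_process_law_def same_law_def)
  have "distr N ?P (\<lambda>\<omega>. WK_path (Wf s (?\<xi> \<omega>) (fst (drive 0 Y K \<omega>)), drive s Y K \<omega>)) =
      distr N ?P (\<lambda>\<omega>. WK_path (?\<xi> \<omega>, drive 0 Y K \<omega>))" if "0 \<le> s" for s
    unfolding ds[OF that, symmetric] d0[symmetric]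
    using st that by (auto simp: stationary_process_def same_process_law_def same_law_def)
  from stationary_imp_path_law[OF Q c \<xi> this]
  show law: "distr N ?P (traj {0..} ?Z) = distr Q ?P WK_path" unfolding d0 .
  show "distr N borel (refl_W R \<eta> Y t) = distr Q borel fst" if t: "0 \<le> t"
  proof -
    have mQ: "WK_path \<in> measurable Q ?P"
      using measurable_WK_path by (simp add: measurable_cong_sets[OF Q_sets[OF Q] refl])
    have ct: "(\<lambda>f. fst (f t)) \<in> borel_measurable ?P"
      using t by (intro measurable_compose[OF measurable_path_coordinate borel_measurable_fst_snd(1)]) simp
    have stm: "(\<lambda>z. (Wf t (fst z) (fst (snd z)), advance t (snd z))) \<in> measurable Q (borel \<Otimes>\<^sub>M ?S)"
      using measurable_step[OF t] by (simp add: measurable_cong_sets[OF Q_sets[OF Q] refl])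
    have "distr N borel (refl_W R \<eta> Y t) = distr (distr N ?P (traj {0..} ?Z)) borel (\<lambda>f. fst (f t))"
      using t by (subst distr_distr[OF ct m]) (intro distr_cong refl, simp add: traj_def)
    also have "\<dots> = distr Q borel (\<lambda>z. Wf t (fst z) (fst (snd z)))"
      unfolding law using t by (subst distr_distr[OF ct mQ]) (intro distr_cong refl, simp add: WK_path_def)
    also have "\<dots> = distr (distr Q (borel \<Otimes>\<^sub>M ?S) (\<lambda>z. (Wf t (fst z) (fst (snd z)), advance t (snd z)))) borel fst"
      by (subst distr_distr[OF measurable_fst stm]) (simp add: comp_def)
    also have "\<dots> = distr Q borel fst" by (simp add: limit_law_invariant[OF Q t])
    finally show ?thesis .
  qed
qed

lemma stationary_version_J_unique:
  assumes "stationary_version_J R M X J N1 Y1 K1 \<xi>" "stationary_version_J R M X J N2 Y2 K2 \<eta>"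
  shows "same_process_law N1 (\<lambda>t \<omega>. (refl_W R \<xi> Y1 t \<omega>, K1 t \<omega>)) N2 (\<lambda>t \<omega>. (refl_W R \<eta> Y2 t \<omega>, K2 t \<omega>))"
  unfolding same_process_law_def same_law_def
  using stationary_version_J_path_law(1,2)[OF assms(1)] stationary_version_J_path_law(1,2)[OF assms(2)] by simp

lemma measurable_traj_pair:
  assumes "carries N Y K"
  shows "traj {0..} (\<lambda>t \<omega>. (Y t \<omega>, K t \<omega>)) \<in> measurable N (path_space {0..})"
    "traj {0..} (\<lambda>t \<omega>. (incr 0 Y t \<omega>, K t \<omega>)) \<in> measurable N (path_space {0..})"
proof -
  have "Y t \<in> borel_measurable N" if "0 \<le> t" for t using assms that by (simp add: carries_def cadlag_process_def)
  then show "traj {0..} (\<lambda>t \<omega>. (Y t \<omega>, K t \<omega>)) \<in> measurable N (path_space {0..})"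
    "traj {0..} (\<lambda>t \<omega>. (incr 0 Y t \<omega>, K t \<omega>)) \<in> measurable N (path_space {0..})"
    unfolding incr_def
    by (auto intro!: measurable_trajI borel_measurable_Pair borel_measurable_diff carries_J_measurable[OF assms])
qed

text \<open>
  One start of law \<open>Q\<close> serves both purposes: as it stands for the increments of \<open>X\<close>, and with \<open>X(0)\<close>
  subtracted for \<open>X\<close> itself.
\<close>
lemma versions_exist:
  "\<exists>(N :: ('a \<times> (real^'n)) measure) \<xi>. enlargement M N \<and>
     stationary_version_J R M X J N (\<lambda>t \<omega>. X t (fst \<omega>)) (\<lambda>t \<omega>. J t (fst \<omega>)) \<xi>"
  "\<exists>(N :: ('a \<times> (real^'n)) measure) \<xi>. enlargement M N \<and>
     invariant_version_J R M X J N (\<lambda>t \<omega>. X t (fst \<omega>)) (\<lambda>t \<omega>. J t (fst \<omega>)) \<xi>"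
proof -
  let ?Y = "\<lambda>t \<omega>. X t (fst \<omega>)" and ?K = "\<lambda>t \<omega>. J t (fst \<omega>)"
  let ?P = "path_space {0..} :: (real \<Rightarrow> (real^'n) \<times> 'j) measure"
  obtain N :: "('a \<times> (real^'n)) measure" and \<xi> where enl: "enlargement M N" and \<xi>: "\<xi> \<in> borel_measurable N"
    and c: "carries N ?Y ?K" and law: "distr N (borel \<Otimes>\<^sub>M drive_space) (\<lambda>\<omega>. (\<xi> \<omega>, drive 0 ?Y ?K \<omega>)) = Q"
    by (rule stationary_start_exists[OF Q]) blast
  have fstm: "fst \<in> measurable N M" and fstl: "distr N M fst = M" using enl by (auto simp: enlargement_def)
  have cN: "cadlag_process N ?Y" using c by (simp add: carries_def)
  have copy: "same_process_law N (\<lambda>t \<omega>. Z t (fst \<omega>)) M Z" if m: "traj {0..} Z \<in> measurable M ?P" for Z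
  proof -
    have e: "traj {0..} (\<lambda>t \<omega>. Z t (fst \<omega>)) = (\<lambda>\<omega>. traj {0..} Z (fst \<omega>))" by (auto simp: traj_def fun_eq_iff)
    have "distr N ?P (\<lambda>\<omega>. traj {0..} Z (fst \<omega>)) = distr (distr N M fst) ?P (traj {0..} Z)"
      by (subst distr_distr[OF m fstm]) (simp add: comp_def)
    then show ?thesis using m measurable_compose[OF fstm m] by (simp add: same_process_law_def same_law_def e fstl)
  qed
  have l1: "same_process_law N (\<lambda>t \<omega>. (?Y t \<omega>, ?K t \<omega>)) M (\<lambda>t \<omega>. (X t \<omega>, J t \<omega>))"
    by (rule copy[OF measurable_traj_pair(1)[OF carries_M]])
  have l2: "same_process_law N (\<lambda>t \<omega>. (incr 0 ?Y t \<omega>, ?K t \<omega>)) M (\<lambda>t \<omega>. (incr 0 X t \<omega>, J t \<omega>))"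
    using copy[OF measurable_traj_pair(2)[OF carries_M]] by (simp add: incr_def)
  show "\<exists>(N :: ('a \<times> (real^'n)) measure) \<xi>. enlargement M N \<and> invariant_version_J R M X J N ?Y ?K \<xi>"
    using enl cN l2 \<xi> invariant_start_iff[OF c \<xi>] law unfolding invariant_version_J_def by blast
  define \<eta> where "\<eta> \<omega> = \<xi> \<omega> - X 0 (fst \<omega>)" for \<omega>
  have \<eta>: "\<eta> \<in> borel_measurable N"
    unfolding \<eta>_def[abs_def] using \<xi> carries_start_measurable[OF c] by simp
  have \<eta>\<xi>: "\<eta> \<omega> + ?Y 0 \<omega> = \<xi> \<omega>" for \<omega> by (simp add: \<eta>_def)
  have "stationary_process N (\<lambda>t \<omega>. (refl_W R \<eta> ?Y t \<omega>, ?K t \<omega>))"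
    unfolding stationary_process_def same_process_law_def
  proof (intro allI impI)
    fix s :: real assume s: "0 \<le> s"
    have "same_law (borel \<Otimes>\<^sub>M drive_space) N (\<lambda>\<omega>. (Wf s (\<xi> \<omega>) (fst (drive 0 ?Y ?K \<omega>)), drive s ?Y ?K \<omega>)) N (\<lambda>\<omega>. (\<xi> \<omega>, drive 0 ?Y ?K \<omega>))"
      using measurable_start_step[OF c \<xi> s] measurable_start[OF c \<xi>] step_law[OF Q c \<xi> law s] law
      by (simp add: same_law_def)
    then show "same_law ?P N (traj {0..} (\<lambda>t \<omega>. (refl_W R \<eta> ?Y (s + t) \<omega>, ?K (s + t) \<omega>))) N
        (traj {0..} (\<lambda>t \<omega>. (refl_W R \<eta> ?Y t \<omega>, ?K t \<omega>)))"
    proof (rule same_law_map[OF _ measurable_WK_path])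
      show "traj {0..} (\<lambda>t \<omega>. (refl_W R \<eta> ?Y (s + t) \<omega>, ?K (s + t) \<omega>)) \<omega> =
          WK_path (Wf s (\<xi> \<omega>) (fst (drive 0 ?Y ?K \<omega>)), drive s ?Y ?K \<omega>)" if "\<omega> \<in> space N" for \<omega>
        using traj_refl_J[OF c that s, of \<eta>] unfolding \<eta>\<xi> .
      show "traj {0..} (\<lambda>t \<omega>. (refl_W R \<eta> ?Y t \<omega>, ?K t \<omega>)) \<omega> = WK_path (\<xi> \<omega>, drive 0 ?Y ?K \<omega>)" if "\<omega> \<in> space N" for \<omega>
        using traj_refl_J0[OF c that, of \<eta>] unfolding \<eta>\<xi> .
    qed
  qed
  then show "\<exists>(N :: ('a \<times> (real^'n)) measure) \<xi>. enlargement M N \<and> stationary_version_J R M X J N ?Y ?K \<xi>"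
    using enl cN l1 \<eta> unfolding stationary_version_J_def by blast
qed

lemma invariant_version_J_law:
  assumes "invariant_version_J R M X J N Y K \<xi>"
  shows "carries N Y K" "\<xi> \<in> borel_measurable N"
    "distr N (borel \<Otimes>\<^sub>M drive_space) (\<lambda>\<omega>. (\<xi> \<omega>, drive 0 Y K \<omega>)) = Q"
proof -
  show c: "carries N Y K" and \<xi>: "\<xi> \<in> borel_measurable N"
    using assms by (auto simp: invariant_version_J_def intro: carries_if_incr_law)
  show "distr N (borel \<Otimes>\<^sub>M drive_space) (\<lambda>\<omega>. (\<xi> \<omega>, drive 0 Y K \<omega>)) = Q"
    using assms invariant_start_iff[OF c \<xi>] by (simp add: invariant_version_J_def)
qed

lemma invariant_version_J_unique:
  assumes "invariant_version_J R M X J N1 Y1 K1 \<xi>" "invariant_version_J R M X J N2 Y2 K2 \<eta>"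
  shows "same_law (borel \<Otimes>\<^sub>M (path_space {0..} \<Otimes>\<^sub>M path_space {0..}))
          N1 (\<lambda>\<omega>. (\<xi> \<omega>, traj {0..} (incr 0 Y1) \<omega>, traj {0..} K1 \<omega>))
          N2 (\<lambda>\<omega>. (\<eta> \<omega>, traj {0..} (incr 0 Y2) \<omega>, traj {0..} K2 \<omega>))"
proof -
  have "(\<lambda>\<omega>. (\<xi> \<omega>, traj {0..} (incr 0 Y1) \<omega>, traj {0..} K1 \<omega>)) = (\<lambda>\<omega>. (\<xi> \<omega>, drive 0 Y1 K1 \<omega>))"
    "(\<lambda>\<omega>. (\<eta> \<omega>, traj {0..} (incr 0 Y2) \<omega>, traj {0..} K2 \<omega>)) = (\<lambda>\<omega>. (\<eta> \<omega>, drive 0 Y2 K2 \<omega>))"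
    by (simp_all add: drive_def)
  then show ?thesis
    unfolding same_law_def drive_space_def[symmetric]
    using measurable_start[OF invariant_version_J_law(1,2)[OF assms(1)]] measurable_start[OF invariant_version_J_law(1,2)[OF assms(2)]]
      invariant_version_J_law(3)[OF assms(1)] invariant_version_J_law(3)[OF assms(2)] by simp
qed

lemma invariant_version_J_process_law:
  assumes v: "invariant_version_J R M X J N Y K \<xi>" and s: "0 \<le> s"
  shows "same_process_law
     N (\<lambda>t \<omega>. (refl_W R \<xi> (incr 0 Y) (s + t) \<omega>, incr s (refl_L R \<xi> (incr 0 Y)) t \<omega>, incr s Y t \<omega>, K (s + t) \<omega>))
     N (\<lambda>t \<omega>. (refl_W R \<xi> (incr 0 Y) t \<omega>, refl_L R \<xi> (incr 0 Y) t \<omega>, incr 0 Y t \<omega>, K t \<omega>))"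
proof -
  note c = invariant_version_J_law(1)[OF v] and \<xi> = invariant_version_J_law(2)[OF v] and law = invariant_version_J_law(3)[OF v]
  have "same_law (borel \<Otimes>\<^sub>M drive_space) N (\<lambda>\<omega>. (Wf s (\<xi> \<omega>) (fst (drive 0 Y K \<omega>)), drive s Y K \<omega>)) N (\<lambda>\<omega>. (\<xi> \<omega>, drive 0 Y K \<omega>))"
    using measurable_start_step[OF c \<xi> s] measurable_start[OF c \<xi>] step_law[OF Q c \<xi> law s] law
    by (simp add: same_law_def)
  then show ?thesis
    unfolding same_process_law_def
  proof (rule same_law_map[OF _ measurable_full_path])
    fix \<omega> assume \<omega>: "\<omega> \<in> space N"
    have W: "Wf (s + t) (\<xi> \<omega>) (fst (drive 0 Y K \<omega>)) = Wf t (Wf s (\<xi> \<omega>) (fst (drive 0 Y K \<omega>))) (fst (drive s Y K \<omega>))"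
      and L: "Lf (s + t) (\<xi> \<omega>) (fst (drive 0 Y K \<omega>)) - Lf s (\<xi> \<omega>) (fst (drive 0 Y K \<omega>)) =
        Lf t (Wf s (\<xi> \<omega>) (fst (drive 0 Y K \<omega>))) (fst (drive s Y K \<omega>))" if "0 \<le> t" for t
      using Wf_flow[OF c \<omega> order_refl s that, of "\<xi> \<omega>"] Lf_flow[OF c \<omega> order_refl s that, of "\<xi> \<omega>"] by simp_all
    have d: "fst (drive r Y K \<omega>) t = incr r Y t \<omega>" "snd (drive r Y K \<omega>) t = K (r + t) \<omega>" if "0 \<le> t" for r t
      using that by (auto simp: drive_def traj_def)
    show "traj {0..} (\<lambda>t \<omega>. (refl_W R \<xi> (incr 0 Y) (s + t) \<omega>, incr s (refl_L R \<xi> (incr 0 Y)) t \<omega>, incr s Y t \<omega>, K (s + t) \<omega>)) \<omega> =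
        full_path (Wf s (\<xi> \<omega>) (fst (drive 0 Y K \<omega>)), drive s Y K \<omega>)"
      unfolding full_path_def traj_def
    proof (intro restrict_ext)
      fix t :: real assume "t \<in> {0..}"
      then have t: "0 \<le> t" "0 \<le> s + t" using s by auto
      show "(refl_W R \<xi> (incr 0 Y) (s + t) \<omega>, incr s (refl_L R \<xi> (incr 0 Y)) t \<omega>, incr s Y t \<omega>, K (s + t) \<omega>) =
        (Wf t (fst (Wf s (\<xi> \<omega>) (fst (drive 0 Y K \<omega>)), drive s Y K \<omega>)) (fst (snd (Wf s (\<xi> \<omega>) (fst (drive 0 Y K \<omega>)), drive s Y K \<omega>))),
         Lf t (fst (Wf s (\<xi> \<omega>) (fst (drive 0 Y K \<omega>)), drive s Y K \<omega>)) (fst (snd (Wf s (\<xi> \<omega>) (fst (drive 0 Y K \<omega>)), drive s Y K \<omega>))),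
         fst (snd (Wf s (\<xi> \<omega>) (fst (drive 0 Y K \<omega>)), drive s Y K \<omega>)) t,
         snd (snd (Wf s (\<xi> \<omega>) (fst (drive 0 Y K \<omega>)), drive s Y K \<omega>)) t)"
        using W[OF t(1)] L[OF t(1)] d[OF t(1)]
        by (simp add: refl_incr[OF c \<omega> t(2)] refl_incr[OF c \<omega> s] incr_def[of s "refl_L R \<xi> (incr 0 Y)"])
    qed
    show "traj {0..} (\<lambda>t \<omega>. (refl_W R \<xi> (incr 0 Y) t \<omega>, refl_L R \<xi> (incr 0 Y) t \<omega>, incr 0 Y t \<omega>, K t \<omega>)) \<omega> =
        full_path (\<xi> \<omega>, drive 0 Y K \<omega>)"
      unfolding full_path_def traj_def
      using d[of _ 0] by (intro restrict_ext) (simp add: refl_incr[OF c \<omega>])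
  qed
qed

end

end

section \<open>Deviations from the drift over long time windows\<close>

lemma same_law_prob:
  assumes l: "same_law S M A N B" and Q: "{x\<in>space S. Q x} \<in> sets S"
  shows "measure M {\<omega>\<in>space M. Q (A \<omega>)} = measure N {\<omega>\<in>space N. Q (B \<omega>)}"
proof -
  have *: "measure M' {\<omega>\<in>space M'. Q (F \<omega>)} = measure (distr M' S F) {x\<in>space S. Q x}"
    if F: "F \<in> measurable M' S" for M' :: "'z measure" and F
    unfolding measure_distr[OF F Q]
    by (rule arg_cong[where f = "measure M'"]) (use measurable_space[OF F] in auto)
  show ?thesis using l by (simp add: same_law_def *)
qed

lemma same_law_AE:
  assumes l: "same_law S M A N B" and Q: "{x\<in>space S. Q x} \<in> sets S" and ae: "AE \<omega> in N. Q (B \<omega>)"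
  shows "AE \<omega> in M. Q (A \<omega>)"
proof -
  have m: "A \<in> measurable M S" "B \<in> measurable N S" and e: "distr M S A = distr N S B"
    using l by (auto simp: same_law_def)
  show ?thesis
    unfolding AE_distr_iff[OF m(1) Q, symmetric] e AE_distr_iff[OF m(2) Q] by (rule ae)
qed

text \<open>
  The two-sided process seen from any time \<open>s\<close> is a copy of the increments of \<open>X\<close>. Events of
  a window \<open>[-k, 0]\<close> of the former thus have the probability of the same event of \<open>[0, k]\<close> for the latter.
\<close>
lemma two_sided_window:
  fixes X :: "real \<Rightarrow> 'a \<Rightarrow> real^'n" and Z :: "real \<Rightarrow> 'b \<Rightarrow> real^'n"
  assumes "two_sided_extension M X N Z"
  shows "same_process_law N (incr s Z) M (incr 0 X)"
proof -
  have u: "same_law (path_space UNIV) N (traj UNIV (incr s Z)) N (traj UNIV (incr 0 Z))"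
    and x: "same_process_law N (incr 0 Z) M (incr 0 X)"
    using assms by (auto simp: two_sided_extension_def)
  have "same_law (path_space {0..}) N (traj {0..} (incr s Z)) N (traj {0..} (incr 0 Z))"
  proof (rule same_law_map[OF u])
    show "(\<lambda>f. restrict f {0..}) \<in> measurable (path_space UNIV) (path_space {0..})"
      unfolding path_space_def by (rule measurable_restrict_subset) simp
  qed (auto simp: traj_def restrict_def fun_eq_iff)
  then show ?thesis using x unfolding same_process_law_def by (rule same_law_trans)
qed

text \<open>
  Looking back from \<open>T\<close>, the path leaves a corridor of width \<open>c + \<epsilon> s\<close> around the drift. Only rational
  look-back times are used, for the sake of measurability.
\<close>
definition deviates :: "real^'n \<Rightarrow> real \<Rightarrow> real \<Rightarrow> real \<Rightarrow> (real \<Rightarrow> real^'n) \<Rightarrow> bool" where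
  "deviates v \<epsilon> c T y \<longleftrightarrow> (\<exists>s\<in>\<rat> \<inter> {0..T}. c + \<epsilon> * s < norm (y T - y (T - s) - s *\<^sub>R v))"

lemma sets_norm_less:
  fixes f :: "'a \<Rightarrow> real^'n"
  assumes "f \<in> borel_measurable M"
  shows "{x\<in>space M. c < norm (f x)} \<in> sets M" "{x\<in>space M. norm (f x) \<le> c} \<in> sets M"
  using assms by measurable

lemma sets_deviates:
  assumes "\<And>u. u \<in> {0..T} \<Longrightarrow> (\<lambda>x. y x u) \<in> borel_measurable M"
  shows "{x\<in>space M. deviates v \<epsilon> c T (y x)} \<in> sets M"
  unfolding deviates_def
  by (intro sets.sets_Collect_countable_Ex' sets_norm_less countable_Int1 countable_rat
      borel_measurable_diff borel_measurable_const assms) auto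

text \<open>
  Right continuity extends the corridor from rational to all times; the end time is an integer, so
  that a rational look-back time corresponds to a rational time.
\<close>
lemma not_deviates_bound:
  fixes y :: "real \<Rightarrow> real^'n"
  assumes y: "cadlag y" and nd: "\<not> deviates v \<epsilon> c (real k) y" and c: "0 \<le> c" and u: "0 \<le> u" "u \<le> real k"
  shows "norm (y (real k) - y u - (real k - u) *\<^sub>R v) \<le> c + \<epsilon> * (real k - u)"
proof (rule ccontr)
  let ?g = "\<lambda>u. norm (y (real k) - y u - (real k - u) *\<^sub>R v) - (c + \<epsilon> * (real k - u))"
  assume neg: "\<not> ?thesis"
  then have "u \<noteq> real k" using c by auto
  then have uk: "u < real k" using u by simp
  have "continuous (at_right u) y" using y u by (simp add: cadlag_def)
  then have "(?g \<longlongrightarrow> ?g u) (at_right u)"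
    unfolding continuous_within by (intro tendsto_intros)
  moreover have "0 < ?g u" using neg by simp
  ultimately have "eventually (\<lambda>x. 0 < ?g x) (at_right u)" by (rule order_tendstoD(1))
  then obtain b where b: "u < b" "\<And>x. u < x \<Longrightarrow> x < b \<Longrightarrow> 0 < ?g x"
    unfolding eventually_at_right_field by blast
  obtain q where q: "q \<in> \<rat>" "u < q" "q < min b (real k)"
    using Rats_dense_in_real[of u "min b (real k)"] b uk by auto
  have "deviates v \<epsilon> c (real k) y"
    unfolding deviates_def
  proof (rule bexI[of _ "real k - q"])
    show "c + \<epsilon> * (real k - q) < norm (y (real k) - y (real k - (real k - q)) - (real k - q) *\<^sub>R v)"
      using b(2)[of q] q by simp
    show "real k - q \<in> \<rat> \<inter> {0..real k}" using q u by auto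
  qed
  then show False using nd by simp
qed

text \<open>
  The two-sided process need not be cadlag, but boundedness along the rationals of a compact window
  is an event on the product space, and it holds for \<open>X\<close>.
\<close>
lemma AE_window_bounded:
  fixes X :: "real \<Rightarrow> 'a \<Rightarrow> real^'n" and Z :: "real \<Rightarrow> 'b \<Rightarrow> real^'n"
  assumes X: "cadlag_process M X" and Z: "two_sided_extension M X N Z"
  shows "AE \<omega> in N. \<exists>b::nat. \<forall>s\<in>\<rat> \<inter> {0..real T}. norm (Z 0 \<omega> - Z (- s) \<omega>) \<le> real b"
proof -
  let ?S = "path_space {0..} :: (real \<Rightarrow> real^'n) measure"
  let ?Q = "\<lambda>y :: real \<Rightarrow> real^'n. \<exists>b::nat. \<forall>s\<in>\<rat> \<inter> {0..real T}. norm (y (real T) - y (real T - s)) \<le> real b"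
  have Q: "{y\<in>space ?S. ?Q y} \<in> sets ?S"
    by (intro sets.sets_Collect_countable_Ex sets.sets_Collect_countable_All' sets_norm_less countable_Int1
        countable_rat borel_measurable_diff measurable_path_coordinate) auto
  have "AE \<omega> in N. ?Q (traj {0..} (incr (- real T) Z) \<omega>)"
  proof (rule same_law_AE[OF two_sided_window[OF Z, of "- real T", unfolded same_process_law_def] Q], rule AE_I2)
    fix \<omega> assume "\<omega> \<in> space M"
    then have "cadlag (\<lambda>t. X t \<omega>)" using X by (simp add: cadlag_process_def)
    then have "bounded ((\<lambda>t. X t \<omega>) ` {0..real T})" by (rule cadlag_bounded) simp
    then obtain a where a: "\<And>t. t \<in> {0..real T} \<Longrightarrow> norm (X t \<omega>) \<le> a" unfolding bounded_iff by blast
    obtain b :: nat where b: "2 * a \<le> real b" using real_arch_simple by blast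
    show "?Q (traj {0..} (incr 0 X) \<omega>)"
    proof (intro exI[of _ b] ballI)
      fix s :: real assume s: "s \<in> \<rat> \<inter> {0..real T}"
      have "norm (X (real T) \<omega> - X (real T - s) \<omega>) \<le> norm (X (real T) \<omega>) + norm (X (real T - s) \<omega>)"
        by (rule norm_triangle_ineq4)
      also have "\<dots> \<le> a + a" using s by (intro add_mono a) auto
      finally show "norm (traj {0..} (incr 0 X) \<omega> (real T) - traj {0..} (incr 0 X) \<omega> (real T - s)) \<le> real b"
        using b s by (simp add: traj_def incr_def)
    qed
  qed
  then show ?thesis by (simp add: traj_def incr_def)
qed

text \<open>
  The limit at minus infinity controls all sufficiently long look-back times, and boundedness along
  the rationals the remaining ones.
\<close>
lemma AE_backward_deviation_finite:
  fixes X :: "real \<Rightarrow> 'a \<Rightarrow> real^'n" and Z :: "real \<Rightarrow> 'b \<Rightarrow> real^'n"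
  assumes X: "cadlag_process M X" and Z: "two_sided_extension M X N Z"
    and lim: "AE \<omega> in N. ((\<lambda>t. Z t \<omega> /\<^sub>R t) \<longlongrightarrow> v) at_bot" and e: "0 < \<epsilon>"
  shows "AE \<omega> in N. \<exists>c::nat. \<forall>s::real\<in>\<rat> \<inter> {0..}. norm (Z 0 \<omega> - Z (- s) \<omega> - s *\<^sub>R v) \<le> real c + \<epsilon> * s"
proof -
  have "AE \<omega> in N. \<forall>T::nat. \<exists>b::nat. \<forall>s\<in>\<rat> \<inter> {0..real T}. norm (Z 0 \<omega> - Z (- s) \<omega>) \<le> real b"
    unfolding AE_all_countable using AE_window_bounded[OF X Z] by blast
  with lim show ?thesis
  proof eventually_elim
    case (elim \<omega>)
    have "eventually (\<lambda>t. dist (Z t \<omega> /\<^sub>R t) v < \<epsilon>) at_bot" using elim(1) e by (rule tendstoD)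
    then obtain t0 where t0: "\<And>t. t \<le> t0 \<Longrightarrow> dist (Z t \<omega> /\<^sub>R t) v < \<epsilon>"
      unfolding eventually_at_bot_linorder by blast
    obtain T :: nat where T: "max 1 (- t0) \<le> real T" using real_arch_simple by blast
    obtain b :: nat where b: "\<And>s. s \<in> \<rat> \<inter> {0..real T} \<Longrightarrow> norm (Z 0 \<omega> - Z (- s) \<omega>) \<le> real b"
      using elim(2) by blast
    obtain c :: nat where c: "max (norm (Z 0 \<omega>)) (real b + real T * norm v) \<le> real c" using real_arch_simple by blast
    show ?case
    proof (intro exI[of _ c] ballI)
      fix s :: real assume s: "s \<in> \<rat> \<inter> {0..}"
      show "norm (Z 0 \<omega> - Z (- s) \<omega> - s *\<^sub>R v) \<le> real c + \<epsilon> * s"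
      proof (cases "s \<le> real T")
        case True
        have "norm (Z 0 \<omega> - Z (- s) \<omega> - s *\<^sub>R v) \<le> norm (Z 0 \<omega> - Z (- s) \<omega>) + norm (s *\<^sub>R v)"
          by (rule norm_triangle_ineq4)
        also have "\<dots> \<le> real b + real T * norm v"
          using b[of s] True s by (intro add_mono) (auto intro: mult_right_mono)
        also have "\<dots> \<le> real c + \<epsilon> * s" using c e s by (intro add_increasing2) auto
        finally show ?thesis .
      next
        case False
        then have s0: "0 < s" "- s \<le> t0" using T by auto
        have "dist (Z (- s) \<omega> /\<^sub>R (- s)) v < \<epsilon>" by (rule t0[OF s0(2)])
        then have "s * norm (Z (- s) \<omega> /\<^sub>R (- s) - v) \<le> s * \<epsilon>" using s0 by (simp add: dist_norm)
        moreover have "s * norm (Z (- s) \<omega> /\<^sub>R (- s) - v) = norm (- Z (- s) \<omega> - s *\<^sub>R v)"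
        proof -
          have "s * norm (Z (- s) \<omega> /\<^sub>R (- s) - v) = norm (s *\<^sub>R (Z (- s) \<omega> /\<^sub>R (- s) - v))" using s0 by simp
          also have "s *\<^sub>R (Z (- s) \<omega> /\<^sub>R (- s) - v) = - Z (- s) \<omega> - s *\<^sub>R v"
            using s0 by (simp add: scaleR_diff_right)
          finally show ?thesis .
        qed
        moreover have "norm (Z 0 \<omega> - Z (- s) \<omega> - s *\<^sub>R v) \<le> norm (Z 0 \<omega>) + norm (- Z (- s) \<omega> - s *\<^sub>R v)"
          using norm_triangle_ineq[of "Z 0 \<omega>" "- Z (- s) \<omega> - s *\<^sub>R v"] by (simp add: algebra_simps)
        ultimately show ?thesis using c by (simp add: mult.commute)
      qed
    qed
  qed
qed

text \<open>
  The width that is exceeded only with probability \<open>\<delta>\<close> by some look-back time from the origin of the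
  two-sided process works for every end time \<open>k\<close> of \<open>X\<close>: shift the window to end at \<open>0\<close>.
\<close>
lemma deviation_control:
  fixes X :: "real \<Rightarrow> 'a \<Rightarrow> real^'n" and Z :: "real \<Rightarrow> 'b \<Rightarrow> real^'n"
  assumes X: "cadlag_process M X" and Z: "two_sided_extension M X N Z"
    and lim: "AE \<omega> in N. ((\<lambda>t. Z t \<omega> /\<^sub>R t) \<longlongrightarrow> v) at_bot" and e: "0 < \<epsilon>" and d: "0 < \<delta>"
  obtains c where "0 \<le> c" "\<And>k::nat. measure M {\<omega>\<in>space M. deviates v \<epsilon> c (real k) (\<lambda>u. incr 0 X u \<omega>)} \<le> \<delta>"
proof -
  let ?S = "path_space {0..} :: (real \<Rightarrow> real^'n) measure"
  interpret N: prob_space N using Z by (simp add: two_sided_extension_def)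
  have Zm: "Z t \<in> borel_measurable N" for t using Z by (simp add: two_sided_extension_def)
  define G where "G m = {\<omega>\<in>space N. \<exists>s::real\<in>\<rat> \<inter> {0..}. real m + \<epsilon> * s < norm (Z 0 \<omega> - Z (- s) \<omega> - s *\<^sub>R v)}" for m :: nat
  have G: "G m \<in> sets N" for m
    unfolding G_def
    by (intro sets.sets_Collect_countable_Ex' sets_norm_less countable_Int1 countable_rat
        borel_measurable_diff borel_measurable_const Zm)
  have "decseq G"
  proof (rule decseq_SucI, rule subsetI)
    fix m \<omega> assume "\<omega> \<in> G (Suc m)"
    then obtain s :: real where "\<omega> \<in> space N" "s \<in> \<rat> \<inter> {0..}"
      "real (Suc m) + \<epsilon> * s < norm (Z 0 \<omega> - Z (- s) \<omega> - s *\<^sub>R v)"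
      unfolding G_def by blast
    then show "\<omega> \<in> G m" unfolding G_def by (auto intro!: bexI[of _ s])
  qed
  then have "(\<lambda>m. measure N (G m)) \<longlonglongrightarrow> measure N (\<Inter>m. G m)"
    using G by (intro N.finite_Lim_measure_decseq) auto
  moreover have "measure N (\<Inter>m. G m) = 0"
  proof -
    have "AE \<omega> in N. \<omega> \<notin> (\<Inter>m. G m)"
      using AE_backward_deviation_finite[OF X Z lim e]
      by eventually_elim (auto simp: G_def not_less)
    moreover have "(\<Inter>m. G m) \<in> sets N" using G by auto
    ultimately show ?thesis by (simp add: N.prob_eq_0)
  qed
  ultimately have "eventually (\<lambda>m. measure N (G m) < \<delta>) sequentially"
    using d by (auto dest: order_tendstoD(2))
  then obtain m where m: "measure N (G m) < \<delta>" by (auto simp: eventually_sequentially)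
  have "measure M {\<omega>\<in>space M. deviates v \<epsilon> (real m) (real k) (\<lambda>u. incr 0 X u \<omega>)} \<le> \<delta>" for k :: nat
  proof -
    have traj: "deviates v \<epsilon> (real m) (real k) (traj {0..} f \<omega>) = deviates v \<epsilon> (real m) (real k) (\<lambda>u. f u \<omega>)"
      for f :: "real \<Rightarrow> 'z \<Rightarrow> real^'n" and \<omega>
      unfolding deviates_def traj_def by (intro bex_cong refl) auto
    have "measure M {\<omega>\<in>space M. deviates v \<epsilon> (real m) (real k) (traj {0..} (incr 0 X) \<omega>)} =
        measure N {\<omega>\<in>space N. deviates v \<epsilon> (real m) (real k) (traj {0..} (incr (- real k) Z) \<omega>)}"
    proof (rule same_law_prob[symmetric, OF two_sided_window[OF Z, unfolded same_process_law_def]])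
      show "{x \<in> space ?S. deviates v \<epsilon> (real m) (real k) x} \<in> sets ?S"
        by (intro sets_deviates measurable_path_coordinate) auto
    qed
    also have "\<dots> \<le> measure N (G m)"
    proof (rule N.finite_measure_mono[OF _ G], rule subsetI)
      fix \<omega> assume "\<omega> \<in> {\<omega>\<in>space N. deviates v \<epsilon> (real m) (real k) (traj {0..} (incr (- real k) Z) \<omega>)}"
      then show "\<omega> \<in> G m"
        unfolding traj by (auto simp: deviates_def incr_def G_def)
    qed
    also have "\<dots> \<le> \<delta>" using m by simp
    finally show ?thesis unfolding traj .
  qed
  then show thesis by (intro that[of "real m"]) auto
qed

section \<open>The drift as mean increment, and stability of the driving law\<close>

lemma deviates_end: "c + \<epsilon> * real k < norm (y (real k) - y 0 - real k *\<^sub>R v) \<Longrightarrow> deviates v \<epsilon> c (real k) y"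
  unfolding deviates_def by (intro bexI[of _ "real k"]) auto

lemma stationary_increments_step:
  fixes X :: "real \<Rightarrow> 'a \<Rightarrow> real^'n"
  assumes X: "cadlag_process M X" and st: "stationary_increments M X" and s: "0 \<le> s"
    and g: "(g :: real^'n \<Rightarrow> 'b::{banach, second_countable_topology}) \<in> borel_measurable borel"
  shows "(\<integral>\<omega>. g (X (s + 1) \<omega> - X s \<omega>) \<partial>M) = (\<integral>\<omega>. g (X 1 \<omega> - X 0 \<omega>) \<partial>M)"
    "integrable M (\<lambda>\<omega>. g (X (s + 1) \<omega> - X s \<omega>)) \<longleftrightarrow> integrable M (\<lambda>\<omega>. g (X 1 \<omega> - X 0 \<omega>))"
proof -
  let ?S = "path_space {0..} :: (real \<Rightarrow> real^'n) measure"
  have m: "traj {0..} (incr s X) \<in> measurable M ?S" "traj {0..} (incr 0 X) \<in> measurable M ?S"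
    and e: "distr M ?S (traj {0..} (incr s X)) = distr M ?S (traj {0..} (incr 0 X))"
    using st[unfolded stationary_increments_def same_process_law_def same_law_def, rule_format, OF s] by blast+
  have gm: "(\<lambda>f. g (f 1)) \<in> borel_measurable ?S"
    by (rule measurable_compose[OF measurable_path_coordinate g]) simp
  have t: "traj {0..} (incr r X) \<omega> 1 = X (r + 1) \<omega> - X r \<omega>" for r \<omega> by (simp add: traj_def incr_def)
  show "(\<integral>\<omega>. g (X (s + 1) \<omega> - X s \<omega>) \<partial>M) = (\<integral>\<omega>. g (X 1 \<omega> - X 0 \<omega>) \<partial>M)"
    using trans[OF integral_distr[OF m(1) gm, symmetric, unfolded e] integral_distr[OF m(2) gm]] unfolding t by simp
  show "integrable M (\<lambda>\<omega>. g (X (s + 1) \<omega> - X s \<omega>)) \<longleftrightarrow> integrable M (\<lambda>\<omega>. g (X 1 \<omega> - X 0 \<omega>))"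
    using trans[OF integrable_distr_eq[OF m(1) gm, symmetric, unfolded e] integrable_distr_eq[OF m(2) gm]] unfolding t by simp
qed

lemma integral_tail_small:
  fixes f :: "'a \<Rightarrow> real^'n"
  assumes f: "integrable M f" and e: "0 < \<epsilon>"
  obtains B where "0 \<le> B" "(\<integral>x. (if B < norm (f x) then norm (f x) else 0) \<partial>M) < \<epsilon>"
proof -
  have fm [measurable]: "f \<in> borel_measurable M" using f by (rule borel_measurable_integrable)
  have "(\<lambda>m. \<integral>x. (if real m < norm (f x) then norm (f x) else 0) \<partial>M) \<longlonglongrightarrow> (\<integral>x. 0 \<partial>M)"
  proof (rule integral_dominated_convergence[where w = "\<lambda>x. norm (f x)"])
    show "AE x in M. (\<lambda>m. if real m < norm (f x) then norm (f x) else 0) \<longlonglongrightarrow> 0"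
    proof (rule AE_I2)
      fix x
      obtain m0 :: nat where m0: "norm (f x) \<le> real m0" using real_arch_simple by blast
      have "eventually (\<lambda>m. (if real m < norm (f x) then norm (f x) else 0) = 0) sequentially"
        using eventually_ge_at_top[of m0] by eventually_elim (use m0 in auto)
      then show "(\<lambda>m. if real m < norm (f x) then norm (f x) else 0) \<longlonglongrightarrow> 0" by (rule tendsto_eventually)
    qed
  qed (use f in auto)
  then have "eventually (\<lambda>m. (\<integral>x. (if real m < norm (f x) then norm (f x) else 0) \<partial>M) < \<epsilon>) sequentially"
    using e by (auto dest: order_tendstoD(2))
  then obtain m where "(\<integral>x. (if real m < norm (f x) then norm (f x) else 0) \<partial>M) < \<epsilon>"
    by (auto simp: eventually_sequentially)
  then show thesis by (intro that[of "real m"]) auto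
qed

text \<open>
  The average \<open>S / k\<close> of \<open>k\<close> increments is within \<open>\<epsilon> + c / k\<close> of \<open>v\<close> off an event of probability \<open>\<delta>\<close>. On that
  event it is bounded by \<open>B\<close> plus the average of the increments larger than \<open>B\<close>, whose expectation
  is that of a single large increment. So the expectation of \<open>S / k\<close>, which is the mean increment, is
  within \<open>4 \<epsilon>\<close> of \<open>v\<close>.
\<close>
lemma drift_eq_mean:
  fixes X :: "real \<Rightarrow> 'a \<Rightarrow> real^'n" and Z :: "real \<Rightarrow> 'b \<Rightarrow> real^'n"
  assumes X: "cadlag_process M X" and st: "stationary_increments M X" and Z: "two_sided_extension M X N Z"
    and lim: "AE \<omega> in N. ((\<lambda>t. Z t \<omega> /\<^sub>R t) \<longlongrightarrow> v) at_bot"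
    and int: "integrable M (\<lambda>\<omega>. X 1 \<omega> - X 0 \<omega>)"
  shows "v = (\<integral>\<omega>. X 1 \<omega> - X 0 \<omega> \<partial>M)"
proof -
  interpret M: prob_space M using X by (simp add: cadlag_process_def)
  have Xm [measurable]: "X t \<in> borel_measurable M" if "0 \<le> t" for t using X that by (simp add: cadlag_process_def)
  define m where "m = (\<integral>\<omega>. X 1 \<omega> - X 0 \<omega> \<partial>M)"
  define \<xi> where "\<xi> j \<omega> = X (real j + 1) \<omega> - X (real j) \<omega>" for j :: nat and \<omega>
  define tail :: "real \<Rightarrow> real^'n \<Rightarrow> real" where "tail B x = (if B < norm x then norm x else 0)" for B x
  have tm [measurable]: "tail B \<in> borel_measurable borel" for B unfolding tail_def[abs_def] by measurable
  have \<xi>i: "integrable M (\<xi> j)" and \<xi>m: "(\<integral>\<omega>. \<xi> j \<omega> \<partial>M) = m" for j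
    using stationary_increments_step[OF X st, of "real j" "\<lambda>x. x"] int by (simp_all add: \<xi>_def[abs_def] m_def)
  have ti: "integrable M (\<lambda>\<omega>. tail B (\<xi> j \<omega>))" for B j
    by (rule Bochner_Integration.integrable_bound[OF integrable_norm[OF \<xi>i[of j]]])
      (use \<xi>i[of j] in \<open>auto simp: tail_def[abs_def] dest: borel_measurable_integrable\<close>)
  have tl: "(\<integral>\<omega>. tail B (\<xi> j \<omega>) \<partial>M) = (\<integral>\<omega>. tail B (X 1 \<omega> - X 0 \<omega>) \<partial>M)" for B j
    using stationary_increments_step(1)[OF X st, of "real j" "tail B"] by (simp add: \<xi>_def)
  have "norm (m - v) \<le> 4 * \<epsilon>" if e: "0 < \<epsilon>" for \<epsilon>
  proof -
    obtain B where B: "0 \<le> B" "(\<integral>\<omega>. tail B (X 1 \<omega> - X 0 \<omega>) \<partial>M) < \<epsilon>"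
      by (rule integral_tail_small[OF int e]) (auto simp: tail_def)
    \<comment> \<open>on the exceptional event the integrand is at most \<open>B + norm v\<close> plus the tail\<close>
    define \<delta> where "\<delta> = \<epsilon> / (B + norm v + 1)"
    have \<delta>: "0 < \<delta>" "(B + norm v) * \<delta> \<le> \<epsilon>"
    proof -
      have p: "0 < B + norm v + 1" using B(1) norm_ge_zero[of v] by linarith
      then show "0 < \<delta>" using e by (simp add: \<delta>_def)
      show "(B + norm v) * \<delta> \<le> \<epsilon>" using p e by (simp add: \<delta>_def pos_divide_le_eq algebra_simps)
    qed
    obtain c where c: "0 \<le> c" "\<And>k::nat. measure M {\<omega>\<in>space M. deviates v \<epsilon> c (real k) (\<lambda>u. incr 0 X u \<omega>)} \<le> \<delta>"
      using deviation_control[OF X Z lim e \<delta>(1)] by blast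
    obtain k0 :: nat where k0: "c / \<epsilon> \<le> real k0" using real_arch_simple by blast
    define k where "k = Suc k0"
    have k: "0 < real k" "c \<le> \<epsilon> * real k"
      using k0 e by (auto simp: k_def pos_divide_le_eq algebra_simps)
    define E where "E = {\<omega>\<in>space M. deviates v \<epsilon> c (real k) (\<lambda>u. incr 0 X u \<omega>)}"
    have E: "E \<in> sets M" unfolding E_def incr_def by (intro sets_deviates borel_measurable_diff Xm) auto
    define S where "S \<omega> = (\<Sum>j<k. \<xi> j \<omega>)" for \<omega>
    have S_eq: "S \<omega> = X (real k) \<omega> - X 0 \<omega>" for \<omega>
      using sum_lessThan_telescope[of "\<lambda>j. X (real j) \<omega>" k] by (simp add: S_def \<xi>_def add.commute)
    have bound: "norm (S \<omega> - real k *\<^sub>R v) \<le>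
        2 * \<epsilon> * real k + real k * (B + norm v) * indicator E \<omega> + (\<Sum>j<k. tail B (\<xi> j \<omega>))" if \<omega>: "\<omega> \<in> space M" for \<omega>
    proof (cases "\<omega> \<in> E")
      case True
      have "norm (S \<omega> - real k *\<^sub>R v) \<le> norm (S \<omega>) + norm (real k *\<^sub>R v)" by (rule norm_triangle_ineq4)
      also have "norm (S \<omega>) \<le> (\<Sum>j<k. norm (\<xi> j \<omega>))" unfolding S_def by (rule norm_sum)
      also have "\<dots> \<le> (\<Sum>j<k. B + tail B (\<xi> j \<omega>))" using B(1) by (intro sum_mono) (auto simp: tail_def)
      also have "\<dots> = real k * B + (\<Sum>j<k. tail B (\<xi> j \<omega>))" by (simp add: sum.distrib)
      finally have "norm (S \<omega> - real k *\<^sub>R v) \<le> real k * B + (\<Sum>j<k. tail B (\<xi> j \<omega>)) + real k * norm v" by simp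
      moreover have "0 \<le> 2 * \<epsilon> * real k" using e by simp
      ultimately show ?thesis using True by (simp add: algebra_simps)
    next
      case False
      then have "\<not> c + \<epsilon> * real k < norm (S \<omega> - real k *\<^sub>R v)"
        using \<omega> deviates_end[of c \<epsilon> k "\<lambda>u. incr 0 X u \<omega>" v] by (auto simp: E_def S_eq incr_def)
      moreover have "0 \<le> (\<Sum>j<k. tail B (\<xi> j \<omega>))" by (intro sum_nonneg) (simp add: tail_def)
      ultimately show ?thesis using False k(2) by simp
    qed
    have Si: "integrable M S" unfolding S_def[abs_def] using \<xi>i by auto
    have "(\<integral>\<omega>. S \<omega> - real k *\<^sub>R v \<partial>M) = real k *\<^sub>R (m - v)"
      using Si \<xi>i by (simp add: S_def[abs_def] \<xi>m scaleR_diff_right sum_constant_scaleR M.prob_space del: sum_constant)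
    then have "real k * norm (m - v) = norm (\<integral>\<omega>. S \<omega> - real k *\<^sub>R v \<partial>M)" by simp
    also have "\<dots> \<le> (\<integral>\<omega>. norm (S \<omega> - real k *\<^sub>R v) \<partial>M)" by (rule integral_norm_bound)
    also have "\<dots> \<le> (\<integral>\<omega>. 2 * \<epsilon> * real k + real k * (B + norm v) * indicator E \<omega> + (\<Sum>j<k. tail B (\<xi> j \<omega>)) \<partial>M)"
    proof (rule integral_mono)
      show "integrable M (\<lambda>\<omega>. norm (S \<omega> - real k *\<^sub>R v))" using Si by auto
      show "integrable M (\<lambda>\<omega>. 2 * \<epsilon> * real k + real k * (B + norm v) * indicator E \<omega> + (\<Sum>j<k. tail B (\<xi> j \<omega>)))"
        using ti E by (intro Bochner_Integration.integrable_add Bochner_Integration.integrable_sum integrable_mult_right)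
          (auto simp: M.emeasure_eq_measure)
    qed (rule bound)
    also have "\<dots> = 2 * \<epsilon> * real k + real k * (B + norm v) * measure M E + real k * (\<integral>\<omega>. tail B (X 1 \<omega> - X 0 \<omega>) \<partial>M)"
    proof -
      have "integrable M (indicator E :: 'a \<Rightarrow> real)" using E by (auto simp: M.emeasure_eq_measure)
      then show ?thesis
        using ti E by (simp add: Bochner_Integration.integral_sum tl M.prob_space del: indicator_simps)
    qed
    also have "\<dots> \<le> 2 * \<epsilon> * real k + real k * \<epsilon> + real k * \<epsilon>"
    proof -
      have "(B + norm v) * measure M E \<le> (B + norm v) * \<delta>"
        using c(2)[of k] B(1) by (intro mult_left_mono) (auto simp: E_def)
      then have "(B + norm v) * measure M E \<le> \<epsilon>" using \<delta>(2) by linarith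
      then have "real k * ((B + norm v) * measure M E) \<le> real k * \<epsilon>" by (intro mult_left_mono) auto
      moreover have "real k * (\<integral>\<omega>. tail B (X 1 \<omega> - X 0 \<omega>) \<partial>M) \<le> real k * \<epsilon>"
        using B(2) by (intro mult_left_mono) auto
      ultimately show ?thesis by (simp only: mult.assoc[of "real k"])
    qed
    also have "\<dots> = real k * (4 * \<epsilon>)" by (simp add: algebra_simps)
    finally show ?thesis using k(1) by simp
  qed
  from this[of "e / 4" for e] have "norm (m - v) \<le> 0 + e" if "0 < e" for e :: real
    using that by simp
  then have "norm (m - v) \<le> 0" by (rule field_le_epsilon)
  then show ?thesis by (simp add: m_def)
qed


context skorohod_matrix
begin

lemma one_le_Ri_one: "1 \<le> Ri 1 $ i"
  using le_Ri[of 1] by (simp add: less_eq_vec_def)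

text \<open>
  The factor two leaves room both for the bound on the state and for the drift of the path itself.
\<close>
lemma stability_margin:
  assumes v: "\<And>i. Ri v $ i < 0"
  obtains \<epsilon> where "0 < \<epsilon>" "\<And>i. 2 * \<epsilon> * Ri 1 $ i \<le> - Ri v $ i"
proof -
  define \<epsilon> where "\<epsilon> = Min (range (\<lambda>i. - Ri v $ i / (2 * Ri 1 $ i)))"
  have p: "0 < Ri 1 $ i" for i using one_le_Ri_one[of i] by linarith
  have "0 < \<epsilon>" unfolding \<epsilon>_def using v p by (auto simp: divide_neg_pos)
  moreover have "2 * \<epsilon> * Ri 1 $ i \<le> - Ri v $ i" for i
  proof -
    have "\<epsilon> \<le> - Ri v $ i / (2 * Ri 1 $ i)" unfolding \<epsilon>_def by (intro Min_le) auto
    then have "\<epsilon> * (2 * Ri 1 $ i) \<le> - Ri v $ i" using p[of i] by (subst (asm) pos_le_divide_eq) auto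
    then show ?thesis by (simp add: mult_ac)
  qed
  ultimately show thesis by (rule that)
qed

text \<open>
  One event yields both standing assumptions: a bounded state, and a path that has moved far into the
  negative direction under \<open>R\<^sup>-\<^sup>1\<close>.
\<close>
lemma no_deviation_consequences:
  assumes y: "cadlag y" "y 0 = 0" and nd: "\<not> deviates v \<epsilon> c (real k) y" and c: "0 \<le> c"
    and \<epsilon>: "0 < \<epsilon>" "\<And>i. 2 * \<epsilon> * Ri 1 $ i \<le> - Ri v $ i"
  shows "Wlim {0..} y (real k) $ i \<le> c * Ri 1 $ i"
    and "Ri (y (real k)) $ i \<le> c * Ri 1 $ i + real k * Ri v $ i / 2"
proof -
  have b: "\<bar>y (real k) $ i - y u $ i - v $ i * (real k - u)\<bar> \<le> c + \<epsilon> * (real k - u)" if "0 \<le> u" "u \<le> real k" for u i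
    using component_le_norm_cart[of "y (real k) - y u - (real k - u) *\<^sub>R v" i] not_deviates_bound[OF y(1) nd c that]
    by (simp add: mult.commute)
  have m: "\<epsilon> * Ri 1 $ i \<le> - Ri v $ i" for i
    using \<epsilon>(2)[of i] mult_pos_pos[OF \<epsilon>(1), of "Ri 1 $ i"] one_le_Ri_one[of i] by linarith
  show "Wlim {0..} y (real k) $ i \<le> c * Ri 1 $ i"
    by (rule Wlim_stability_bound[OF cadlag_lower_bounded[OF y(1)] y(2) _ c m b]) simp_all
  have "y (real k) \<le> real k *\<^sub>R v + (c + \<epsilon> * real k) *\<^sub>R 1"
    using b[of 0] by (auto simp: less_eq_vec_def y(2) abs_le_iff algebra_simps)
  then have "Ri (y (real k)) \<le> Ri (real k *\<^sub>R v + (c + \<epsilon> * real k) *\<^sub>R 1)" by (rule Ri_mono)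
  then have "Ri (y (real k)) $ i \<le> real k * Ri v $ i + (c + \<epsilon> * real k) * Ri 1 $ i"
    by (simp add: less_eq_vec_def matrix_vector_right_distrib matrix_vector_mult_scaleR)
  moreover have "real k * (2 * \<epsilon> * Ri 1 $ i) \<le> real k * (- Ri v $ i)" by (intro mult_left_mono \<epsilon>(2)) simp
  ultimately show "Ri (y (real k)) $ i \<le> c * Ri 1 $ i + real k * Ri v $ i / 2" by (simp add: algebra_simps)
qed

text \<open>
  Both pathwise conclusions hold off an event whose probability is small uniformly in \<open>k\<close>. For
  tightness this is what is asked for. For unboundedness, a large \<open>k\<close> shows that every level is reached
  with probability at least \<open>1 - \<delta>\<close>, for every \<open>\<delta>\<close>.
\<close>
lemma stationary_driver_intro:
  fixes X :: "real \<Rightarrow> 'a \<Rightarrow> real^'n" and Z :: "real \<Rightarrow> 'b \<Rightarrow> real^'n" and J :: "real \<Rightarrow> 'a \<Rightarrow> 'j::polish_space"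
  assumes X: "cadlag_process M X" and Z: "two_sided_extension M X N Z"
    and lim: "AE \<omega> in N. ((\<lambda>t. Z t \<omega> /\<^sub>R t) \<longlongrightarrow> v) at_bot" and v: "\<And>i. Ri v $ i < 0"
    and XJ: "\<And>s. 0 \<le> s \<Longrightarrow> same_process_law M (\<lambda>t \<omega>. (incr s X t \<omega>, J (s + t) \<omega>)) M (\<lambda>t \<omega>. (incr 0 X t \<omega>, J t \<omega>))"
  shows "stationary_driver P p \<alpha> (distr M drive_space (drive 0 X J)) M X J"
proof -
  let ?S = "drive_space :: ((real \<Rightarrow> real^'n) \<times> (real \<Rightarrow> 'j)) measure"
  interpret M: prob_space M using X by (simp add: cadlag_process_def)
  obtain \<epsilon> where \<epsilon>: "0 < \<epsilon>" "\<And>i. 2 * \<epsilon> * Ri 1 $ i \<le> - Ri v $ i"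
    by (rule stability_margin[OF v]) blast
  have dl: "same_law ?S M (drive s X J) M (drive 0 X J)" if s: "0 \<le> s" for s
  proof (rule same_law_map[OF XJ[OF s, unfolded same_process_law_def] measurable_pair_drive])
    show "drive 0 X J \<omega> = pair_drive (traj {0..} (\<lambda>t \<omega>. (incr 0 X t \<omega>, J t \<omega>)) \<omega>)" for \<omega>
      using pair_drive_traj_incr[of 0 X J \<omega>] by simp
  qed (rule pair_drive_traj_incr[symmetric])
  have dm: "drive 0 X J \<in> measurable M ?S" using dl[of 0] by (simp add: same_law_def)
  have y: "cadlag (\<lambda>u. incr 0 X u \<omega>)" "incr 0 X 0 \<omega> = 0" if "\<omega> \<in> space M" for \<omega>
  proof -
    have "cadlag (\<lambda>u. X u \<omega>)" using X that by (simp add: cadlag_process_def)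
    from cadlag_shift[OF this order_refl, of 0 "X 0 \<omega>"] show "cadlag (\<lambda>u. incr 0 X u \<omega>)" by (simp add: incr_def)
  qed (simp add: incr_def)
  have Xm: "X t \<in> borel_measurable M" if "0 \<le> t" for t using X that by (simp add: cadlag_process_def)
  have W: "Wf t 0 (fst (drive 0 X J \<omega>)) = Wlim {0..} (\<lambda>u. incr 0 X u \<omega>) t" if "\<omega> \<in> space M" "0 \<le> t" for \<omega> t
    using refl_W_eq[where X = "incr 0 X" and \<omega> = \<omega> and \<xi> = "\<lambda>_. 0", OF y(1)[OF that(1)] that(2)]
      refl_W_Wlim[where X = "incr 0 X" and \<omega> = \<omega> and \<xi> = "\<lambda>_. 0", OF y(1)[OF that(1)] that(2)]
    by (simp add: drive_def)
  define E where "E c k = {\<omega>\<in>space M. deviates v \<epsilon> c (real k) (\<lambda>u. incr 0 X u \<omega>)}" for c k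
  have E: "E c k \<in> sets M" for c k
    unfolding E_def incr_def by (intro sets_deviates borel_measurable_diff Xm) auto
  have tight: "\<exists>c\<ge>0. \<forall>k. measure M (E c k) \<le> \<delta>" if "0 < \<delta>" for \<delta>
    using deviation_control[OF X Z lim \<epsilon>(1) that] unfolding E_def by metis
  show ?thesis
  proof unfold_locales
    show "cadlag_process M X" by (rule X)
    show "drive 0 X J \<in> measurable M drive_space" by (rule dm)
    show "distr M ?S (drive 0 X J) = distr M ?S (drive 0 X J)" ..
    show "distr (distr M ?S (drive 0 X J)) ?S (advance s) = distr M ?S (drive 0 X J)" if s: "0 \<le> s" for s
    proof -
      have "distr (distr M ?S (drive 0 X J)) ?S (advance s) = distr M ?S (drive s X J)"
        by (subst distr_distr[OF measurable_advance[OF s] dm]) (intro distr_cong refl, simp add: advance_drive[OF s])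
      then show ?thesis using dl[OF s] by (simp add: same_law_def)
    qed
    show "AE \<tau> in distr M ?S (drive 0 X J). \<forall>i. \<forall>c::nat. \<exists>k::nat. Ri (fst \<tau> (real k)) $ i \<le> - real c"
    proof (rule eventually_all_finite, unfold AE_all_countable, rule allI)
      fix i :: 'n and a :: nat
      have Qm: "{\<tau>\<in>space ?S. \<exists>k::nat. Ri (fst \<tau> (real k)) $ i \<le> - real a} \<in> sets ?S"
      proof -
        have c: "continuous_on UNIV (\<lambda>x. Ri x $ i)"
          by (intro continuous_on_component linear_continuous_on matrix_vector_mul_bounded_linear)
        have "(\<lambda>\<tau>. Ri (fst \<tau> (real k)) $ i) \<in> borel_measurable ?S" for k :: nat
          by (rule measurable_compose[OF _ borel_measurable_continuous_onI[OF c]])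
            (auto simp: drive_space_def intro!: measurable_path_eval[of _ _ "{0..}"])
        then show ?thesis by measurable
      qed
      define U where "U = {\<omega>\<in>space M. \<exists>k::nat. Ri (fst (drive 0 X J \<omega>) (real k)) $ i \<le> - real a}"
      have U: "U \<in> sets M"
        using measurable_sets[OF dm Qm] measurable_space[OF dm]
        by (simp add: U_def vimage_def Int_def conj_commute cong: conj_cong)
      have "1 \<le> measure M U + \<delta>" if \<delta>: "0 < \<delta>" for \<delta>
      proof -
        obtain c where c: "0 \<le> c" "\<And>k. measure M (E c k) \<le> \<delta>" using tight[OF \<delta>] by blast
        obtain k :: nat where k: "(c * Ri 1 $ i + real a) / (- Ri v $ i / 2) \<le> real k" using real_arch_simple by blast
        have "c * Ri 1 $ i + real k * Ri v $ i / 2 \<le> - real a"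
        proof -
          have "c * Ri 1 $ i + real a \<le> real k * (- Ri v $ i / 2)"
            using k v[of i] by (subst (asm) pos_divide_le_eq) auto
          then show ?thesis by (simp add: algebra_simps)
        qed
        then have "space M - E c k \<subseteq> U"
          using no_deviation_consequences(2)[OF y _ c(1) \<epsilon>, of _ k i]
          unfolding U_def E_def by (auto simp: drive_def traj_def intro!: exI[of _ k] elim!: order_trans[rotated])
        then have "measure M (space M - E c k) \<le> measure M U" by (rule M.finite_measure_mono[OF _ U])
        then show ?thesis using c(2)[of k] by (simp add: M.prob_compl[OF E])
      qed
      then have "1 \<le> measure M U" by (rule field_le_epsilon)
      then have "measure M U = 1" using M.prob_le_1[of U] by linarith
      from M.AE_prob_1[OF this] show "AE \<tau> in distr M ?S (drive 0 X J). \<exists>k::nat. Ri (fst \<tau> (real k)) $ i \<le> - real a"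
        unfolding AE_distr_iff[OF dm Qm] by eventually_elim (simp add: U_def)
    qed
    show "\<exists>b. \<forall>k::nat. measure (distr M ?S (drive 0 X J))
        {\<tau>\<in>space (distr M ?S (drive 0 X J)). \<exists>i. b < Wf (real k) 0 (fst \<tau>) $ i} \<le> \<delta>" if \<delta>: "0 < \<delta>" for \<delta>
    proof -
      obtain c where c: "0 \<le> c" "\<And>k. measure M (E c k) \<le> \<delta>" using tight[OF \<delta>] by blast
      define b where "b = (\<Sum>i\<in>UNIV. c * Ri 1 $ i)"
      have b: "c * Ri 1 $ i \<le> b" for i
        unfolding b_def using c(1) one_le_Ri_one by (intro member_le_sum) (auto intro!: mult_nonneg_nonneg intro: order_trans[OF zero_le_one])
      have "measure (distr M ?S (drive 0 X J)) {\<tau>\<in>space ?S. \<exists>i. b < Wf (real k) 0 (fst \<tau>) $ i} \<le> \<delta>" for k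
      proof -
        have "(\<lambda>\<tau>. Wf (real k) 0 (fst \<tau>) $ i) \<in> borel_measurable ?S" for i
          by (intro borel_measurable_nth measurable_Wf) (auto simp: drive_space_def)
        then have "{\<tau>\<in>space ?S. \<exists>i\<in>UNIV. b < Wf (real k) 0 (fst \<tau>) $ i} \<in> sets ?S"
          by (intro sets.sets_Collect_finite_Ex) auto
        then have Qm: "{\<tau>\<in>space ?S. \<exists>i. b < Wf (real k) 0 (fst \<tau>) $ i} \<in> sets ?S" by simp
        have "measure (distr M ?S (drive 0 X J)) {\<tau>\<in>space ?S. \<exists>i. b < Wf (real k) 0 (fst \<tau>) $ i} \<le> measure M (E c k)"
          unfolding measure_distr[OF dm Qm]
        proof (rule M.finite_measure_mono[OF _ E], rule subsetI)
          fix \<omega> assume "\<omega> \<in> drive 0 X J -` {\<tau>\<in>space ?S. \<exists>i. b < Wf (real k) 0 (fst \<tau>) $ i} \<inter> space M"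
          then obtain i where \<omega>: "\<omega> \<in> space M" and i: "b < Wlim {0..} (\<lambda>u. incr 0 X u \<omega>) (real k) $ i" by (auto simp: W)
          show "\<omega> \<in> E c k"
          proof (rule ccontr)
            assume "\<omega> \<notin> E c k"
            then have "\<not> deviates v \<epsilon> c (real k) (\<lambda>u. incr 0 X u \<omega>)" using \<omega> by (simp add: E_def)
            from no_deviation_consequences(1)[OF y[OF \<omega>] this c(1) \<epsilon>, of i] show False using i b[of i] by linarith
          qed
        qed
        then show ?thesis using c(2)[of k] by linarith
      qed
      then show ?thesis by auto
    qed
  qed
qed

end

section \<open>Stationarity without a background process\<close>

text \<open>
  Adjoining the constant background process zero is a measurable transformation with measurable inverse.
\<close>
lemma same_process_law_zero:
  fixes Z :: "real \<Rightarrow> 'a \<Rightarrow> 'c::second_countable_topology" and Z' :: "real \<Rightarrow> 'b \<Rightarrow> 'c"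
  shows "same_process_law M (\<lambda>t \<omega>. (Z t \<omega>, 0::real)) N (\<lambda>t \<omega>. (Z' t \<omega>, 0)) \<longleftrightarrow> same_process_law M Z N Z'"
proof
  assume "same_process_law M (\<lambda>t \<omega>. (Z t \<omega>, 0::real)) N (\<lambda>t \<omega>. (Z' t \<omega>, 0))"
  from same_process_law_map[OF this borel_measurable_fst_snd(1)] show "same_process_law M Z N Z'" by simp
next
  assume l: "same_process_law M Z N Z'"
  have "(\<lambda>x::'c. (x, 0::real)) \<in> borel_measurable borel" by (intro borel_measurable_Pair) auto
  from same_process_law_map[OF l this] show "same_process_law M (\<lambda>t \<omega>. (Z t \<omega>, 0::real)) N (\<lambda>t \<omega>. (Z' t \<omega>, 0))" .
qed

lemma stationary_version_zero:
  "stationary_version_J R M X (\<lambda>_ _. 0::real) N Y (\<lambda>_ _. 0) \<xi> \<longleftrightarrow> stationary_version R M X N Y \<xi>"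
  unfolding stationary_version_J_def stationary_version_def stationary_process_def same_process_law_zero ..

lemma invariant_start_zero:
  "invariant_start_J R N \<xi> Y (\<lambda>_ _. 0::real) \<longleftrightarrow> invariant_start R N \<xi> Y"
proof -
  let ?B = "borel :: (real^'n) measure" and ?P = "path_space {0..} :: (real \<Rightarrow> real^'n) measure" and ?K = "path_space {0..} :: (real \<Rightarrow> real) measure"
  let ?k = "\<lambda>t\<in>{0..}. 0 :: real"
  have add: "(\<lambda>z. (fst z, snd z, ?k)) \<in> measurable (?B \<Otimes>\<^sub>M ?P) (?B \<Otimes>\<^sub>M (?P \<Otimes>\<^sub>M ?K))"
    by (intro measurable_Pair measurable_fst measurable_snd measurable_const) (simp add: path_space_def space_PiM)
  have forget: "(\<lambda>z. (fst z, fst (snd z))) \<in> measurable (?B \<Otimes>\<^sub>M (?P \<Otimes>\<^sub>M ?K)) (?B \<Otimes>\<^sub>M ?P)"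
    by (intro measurable_Pair measurable_fst measurable_compose[OF measurable_snd measurable_fst])
  have eq: "same_law (?B \<Otimes>\<^sub>M (?P \<Otimes>\<^sub>M ?K)) N (\<lambda>\<omega>. (a \<omega>, b \<omega>, ?k)) N (\<lambda>\<omega>. (c \<omega>, d \<omega>, ?k)) \<longleftrightarrow>
      same_law (?B \<Otimes>\<^sub>M ?P) N (\<lambda>\<omega>. (a \<omega>, b \<omega>)) N (\<lambda>\<omega>. (c \<omega>, d \<omega>))"
    for a b c d
    by (auto elim!: same_law_map[OF _ add] same_law_map[OF _ forget])
  show ?thesis by (simp only: invariant_start_J_def invariant_start_def traj_def eq)
qed

lemma invariant_version_zero:
  "invariant_version_J R M X (\<lambda>_ _. 0::real) N Y (\<lambda>_ _. 0) \<xi> \<longleftrightarrow> invariant_version R M X N Y \<xi>"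
  unfolding invariant_version_J_def invariant_version_def same_process_law_zero invariant_start_zero ..

lemma converges_in_distribution_map:
  fixes Z :: "real \<Rightarrow> 'a \<Rightarrow> 'b::topological_space" and \<phi> :: "'b \<Rightarrow> 'c::topological_space"
  assumes c: "converges_in_distribution M Z \<nu>" and \<phi>: "continuous_on UNIV \<phi>"
  shows "converges_in_distribution M (\<lambda>t \<omega>. \<phi> (Z t \<omega>)) (distr \<nu> borel \<phi>)"
proof -
  have \<nu>: "prob_space \<nu>" "sets \<nu> = sets borel" and Z: "\<And>t. 0 \<le> t \<Longrightarrow> Z t \<in> borel_measurable M"
    and lim: "\<And>f :: 'b \<Rightarrow> real. continuous_on UNIV f \<and> bounded (range f) \<Longrightarrow>
      ((\<lambda>t. \<integral>\<omega>. f (Z t \<omega>) \<partial>M) \<longlongrightarrow> (\<integral>x. f x \<partial>\<nu>)) at_top"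
    using c unfolding converges_in_distribution_def by blast+
  have m: "\<phi> \<in> borel_measurable borel" using \<phi> by (rule borel_measurable_continuous_onI)
  have m\<nu>: "\<phi> \<in> borel_measurable \<nu>" using m by (simp add: measurable_cong_sets[OF \<nu>(2) refl])
  show ?thesis
    unfolding converges_in_distribution_def
  proof (intro conjI allI impI)
    show "prob_space (distr \<nu> borel \<phi>)" by (rule prob_space.prob_space_distr[OF \<nu>(1) m\<nu>])
    show "(\<lambda>\<omega>. \<phi> (Z t \<omega>)) \<in> borel_measurable M" if "0 \<le> t" for t
      by (rule measurable_compose[OF Z[OF that] m])
    fix f :: "'c \<Rightarrow> real" assume f: "continuous_on UNIV f \<and> bounded (range f)"
    have "continuous_on UNIV (\<lambda>x. f (\<phi> x)) \<and> bounded (range (\<lambda>x. f (\<phi> x)))"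
      using continuous_on_compose2[OF conjunct1[OF f] \<phi>] bounded_subset[OF conjunct2[OF f]] by (auto simp: image_subset_iff)
    then have "((\<lambda>t. \<integral>\<omega>. f (\<phi> (Z t \<omega>)) \<partial>M) \<longlongrightarrow> (\<integral>x. f (\<phi> x) \<partial>\<nu>)) at_top" by (rule lim)
    moreover have "f \<in> borel_measurable borel" using f by (intro borel_measurable_continuous_onI) simp
    ultimately show "((\<lambda>t. \<integral>\<omega>. f (\<phi> (Z t \<omega>)) \<partial>M) \<longlongrightarrow> (\<integral>x. f x \<partial>distr \<nu> borel \<phi>)) at_top"
      by (simp add: integral_distr[OF m\<nu>])
  qed simp
qed

locale driver_without_background = stationary_driver P p \<alpha> D M X "\<lambda>_ _. 0 :: real"
  for P :: "real^'n^'n" and p \<alpha> D and M :: "'a measure" and X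
begin

lemma converges:
  assumes Q: "limit_law Q" and \<xi>: "\<xi> \<in> borel_measurable M"
  shows "converges_in_distribution M (refl_W R \<xi> X) (distr Q borel fst)"
proof -
  have m: "(\<lambda>z. (fst z, snd (snd z) 0)) \<in> borel_measurable (borel \<Otimes>\<^sub>M drive_space :: ((real^'n) \<times> (real \<Rightarrow> real^'n) \<times> (real \<Rightarrow> real)) measure)"
    by (intro borel_measurable_Pair measurable_fst measurable_flow_coordinates(4)) simp
  have mQ: "(\<lambda>z. (fst z, snd (snd z) 0)) \<in> borel_measurable Q"
    using m by (simp add: measurable_cong_sets[OF Q_sets[OF Q] refl])
  have "distr (distr Q borel (\<lambda>z. (fst z, snd (snd z) 0))) borel fst = distr Q borel fst"
    by (subst distr_distr[OF borel_measurable_fst_snd(1) mQ]) (simp add: comp_def)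
  then show ?thesis
    using converges_in_distribution_map[OF converges_J[OF Q \<xi>] continuous_on_fst[OF continuous_on_id]] by simp
qed

lemma stationary_versions_exist:
  assumes Q: "limit_law Q"
  shows "\<exists>(N :: ('a \<times> (real^'n)) measure) \<xi>. enlargement M N \<and> stationary_version R M X N (\<lambda>t \<omega>. X t (fst \<omega>)) \<xi>"
    "\<exists>(N :: ('a \<times> (real^'n)) measure) \<xi>. enlargement M N \<and> invariant_version R M X N (\<lambda>t \<omega>. X t (fst \<omega>)) \<xi>"
  using versions_exist[OF Q] unfolding stationary_version_zero invariant_version_zero .

lemma stationary_version_unique:
  assumes Q: "limit_law Q" and "stationary_version R M X N1 Y1 \<xi>" "stationary_version R M X N2 Y2 \<eta>"
  shows "same_process_law N1 (refl_W R \<xi> Y1) N2 (refl_W R \<eta> Y2)"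
  using stationary_version_J_unique[OF Q assms(2,3)[folded stationary_version_zero]]
  unfolding same_process_law_zero .

lemma stationary_version_marginal:
  assumes Q: "limit_law Q" and "stationary_version R M X N Y \<xi>" "0 \<le> t"
  shows "distr N borel (refl_W R \<xi> Y t) = distr Q borel fst"
  using stationary_version_J_path_law(3)[OF Q assms(2)[folded stationary_version_zero] assms(3)] .

lemma invariant_version_unique:
  assumes Q: "limit_law Q" and v: "invariant_version R M X N1 Y1 \<xi>" "invariant_version R M X N2 Y2 \<eta>"
  shows "same_law (borel \<Otimes>\<^sub>M path_space {0..})
      N1 (\<lambda>\<omega>. (\<xi> \<omega>, traj {0..} (incr 0 Y1) \<omega>)) N2 (\<lambda>\<omega>. (\<eta> \<omega>, traj {0..} (incr 0 Y2) \<omega>))"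
proof (rule same_law_map[OF invariant_version_J_unique[OF Q v[folded invariant_version_zero]]])
  show "(\<lambda>z. (fst z, fst (snd z))) \<in> measurable (borel \<Otimes>\<^sub>M (path_space {0..} \<Otimes>\<^sub>M path_space {0..})) (borel \<Otimes>\<^sub>M path_space {0..})"
    by (intro measurable_Pair measurable_fst measurable_compose[OF measurable_snd measurable_fst])
qed simp_all

lemma invariant_version_process_law:
  assumes Q: "limit_law Q" and v: "invariant_version R M X N Y \<xi>"
  shows "0 \<le> s \<Longrightarrow> same_process_law
      N (\<lambda>t \<omega>. (refl_W R \<xi> (incr 0 Y) (s + t) \<omega>, incr s (refl_L R \<xi> (incr 0 Y)) t \<omega>, incr s Y t \<omega>))
      N (\<lambda>t \<omega>. (refl_W R \<xi> (incr 0 Y) t \<omega>, refl_L R \<xi> (incr 0 Y) t \<omega>, incr 0 Y t \<omega>))"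
    and "stationary_process N (refl_W R \<xi> (incr 0 Y))"
    and "stationary_increments N (refl_L R \<xi> (incr 0 Y))"
proof -
  let ?W = "refl_W R \<xi> (incr 0 Y)" and ?L = "refl_L R \<xi> (incr 0 Y)"
  have triple: "same_process_law N (\<lambda>t \<omega>. (?W (s + t) \<omega>, incr s ?L t \<omega>, incr s Y t \<omega>)) N (\<lambda>t \<omega>. (?W t \<omega>, ?L t \<omega>, incr 0 Y t \<omega>))"
    if s: "0 \<le> s" for s
  proof -
    have "(\<lambda>x. (fst x, fst (snd x), fst (snd (snd x)))) \<in> borel_measurable (borel :: ((real^'n) \<times> (real^'n) \<times> (real^'n) \<times> real) measure)"
      by (intro borel_measurable_continuous_onI continuous_intros)
    from same_process_law_map[OF invariant_version_J_process_law[OF Q v[folded invariant_version_zero] s] this] show ?thesis by simp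
  qed
  show "0 \<le> s \<Longrightarrow> same_process_law N (\<lambda>t \<omega>. (?W (s + t) \<omega>, incr s ?L t \<omega>, incr s Y t \<omega>)) N (\<lambda>t \<omega>. (?W t \<omega>, ?L t \<omega>, incr 0 Y t \<omega>))"
    by (rule triple)
  have "(\<lambda>x. fst x) \<in> borel_measurable (borel :: ((real^'n) \<times> (real^'n) \<times> (real^'n)) measure)"
    by (intro borel_measurable_continuous_onI continuous_intros)
  from same_process_law_map[OF triple this]
  show "stationary_process N ?W" by (simp add: stationary_process_def)
  have "(\<lambda>x. fst (snd x)) \<in> borel_measurable (borel :: ((real^'n) \<times> (real^'n) \<times> (real^'n)) measure)"
    by (intro borel_measurable_continuous_onI continuous_intros)
  from same_process_law_map[OF triple this]
  have L: "same_process_law N (incr s ?L) N ?L" if "0 \<le> s" for s using that by simp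
  show "stationary_increments N ?L"
    unfolding stationary_increments_def
    using L L[of 0] unfolding same_process_law_def by (meson same_law_sym same_law_trans order_refl)
qed

end

section \<open>Limiting distribution and stationary versions\<close>

theorem theorem2p10:
  fixes P R :: "real ^ 'n ^ 'n"
    and M :: "'a measure" and X :: "real \<Rightarrow> 'a \<Rightarrow> real ^ 'n"
    and M2 :: "'b measure" and X2 :: "real \<Rightarrow> 'b \<Rightarrow> real ^ 'n"
    and v :: "real ^ 'n"
  assumes P_nonneg: "\<forall>i j. 0 \<le> P $ i $ j"
    and P_radius: "spectral_radius P < 1"
    and R_def: "R = mat 1 - transpose P"
    and X_cadlag: "cadlag_process M X"
    and X_incr: "stationary_increments M X"
    and X2_ext: "two_sided_extension M X M2 X2"
    and X2_lim: "AE \<omega> in M2. ((\<lambda>t. X2 t \<omega> /\<^sub>R t) \<longlongrightarrow> v) at_bot"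
    and stability: "\<forall>i. (matrix_inv R *v v) $ i < 0"
  shows
    \<comment> \<open>identification of the drift\<close>
    "(ergodic_increments M X \<and> integrable M (\<lambda>\<omega>. X 1 \<omega> - X 0 \<omega>) \<longrightarrow>
        v = (\<integral>\<omega>. X 1 \<omega> - X 0 \<omega> \<partial>M)) \<and>
    \<comment> \<open>(i) and (ii)\<close>
     (\<exists>\<mu>. converges_in_distribution M (refl_W R (\<lambda>_. 0) X) \<mu> \<and>
        (\<forall>\<xi>\<in>borel_measurable M. converges_in_distribution M (refl_W R \<xi> X) \<mu>) \<and>
        (\<exists>(N :: ('a \<times> (real ^ 'n)) measure) \<xi>.
           enlargement M N \<and> stationary_version R M X N (\<lambda>t \<omega>. X t (fst \<omega>)) \<xi>) \<and>
        (\<forall>(N1 :: 'c measure) Y1 \<xi> (N2 :: 'd measure) Y2 \<eta>.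
           stationary_version R M X N1 Y1 \<xi> \<and> stationary_version R M X N2 Y2 \<eta> \<longrightarrow>
           same_process_law N1 (refl_W R \<xi> Y1) N2 (refl_W R \<eta> Y2)) \<and>
        (\<forall>(N :: 'c measure) Y \<xi>. stationary_version R M X N Y \<xi> \<longrightarrow>
           (\<forall>t\<ge>0. distr N borel (refl_W R \<xi> Y t) = \<mu>))) \<and>
    \<comment> \<open>(iii)\<close>
     (\<exists>(N :: ('a \<times> (real ^ 'n)) measure) \<xi>.
        enlargement M N \<and> invariant_version R M X N (\<lambda>t \<omega>. X t (fst \<omega>)) \<xi>) \<and>
     (\<forall>(N1 :: 'c measure) Y1 \<xi> (N2 :: 'd measure) Y2 \<eta>.
        invariant_version R M X N1 Y1 \<xi> \<and> invariant_version R M X N2 Y2 \<eta> \<longrightarrow>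
        same_law (borel \<Otimes>\<^sub>M path_space {0..})
          N1 (\<lambda>\<omega>. (\<xi> \<omega>, traj {0..} (incr 0 Y1) \<omega>))
          N2 (\<lambda>\<omega>. (\<eta> \<omega>, traj {0..} (incr 0 Y2) \<omega>))) \<and>
     (\<forall>(N :: 'c measure) Y \<xi>. invariant_version R M X N Y \<xi> \<longrightarrow>
        (\<forall>s\<ge>0. same_process_law
           N (\<lambda>t \<omega>. (refl_W R \<xi> (incr 0 Y) (s + t) \<omega>,
                      incr s (refl_L R \<xi> (incr 0 Y)) t \<omega>, incr s Y t \<omega>))
           N (\<lambda>t \<omega>. (refl_W R \<xi> (incr 0 Y) t \<omega>,
                      refl_L R \<xi> (incr 0 Y) t \<omega>, incr 0 Y t \<omega>))) \<and>
        stationary_process N (refl_W R \<xi> (incr 0 Y)) \<and>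
        stationary_increments N (refl_L R \<xi> (incr 0 Y))) \<and>
    \<comment> \<open>(iv)\<close>
     (\<forall>J :: real \<Rightarrow> 'a \<Rightarrow> 'j::polish_space.
        (\<forall>s\<ge>0. same_process_law M (\<lambda>t \<omega>. (incr s X t \<omega>, J (s + t) \<omega>))
                                 M (\<lambda>t \<omega>. (incr 0 X t \<omega>, J t \<omega>))) \<longrightarrow>
        \<comment> \<open>(i-J)\<close>
        (\<exists>\<nu>. \<forall>\<xi>\<in>borel_measurable M.
           converges_in_distribution M (\<lambda>t \<omega>. (refl_W R \<xi> X t \<omega>, J t \<omega>)) \<nu>) \<and>
        \<comment> \<open>(ii-J)\<close>
        (\<exists>(N :: ('a \<times> (real ^ 'n)) measure) \<xi>.
           enlargement M N \<and>
           stationary_version_J R M X J N (\<lambda>t \<omega>. X t (fst \<omega>)) (\<lambda>t \<omega>. J t (fst \<omega>)) \<xi>) \<and>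
        (\<forall>(N1 :: 'c measure) Y1 K1 \<xi> (N2 :: 'd measure) Y2 K2 \<eta>.
           stationary_version_J R M X J N1 Y1 K1 \<xi> \<and>
           stationary_version_J R M X J N2 Y2 K2 \<eta> \<longrightarrow>
           same_process_law N1 (\<lambda>t \<omega>. (refl_W R \<xi> Y1 t \<omega>, K1 t \<omega>))
                            N2 (\<lambda>t \<omega>. (refl_W R \<eta> Y2 t \<omega>, K2 t \<omega>))) \<and>
        \<comment> \<open>(iii-J)\<close>
        (\<exists>(N :: ('a \<times> (real ^ 'n)) measure) \<xi>.
           enlargement M N \<and>
           invariant_version_J R M X J N (\<lambda>t \<omega>. X t (fst \<omega>)) (\<lambda>t \<omega>. J t (fst \<omega>)) \<xi>) \<and>
        (\<forall>(N1 :: 'c measure) Y1 K1 \<xi> (N2 :: 'd measure) Y2 K2 \<eta>.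
           invariant_version_J R M X J N1 Y1 K1 \<xi> \<and>
           invariant_version_J R M X J N2 Y2 K2 \<eta> \<longrightarrow>
           same_law (borel \<Otimes>\<^sub>M (path_space {0..} \<Otimes>\<^sub>M path_space {0..}))
             N1 (\<lambda>\<omega>. (\<xi> \<omega>, traj {0..} (incr 0 Y1) \<omega>, traj {0..} K1 \<omega>))
             N2 (\<lambda>\<omega>. (\<eta> \<omega>, traj {0..} (incr 0 Y2) \<omega>, traj {0..} K2 \<omega>))) \<and>
        (\<forall>(N :: 'c measure) Y K \<xi>. invariant_version_J R M X J N Y K \<xi> \<longrightarrow>
           (\<forall>s\<ge>0. same_process_law
              N (\<lambda>t \<omega>. (refl_W R \<xi> (incr 0 Y) (s + t) \<omega>,
                         incr s (refl_L R \<xi> (incr 0 Y)) t \<omega>, incr s Y t \<omega>, K (s + t) \<omega>))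
              N (\<lambda>t \<omega>. (refl_W R \<xi> (incr 0 Y) t \<omega>,
                         refl_L R \<xi> (incr 0 Y) t \<omega>, incr 0 Y t \<omega>, K t \<omega>)))))"
proof -
  obtain p \<alpha> where "skorohod_matrix P p \<alpha>" by (rule skorohod_matrix_exists[OF P_nonneg P_radius])
  then interpret sk: skorohod_matrix P p \<alpha> .
  have v: "(matrix_inv (mat 1 - transpose P) *v v) $ i < 0" for i using stability by (simp add: R_def)
  have "same_process_law M (\<lambda>t \<omega>. (incr s X t \<omega>, 0::real)) M (\<lambda>t \<omega>. (incr 0 X t \<omega>, 0))" if "0 \<le> s" for s
    using X_incr that unfolding same_process_law_zero stationary_increments_def by simp
  from sk.stationary_driver_intro[OF X_cadlag X2_ext X2_lim v this]
  interpret dr: driver_without_background P p \<alpha> "distr M drive_space (drive 0 X (\<lambda>_ _. 0))" M X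
    by (simp add: driver_without_background_def)
  obtain Q where Q: "dr.limit_law Q" by (rule dr.limit_law_exists)
  have with_J: "(\<exists>\<nu>. \<forall>\<xi>\<in>borel_measurable M.
           converges_in_distribution M (\<lambda>t \<omega>. (refl_W R \<xi> X t \<omega>, J t \<omega>)) \<nu>) \<and>
        (\<exists>(N :: ('a \<times> (real ^ 'n)) measure) \<xi>.
           enlargement M N \<and>
           stationary_version_J R M X J N (\<lambda>t \<omega>. X t (fst \<omega>)) (\<lambda>t \<omega>. J t (fst \<omega>)) \<xi>) \<and>
        (\<forall>(N1 :: 'c measure) Y1 K1 \<xi> (N2 :: 'd measure) Y2 K2 \<eta>.
           stationary_version_J R M X J N1 Y1 K1 \<xi> \<and>
           stationary_version_J R M X J N2 Y2 K2 \<eta> \<longrightarrow>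
           same_process_law N1 (\<lambda>t \<omega>. (refl_W R \<xi> Y1 t \<omega>, K1 t \<omega>))
                            N2 (\<lambda>t \<omega>. (refl_W R \<eta> Y2 t \<omega>, K2 t \<omega>))) \<and>
        (\<exists>(N :: ('a \<times> (real ^ 'n)) measure) \<xi>.
           enlargement M N \<and>
           invariant_version_J R M X J N (\<lambda>t \<omega>. X t (fst \<omega>)) (\<lambda>t \<omega>. J t (fst \<omega>)) \<xi>) \<and>
        (\<forall>(N1 :: 'c measure) Y1 K1 \<xi> (N2 :: 'd measure) Y2 K2 \<eta>.
           invariant_version_J R M X J N1 Y1 K1 \<xi> \<and>
           invariant_version_J R M X J N2 Y2 K2 \<eta> \<longrightarrow>
           same_law (borel \<Otimes>\<^sub>M (path_space {0..} \<Otimes>\<^sub>M path_space {0..}))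
             N1 (\<lambda>\<omega>. (\<xi> \<omega>, traj {0..} (incr 0 Y1) \<omega>, traj {0..} K1 \<omega>))
             N2 (\<lambda>\<omega>. (\<eta> \<omega>, traj {0..} (incr 0 Y2) \<omega>, traj {0..} K2 \<omega>))) \<and>
        (\<forall>(N :: 'c measure) Y K \<xi>. invariant_version_J R M X J N Y K \<xi> \<longrightarrow>
           (\<forall>s\<ge>0. same_process_law
              N (\<lambda>t \<omega>. (refl_W R \<xi> (incr 0 Y) (s + t) \<omega>,
                         incr s (refl_L R \<xi> (incr 0 Y)) t \<omega>, incr s Y t \<omega>, K (s + t) \<omega>))
              N (\<lambda>t \<omega>. (refl_W R \<xi> (incr 0 Y) t \<omega>,
                         refl_L R \<xi> (incr 0 Y) t \<omega>, incr 0 Y t \<omega>, K t \<omega>))))"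
    if XJ: "\<forall>s\<ge>0. same_process_law M (\<lambda>t \<omega>. (incr s X t \<omega>, J (s + t) \<omega>)) M (\<lambda>t \<omega>. (incr 0 X t \<omega>, J t \<omega>))"
    for J :: "real \<Rightarrow> 'a \<Rightarrow> 'j::polish_space"
  proof -
    interpret dJ: stationary_driver P p \<alpha> "distr M drive_space (drive 0 X J)" M X J
      by (rule sk.stationary_driver_intro[OF X_cadlag X2_ext X2_lim v XJ[rule_format]])
    obtain QJ where QJ: "dJ.limit_law QJ" by (rule dJ.limit_law_exists)
    show ?thesis
      unfolding R_def
      using dJ.converges_J[OF QJ] dJ.versions_exist[OF QJ] dJ.stationary_version_J_unique[OF QJ]
        dJ.invariant_version_J_unique[OF QJ] dJ.invariant_version_J_process_law[OF QJ]
      by (intro conjI allI impI exI[of _ "distr QJ borel (\<lambda>z. (fst z, snd (snd z) 0))"] ballI) blast+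
  qed
  show ?thesis
  proof (intro conjI impI allI exI[of _ "distr Q borel fst"])
    show "v = (\<integral>\<omega>. X 1 \<omega> - X 0 \<omega> \<partial>M)" if "ergodic_increments M X \<and> integrable M (\<lambda>\<omega>. X 1 \<omega> - X 0 \<omega>)"
      using that drift_eq_mean[OF X_cadlag X_incr X2_ext X2_lim] by simp
  qed (use dr.converges[OF Q] dr.stationary_versions_exist[OF Q] dr.stationary_version_unique[OF Q]
      dr.stationary_version_marginal[OF Q] dr.invariant_version_unique[OF Q] dr.invariant_version_process_law[OF Q]
      with_J in \<open>auto simp: R_def\<close>)
qed

end
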